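(* Let $r,s$ be positive integers, let $n := r+s$, let $\mathcal{E} := \mathcal{O}_{\mathbb{P}^s}^{\oplus r} \oplus \mathcal{O}_{\mathbb{P}^s}(1)$ and let $X := \mathbb{P}(\mathcal{E}) := \operatorname{Proj}(\operatorname{Sym}^\bullet(\mathcal{E})) \simeq \operatorname{Bl}_{\mathbb{P}^{r-1}}(\mathbb{P}^{n})$. Let $M$ be the numerical class of the tautological line bundle $\mathcal{O}_{\mathbb{P}(\mathcal{E})}(1)$ and let $E$ be the numerical class of the exceptional divisor of the blow-up $X \to \mathbb{P}^n$. Then the big and nef class $M$ is Seshadri slope K-semistable with respect to $E$, and it is not Seshadri slope K-stable with respect to $E$.
   Context: We work over an algebraically closed field $\mathbf{k}$ of characteristic zero. $\mathbb{P}(\mathcal{E}) = \operatorname{Proj}(\operatorname{Sym}^\bullet(\mathcal{E}))$ is the projective bundle whose tautological line bundle $\mathcal{O}_{\mathbb{P}(\mathcal{E})}(1)$ is a quotient of the pullback of $\mathcal{E}$; its dimension is $n = r+s$. The morphism $X \to \mathbb{P}^n$ given by $|\mathcal{O}_{\mathbb{P}(\mathcal{E})}(1)|$ is the blow-up of $\mathbb{P}^n$ along an $(r-1)$-plane. If $N$ is the class of the pullback of $\mathcal{O}_{\mathbb{P}^s}(1)$ to $X$, then $E = M-N$. For a big and nef class $L$ on $X$, let $c := \epsilon(L;E) := \sup\{t \geq 0 : L - tE \text{ is nef}\}$ be the Seshadri constant; for $L = M$ one has $c = 1$. Let $K$ be the canonical class of $X$. For $0 \leq t \leq c$ define $$\alpha_0(t)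 := \frac{1}{n!}\left((L-tE)^n\right), \quad \alpha_1(t) := -\frac{\left(K\cdot (L-tE)^{n-1}\right)}{2(n-1)!}, \quad \alpha_0 := \alpha_0(0), \quad \alpha_1 := \alpha_1(0),$$ and the Seshadri slope K-stability invariants $$\mu_c(L;E) := \frac{\int_0^c\left(\alpha_1(t)+\frac{\alpha_0'(t)}{2}\right)\mathrm{d}t}{\int_0^c \alpha_0(t)\,\mathrm{d}t}, \qquad \mu(L) := \frac{\alpha_1}{\alpha_0}.$$ The class $L$ is Seshadri slope K-semistable with respect to $E$ if $\mu_c(L;E) - \mu(L) \leq 0$ for $c = \epsilon(L;E)$, and Seshadri slope K-stable with respect to $E$ if $\mu_c(L;E) - \mu(L) < 0$ for $c = \epsilon(L;E)$. *)

theory Defs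
  imports
    "HOL-Analysis.Analysis"
    "HOL-Library.Function_Algebras"
    "HOL-Computational_Algebra.Polynomial"
    "Jordan_Normal_Form.Determinant"
begin

section \<open>Closed subvarieties of \<open>P^a \<times> P^b\<close>\<close>

text \<open>
  Classical varieties over an algebraically closed field: a point of \<open>P^N\<close> is the set of all its
  (nonzero) homogeneous coordinate vectors \<open>(v 0, ..., v N)\<close>, padded with zeros.  Projective
  varieties are closed subsets of \<open>P^a \<times> P^b\<close> with their reduced structure.
\<close>

definition ppoint :: "(nat \<Rightarrow> 'k::field) \<Rightarrow> (nat \<Rightarrow> 'k) set" where
  "ppoint v = {\<lambda>i. c * v i | c. c \<noteq> 0}"

definition proj_space :: "nat \<Rightarrow> (nat \<Rightarrow> 'k::field) set set" where
  "proj_space N = {ppoint v | v. v \<noteq> (\<lambda>_. 0) \<and> (\<forall>i>N. v i = 0)}"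

type_synonym 'k pt = "(nat \<Rightarrow> 'k) set \<times> (nat \<Rightarrow> 'k) set"

definition biproj :: "nat \<Rightarrow> nat \<Rightarrow> 'k::field pt set" where
  "biproj a b = proj_space a \<times> proj_space b"

text \<open>
  A choice of homogeneous coordinates.  They are only used in expressions (vanishing of
  bihomogeneous forms, quotients of forms of equal bidegree) that do not depend on the choice.
\<close>

definition xc :: "'k::field pt \<Rightarrow> nat \<Rightarrow> 'k" where
  "xc p = (SOME v. v \<in> fst p)"

definition yc :: "'k::field pt \<Rightarrow> nat \<Rightarrow> 'k" where
  "yc p = (SOME v. v \<in> snd p)"

text \<open>
  Bihomogeneous polynomials of bidegree \<open>(d, e)\<close> in \<open>x_0, ..., x_a; y_0, ..., y_b\<close>, as polynomial
  functions (the base field is infinite).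
\<close>

inductive biform ::
  "nat \<Rightarrow> nat \<Rightarrow> nat \<Rightarrow> nat \<Rightarrow> ((nat \<Rightarrow> 'k::field) \<Rightarrow> (nat \<Rightarrow> 'k) \<Rightarrow> 'k) \<Rightarrow> bool"
  for a b where
  const: "biform a b 0 0 (\<lambda>x y. c)"
| coord_x: "i \<le> a \<Longrightarrow> biform a b 1 0 (\<lambda>x y. x i)"
| coord_y: "j \<le> b \<Longrightarrow> biform a b 0 1 (\<lambda>x y. y j)"
| add: "biform a b d e F \<Longrightarrow> biform a b d e G \<Longrightarrow> biform a b d e (\<lambda>x y. F x y + G x y)"
| mult: "biform a b d e F \<Longrightarrow> biform a b d' e' G \<Longrightarrow>
    biform a b (d + d') (e + e') (\<lambda>x y. F x y * G x y)"

definition form_at :: "((nat \<Rightarrow> 'k::field) \<Rightarrow> (nat \<Rightarrow> 'k) \<Rightarrow> 'k) \<Rightarrow> 'k pt \<Rightarrow> 'k" where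
  "form_at F p = F (xc p) (yc p)"

definition zclosed :: "nat \<Rightarrow> nat \<Rightarrow> 'k::field pt set \<Rightarrow> bool" where
  "zclosed a b Z \<longleftrightarrow> (\<exists>T. (\<forall>F\<in>T. \<exists>d e. biform a b d e F) \<and>
     Z = {p \<in> biproj a b. \<forall>F\<in>T. form_at F p = 0})"

definition zopen :: "nat \<Rightarrow> nat \<Rightarrow> 'k::field pt set \<Rightarrow> bool" where
  "zopen a b U \<longleftrightarrow> U \<subseteq> biproj a b \<and> zclosed a b (biproj a b - U)"

definition irreducible_closed :: "nat \<Rightarrow> nat \<Rightarrow> 'k::field pt set \<Rightarrow> bool" where
  "irreducible_closed a b Z \<longleftrightarrow> zclosed a b Z \<and> Z \<noteq> {} \<and>
     (\<forall>Z1 Z2. zclosed a b Z1 \<longrightarrow> zclosed a b Z2 \<longrightarrow> Z = Z1 \<union> Z2 \<longrightarrow> Z = Z1 \<or> Z = Z2)"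

text \<open>Irreducible closed subsets of Krull dimension one.\<close>

definition curve :: "nat \<Rightarrow> nat \<Rightarrow> 'k::field pt set \<Rightarrow> bool" where
  "curve a b C \<longleftrightarrow> irreducible_closed a b C \<and> (\<nexists>p. C = {p}) \<and>
     (\<forall>W. irreducible_closed a b W \<longrightarrow> W \<subset> C \<longrightarrow> (\<exists>p. W = {p}))"

text \<open>\<open>W\<close> is meant to be locally closed; only the values of \<open>f\<close> on \<open>W\<close> matter.\<close>

definition regular_on :: "nat \<Rightarrow> nat \<Rightarrow> 'k::field pt set \<Rightarrow> ('k pt \<Rightarrow> 'k) \<Rightarrow> bool" where
  "regular_on a b W f \<longleftrightarrow> (\<forall>p\<in>W. \<exists>U F G d e. zopen a b U \<and> p \<in> U \<and>
     biform a b d e F \<and> biform a b d e G \<and>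
     (\<forall>q\<in>W \<inter> U. form_at G q \<noteq> 0 \<and> f q = form_at F q / form_at G q))"

text \<open>Functions representing elements of the local ring of \<open>Z\<close> at \<open>z\<close>, and equality of germs.\<close>

definition local_ring :: "nat \<Rightarrow> nat \<Rightarrow> 'k::field pt set \<Rightarrow> 'k pt \<Rightarrow> ('k pt \<Rightarrow> 'k) set" where
  "local_ring a b Z z = {f. \<exists>U. zopen a b U \<and> z \<in> U \<and> regular_on a b (Z \<inter> U) f}"

definition same_germ ::
  "nat \<Rightarrow> nat \<Rightarrow> 'k::field pt set \<Rightarrow> 'k pt \<Rightarrow> ('k pt \<Rightarrow> 'k) \<Rightarrow> ('k pt \<Rightarrow> 'k) \<Rightarrow> bool" where
  "same_germ a b Z z f g \<longleftrightarrow> (\<exists>U. zopen a b U \<and> z \<in> U \<and> (\<forall>q\<in>Z \<inter> U. f q = g q))"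

definition max_ideal :: "nat \<Rightarrow> nat \<Rightarrow> 'k::field pt set \<Rightarrow> 'k pt \<Rightarrow> ('k pt \<Rightarrow> 'k) set" where
  "max_ideal a b Z z = {f \<in> local_ring a b Z z. f z = 0}"

definition max_ideal_sq :: "nat \<Rightarrow> nat \<Rightarrow> 'k::field pt set \<Rightarrow> 'k pt \<Rightarrow> ('k pt \<Rightarrow> 'k) set" where
  "max_ideal_sq a b Z z = {f. \<exists>(N::nat) g h.
     (\<forall>k<N. g k \<in> max_ideal a b Z z \<and> h k \<in> max_ideal a b Z z) \<and>
     same_germ a b Z z f (\<lambda>q. \<Sum>k<N. g k q * h k q)}"


section \<open>Line bundles\<close>

text \<open>
  A line bundle is given by transition functions.  For convenience the trivialising open cover is
  indexed by the points: \<open>nbhd L p\<close> is an open neighbourhood of \<open>p\<close> on which \<open>L\<close> is trivialised, and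
  a section is a family \<open>\<sigma> p\<close> of regular functions on these open sets such that
  \<open>\<sigma> p = trans L p q * \<sigma> q\<close> on overlaps.
\<close>

record 'k lbundle =
  nbhd :: "'k pt \<Rightarrow> 'k pt set"
  trans :: "'k pt \<Rightarrow> 'k pt \<Rightarrow> 'k pt \<Rightarrow> 'k"

definition line_bundle ::
  "nat \<Rightarrow> nat \<Rightarrow> 'k::field pt set \<Rightarrow> 'k lbundle \<Rightarrow> bool" where
  "line_bundle a b X L \<longleftrightarrow>
     (\<forall>p\<in>X. zopen a b (nbhd L p) \<and> p \<in> nbhd L p) \<and>
     (\<forall>p\<in>X. \<forall>q\<in>X. regular_on a b (X \<inter> nbhd L p \<inter> nbhd L q) (trans L p q) \<and>
        (\<forall>z\<in>X \<inter> nbhd L p \<inter> nbhd L q. trans L p q z \<noteq> 0)) \<and>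
     (\<forall>p\<in>X. \<forall>q\<in>X. \<forall>w\<in>X. \<forall>z\<in>X \<inter> nbhd L p \<inter> nbhd L q \<inter> nbhd L w.
        trans L p w z = trans L p q z * trans L q w z)"

text \<open>
  Global sections of the restriction of \<open>L\<close> to a closed subset \<open>Z\<close>; the last condition only
  normalises the irrelevant values, so that the sections form a vector space of functions.
\<close>

definition sections ::
  "nat \<Rightarrow> nat \<Rightarrow> 'k::field pt set \<Rightarrow> 'k lbundle \<Rightarrow> ('k pt \<Rightarrow> 'k pt \<Rightarrow> 'k) set" where
  "sections a b Z L = {\<sigma>.
     (\<forall>p\<in>Z. regular_on a b (Z \<inter> nbhd L p) (\<sigma> p)) \<and>
     (\<forall>p\<in>Z. \<forall>q\<in>Z. \<forall>z\<in>Z \<inter> nbhd L p \<inter> nbhd L q. \<sigma> p z = trans L p q z * \<sigma> q z) \<and>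
     (\<forall>p z. p \<notin> Z \<or> z \<notin> Z \<inter> nbhd L p \<longrightarrow> \<sigma> p z = 0)}"

definition h0 :: "nat \<Rightarrow> nat \<Rightarrow> 'k::field pt set \<Rightarrow> 'k lbundle \<Rightarrow> nat" where
  "h0 a b Z L = vector_space.dim (\<lambda>c \<sigma> p z. c * \<sigma> p z) (sections a b Z L)"

definition tensor :: "'k::field lbundle \<Rightarrow> 'k lbundle \<Rightarrow> 'k lbundle" where
  "tensor L L' = \<lparr>nbhd = (\<lambda>p. nbhd L p \<inter> nbhd L' p),
                  trans = (\<lambda>p q z. trans L p q z * trans L' p q z)\<rparr>"

definition tensor_power :: "'k::field lbundle \<Rightarrow> nat \<Rightarrow> 'k lbundle" where
  "tensor_power L m = \<lparr>nbhd = nbhd L, trans = (\<lambda>p q z. trans L p q z ^ m)\<rparr>"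

text \<open>
  \<open>O(d, e)\<close> on \<open>P^a \<times> P^b\<close>, trivialised near \<open>p\<close> by \<open>x_i^d y_j^e\<close>, where \<open>i, j\<close> are the first indices
  of nonzero coordinates of \<open>p\<close>.
\<close>

definition ix :: "'k::field pt \<Rightarrow> nat" where
  "ix p = (LEAST i. xc p i \<noteq> 0)"

definition jy :: "'k::field pt \<Rightarrow> nat" where
  "jy p = (LEAST j. yc p j \<noteq> 0)"

definition O_bundle :: "nat \<Rightarrow> nat \<Rightarrow> int \<Rightarrow> int \<Rightarrow> 'k::field lbundle" where
  "O_bundle a b d e =
     \<lparr>nbhd = (\<lambda>p. {z \<in> biproj a b. xc z (ix p) \<noteq> 0 \<and> yc z (jy p) \<noteq> 0}),
      trans = (\<lambda>p q z. (xc z (ix q) / xc z (ix p)) powi d * (yc z (jy q) / yc z (jy p)) powi e)\<rparr>"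

definition tensor_list :: "nat \<Rightarrow> nat \<Rightarrow> 'k::field lbundle list \<Rightarrow> 'k lbundle" where
  "tensor_list a b Ls = foldr tensor Ls (O_bundle a b 0 0)"


section \<open>The canonical bundle\<close>

text \<open>
  The class of \<open>f - f(z)\<close> in the cotangent space \<open>m_z / m_z^2\<close> (i.e. \<open>df\<close> at \<open>z\<close>) is
  \<open>\<Sum>j<n. c j du_j\<close>.
\<close>

definition has_differential ::
  "nat \<Rightarrow> nat \<Rightarrow> 'k::field pt set \<Rightarrow> 'k pt \<Rightarrow> nat \<Rightarrow> (nat \<Rightarrow> 'k pt \<Rightarrow> 'k) \<Rightarrow> ('k pt \<Rightarrow> 'k) \<Rightarrow>
    (nat \<Rightarrow> 'k) \<Rightarrow> bool" where
  "has_differential a b X z n u f c \<longleftrightarrow>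
     (\<lambda>q. f q - f z - (\<Sum>j<n. c j * (u j q - u j z))) \<in> max_ideal_sq a b X z"

text \<open>\<open>u_0, ..., u_{n-1}\<close> are regular on \<open>V\<close> and their differentials form a basis of each cotangent
  space.\<close>

definition local_coordinates ::
  "nat \<Rightarrow> nat \<Rightarrow> 'k::field pt set \<Rightarrow> nat \<Rightarrow> 'k pt set \<Rightarrow> (nat \<Rightarrow> 'k pt \<Rightarrow> 'k) \<Rightarrow> bool" where
  "local_coordinates a b X n V u \<longleftrightarrow>
     (\<forall>j<n. regular_on a b V (u j)) \<and>
     (\<forall>z\<in>V. \<forall>f\<in>local_ring a b X z.
        \<exists>!c. c \<in> extensional {..<n} \<and> has_differential a b X z n u f c)"

text \<open>
  \<open>K\<close> is the line bundle of \<open>n\<close>-forms on the smooth \<open>n\<close>-dimensional variety \<open>X\<close>, trivialised on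
  \<open>nbhd K p\<close> by \<open>du_0 \<and> ... \<and> du_{n-1}\<close> for local coordinates \<open>u = u p\<close>; the transition functions are
  Jacobian determinants.
\<close>

definition canonical_bundle ::
  "nat \<Rightarrow> nat \<Rightarrow> 'k::field pt set \<Rightarrow> nat \<Rightarrow> 'k lbundle \<Rightarrow> bool" where
  "canonical_bundle a b X n K \<longleftrightarrow> line_bundle a b X K \<and>
     (\<exists>u. (\<forall>p\<in>X. local_coordinates a b X n (X \<inter> nbhd K p) (u p)) \<and>
        (\<forall>p\<in>X. \<forall>q\<in>X. \<forall>z\<in>X \<inter> nbhd K p \<inter> nbhd K q.
           \<exists>J. (\<forall>i<n. has_differential a b X z n (u p) (u q i) (J i)) \<and>
               trans K p q z = Determinant.det (mat n n (\<lambda>(i, j). J i j))))"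


section \<open>Intersection numbers\<close>

text \<open>
  Hilbert polynomial with respect to the ample bundle \<open>O(1,1)\<close>: by Serre vanishing,
  \<open>h^0(Z, L(m,m)) = \<chi>(Z, L(m,m))\<close> for large \<open>m\<close>, which is a polynomial in \<open>m\<close>; its value at \<open>0\<close> is the
  Euler characteristic of \<open>L\<close> on \<open>Z\<close>.
\<close>

definition hilbert_poly :: "nat \<Rightarrow> nat \<Rightarrow> 'k::field pt set \<Rightarrow> 'k lbundle \<Rightarrow> real poly" where
  "hilbert_poly a b Z L = (THE P. \<forall>\<^sub>F m in sequentially.
     poly P (real m) = real (h0 a b Z (tensor L (O_bundle a b (int m) (int m)))))"

definition euler_char :: "nat \<Rightarrow> nat \<Rightarrow> 'k::field pt set \<Rightarrow> 'k lbundle \<Rightarrow> real" where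
  "euler_char a b Z L = poly (hilbert_poly a b Z L) 0"

text \<open>
  Snapper--Kleiman intersection number \<open>(L_1 \<cdots> L_d \<cdot> Z)\<close>, \<open>d = dim Z\<close>: the coefficient of
  \<open>m_1 \<cdots> m_d\<close> in the polynomial \<open>\<chi>(Z, L_1^{m_1} \<otimes> \<cdots> \<otimes> L_d^{m_d})\<close> of total degree at most \<open>d\<close>,
  written as its mixed difference.  For \<open>d = 1\<close> this is \<open>deg L = \<chi>(L) - \<chi>(O)\<close>.
\<close>

definition intersection_number ::
  "nat \<Rightarrow> nat \<Rightarrow> 'k::field pt set \<Rightarrow> 'k lbundle list \<Rightarrow> real" where
  "intersection_number a b Z Ls =
     (\<Sum>I\<in>Pow {..<length Ls}. (-1) ^ (length Ls - card I) *
        euler_char a b Z (tensor_list a b (nths Ls I)))"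

text \<open>
  Real divisor classes are represented by formal real linear combinations of line bundles;
  intersection numbers are extended to them multilinearly.
\<close>

type_synonym 'k rclass = "(real \<times> 'k lbundle) list"

definition cls :: "'k lbundle \<Rightarrow> 'k rclass" where
  "cls L = [(1, L)]"

definition sub_mult :: "'k rclass \<Rightarrow> real \<Rightarrow> 'k rclass \<Rightarrow> 'k rclass" where
  "sub_mult L t E = L @ map (\<lambda>(c, B). (- t * c, B)) E"

fun intersect_acc ::
  "nat \<Rightarrow> nat \<Rightarrow> 'k::field pt set \<Rightarrow> 'k rclass list \<Rightarrow> 'k lbundle list \<Rightarrow> real" where
  "intersect_acc a b Z [] Bs = intersection_number a b Z Bs"
| "intersect_acc a b Z (A # As) Bs =
     (\<Sum>(c, B)\<leftarrow>A. c * intersect_acc a b Z As (Bs @ [B]))"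

definition intersect :: "nat \<Rightarrow> nat \<Rightarrow> 'k::field pt set \<Rightarrow> 'k rclass list \<Rightarrow> real" where
  "intersect a b Z As = intersect_acc a b Z As []"

definition nef :: "nat \<Rightarrow> nat \<Rightarrow> 'k::field pt set \<Rightarrow> 'k rclass \<Rightarrow> bool" where
  "nef a b X A \<longleftrightarrow> (\<forall>C. curve a b C \<longrightarrow> C \<subseteq> X \<longrightarrow> intersect a b C [A] \<ge> 0)"

definition big :: "nat \<Rightarrow> nat \<Rightarrow> 'k::field pt set \<Rightarrow> nat \<Rightarrow> 'k lbundle \<Rightarrow> bool" where
  "big a b X n L \<longleftrightarrow> (\<exists>c>0. \<forall>\<^sub>F m in sequentially.
     real (h0 a b X (tensor_power L m)) \<ge> c * real m ^ n)"


section \<open>Seshadri slope stability\<close>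

definition seshadri ::
  "nat \<Rightarrow> nat \<Rightarrow> 'k::field pt set \<Rightarrow> 'k rclass \<Rightarrow> 'k rclass \<Rightarrow> real" where
  "seshadri a b X L E = Sup {t. t \<ge> 0 \<and> nef a b X (sub_mult L t E)}"

definition alpha0 ::
  "nat \<Rightarrow> nat \<Rightarrow> 'k::field pt set \<Rightarrow> nat \<Rightarrow> 'k rclass \<Rightarrow> 'k rclass \<Rightarrow> real \<Rightarrow> real" where
  "alpha0 a b X n L E t = 1 / fact n * intersect a b X (replicate n (sub_mult L t E))"

definition alpha1 ::
  "nat \<Rightarrow> nat \<Rightarrow> 'k::field pt set \<Rightarrow> nat \<Rightarrow> 'k rclass \<Rightarrow> 'k rclass \<Rightarrow> 'k rclass \<Rightarrow> real \<Rightarrow> real" where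
  "alpha1 a b X n K L E t =
     - intersect a b X (K # replicate (n - 1) (sub_mult L t E)) / (2 * fact (n - 1))"

definition slope_c ::
  "nat \<Rightarrow> nat \<Rightarrow> 'k::field pt set \<Rightarrow> nat \<Rightarrow> 'k rclass \<Rightarrow> 'k rclass \<Rightarrow> 'k rclass \<Rightarrow> real \<Rightarrow> real" where
  "slope_c a b X n K L E c =
     integral {0..c} (\<lambda>t. alpha1 a b X n K L E t + deriv (alpha0 a b X n L E) t / 2) /
     integral {0..c} (alpha0 a b X n L E)"

definition slope ::
  "nat \<Rightarrow> nat \<Rightarrow> 'k::field pt set \<Rightarrow> nat \<Rightarrow> 'k rclass \<Rightarrow> 'k rclass \<Rightarrow> 'k rclass \<Rightarrow> real" where
  "slope a b X n K L E = alpha1 a b X n K L E 0 / alpha0 a b X n L E 0"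

definition slope_semistable ::
  "nat \<Rightarrow> nat \<Rightarrow> 'k::field pt set \<Rightarrow> nat \<Rightarrow> 'k rclass \<Rightarrow> 'k rclass \<Rightarrow> 'k rclass \<Rightarrow> bool" where
  "slope_semistable a b X n K L E \<longleftrightarrow>
     slope_c a b X n K L E (seshadri a b X L E) - slope a b X n K L E \<le> 0"

definition slope_stable ::
  "nat \<Rightarrow> nat \<Rightarrow> 'k::field pt set \<Rightarrow> nat \<Rightarrow> 'k rclass \<Rightarrow> 'k rclass \<Rightarrow> 'k rclass \<Rightarrow> bool" where
  "slope_stable a b X n K L E \<longleftrightarrow>
     slope_c a b X n K L E (seshadri a b X L E) - slope a b X n K L E < 0"


section \<open>The projective bundle and its exceptional divisor\<close>

text \<open>
  \<open>\<E> = O^r \<oplus> O(1)\<close> on \<open>P^s\<close>.  The fibre of the dual bundle \<open>O(-1) \<oplus> O^r\<close> at \<open>y\<close> is a subspace of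
  \<open>k^{s+1} \<oplus> k^r = k^{r+s+1}\<close>, namely the line \<open>y\<close> plus \<open>k^r\<close>.
\<close>

definition dual_fibre :: "nat \<Rightarrow> nat \<Rightarrow> (nat \<Rightarrow> 'k::field) set \<Rightarrow> (nat \<Rightarrow> 'k) set" where
  "dual_fibre r s y = {v. (\<forall>i>r + s. v i = 0) \<and> (\<exists>w\<in>y. \<exists>c. \<forall>i\<le>s. v i = c * w i)}"

text \<open>
  With the quotient convention, the points of \<open>P(\<E>)\<close> over \<open>y\<close> are the one-dimensional quotients of the
  fibre of \<open>\<E>\<close>, that is, the lines in the fibre of its dual.  Such a line is a point of \<open>P^{r+s}\<close>,
  so \<open>P(\<E>)\<close> is a closed subvariety of \<open>P^{r+s} \<times> P^s\<close>.
\<close>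

definition PE :: "nat \<Rightarrow> nat \<Rightarrow> 'k::field pt set" where
  "PE r s = {(l, y) \<in> biproj (r + s) s. l \<subseteq> dual_fibre r s y}"

text \<open>
  The tautological quotient of the pullback of \<open>\<E>\<close> has as fibre at \<open>(l, y)\<close> the dual of the line \<open>l\<close>;
  it is the pullback of \<open>O(1)\<close> along the first projection.
\<close>

definition taut :: "nat \<Rightarrow> nat \<Rightarrow> 'k::field lbundle" where
  "taut r s = O_bundle (r + s) s 1 0"

text \<open>
  The first projection \<open>P(\<E>) \<rightarrow> P^{r+s}\<close> is the blow-up of the \<open>(r-1)\<close>-plane
  \<open>x_0 = ... = x_s = 0\<close>.  \<open>L\<close> is the line bundle of the exceptional divisor if it has a section
  whose zero scheme is the scheme-theoretic preimage of this plane: at a point with \<open>x_i \<noteq> 0\<close>, the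
  section generates the ideal \<open>(x_0/x_i, ..., x_s/x_i)\<close> of the local ring.
\<close>

definition exceptional_bundle :: "nat \<Rightarrow> nat \<Rightarrow> 'k::field lbundle \<Rightarrow> bool" where
  "exceptional_bundle r s L \<longleftrightarrow> line_bundle (r + s) s (PE r s) L \<and>
     (\<exists>\<sigma>\<in>sections (r + s) s (PE r s) L. \<forall>p\<in>PE r s. \<forall>i\<le>r + s. xc p i \<noteq> 0 \<longrightarrow>
        (\<exists>g. (\<forall>j\<le>s. g j \<in> local_ring (r + s) s (PE r s) p) \<and>
           same_germ (r + s) s (PE r s) p (\<sigma> p) (\<lambda>z. \<Sum>j\<le>s. g j z * (xc z j / xc z i))) \<and>
        (\<forall>j\<le>s. \<exists>h\<in>local_ring (r + s) s (PE r s) p.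
           same_germ (r + s) s (PE r s) p (\<lambda>z. xc z j / xc z i) (\<lambda>z. h z * \<sigma> p z)))"

end

theory Submission
  imports Defs
begin

text \<open>
  All line bundles in question have a type \<open>(d, e)\<close>: they are isomorphic to \<open>O(d, e)\<close> on \<open>X\<close>.
  This is clear for \<open>M\<close>, of type \<open>(1, 0)\<close>.  In the Cox coordinates of the blow-up, \<open>E\<close> is cut out by a
  coordinate of weight \<open>(1, -1)\<close>, and the Jacobian determinants of \<open>K\<close> compare with determinants of
  gradients, which have weight \<open>(-r-1, -s)\<close>.  The Euler characteristic of a bundle depends only on its
  type.  On \<open>X\<close> it is obtained by counting Cox monomials, so that intersection numbers are sums of
  coefficients of \<open>\<Prod> (d + e T)\<close>.  On a curve it is monotone in \<open>d\<close> and \<open>e\<close>, whence \<open>M\<close> and \<open>M - t E\<close> for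
  \<open>0 \<le> t \<le> 1\<close> are nef; a line in a fibre, on which \<open>M\<close> and \<open>E\<close> have the same positive degree, shows
  that the Seshadri constant is \<open>1\<close>.  Finally \<open>\<alpha>0\<close> and \<open>\<alpha>1\<close> are sums of Bernstein polynomials, all of the
  same integral, and both slopes are \<open>n (n + 1) / 2\<close>.
\<close>

section \<open>Vector spaces of functions\<close>

text \<open>The Euler characteristic is the value at 0 of a polynomial selected by
  \<open>THE\<close>, so each intersection number, on the blow-up and on every curve in it,
  presupposes that spaces of sections are finite-dimensional with eventually polynomial dimension.
  Cohomology and dimension theory are avoided. The one global input is a Nullstellensatz for forms
  of equal bidegree \<open>(m, m)\<close>, obtained by linear algebra; it shows that a section of
  O(d, e) becomes a form after multiplication by any form of large degree \<open>(m, m)\<close>. On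
  a curve it also yields two forms of bidegree (1, 1) without a common zero; multiplication by them
  makes the increments of the dimension nondecreasing and bounded, hence eventually constant. Only
  inequalities between constant terms are then needed: the degree of a bundle on a curve is never
  computed. The bundles of \<open>E\<close> and \<open>K\<close> are known only through local
  conditions. Comparing them with Cox coordinates means dividing by coordinates that may vanish;
  this is legitimate because a twisted function that vanishes wherever all Cox coordinates are
  nonzero vanishes identically.\<close>

global_interpretation fs: vector_space "\<lambda>(c::'k::field) (f::'a => 'k) x. c * f x"
  by standard (auto simp: fun_eq_iff algebra_simps)

global_interpretation fs_pair: vector_space_pair
  "\<lambda>(c::'k::field) (f::'a => 'k) x. c * f x" "\<lambda>(c::'k::field) (f::'b => 'k) x. c * f x"
  by unfold_locales

lemma sum_fun_apply: "(\<Sum>v\<in>S. f v) x = (\<Sum>v\<in>S. (f v x :: 'k::comm_monoid_add))"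
  by (induction S rule: infinite_finite_induct) auto

lemma fs_span_finite_iff:
  assumes "finite S"
  shows "f \<in> fs.span S \<longleftrightarrow> (\<exists>c. f = (\<lambda>x. \<Sum>v\<in>S. c v * v x))"
  by (subst fs.span_finite[OF assms]) (auto simp: fun_eq_iff sum_fun_apply image_iff)

lemma fs_subspace_iff:
  "fs.subspace V \<longleftrightarrow> (\<lambda>_. 0) \<in> V \<and> (\<forall>f\<in>V. \<forall>g\<in>V. (\<lambda>x. f x + g x) \<in> V) \<and> (\<forall>c. \<forall>f\<in>V. (\<lambda>x. c * f x) \<in> V)"
  by (simp add: fs.subspace_def plus_fun_def zero_fun_def)

lemma fs_subspace_sum:
  assumes "fs.subspace V" and "\<And>i. i \<in> I ==> f i \<in> V"
  shows "(\<lambda>x. \<Sum>i\<in>I. c i * f i x) \<in> V"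
proof -
  have "(\<Sum>i\<in>I. (\<lambda>x. c i * f i x)) \<in> V" using assms by (intro fs.subspace_sum fs.subspace_scale) auto
  moreover have "(\<Sum>i\<in>I. (\<lambda>x. c i * f i x)) = (\<lambda>x. \<Sum>i\<in>I. c i * f i x)"
    by (auto simp: fun_eq_iff sum_fun_apply)
  ultimately show ?thesis by simp
qed

lemma sum_indicator_mult:
  assumes "finite Q" "q \<in> Q"
  shows "(\<lambda>x. \<Sum>q'\<in>Q. (if q' = q then 1 else 0) * q' x) = (q :: 'a => 'k::field)"
proof
  fix x
  have "(\<Sum>q'\<in>Q. (if q' = q then 1 else 0) * q' x) = (\<Sum>q'\<in>Q. if q' = q then q x else 0)"
    by (rule sum.cong) auto
  thus "(\<Sum>q'\<in>Q. (if q' = q then 1 else 0) * q' x) = q x" using assms by simp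
qed

text \<open>The spanning set need not lie in \<open>V\<close>, so the property passes to subsets at
  once. It accompanies every dimension count because \<open>fs.dim\<close> of an
  infinite-dimensional space is 0.\<close>

definition fin_dim :: "('a => 'k::field) set => bool" where
  "fin_dim V \<longleftrightarrow> (\<exists>B. finite B \<and> V \<subseteq> fs.span B)"

text \<open>Linear independence of the classes of \<open>Q\<close> in the quotient by
  \<open>U\<close>. Stating it for representatives avoids quotient spaces, and \<open>card Q\<close>
  acts as a lower bound for the codimension of \<open>U\<close>.\<close>

definition indep_mod :: "('a => 'k::field) set => ('a => 'k) set => bool" where
  "indep_mod U Q \<longleftrightarrow> finite Q \<and> (\<forall>c. (\<lambda>x. \<Sum>q\<in>Q. c q * q x) \<in> U --> (\<forall>q\<in>Q. c q = 0))"

lemma fin_dim_subset: "fin_dim W ==> V \<subseteq> W ==> fin_dim V" unfolding fin_dim_def by blast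

lemma fin_dim_basis:
  assumes "fin_dim V"
  obtains B where "B \<subseteq> V" "finite B" "fs.independent B" "V \<subseteq> fs.span B" "card B = fs.dim V"
proof -
  obtain S where S: "finite S" "V \<subseteq> fs.span S" using assms by (auto simp: fin_dim_def)
  obtain B where B: "B \<subseteq> V" "fs.independent B" "V \<subseteq> fs.span B" "card B = fs.dim V"
    using fs.basis_exists by blast
  have "finite B" using fs.independent_span_bound[OF S(1) B(2)] B(1) S(2) by blast
  thus ?thesis using that B by blast
qed

lemma fin_dim_dim_mono:
  assumes "fin_dim W" "V \<subseteq> W"
  shows "fs.dim V \<le> fs.dim W"
proof -
  obtain B where B: "B \<subseteq> W" "finite B" "W \<subseteq> fs.span B" "card B = fs.dim W"
    using fin_dim_basis[OF assms(1)] by metis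
  thus ?thesis using fs.dim_le_card[of V B] assms(2) by auto
qed

lemma fs_dependent_finite:
  assumes "finite S"
  shows "fs.dependent S \<longleftrightarrow> (\<exists>u. (\<exists>v\<in>S. u v \<noteq> 0) \<and> (\<lambda>x. \<Sum>v\<in>S. u v * v x) = (\<lambda>_. 0))"
  by (subst fs.dependent_finite[OF assms]) (auto simp: fun_eq_iff sum_fun_apply)

lemma indep_mod_notin:
  assumes "indep_mod U Q" "q \<in> Q"
  shows "q \<notin> U"
proof
  assume "q \<in> U"
  have fin: "finite Q" using assms by (auto simp: indep_mod_def)
  have "(\<lambda>x. \<Sum>q'\<in>Q. (if q' = q then 1 else 0) * q' x) = q"
    by (rule sum_indicator_mult[OF fin assms(2)])
  hence "(\<lambda>x. \<Sum>q'\<in>Q. (if q' = q then 1 else 0) * q' x) \<in> U" using \<open>q \<in> U\<close> by simp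
  from assms(1)[unfolded indep_mod_def, THEN conjunct2, THEN spec, THEN mp, OF this] assms(2)
  show False by force
qed

lemma indep_mod_union:
  assumes U: "fs.subspace U" and B: "B \<subseteq> U" "finite B" "fs.independent B" and Q: "indep_mod U Q"
  shows "fs.independent (B \<union> Q)" "B \<inter> Q = {}"
proof -
  show disj: "B \<inter> Q = {}" using indep_mod_notin[OF Q] B(1) by blast
  have fQ: "finite Q" using Q by (simp add: indep_mod_def)
  show "fs.independent (B \<union> Q)"
  proof
    assume "fs.dependent (B \<union> Q)"
    then obtain u where u: "\<exists>v\<in>B \<union> Q. u v \<noteq> 0" "(\<lambda>x. \<Sum>v\<in>B \<union> Q. u v * v x) = (\<lambda>_. 0)"
      using fs_dependent_finite[of "B \<union> Q"] B(2) fQ by auto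
    have split: "(\<Sum>v\<in>B. u v * v x) + (\<Sum>v\<in>Q. u v * v x) = 0" for x
      using u(2) sum.union_disjoint[OF B(2) fQ disj] by (metis (no_types, lifting))
    have "(\<lambda>x. \<Sum>v\<in>Q. u v * v x) = (\<lambda>x. \<Sum>v\<in>B. (- u v) * v x)"
      using split by (auto simp: fun_eq_iff sum_negf eq_neg_iff_add_eq_0 add.commute)
    also have "\<dots> \<in> U" using fs_subspace_sum[OF U, of B "\<lambda>v. v" "\<lambda>v. - u v"] B(1) by auto
    finally have uQ: "\<forall>q\<in>Q. u q = 0" using Q by (auto simp: indep_mod_def)
    hence "(\<lambda>x. \<Sum>v\<in>B. u v * v x) = (\<lambda>_. 0)" using split by (auto simp: fun_eq_iff)
    hence "\<forall>v\<in>B. u v = 0" using B(2,3) fs_dependent_finite[of B] by blast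
    thus False using u(1) uQ by auto
  qed
qed

lemma indep_mod_dim_le:
  assumes "fs.subspace U" "U \<subseteq> W" "fin_dim W" "Q \<subseteq> W" "indep_mod U Q"
  shows "fs.dim U + card Q \<le> fs.dim W"
proof -
  obtain B where B: "B \<subseteq> U" "finite B" "fs.independent B" "U \<subseteq> fs.span B" "card B = fs.dim U"
    using fin_dim_basis[OF fin_dim_subset[OF assms(3,2)]] by metis
  note ind = indep_mod_union[OF assms(1) B(1-3) assms(5)]
  obtain C where C: "C \<subseteq> W" "finite C" "W \<subseteq> fs.span C" "card C = fs.dim W"
    using fin_dim_basis[OF assms(3)] by metis
  have fQ: "finite Q" using assms(5) by (simp add: indep_mod_def)
  have "card (B \<union> Q) \<le> card C"
    using fs.independent_span_bound[OF C(2) ind(1)] B(1) assms(2,4) C(3) by blast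
  thus ?thesis using card_Un_disjoint[OF B(2) fQ ind(2)] B(5) C(4) by simp
qed

lemma indep_mod_dim_eq:
  assumes U: "fs.subspace U" "U \<subseteq> W" "fin_dim U" and Q: "Q \<subseteq> W" "indep_mod U Q"
    and W: "\<And>w. w \<in> W ==> \<exists>u\<in>U. \<exists>c. w = (\<lambda>x. u x + (\<Sum>q\<in>Q. c q * q x))"
  shows "fin_dim W" "fs.dim W = fs.dim U + card Q"
proof -
  obtain B where B: "B \<subseteq> U" "finite B" "fs.independent B" "U \<subseteq> fs.span B" "card B = fs.dim U"
    using fin_dim_basis[OF U(3)] by metis
  have fQ: "finite Q" using Q(2) by (simp add: indep_mod_def)
  have sub: "W \<subseteq> fs.span (B \<union> Q)"
  proof
    fix w assume "w \<in> W"
    then obtain u c where u: "u \<in> U" "w = (\<lambda>x. u x + (\<Sum>q\<in>Q. c q * q x))" using W by blast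
    have "u \<in> fs.span (B \<union> Q)" using u(1) B(4) fs.span_mono[of B "B \<union> Q"] by auto
    moreover have "(\<lambda>x. \<Sum>q\<in>Q. c q * q x) \<in> fs.span (B \<union> Q)"
      by (rule fs_subspace_sum[OF fs.subspace_span]) (auto intro: fs.span_base)
    ultimately show "w \<in> fs.span (B \<union> Q)" using fs.span_add u(2) by (fastforce simp: plus_fun_def)
  qed
  show fd: "fin_dim W" unfolding fin_dim_def using sub B(2) fQ by blast
  have "fs.dim W \<le> card (B \<union> Q)" by (rule fs.dim_le_card[OF sub]) (use B(2) fQ in auto)
  also have "\<dots> \<le> card B + card Q" by (rule card_Un_le)
  finally show "fs.dim W = fs.dim U + card Q" using indep_mod_dim_le[OF U(1,2) fd Q] B(5) by simp
qed

text \<open>A family of maximal cardinality must span the quotient: adjoining a further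
  \<open>w\<close> creates a relation in which \<open>w\<close> has a nonzero coefficient. Only the
  bound on \<open>card Q\<close> is known beforehand; finite dimension of \<open>W\<close> is drawn
  from the resulting decomposition in \<open>indep_mod_dim_eq\<close>.\<close>

lemma indep_mod_maximal:
  assumes U: "fs.subspace U" "U \<subseteq> W" and W: "fs.subspace W"
    and bd: "\<And>Q. Q \<subseteq> W ==> indep_mod U Q ==> card Q \<le> K"
  obtains Q where "Q \<subseteq> W" "indep_mod U Q"
    "\<And>w. w \<in> W ==> \<exists>u\<in>U. \<exists>c. w = (\<lambda>x. u x + (\<Sum>q\<in>Q. c q * q x))"
proof -
  let ?P = "\<lambda>n. \<exists>Q. Q \<subseteq> W \<and> indep_mod U Q \<and> card Q = n"
  have "?P 0" by (rule exI[of _ "{}"]) (auto simp: indep_mod_def)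
  moreover have "\<forall>n. ?P n --> n \<le> K" using bd by blast
  ultimately obtain N where N: "?P N" "\<forall>n. ?P n --> n \<le> N"
    using Nat.ex_has_greatest_nat[of ?P 0 K] by metis
  then obtain Q where Q: "Q \<subseteq> W" "indep_mod U Q" "card Q = N" by blast
  have fQ: "finite Q" using Q(2) by (simp add: indep_mod_def)
  have "\<exists>u\<in>U. \<exists>c. w = (\<lambda>x. u x + (\<Sum>q\<in>Q. c q * q x))" if w: "w \<in> W" for w
  proof (cases "w \<in> Q")
    case True
    have "(\<lambda>x. \<Sum>q'\<in>Q. (if q' = w then 1 else 0) * q' x) = w"
      by (rule sum_indicator_mult[OF fQ True])
    moreover have "(\<lambda>_. 0) \<in> U" using U(1) by (simp add: fs_subspace_iff)
    ultimately show ?thesis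
      by (intro bexI[of _ "\<lambda>_. 0"] exI[of _ "\<lambda>q'. if q' = w then 1 else 0"]) auto
  next
    case False
    have "\<not> indep_mod U (insert w Q)"
    proof
      assume "indep_mod U (insert w Q)"
      hence "card (insert w Q) \<le> N" using N(2) Q(1) w by blast
      thus False using False fQ Q(3) by simp
    qed
    then obtain c where c: "(\<lambda>x. \<Sum>q\<in>insert w Q. c q * q x) \<in> U" "\<exists>q\<in>insert w Q. c q \<noteq> 0"
      using fQ by (auto simp: indep_mod_def)
    have eq: "(\<Sum>q\<in>insert w Q. c q * q x) = c w * w x + (\<Sum>q\<in>Q. c q * q x)" for x
      using fQ False by simp
    have cw: "c w \<noteq> 0"
    proof
      assume "c w = 0"
      hence "(\<lambda>x. \<Sum>q\<in>Q. c q * q x) \<in> U" using c(1) unfolding eq by simp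
      hence "\<forall>q\<in>Q. c q = 0" using Q(2) by (auto simp: indep_mod_def)
      thus False using c(2) \<open>c w = 0\<close> by auto
    qed
    let ?u = "\<lambda>x. inverse (c w) * (\<Sum>q\<in>insert w Q. c q * q x)"
    have "?u \<in> U" using U(1) c(1) by (auto simp: fs_subspace_iff)
    moreover have "w = (\<lambda>x. ?u x + (\<Sum>q\<in>Q. (- inverse (c w) * c q) * q x))"
      unfolding eq using cw by (auto simp: fun_eq_iff field_simps sum_distrib_left sum_negf)
    ultimately show ?thesis by (intro bexI[of _ ?u] exI[of _ "\<lambda>q. - inverse (c w) * c q"])
  qed
  thus ?thesis using that Q by blast
qed

section \<open>Linear maps defined on a subspace of functions\<close>

definition lin_on :: "('a => 'k::field) set => (('a => 'k) => ('b => 'k)) => bool" where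
  "lin_on V T \<longleftrightarrow> (\<forall>f\<in>V. \<forall>g\<in>V. T (\<lambda>x. f x + g x) = (\<lambda>x. T f x + T g x)) \<and>
     (\<forall>c. \<forall>f\<in>V. T (\<lambda>x. c * f x) = (\<lambda>x. c * T f x))"

lemma lin_on_add:
  assumes "lin_on V T" "f \<in> V" "g \<in> V"
  shows "T (\<lambda>x. f x + g x) = (\<lambda>x. T f x + T g x)"
  using assms unfolding lin_on_def by (elim conjE) (drule (1) bspec, drule (1) bspec, assumption)

lemma lin_on_scale:
  assumes "lin_on V T" "f \<in> V"
  shows "T (\<lambda>x. c * f x) = (\<lambda>x. c * T f x)"
  using assms unfolding lin_on_def by (elim conjE) (drule spec, drule (1) bspec, assumption)

lemma lin_on_sum:
  assumes "lin_on V T" "fs.subspace V" "finite I" "\<And>i. i \<in> I ==> f i \<in> V"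
  shows "T (\<lambda>x. \<Sum>i\<in>I. c i * f i x) = (\<lambda>x. \<Sum>i\<in>I. c i * T (f i) x)" using assms(3,4)
proof (induction I rule: finite_induct)
  case empty
  have z: "(\<lambda>_. 0) \<in> V" using assms(2) by (simp add: fs_subspace_iff)
  from lin_on_scale[OF assms(1) z, of 0] have "T (\<lambda>_. 0) = (\<lambda>_. 0)" by simp
  thus ?case by simp
next
  case (insert i I)
  have 1: "(\<lambda>x. c i * f i x) \<in> V" using assms(2) insert by (auto simp: fs_subspace_iff)
  have 2: "(\<lambda>x. \<Sum>i\<in>I. c i * f i x) \<in> V" by (rule fs_subspace_sum[OF assms(2)]) (use insert in auto)
  have "T (\<lambda>x. c i * f i x + (\<Sum>i\<in>I. c i * f i x)) =
      (\<lambda>x. T (\<lambda>x. c i * f i x) x + T (\<lambda>x. \<Sum>i\<in>I. c i * f i x) x)"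
    by (rule lin_on_add[OF assms(1) 1 2])
  also have "T (\<lambda>x. c i * f i x) = (\<lambda>x. c i * T (f i) x)"
    using assms(1) insert by (intro lin_on_scale) auto
  finally show ?case using insert by simp
qed

lemma lin_on_dim:
  assumes T: "lin_on V T" and V: "fs.subspace V"
    and inj: "\<And>f. f \<in> V ==> T f = (\<lambda>_. 0) ==> f = (\<lambda>_. 0)" and fd: "fin_dim V"
  shows "fin_dim (T ` V)" "fs.dim (T ` V) = fs.dim V"
proof -
  obtain B where B: "B \<subseteq> V" "finite B" "fs.independent B" "V \<subseteq> fs.span B" "card B = fs.dim V"
    using fin_dim_basis[OF fd] by metis
  have zero: "T (\<lambda>_. 0) = (\<lambda>_. 0)" using lin_on_sum[OF T V, of "{}"] by simp
  have injT: "inj_on T V"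
  proof (rule inj_onI)
    fix f g assume fg: "f \<in> V" "g \<in> V" "T f = T g"
    have m: "(\<lambda>x. (-1) * g x) \<in> V" by (rule fs.subspace_scale[OF V fg(2)])
    have "T (\<lambda>x. f x + (-1) * g x) = (\<lambda>x. T f x + T (\<lambda>x. (-1) * g x) x)"
      by (rule lin_on_add[OF T fg(1) m])
    also have "T (\<lambda>x. (-1) * g x) = (\<lambda>x. (-1) * T g x)" by (rule lin_on_scale[OF T fg(2)])
    finally have "T (\<lambda>x. f x + (-1) * g x) = (\<lambda>_. 0)" using fg(3) by simp
    moreover have "(\<lambda>x. f x + (-1) * g x) \<in> V" using fs.subspace_add[OF V fg(1) m] by (simp add: plus_fun_def)
    ultimately have "(\<lambda>x. f x + (-1) * g x) = (\<lambda>_. 0)" using inj by blast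
    thus "f = g" by (auto simp: fun_eq_iff)
  qed
  have span: "T ` V \<subseteq> fs.span (T ` B)"
  proof
    fix g assume "g \<in> T ` V"
    then obtain f where f: "f \<in> V" "g = T f" by blast
    obtain c where c: "f = (\<lambda>x. \<Sum>v\<in>B. c v * v x)"
      using f(1) B(4) fs_span_finite_iff[OF B(2)] by blast
    have "g = (\<lambda>x. \<Sum>v\<in>B. c v * T v x)"
      unfolding f(2) c by (rule lin_on_sum[OF T V B(2)]) (use B in auto)
    also have "\<dots> \<in> fs.span (T ` B)"
      by (rule fs_subspace_sum[OF fs.subspace_span]) (auto intro: fs.span_base)
    finally show "g \<in> fs.span (T ` B)" .
  qed
  have ind: "fs.independent (T ` B)"
  proof
    assume "fs.dependent (T ` B)"
    then obtain u where u: "\<exists>v\<in>T ` B. u v \<noteq> 0" "(\<lambda>x. \<Sum>v\<in>T ` B. u v * v x) = (\<lambda>_. 0)"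
      using fs_dependent_finite[of "T ` B"] B(2) by auto
    have "(\<lambda>x. \<Sum>v\<in>T ` B. u v * v x) = (\<lambda>x. \<Sum>v\<in>B. u (T v) * T v x)"
      by (intro ext) (subst sum.reindex[OF inj_on_subset[OF injT B(1)]], simp)
    also have "\<dots> = T (\<lambda>x. \<Sum>v\<in>B. u (T v) * v x)"
      by (rule lin_on_sum[OF T V B(2), symmetric]) (use B in auto)
    finally have "T (\<lambda>x. \<Sum>v\<in>B. u (T v) * v x) = (\<lambda>_. 0)" using u(2) by simp
    moreover have "(\<lambda>x. \<Sum>v\<in>B. u (T v) * v x) \<in> V" by (rule fs_subspace_sum[OF V]) (use B(1) in auto)
    ultimately have "(\<lambda>x. \<Sum>v\<in>B. u (T v) * v x) = (\<lambda>_. 0)" using inj by blast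
    hence "\<forall>v\<in>B. u (T v) = 0" using B(2,3) fs_dependent_finite[of B] by auto
    thus False using u(1) by auto
  qed
  show "fin_dim (T ` V)" unfolding fin_dim_def using span B(2) by blast
  have "fs.dim (T ` V) = card (T ` B)" using B(1) span ind by (intro fs.dim_unique) auto
  thus "fs.dim (T ` V) = fs.dim V" using card_image[OF inj_on_subset[OF injT B(1)]] B(5) by simp
qed

lemma lin_on_mult: "lin_on V (\<lambda>f x. g x * f x)" by (auto simp: lin_on_def algebra_simps)

section \<open>Forms, points and closed sets\<close>

text \<open>Bihomogeneity as an identity of functions; through it the vanishing of a form at a point
  does not depend on the coordinate vectors picked by \<open>SOME\<close>.\<close>

lemma biform_rescale:
  "biform a b d e F ==> F (\<lambda>i. c * x i) (\<lambda>j. c' * y j) = c ^ d * c' ^ e * F x y"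
  by (induction rule: biform.induct) (auto simp: power_add algebra_simps)

lemma biform_scale: "biform a b d e F ==> biform a b d e (\<lambda>x y. c * F x y)"
  using biform.mult[OF biform.const[of a b c], of d e F] by simp

lemma biform_power: "biform a b d e F ==> biform a b (m * d) (m * e) (\<lambda>x y. F x y ^ m)"
proof (induction m)
  case 0
  thus ?case using biform.const[of a b 1] by simp
next
  case (Suc m)
  from biform.mult[OF Suc.prems Suc.IH[OF Suc.prems]] show ?case by simp
qed

lemma biform_coord_x_power: "i \<le> a ==> biform a b m 0 (\<lambda>x y. x i ^ m)"
  using biform_power[OF biform.coord_x, of i a b m] by simp

lemma biform_coord_y_power: "j \<le> b ==> biform a b 0 m (\<lambda>x y. y j ^ m)"
  using biform_power[OF biform.coord_y, of j b a m] by simp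

lemma biform_coords: "i \<le> a ==> j \<le> b ==> biform a b d e (\<lambda>x y. x i ^ d * y j ^ e)"
  using biform.mult[OF biform_coord_x_power[of i a b d] biform_coord_y_power[of j b a e]] by simp

lemma biform_zero: "biform a b d e (\<lambda>_ _. 0)"
  using biform_scale[OF biform_coords[of 0 a 0 b d e], of 0] by simp

lemma biform_diff:
  assumes "biform a b d e F" "biform a b d e G"
  shows "biform a b d e (\<lambda>x y. F x y - G x y)"
  using biform.add[OF assms(1) biform_scale[OF assms(2), of "-1"]] by simp

lemma form_at_mult [simp]: "form_at (\<lambda>x y. F x y * G x y) p = form_at F p * form_at G p"
  and form_at_add [simp]: "form_at (\<lambda>x y. F x y + G x y) p = form_at F p + form_at G p"
  and form_at_diff [simp]: "form_at (\<lambda>x y. F x y - G x y) p = form_at F p - form_at G p"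
  and form_at_const [simp]: "form_at (\<lambda>x y. c) p = c"
  and form_at_power [simp]: "form_at (\<lambda>x y. F x y ^ m) p = form_at F p ^ m"
  and form_at_sum [simp]: "form_at (\<lambda>x y. \<Sum>i\<in>I. H i x y) p = (\<Sum>i\<in>I. form_at (H i) p)"
  and form_at_x [simp]: "form_at (\<lambda>x y. x i) p = xc p i"
  and form_at_y [simp]: "form_at (\<lambda>x y. y i) p = yc p i" by (simp_all add: form_at_def)

lemma ppoint_self: "v \<in> ppoint v" unfolding ppoint_def by (rule CollectI, rule exI[of _ 1]) auto

lemma ppoint_scale:
  assumes "c \<noteq> 0"
  shows "ppoint (\<lambda>i. c * v i) = ppoint v"
proof -
  have "\<exists>d. (\<lambda>i. c' * v i) = (\<lambda>i. d * (c * v i)) \<and> d \<noteq> 0" if "c' \<noteq> 0" for c'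
    using assms that by (intro exI[of _ "c' / c"]) (auto simp: fun_eq_iff)
  moreover have "\<exists>d. (\<lambda>i. c' * (c * v i)) = (\<lambda>i. d * v i) \<and> d \<noteq> 0" if "c' \<noteq> 0" for c'
    using assms that by (intro exI[of _ "c' * c"]) (auto simp: fun_eq_iff)
  ultimately show ?thesis unfolding ppoint_def by blast
qed

lemma proj_space_mem:
  assumes "P \<in> proj_space N" "v \<in> P"
  shows "P = ppoint v" "v \<noteq> (\<lambda>_. 0)" "\<And>i. i > N ==> v i = 0"
proof -
  obtain w where w: "P = ppoint w" "w \<noteq> (\<lambda>_. 0)" "\<forall>i>N. w i = 0"
    using assms(1) by (auto simp: proj_space_def)
  obtain c where c: "c \<noteq> 0" "v = (\<lambda>i. c * w i)" using assms(2) w(1) by (auto simp: ppoint_def)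
  show "P = ppoint v" using w(1) c ppoint_scale by metis
  show "v \<noteq> (\<lambda>_. 0)" using w(2) c by (auto simp: fun_eq_iff)
  show "v i = 0" if "i > N" for i using that w(3) c by simp
qed

lemma
  assumes "p \<in> biproj a b"
  shows fst_biproj: "fst p = ppoint (xc p)" and xc_nonzero: "xc p \<noteq> (\<lambda>_. 0)"
    and xc_zero: "\<And>i. i > a ==> xc p i = 0"
    and snd_biproj: "snd p = ppoint (yc p)" and yc_nonzero: "yc p \<noteq> (\<lambda>_. 0)"
    and yc_zero: "\<And>j. j > b ==> yc p j = 0"
proof -
  have P: "fst p \<in> proj_space a" "snd p \<in> proj_space b" using assms by (auto simp: biproj_def)
  obtain v w where vw: "fst p = ppoint v" "snd p = ppoint w" using P by (auto simp: proj_space_def)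
  have "xc p \<in> fst p" unfolding xc_def vw by (rule someI[of "\<lambda>u. u \<in> ppoint v"]) (rule ppoint_self)
  from proj_space_mem[OF P(1) this]
  show "fst p = ppoint (xc p)" "xc p \<noteq> (\<lambda>_. 0)" "\<And>i. i > a ==> xc p i = 0" by auto
  have "yc p \<in> snd p" unfolding yc_def vw by (rule someI[of "\<lambda>u. u \<in> ppoint w"]) (rule ppoint_self)
  from proj_space_mem[OF P(2) this]
  show "snd p = ppoint (yc p)" "yc p \<noteq> (\<lambda>_. 0)" "\<And>j. j > b ==> yc p j = 0" by auto
qed

lemma ex_xc_nonzero: "p \<in> biproj a b ==> \<exists>i\<le>a. xc p i \<noteq> 0"
  using xc_nonzero xc_zero by (metis (no_types, lifting) ext not_le)

lemma ex_yc_nonzero: "p \<in> biproj a b ==> \<exists>j\<le>b. yc p j \<noteq> 0"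
  using yc_nonzero yc_zero by (metis (no_types, lifting) ext not_le)

lemma biproj_pointI:
  assumes "v \<noteq> (\<lambda>_. 0)" "\<forall>i>a. v i = 0" "w \<noteq> (\<lambda>_. 0)" "\<forall>j>b. w j = 0"
  shows "(ppoint v, ppoint w) \<in> biproj a b"
    "\<exists>c. c \<noteq> 0 \<and> xc (ppoint v, ppoint w) = (\<lambda>i. c * v i)"
    "\<exists>c. c \<noteq> 0 \<and> yc (ppoint v, ppoint w) = (\<lambda>i. c * w i)"
proof -
  show "(ppoint v, ppoint w) \<in> biproj a b" using assms by (auto simp: biproj_def proj_space_def)
  have "xc (ppoint v, ppoint w) \<in> ppoint v" unfolding xc_def fst_conv
    by (rule someI[of "\<lambda>u. u \<in> ppoint v"]) (rule ppoint_self)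
  thus "\<exists>c. c \<noteq> 0 \<and> xc (ppoint v, ppoint w) = (\<lambda>i. c * v i)" unfolding ppoint_def by blast
  have "yc (ppoint v, ppoint w) \<in> ppoint w" unfolding yc_def snd_conv
    by (rule someI[of "\<lambda>u. u \<in> ppoint w"]) (rule ppoint_self)
  thus "\<exists>c. c \<noteq> 0 \<and> yc (ppoint v, ppoint w) = (\<lambda>i. c * w i)" unfolding ppoint_def by blast
qed

lemma biproj_eqI:
  assumes "p \<in> biproj a b" "q \<in> biproj a b" "c \<noteq> 0" "\<And>i. xc p i = c * xc q i"
    "c' \<noteq> 0" "\<And>j. yc p j = c' * yc q j"
  shows "p = q"
proof -
  have "xc p = (\<lambda>i. c * xc q i)" "yc p = (\<lambda>j. c' * yc q j)" using assms by auto
  hence "fst p = fst q" "snd p = snd q"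
    using fst_biproj[OF assms(1)] fst_biproj[OF assms(2)] snd_biproj[OF assms(1)]
      snd_biproj[OF assms(2)] ppoint_scale assms(3,5) by metis+
  thus ?thesis by (simp add: prod_eq_iff)
qed

lemma form_at_point_eq_0_iff:
  assumes "biform a b d e F" "v \<noteq> (\<lambda>_. 0)" "\<forall>i>a. v i = 0" "w \<noteq> (\<lambda>_. 0)" "\<forall>j>b. w j = 0"
  shows "form_at F (ppoint v, ppoint w) = 0 \<longleftrightarrow> F v w = 0"
proof -
  obtain c where c: "c \<noteq> 0" "xc (ppoint v, ppoint w) = (\<lambda>i. c * v i)"
    using biproj_pointI(2)[OF assms(2-5)] by (elim exE conjE)
  obtain c' where c': "c' \<noteq> 0" "yc (ppoint v, ppoint w) = (\<lambda>i. c' * w i)"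
    using biproj_pointI(3)[OF assms(2-5)] by (elim exE conjE)
  show ?thesis unfolding form_at_def c(2) c'(2) biform_rescale[OF assms(1)] using c(1) c'(1) by simp
qed

lemma zclosed_subset: "zclosed a b Z ==> Z \<subseteq> biproj a b" unfolding zclosed_def by blast

lemma zclosed_form: "biform a b d e F ==> zclosed a b {p \<in> biproj a b. form_at F p = 0}"
  unfolding zclosed_def by (rule exI[of _ "{F}"]) auto

lemma zclosed_empty: "zclosed a b {}"
  unfolding zclosed_def by (rule exI[of _ "{\<lambda>_ _. 1}"]) (use biform.const[of a b 1] in auto)

lemma zclosed_separate:
  assumes "zclosed a b Z" "p \<in> biproj a b" "p \<notin> Z"
  shows "\<exists>F d e. biform a b d e F \<and> form_at F p \<noteq> 0 \<and> (\<forall>q\<in>Z. form_at F q = 0)"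
  using assms unfolding zclosed_def by blast

text \<open>The set of all forms vanishing on \<open>Z\<close> serves as defining equations, so it
  suffices to separate each outside point by one form.\<close>

lemma zclosedI:
  assumes "Z \<subseteq> biproj a b"
    and "\<And>p. p \<in> biproj a b ==> p \<notin> Z ==>
      \<exists>F d e. biform a b d e F \<and> form_at F p \<noteq> 0 \<and> (\<forall>q\<in>Z. form_at F q = 0)"
  shows "zclosed a b Z" unfolding zclosed_def
proof (rule exI[of _ "{F. (\<exists>d e. biform a b d e F) \<and> (\<forall>q\<in>Z. form_at F q = 0)}"], intro conjI)
  show "Z = {p \<in> biproj a b. \<forall>F\<in>{F. (\<exists>d e. biform a b d e F) \<and> (\<forall>q\<in>Z. form_at F q = 0)}.
      form_at F p = 0}" using assms by blast
qed auto

lemma zclosed_Inter: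
  assumes "\<And>Z. Z \<in> S ==> zclosed a b Z" "S \<noteq> {}"
  shows "zclosed a b (\<Inter>S)"
proof (rule zclosedI)
  show "\<Inter>S \<subseteq> biproj a b" using assms zclosed_subset by blast
  fix p assume p: "p \<in> biproj a b" "p \<notin> \<Inter>S"
  then obtain Z where Z: "Z \<in> S" "p \<notin> Z" by blast
  have "\<exists>F d e. biform a b d e F \<and> form_at F p \<noteq> 0 \<and> (\<forall>q\<in>Z. form_at F q = 0)"
    by (rule zclosed_separate[OF assms(1)[OF Z(1)] p(1) Z(2)])
  thus "\<exists>F d e. biform a b d e F \<and> form_at F p \<noteq> 0 \<and> (\<forall>q\<in>\<Inter>S. form_at F q = 0)" using Z(1) by blast
qed

lemma zclosed_Int: "zclosed a b Y ==> zclosed a b Z ==> zclosed a b (Y \<inter> Z)"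
  using zclosed_Inter[of "{Y, Z}" a b] by auto

lemma zclosed_Un:
  assumes "zclosed a b Y" "zclosed a b Z"
  shows "zclosed a b (Y \<union> Z)"
proof (rule zclosedI)
  show "Y \<union> Z \<subseteq> biproj a b" using assms zclosed_subset by blast
  fix p assume p: "p \<in> biproj a b" "p \<notin> Y \<union> Z"
  obtain F d e where F: "biform a b d e F" "form_at F p \<noteq> 0" "\<forall>q\<in>Y. form_at F q = 0"
    using zclosed_separate[OF assms(1) p(1)] p by blast
  obtain G d' e' where G: "biform a b d' e' G" "form_at G p \<noteq> 0" "\<forall>q\<in>Z. form_at G q = 0"
    using zclosed_separate[OF assms(2) p(1)] p by blast
  show "\<exists>F d e. biform a b d e F \<and> form_at F p \<noteq> 0 \<and> (\<forall>q\<in>Y \<union> Z. form_at F q = 0)"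
    using biform.mult[OF F(1) G(1)] F(2,3) G(2,3)
    by (intro exI[of _ "\<lambda>x y. F x y * G x y"] exI[of _ "d + d'"] exI[of _ "e + e'"]) auto
qed

text \<open>The 2 by 2 minors built from the coordinates of \<open>p\<close> vanish at
  \<open>p\<close>. A point \<open>q\<close> not separated from \<open>p\<close> would be a zero of
  all of them, which makes the coordinate vectors of the two points proportional.\<close>

lemma zclosed_singleton:
  assumes p: "p \<in> biproj a b"
  shows "zclosed a b {p}"
proof (rule zclosedI)
  fix q assume q: "q \<in> biproj a b" "q \<notin> {p}"
  show "\<exists>F d e. biform a b d e F \<and> form_at F q \<noteq> 0 \<and> (\<forall>q'\<in>{p}. form_at F q' = 0)"
  proof (rule ccontr)
    assume neg: "\<not> ?thesis"
    hence neg: "biform a b d e F ==> form_at F p = 0 ==> form_at F q = 0" for F d e by auto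
    obtain i j where i: "i \<le> a" "xc p i \<noteq> 0" and j: "j \<le> b" "yc p j \<noteq> 0"
      using ex_xc_nonzero[OF p] ex_yc_nonzero[OF p] by blast
    obtain i' j' where i': "i' \<le> a" "xc q i' \<noteq> 0" and j': "j' \<le> b" "yc q j' \<noteq> 0"
      using ex_xc_nonzero[OF q(1)] ex_yc_nonzero[OF q(1)] by blast
    have x: "xc p i * xc q k = xc p k * xc q i" for k
    proof (cases "k \<le> a")
      case True
      have "biform a b 1 0 (\<lambda>x y. xc p i * x k - xc p k * x i)"
        by (intro biform_diff biform_scale biform.coord_x True i)
      hence "form_at (\<lambda>x y. xc p i * x k - xc p k * x i) q = 0"
        by (rule neg) (simp add: form_at_def)
      thus ?thesis by (simp add: form_at_def)
    next
      case False
      thus ?thesis using xc_zero[OF p] xc_zero[OF q(1)] by simp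
    qed
    have y: "yc p j * yc q k = yc p k * yc q j" for k
    proof (cases "k \<le> b")
      case True
      have "biform a b 0 1 (\<lambda>x y. yc p j * y k - yc p k * y j)"
        by (intro biform_diff biform_scale biform.coord_y True j)
      hence "form_at (\<lambda>x y. yc p j * y k - yc p k * y j) q = 0"
        by (rule neg) (simp add: form_at_def)
      thus ?thesis by (simp add: form_at_def)
    next
      case False
      thus ?thesis using yc_zero[OF p] yc_zero[OF q(1)] by simp
    qed
    have qi: "xc q i \<noteq> 0" using x[of i'] i' i by auto
    have qj: "yc q j \<noteq> 0" using y[of j'] j' j by auto
    have "p = q" by (rule biproj_eqI[OF p q(1), of "xc p i / xc q i" "yc p j / yc q j"])
        (use x y i j qi qj in \<open>auto simp: field_simps\<close>)
    thus False using q by simp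
  qed
qed (use p in auto)

lemma zopen_form: "biform a b d e F ==> zopen a b {p \<in> biproj a b. form_at F p \<noteq> 0}"
proof -
  assume F: "biform a b d e F"
  have "biproj a b - {p \<in> biproj a b. form_at F p \<noteq> 0} = {p \<in> biproj a b. form_at F p = 0}" by blast
  thus ?thesis using zclosed_form[OF F] by (auto simp: zopen_def)
qed

lemma zopen_biproj: "zopen a b (biproj a b)" using zclosed_empty by (auto simp: zopen_def)

lemma zopen_Int: "zopen a b U ==> zopen a b V ==> zopen a b (U \<inter> V)"
  using zclosed_Un[of a b "biproj a b - U" "biproj a b - V"] by (auto simp: zopen_def Diff_Int)

lemma zopen_separate:
  assumes "zopen a b U" "p \<in> U"
  shows "\<exists>F d e. biform a b d e F \<and> form_at F p \<noteq> 0 \<and> (\<forall>q\<in>biproj a b - U. form_at F q = 0)"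
proof -
  have "p \<in> biproj a b" "zclosed a b (biproj a b - U)" using assms by (auto simp: zopen_def)
  from zclosed_separate[OF this(2,1)] assms(2) show ?thesis by blast
qed

section \<open>Twisted regular functions\<close>

text \<open>
  \<open>f\<close> is a section of \<open>O(d, e)\<close> over \<open>W\<close>, recorded through the chosen homogeneous coordinates.  The
  local equation \<open>f = F / G\<close> is demanded on all of \<open>W\<close>, cleared of denominators: multiplying \<open>F\<close> and
  \<open>G\<close> by a form that vanishes outside a given neighbourhood makes this no restriction.
\<close>

definition tw_at where
  "tw_at a b W d e f p F G d1 e1 d2 e2 \<longleftrightarrow> biform a b d1 e1 F \<and> biform a b d2 e2 G \<and>
     int d1 = d + int d2 \<and> int e1 = e + int e2 \<and> form_at G p \<noteq> 0 \<and>
     (\<forall>q\<in>W. form_at G q * f q = form_at F q)"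

definition tw ::
  "nat => nat => 'k::field pt set => int => int => ('k pt => 'k) => bool" where
  "tw a b W d e f \<longleftrightarrow> (\<forall>p\<in>W. \<exists>F G d1 e1 d2 e2. tw_at a b W d e f p F G d1 e1 d2 e2)"

lemma twI:
  assumes "\<And>p. p \<in> W ==> \<exists>F G d1 e1 d2 e2. tw_at a b W d e f p F G d1 e1 d2 e2"
  shows "tw a b W d e f" using assms unfolding tw_def by blast

lemma twD:
  assumes "tw a b W d e f" "p \<in> W"
  shows "\<exists>F G d1 e1 d2 e2. tw_at a b W d e f p F G d1 e1 d2 e2"
  using assms unfolding tw_def by blast

lemma tw_atD:
  assumes "tw_at a b W d e f p F G d1 e1 d2 e2"
  shows "biform a b d1 e1 F" "biform a b d2 e2 G" "int d1 = d + int d2" "int e1 = e + int e2"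
    "form_at G p \<noteq> 0" "\<And>q. q \<in> W ==> form_at G q * f q = form_at F q"
  using assms unfolding tw_at_def by blast+

lemma tw_subset: "tw a b W d e f ==> W' \<subseteq> W ==> tw a b W' d e f"
  unfolding tw_def tw_at_def by (meson subsetD)

lemma tw_cong: "(\<And>q. q \<in> W ==> f q = g q) ==> tw a b W d e f \<longleftrightarrow> tw a b W d e g"
  unfolding tw_def tw_at_def by simp

lemma tw_form:
  assumes "biform a b d e F"
  shows "tw a b W (int d) (int e) (form_at F)"
proof (rule twI, unfold tw_at_def, intro exI conjI ballI)
  show "biform a b d e F" by fact
  show "biform a b 0 0 (\<lambda>x y. 1)" by (rule biform.const)
qed auto

lemma tw_const: "tw a b W 0 0 (\<lambda>_. c)"
  using tw_form[OF biform.const[of a b c], of W] by (simp add: form_at_def[abs_def])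

lemma tw_x: "i \<le> a ==> tw a b W 1 0 (\<lambda>q. xc q i)"
  using tw_form[OF biform.coord_x, of i a b W] by (simp add: form_at_def[abs_def])

lemma tw_y: "j \<le> b ==> tw a b W 0 1 (\<lambda>q. yc q j)"
  using tw_form[OF biform.coord_y, of j b a W] by (simp add: form_at_def[abs_def])

lemma tw_add:
  assumes "tw a b W d e f" "tw a b W d e g"
  shows "tw a b W d e (\<lambda>q. f q + g q)"
proof (rule twI)
  fix p assume p: "p \<in> W"
  obtain F G d1 e1 d2 e2 where "tw_at a b W d e f p F G d1 e1 d2 e2" using twD[OF assms(1) p] by blast
  note F = tw_atD[OF this]
  obtain F' G' d1' e1' d2' e2' where "tw_at a b W d e g p F' G' d1' e1' d2' e2'" using twD[OF assms(2) p] by blast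
  note F' = tw_atD[OF this]
  have eq: "d2 + d1' = d1 + d2'" "e2 + e1' = e1 + e2'" using F(3,4) F'(3,4) by linarith+
  have H: "biform a b (d1 + d2') (e1 + e2') (\<lambda>x y. F x y * G' x y + G x y * F' x y)"
    using biform.add[OF biform.mult[OF F(1) F'(2)], of "\<lambda>x y. G x y * F' x y"]
      biform.mult[OF F(2) F'(1)] eq by simp
  show "\<exists>F G d1 e1 d2 e2. tw_at a b W d e (\<lambda>q. f q + g q) p F G d1 e1 d2 e2" unfolding tw_at_def
  proof (intro exI conjI ballI)
    show "biform a b (d1 + d2') (e1 + e2') (\<lambda>x y. F x y * G' x y + G x y * F' x y)" by (rule H)
    show "biform a b (d2 + d2') (e2 + e2') (\<lambda>x y. G x y * G' x y)" by (rule biform.mult[OF F(2) F'(2)])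
    show "form_at (\<lambda>x y. G x y * G' x y) p \<noteq> 0" using F(5) F'(5) by simp
    fix q assume q: "q \<in> W"
    show "form_at (\<lambda>x y. G x y * G' x y) q * (f q + g q) =
        form_at (\<lambda>x y. F x y * G' x y + G x y * F' x y) q"
      by (simp add: F(6)[OF q, symmetric] F'(6)[OF q, symmetric] algebra_simps)
  qed (use F(3,4) in auto)
qed

lemma tw_mult:
  assumes "tw a b W d e f" "tw a b W d' e' g" "D = d + d'" "E = e + e'"
  shows "tw a b W D E (\<lambda>q. f q * g q)" unfolding assms(3,4)
proof (rule twI)
  fix p assume p: "p \<in> W"
  obtain F G d1 e1 d2 e2 where "tw_at a b W d e f p F G d1 e1 d2 e2" using twD[OF assms(1) p] by blast
  note F = tw_atD[OF this]
  obtain F' G' d1' e1' d2' e2' where "tw_at a b W d' e' g p F' G' d1' e1' d2' e2'" using twD[OF assms(2) p] by blast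
  note F' = tw_atD[OF this]
  show "\<exists>F G d1 e1 d2 e2. tw_at a b W (d + d') (e + e') (\<lambda>q. f q * g q) p F G d1 e1 d2 e2" unfolding tw_at_def
  proof (intro exI conjI ballI)
    show "biform a b (d1 + d1') (e1 + e1') (\<lambda>x y. F x y * F' x y)" by (rule biform.mult[OF F(1) F'(1)])
    show "biform a b (d2 + d2') (e2 + e2') (\<lambda>x y. G x y * G' x y)" by (rule biform.mult[OF F(2) F'(2)])
    show "form_at (\<lambda>x y. G x y * G' x y) p \<noteq> 0" using F(5) F'(5) by simp
    fix q assume q: "q \<in> W"
    show "form_at (\<lambda>x y. G x y * G' x y) q * (f q * g q) = form_at (\<lambda>x y. F x y * F' x y) q"
      by (simp add: F(6)[OF q, symmetric] F'(6)[OF q, symmetric] algebra_simps)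
  qed (use F(3,4) F'(3,4) in auto)
qed

lemma tw_scale: "tw a b W d e f ==> tw a b W d e (\<lambda>q. c * f q)"
  by (rule tw_mult[OF tw_const[of a b W c]]) auto

lemma tw_inverse:
  assumes "tw a b W d e f" "\<And>q. q \<in> W ==> f q \<noteq> 0"
  shows "tw a b W (- d) (- e) (\<lambda>q. inverse (f q))"
proof (rule twI)
  fix p assume p: "p \<in> W"
  obtain F G d1 e1 d2 e2 where "tw_at a b W d e f p F G d1 e1 d2 e2" using twD[OF assms(1) p] by blast
  note F = tw_atD[OF this]
  show "\<exists>F G d1 e1 d2 e2. tw_at a b W (- d) (- e) (\<lambda>q. inverse (f q)) p F G d1 e1 d2 e2" unfolding tw_at_def
  proof (intro exI conjI ballI)
    show "form_at F p \<noteq> 0" using F(5) F(6)[OF p] assms(2)[OF p] by (metis mult_eq_0_iff)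
    fix q assume q: "q \<in> W"
    show "form_at F q * inverse (f q) = form_at G q"
      using F(6)[OF q] assms(2)[OF q] by (simp add: field_simps)
  qed (use F in auto)
qed

lemma tw_power: "tw a b W d e f ==> tw a b W (int m * d) (int m * e) (\<lambda>q. f q ^ m)"
proof (induction m)
  case 0
  show ?case using tw_const[of a b W 1] by simp
next
  case (Suc m)
  show ?case by (simp, rule tw_mult[OF Suc.prems Suc.IH[OF Suc.prems]]) (auto simp: algebra_simps)
qed

lemma tw_powi:
  assumes "tw a b W d e f" "\<And>q. q \<in> W ==> f q \<noteq> 0"
  shows "tw a b W (m * d) (m * e) (\<lambda>q. f q powi m)"
proof (cases "m \<ge> 0")
  case True
  thus ?thesis using tw_power[OF assms(1), of "nat m"] by (simp add: power_int_def)
next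
  case False
  thus ?thesis using tw_power[OF tw_inverse[OF assms], of "nat (- m)"] by (simp add: power_int_def)
qed

lemma ex_form_nonzero_at:
  assumes "p \<in> biproj a b"
  shows "\<exists>G. biform a b m n G \<and> form_at G p \<noteq> 0"
proof -
  obtain i j where "i \<le> a" "xc p i \<noteq> 0" "j \<le> b" "yc p j \<noteq> 0"
    using ex_xc_nonzero[OF assms] ex_yc_nonzero[OF assms] by blast
  thus ?thesis using biform_coords[of i a j b m n]
    by (intro exI[of _ "\<lambda>x y. x i ^ m * y j ^ n"]) auto
qed

lemma tw_zero:
  assumes "W \<subseteq> biproj a b"
  shows "tw a b W d e (\<lambda>_. 0)"
proof (rule twI)
  fix p assume "p \<in> W"
  \<comment> \<open>Denominators of degrees \<open>|d|\<close> and \<open>|e|\<close> leave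
    nonnegative degrees for the numerator 0, whatever the signs of \<open>d\<close> and
    \<open>e\<close>.\<close>
  then obtain G where G: "biform a b (nat \<bar>d\<bar>) (nat \<bar>e\<bar>) G" "form_at G p \<noteq> 0"
    using ex_form_nonzero_at assms by blast
  show "\<exists>F G d1 e1 d2 e2. tw_at a b W d e (\<lambda>_. 0) p F G d1 e1 d2 e2" unfolding tw_at_def
    by (rule exI[of _ "\<lambda>_ _. 0"], rule exI[of _ G], rule exI[of _ "nat (d + \<bar>d\<bar>)"],
        rule exI[of _ "nat (e + \<bar>e\<bar>)"], rule exI[of _ "nat \<bar>d\<bar>"], rule exI[of _ "nat \<bar>e\<bar>"])
       (use G biform_zero[of a b] in auto)
qed

lemma tw_sum:
  assumes "W \<subseteq> biproj a b" "\<And>i. i \<in> I ==> tw a b W d e (f i)"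
  shows "tw a b W d e (\<lambda>q. \<Sum>i\<in>I. f i q)" using assms(2)
proof (induction I rule: infinite_finite_induct)
  case (insert i I)
  have "tw a b W d e (\<lambda>q. f i q + (\<Sum>i\<in>I. f i q))" by (rule tw_add) (use insert in auto)
  thus ?case using insert by simp
qed (auto intro: tw_zero[OF assms(1)])

lemma tw_prod:
  assumes "finite I" "\<And>i. i \<in> I ==> tw a b W (d i) (e i) (f i)"
  shows "tw a b W (\<Sum>i\<in>I. d i) (\<Sum>i\<in>I. e i) (\<lambda>q. \<Prod>i\<in>I. f i q)" using assms
proof (induction I rule: finite_induct)
  case empty
  show ?case using tw_const[of a b W 1] by simp
next
  case (insert i I)
  have "tw a b W (\<Sum>i\<in>insert i I. d i) (\<Sum>i\<in>insert i I. e i) (\<lambda>q. f i q * (\<Prod>i\<in>I. f i q))"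
    by (rule tw_mult[of a b W "d i" "e i" _ "\<Sum>i\<in>I. d i" "\<Sum>i\<in>I. e i"]) (use insert in auto)
  thus ?case using insert by simp
qed

lemma tw_local:
  assumes W: "W \<subseteq> biproj a b"
    and "\<And>p. p \<in> W ==> \<exists>U. zopen a b U \<and> p \<in> U \<and> tw a b (W \<inter> U) d e f"
  shows "tw a b W d e f"
proof (rule twI)
  fix p assume p: "p \<in> W"
  then obtain U where U: "zopen a b U" "p \<in> U" "tw a b (W \<inter> U) d e f" using assms by blast
  have "p \<in> W \<inter> U" using p U by simp
  from twD[OF U(3) this] obtain F G d1 e1 d2 e2 where "tw_at a b (W \<inter> U) d e f p F G d1 e1 d2 e2" by blast
  note F = tw_atD[OF this]
  obtain H d0 e0 where H: "biform a b d0 e0 H" "form_at H p \<noteq> 0"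
    "\<forall>q\<in>biproj a b - U. form_at H q = 0" using zopen_separate[OF U(1,2)] by blast
  show "\<exists>F G d1 e1 d2 e2. tw_at a b W d e f p F G d1 e1 d2 e2" unfolding tw_at_def
  proof (intro exI conjI ballI)
    show "biform a b (d0 + d1) (e0 + e1) (\<lambda>x y. H x y * F x y)" by (rule biform.mult[OF H(1) F(1)])
    show "biform a b (d0 + d2) (e0 + e2) (\<lambda>x y. H x y * G x y)" by (rule biform.mult[OF H(1) F(2)])
    show "form_at (\<lambda>x y. H x y * G x y) p \<noteq> 0" using F(5) H(2) by simp
    fix q assume q: "q \<in> W"
    show "form_at (\<lambda>x y. H x y * G x y) q * f q = form_at (\<lambda>x y. H x y * F x y) q"
      using F(6)[of q] H(3) q W by (cases "q \<in> U") auto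
  qed (use F in auto)
qed

lemma tw_form_div:
  assumes "biform a b d1 e1 F" "biform a b d2 e2 G" "int d1 = d + int d2" "int e1 = e + int e2"
    and "\<And>q. q \<in> W ==> form_at G q \<noteq> 0 \<and> f q = form_at F q / form_at G q"
  shows "tw a b W d e f"
proof (rule twI)
  fix p assume "p \<in> W"
  show "\<exists>F G d1 e1 d2 e2. tw_at a b W d e f p F G d1 e1 d2 e2" unfolding tw_at_def
  proof (intro exI conjI ballI)
    show "form_at G p \<noteq> 0" using assms(5)[OF \<open>p \<in> W\<close>] by blast
    fix q assume "q \<in> W"
    from assms(5)[OF this] show "form_at G q * f q = form_at F q" by simp
  qed (fact assms(1-4))+
qed

lemma regular_on_iff_tw:
  assumes W: "W \<subseteq> biproj a b"
  shows "regular_on a b W f \<longleftrightarrow> tw a b W 0 0 f"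
proof
  assume R: "regular_on a b W f"
  show "tw a b W 0 0 f"
  proof (rule tw_local[OF W])
    fix p assume "p \<in> W"
    with R obtain U F G d e where U: "zopen a b U" "p \<in> U" "biform a b d e F" "biform a b d e G"
      "\<And>q. q \<in> W \<inter> U ==> form_at G q \<noteq> 0 \<and> f q = form_at F q / form_at G q"
      unfolding regular_on_def by meson
    have "tw a b (W \<inter> U) 0 0 f" by (rule tw_form_div[OF U(3,4) _ _ U(5)]) auto
    thus "\<exists>U. zopen a b U \<and> p \<in> U \<and> tw a b (W \<inter> U) 0 0 f" using U by blast
  qed
next
  assume T: "tw a b W 0 0 f"
  show "regular_on a b W f" unfolding regular_on_def
  proof
    fix p assume p: "p \<in> W"
    obtain F G d1 e1 d2 e2 where "tw_at a b W 0 0 f p F G d1 e1 d2 e2" using twD[OF T p] by blast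
    note F = tw_atD[OF this]
    have "d1 = d2" "e1 = e2" using F(3,4) by auto
    hence F1: "biform a b d2 e2 F" using F(1) by simp
    show "\<exists>U F G d e. zopen a b U \<and> p \<in> U \<and> biform a b d e F \<and> biform a b d e G \<and>
      (\<forall>q\<in>W \<inter> U. form_at G q \<noteq> 0 \<and> f q = form_at F q / form_at G q)"
    proof (intro exI conjI)
      show "zopen a b {p \<in> biproj a b. form_at G p \<noteq> 0}" by (rule zopen_form[OF F(2)])
      show "\<forall>q\<in>W \<inter> {p \<in> biproj a b. form_at G p \<noteq> 0}. form_at G q \<noteq> 0 \<and> f q = form_at F q / form_at G q"
        using F(6) by (auto simp: field_simps)
    qed (use F F1 p W in auto)
  qed
qed

section \<open>A Nullstellensatz for diagonally graded forms\<close>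

text \<open>Restriction to \<open>Z\<close> extended by 0, so that forms agreeing on
  \<open>Z\<close> become equal functions and the ideal of \<open>Z\<close> never has to be
  named.\<close>

definition res :: "'k::field pt set => ((nat => 'k) => (nat => 'k) => 'k) => 'k pt => 'k" where
  "res Z F p = (if p \<in> Z then form_at F p else 0)"

text \<open>The piece of bidegree \<open>(d, e)\<close> of the coordinate ring of
  \<open>Z\<close>.\<close>

definition PF :: "nat => nat => 'k::field pt set => nat => nat => ('k pt => 'k) set" where
  "PF a b Z d e = {res Z F | F. biform a b d e F}"

lemma PF_I: "biform a b d e F ==> res Z F \<in> PF a b Z d e" unfolding PF_def by blast

lemma PF_E:
  assumes "f \<in> PF a b Z d e"
  obtains F where "biform a b d e F" "f = res Z F" using assms unfolding PF_def by blast

lemma PF_mult: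
  assumes "f \<in> PF a b Z d e" "g \<in> PF a b Z d' e'"
  shows "(\<lambda>p. f p * g p) \<in> PF a b Z (d + d') (e + e')"
proof -
  obtain F where F: "biform a b d e F" "f = res Z F" using PF_E[OF assms(1)] .
  obtain G where G: "biform a b d' e' G" "g = res Z G" using PF_E[OF assms(2)] .
  have "(\<lambda>p. f p * g p) = res Z (\<lambda>x y. F x y * G x y)" by (rule ext) (simp add: F G res_def)
  thus ?thesis using PF_I[OF biform.mult[OF F(1) G(1)]] by simp
qed

lemma PF_add:
  assumes "f \<in> PF a b Z d e" "g \<in> PF a b Z d e"
  shows "(\<lambda>p. f p + g p) \<in> PF a b Z d e"
proof -
  obtain F where F: "biform a b d e F" "f = res Z F" using PF_E[OF assms(1)] .
  obtain G where G: "biform a b d e G" "g = res Z G" using PF_E[OF assms(2)] .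
  have "(\<lambda>p. f p + g p) = res Z (\<lambda>x y. F x y + G x y)" by (rule ext) (simp add: F G res_def)
  thus ?thesis using PF_I[OF biform.add[OF F(1) G(1)]] by simp
qed

lemma PF_scale:
  assumes "f \<in> PF a b Z d e"
  shows "(\<lambda>p. c * f p) \<in> PF a b Z d e"
proof -
  obtain F where F: "biform a b d e F" "f = res Z F" using PF_E[OF assms(1)] .
  have "(\<lambda>p. c * f p) = res Z (\<lambda>x y. c * F x y)" by (rule ext) (simp add: F res_def)
  thus ?thesis using PF_I[OF biform_scale[OF F(1)]] by simp
qed

lemma PF_zero: "(\<lambda>_. 0) \<in> PF a b Z d e"
proof -
  have "(\<lambda>_. 0) = res Z (\<lambda>_ _. 0)" by (rule ext) (simp add: res_def)
  thus ?thesis using PF_I[OF biform_zero[of a b d e], of Z] by simp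
qed

lemma PF_diff:
  assumes "f \<in> PF a b Z d e" "g \<in> PF a b Z d e"
  shows "(\<lambda>p. f p - g p) \<in> PF a b Z d e"
  using PF_add[OF assms(1) PF_scale[OF assms(2), where c = "-1"]] by simp

lemma PF_subspace: "fs.subspace (PF a b Z d e)"
  unfolding fs_subspace_iff by (intro conjI ballI allI PF_zero PF_add PF_scale)

lemma PF_power:
  assumes "f \<in> PF a b Z d e"
  shows "(\<lambda>p. (if p \<in> Z then f p ^ m else 0)) \<in> PF a b Z (m * d) (m * e)"
proof -
  obtain F where F: "biform a b d e F" "f = res Z F" using PF_E[OF assms(1)] .
  have "(\<lambda>p. (if p \<in> Z then f p ^ m else 0)) = res Z (\<lambda>x y. F x y ^ m)"
    by (rule ext) (simp add: F res_def)
  thus ?thesis using PF_I[OF biform_power[OF F(1)]] by simp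
qed

text \<open>Forms are functions built inductively, so the decomposition follows their construction;
  in a product it is taken from a factor of positive \<open>x\<close>-degree.\<close>

lemma biform_split_x:
  fixes F :: "(nat => 'k::field) => (nat => 'k) => 'k"
  shows "biform a b d e F ==> d = Suc d' ==>
    \<exists>H. (\<forall>i. biform a b d' e (H i)) \<and> F = (\<lambda>x y. \<Sum>i\<le>a. x i * H i x y)"
proof (induction arbitrary: d' rule: biform.induct)
  case (coord_x i)
  show ?case
  proof (intro exI conjI allI)
    show "biform a b d' 0 ((\<lambda>j (x :: nat => 'k) (y :: nat => 'k). if j = i then 1 else 0) j)" for j
      using coord_x biform.const[of a b "if j = i then 1 else 0"] by simp
    have "(\<Sum>j\<le>a. x j * (if j = i then 1 else 0)) = (\<Sum>j\<le>a. if j = i then x i else 0)"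
      for x :: "nat => 'k" by (rule sum.cong) auto
    hence eq: "(\<Sum>j\<le>a. x j * (if j = i then 1 else 0)) = x i" for x :: "nat => 'k"
      using coord_x by simp
    show "(\<lambda>(x :: nat => 'k) (y :: nat => 'k). x i) = (\<lambda>x y. \<Sum>j\<le>a. x j * (\<lambda>j x y. if j = i then 1 else 0) j x y)"
      by (simp only: eq)
  qed
next
  case (add d e F G)
  obtain H where H: "\<forall>i. biform a b d' e (H i)" "F = (\<lambda>x y. \<Sum>i\<le>a. x i * H i x y)"
    using add.IH(1)[OF add.prems] by blast
  obtain H' where H': "\<forall>i. biform a b d' e (H' i)" "G = (\<lambda>x y. \<Sum>i\<le>a. x i * H' i x y)"
    using add.IH(2)[OF add.prems] by blast
  show ?case
  proof (intro exI conjI allI)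
    show "biform a b d' e ((\<lambda>i x y. H i x y + H' i x y) i)" for i
      using H(1) H'(1) by (intro biform.add) auto
    show "(\<lambda>x y. F x y + G x y) = (\<lambda>x y. \<Sum>i\<le>a. x i * (\<lambda>i x y. H i x y + H' i x y) i x y)"
      by (intro ext) (simp add: H(2) H'(2) algebra_simps sum.distrib)
  qed
next
  case (mult d e F d2 e2 G)
  show ?case
  proof (cases d)
    case 0
    hence "d2 = Suc d'" using mult.prems by simp
    from mult.IH(2)[OF this] obtain H where
      H: "\<forall>i. biform a b d' e2 (H i)" "G = (\<lambda>x y. \<Sum>i\<le>a. x i * H i x y)" by blast
    show ?thesis
    proof (intro exI conjI allI)
      show "biform a b d' (e + e2) ((\<lambda>i x y. F x y * H i x y) i)" for i
        using biform.mult[OF mult.hyps(1)] H(1) 0 by fastforce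
      show "(\<lambda>x y. F x y * G x y) = (\<lambda>x y. \<Sum>i\<le>a. x i * (\<lambda>i x y. F x y * H i x y) i x y)"
        by (intro ext) (simp add: H(2) algebra_simps sum_distrib_left)
    qed
  next
    case (Suc k)
    from mult.IH(1)[OF this] obtain H where
      H: "\<forall>i. biform a b k e (H i)" "F = (\<lambda>x y. \<Sum>i\<le>a. x i * H i x y)" by blast
    have d': "d' = k + d2" using mult.prems Suc by simp
    show ?thesis
    proof (intro exI conjI allI)
      show "biform a b d' (e + e2) ((\<lambda>i x y. H i x y * G x y) i)" for i
        using biform.mult[OF _ mult.hyps(2)] H(1) d' by fastforce
      show "(\<lambda>x y. F x y * G x y) = (\<lambda>x y. \<Sum>i\<le>a. x i * (\<lambda>i x y. H i x y * G x y) i x y)"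
        by (intro ext) (simp add: H(2) sum_distrib_right mult.assoc)
    qed
  qed
qed auto

lemma biform_swap: "biform a b d e F ==> biform b a e d (\<lambda>x y. F y x)"
  by (induction rule: biform.induct) (simp_all del: One_nat_def add: biform.intros)

lemma biform_split_y:
  assumes "biform a b d (Suc e) F"
  shows "\<exists>H. (\<forall>j. biform a b d e (H j)) \<and> F = (\<lambda>x y. \<Sum>j\<le>b. y j * H j x y)"
proof -
  obtain H where H: "\<forall>i. biform b a e d (H i)" "(\<lambda>x y. F y x) = (\<lambda>x y. \<Sum>i\<le>b. x i * H i x y)"
    using biform_split_x[OF biform_swap[OF assms] refl] by blast
  show ?thesis
  proof (intro exI conjI allI)
    show "biform a b d e ((\<lambda>j x y. H j y x) j)" for j using biform_swap H(1) by blast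
    show "F = (\<lambda>x y. \<Sum>j\<le>b. y j * (\<lambda>j x y. H j y x) j x y)"
      using fun_cong[OF fun_cong[OF H(2)]] by (intro ext) simp
  qed
qed

lemma biform_0_0: "biform a b d e F ==> d = 0 ==> e = 0 ==> \<exists>c. F = (\<lambda>x y. c)"
proof (induction rule: biform.induct)
  case (add d e F G)
  thus ?case by auto
next
  case (mult d e F d' e' G)
  thus ?case by auto
qed auto

lemma fin_dim_mult_sum:
  assumes "finite I" "fin_dim V" "\<And>f. f \<in> W ==> \<exists>h. (\<forall>i\<in>I. h i \<in> V) \<and> f = (\<lambda>p. \<Sum>i\<in>I. g i p * h i p)"
  shows "fin_dim W"
proof -
  obtain B where B: "finite B" "V \<subseteq> fs.span B" using assms(2) unfolding fin_dim_def by blast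
  let ?S = "\<Union>i\<in>I. (\<lambda>f p. g i p * f p) ` B"
  have "f \<in> fs.span ?S" if "f \<in> W" for f
  proof -
    have "\<exists>h. (\<forall>i\<in>I. h i \<in> V) \<and> f = (\<lambda>p. \<Sum>i\<in>I. g i p * h i p)" by (rule assms(3)) (rule that)
    then obtain h where h: "\<And>i. i \<in> I ==> h i \<in> V" "f = (\<lambda>p. \<Sum>i\<in>I. g i p * h i p)" by blast
    have "(\<lambda>p. g i p * h i p) \<in> fs.span ?S" if i: "i \<in> I" for i
    proof -
      obtain c where c: "h i = (\<lambda>x. \<Sum>v\<in>B. c v * v x)"
        using h(1)[OF i] B(2) fs_span_finite_iff[OF B(1)] by blast
      have "(\<lambda>p. \<Sum>v\<in>B. c v * (\<lambda>p. g i p * v p) p) \<in> fs.span ?S"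
        by (rule fs_subspace_sum[OF fs.subspace_span], rule fs.span_base) (use i in blast)
      moreover have "(\<lambda>p. \<Sum>v\<in>B. c v * (\<lambda>p. g i p * v p) p) = (\<lambda>p. g i p * h i p)"
        by (rule ext) (simp add: c sum_distrib_left algebra_simps)
      ultimately show ?thesis by simp
    qed
    from fs_subspace_sum[OF fs.subspace_span this, where c = "\<lambda>_. 1"] show ?thesis
      unfolding h(2) by simp
  qed
  moreover have "finite ?S" using assms(1) B(1) by simp
  ultimately show ?thesis unfolding fin_dim_def by blast
qed

lemma PF_fin_dim: "fin_dim (PF a b Z d e)"
proof (induction d)
  case 0
  show ?case
  proof (induction e)
    case 0
    have "PF a b Z 0 0 \<subseteq> fs.span {res Z (\<lambda>x y. 1)}"
    proof
      fix f assume "f \<in> PF a b Z 0 0"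
      then obtain F where F: "biform a b 0 0 F" "f = res Z F" by (rule PF_E)
      obtain c where "F = (\<lambda>x y. c)" using biform_0_0[OF F(1)] by blast
      hence "f = (\<lambda>p. c * res Z (\<lambda>x y. 1) p)" by (intro ext) (simp add: F(2) res_def)
      thus "f \<in> fs.span {res Z (\<lambda>x y. 1)}"
        using fs.span_scale[OF fs.span_base[of "res Z (\<lambda>x y. 1)" "{res Z (\<lambda>x y. 1)}"], of c] by simp
    qed
    thus ?case unfolding fin_dim_def by blast
  next
    case (Suc e)
    show ?case
    proof (rule fin_dim_mult_sum[OF _ Suc, of "{..b}" _ "\<lambda>j p. yc p j"])
      fix f assume "f \<in> PF a b Z 0 (Suc e)"
      then obtain F where F: "biform a b 0 (Suc e) F" "f = res Z F" by (rule PF_E)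
      obtain H where H: "\<forall>j. biform a b 0 e (H j)" "F = (\<lambda>x y. \<Sum>j\<le>b. y j * H j x y)"
        using biform_split_y[OF F(1)] by blast
      show "\<exists>h. (\<forall>i\<in>{..b}. h i \<in> PF a b Z 0 e) \<and> f = (\<lambda>p. \<Sum>i\<le>b. yc p i * h i p)"
      proof (intro exI conjI ballI)
        show "(\<lambda>j. res Z (H j)) i \<in> PF a b Z 0 e" for i using H(1) by (auto intro: PF_I)
        show "f = (\<lambda>p. \<Sum>i\<le>b. yc p i * (\<lambda>j. res Z (H j)) i p)"
          by (rule ext) (simp add: F(2) H(2) res_def)
      qed
    qed simp
  qed
next
  case (Suc d)
  show ?case
  proof (rule fin_dim_mult_sum[OF _ Suc, of "{..a}" _ "\<lambda>j p. xc p j"])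
    fix f assume "f \<in> PF a b Z (Suc d) e"
    then obtain F where F: "biform a b (Suc d) e F" "f = res Z F" by (rule PF_E)
    obtain H where H: "\<forall>j. biform a b d e (H j)" "F = (\<lambda>x y. \<Sum>j\<le>a. x j * H j x y)"
      using biform_split_x[OF F(1) refl] by blast
    show "\<exists>h. (\<forall>i\<in>{..a}. h i \<in> PF a b Z d e) \<and> f = (\<lambda>p. \<Sum>i\<le>a. xc p i * h i p)"
    proof (intro exI conjI ballI)
      show "(\<lambda>j. res Z (H j)) i \<in> PF a b Z d e" for i using H(1) by (auto intro: PF_I)
      show "f = (\<lambda>p. \<Sum>i\<le>a. xc p i * (\<lambda>j. res Z (H j)) i p)"
        by (rule ext) (simp add: F(2) H(2) res_def)
    qed
  qed simp
qed

text \<open>Indexed by \<open>I\<close> rather than by a set of vectors, so that a repetition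
  \<open>g i = g j\<close> also counts as a relation.\<close>

lemma family_dependent:
  fixes g :: "'i => 'a => 'k::field"
  assumes "finite S" "finite I" "card S < card I" "\<And>i. i \<in> I ==> g i \<in> fs.span S"
  shows "\<exists>a. (\<exists>i\<in>I. a i \<noteq> 0) \<and> (\<forall>x. (\<Sum>i\<in>I. a i * g i x) = 0)"
proof (cases "inj_on g I")
  case True
  have "fs.dependent (g ` I)"
  proof (rule ccontr)
    assume "fs.independent (g ` I)"
    moreover have "g ` I \<subseteq> fs.span S" using assms(4) by blast
    ultimately have "card (g ` I) \<le> card S" using fs.independent_span_bound[OF assms(1)] by blast
    thus False using card_image[OF True] assms(3) by simp
  qed
  then obtain u where u: "\<exists>v\<in>g ` I. u v \<noteq> 0" "(\<lambda>x. \<Sum>v\<in>g ` I. u v * v x) = (\<lambda>_. 0)"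
    using fs_dependent_finite[of "g ` I"] assms(2) by blast
  have "(\<Sum>i\<in>I. u (g i) * g i x) = 0" for x
    using fun_cong[OF u(2), of x] by (simp add: sum.reindex[OF True])
  thus ?thesis using u(1) by (intro exI[of _ "\<lambda>i. u (g i)"]) auto
next
  case False
  then obtain i j where ij: "i \<in> I" "j \<in> I" "i \<noteq> j" "g i = g j" unfolding inj_on_def by blast
  let ?a = "\<lambda>k. if k = i then 1 else if k = j then -1 else (0::'k)"
  have "(\<Sum>k\<in>I. ?a k * g k x) = 0" for x
  proof -
    have "(\<Sum>k\<in>I. ?a k * g k x) = (\<Sum>k\<in>I. (if k = i then g i x else 0) + (if k = j then - g j x else 0))"
      by (rule sum.cong) (use ij in auto)
    also have "\<dots> = g i x - g j x" using ij assms(2) by (simp add: sum.distrib)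
    finally show ?thesis using ij(4) by simp
  qed
  thus ?thesis using ij by (intro exI[of _ ?a]) auto
qed

text \<open>Setting \<open>W = 1\<close> gives a polynomial that splits over the algebraically
  closed field. The degree it may lose is restored by the factor \<open>W ^ e\<close>, the roots at
  infinity.\<close>

lemma binary_form_split:
  fixes a :: "nat => 'k::alg_closed_field"
  assumes "\<exists>j\<le>m. a j \<noteq> 0"
  shows "\<exists>c e cs. c \<noteq> 0 \<and> e + length cs = m \<and>
    (\<forall>V W. (\<Sum>j\<le>m. a j * (V ^ j * W ^ (m - j))) = c * W ^ e * (\<Prod>u\<leftarrow>cs. V - u * W))"
proof -
  define p where "p = (\<Sum>j\<le>m. monom (a j) j)"
  have cp: "coeff p j = (if j \<le> m then a j else 0)" for j by (simp add: p_def coeff_sum)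
  have p0: "p \<noteq> 0" using assms cp by (metis coeff_0)
  have deg: "degree p \<le> m" by (rule degree_le) (simp add: cp)
  have ev: "poly p x = (\<Sum>j\<le>m. a j * x ^ j)" for x by (simp add: p_def poly_sum poly_monom)
  obtain A where A: "size A = degree p" "p = Polynomial.smult (lead_coeff p) (\<Prod>x\<in>#A. [:-x, 1:])"
    using alg_closed_imp_factorization[OF p0] by blast
  obtain cs where cs: "mset cs = A" using ex_mset by blast
  have len: "length cs = degree p" using A(1) cs by (metis size_mset)
  have ev2: "poly p x = lead_coeff p * (\<Prod>u\<leftarrow>cs. x - u)" for x
  proof -
    have "poly p x = lead_coeff p * poly (\<Prod>x\<in>#A. [:-x, 1:]) x" by (subst A(2)) simp
    also have "poly (\<Prod>x\<in>#A. [:-x, 1:]) x = (\<Prod>u\<leftarrow>cs. x - u)"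
      unfolding cs[symmetric] by (induction cs) (auto simp: algebra_simps)
    finally show ?thesis .
  qed
  show ?thesis
  proof (intro exI conjI allI)
    show "lead_coeff p \<noteq> 0" using p0 by simp
    show "(m - degree p) + length cs = m" using deg len by simp
    fix V W :: 'k
    show "(\<Sum>j\<le>m. a j * (V ^ j * W ^ (m - j))) =
        lead_coeff p * W ^ (m - degree p) * (\<Prod>u\<leftarrow>cs. V - u * W)"
    proof (cases "W = 0")
      case True
      have "(\<Sum>j\<le>m. a j * (V ^ j * W ^ (m - j))) = (\<Sum>j\<le>m. if j = m then a m * V ^ m else 0)"
        by (rule sum.cong) (auto simp: True)
      also have "\<dots> = a m * V ^ m" by simp
      also have "\<dots> = lead_coeff p * W ^ (m - degree p) * (\<Prod>u\<leftarrow>cs. V - u * W)"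
      proof (cases "degree p = m")
        case deg: True
        have "(\<Prod>u\<leftarrow>cs. V - u * W) = V ^ m"
          using len unfolding deg True by (induction cs arbitrary: m) auto
        thus ?thesis using deg cp[of m] by simp
      next
        case False
        hence "degree p < m" using deg by simp
        hence "coeff p m = 0" by (rule coeff_eq_0)
        thus ?thesis using cp[of m] False deg True by simp
      qed
      finally show ?thesis .
    next
      case False
      have "W ^ m * poly p (V / W) = (\<Sum>j\<le>m. a j * (V ^ j * W ^ (m - j)))"
        unfolding ev sum_distrib_left
      proof (rule sum.cong)
        fix j assume "j \<in> {..m}"
        hence "W ^ m = W ^ j * W ^ (m - j)" by (simp flip: power_add)
        thus "W ^ m * (a j * (V / W) ^ j) = a j * (V ^ j * W ^ (m - j))"
          using False by (simp add: field_simps)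
      qed simp
      moreover have "W ^ m * poly p (V / W) = lead_coeff p * W ^ (m - degree p) * (\<Prod>u\<leftarrow>cs. V - u * W)"
      proof -
        have "W ^ length cs * (\<Prod>u\<leftarrow>cs. V / W - u) = (\<Prod>u\<leftarrow>cs. V - u * W)"
          using False by (induction cs) (auto simp: field_simps)
        moreover have "W ^ m = W ^ (m - degree p) * W ^ length cs"
          using deg len by (simp flip: power_add)
        ultimately show ?thesis unfolding ev2 by (simp add: algebra_simps)
      qed
      ultimately show ?thesis by simp
    qed
  qed
qed

text \<open>Homogeneous ideals of the ring of forms of equal bidegree, the coordinate ring of the
  Segre embedding. A single grading suffices, since every closed set is cut out by forms of this
  kind.\<close>

definition hideal :: "nat => nat => 'k::field pt set => (nat => ('k pt => 'k) set) => bool" where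
  "hideal a b Z J \<longleftrightarrow> (\<forall>m. J m \<subseteq> PF a b Z m m \<and> fs.subspace (J m)) \<and>
     (\<forall>m k. \<forall>f\<in>J m. \<forall>g\<in>PF a b Z k k. (\<lambda>p. f p * g p) \<in> J (m + k))"

text \<open>Full in one degree implies full in all larger ones (\<open>hideal_full_mono\<close>), so
  this says that the ideal does not swallow all forms of large degree.\<close>

definition proper :: "nat => nat => 'k::field pt set => (nat => ('k pt => 'k) set) => bool" where
  "proper a b Z J \<longleftrightarrow> (\<forall>m. J m \<noteq> PF a b Z m m)"

text \<open>\<open>J\<close> together with \<open>u\<close>, of degree \<open>k\<close>, generates
  everything in large degrees; geometrically, \<open>u\<close> has no zero on the locus of
  \<open>J\<close>. In degree 1 the negation is what allows \<open>u\<close> to be adjoined to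
  \<open>J\<close> without losing properness.\<close>

definition full_mod :: "nat => nat => 'k::field pt set => (nat => ('k pt => 'k) set) => nat =>
    ('k pt => 'k) => bool" where
  "full_mod a b Z J k u \<longleftrightarrow> (\<exists>B. \<forall>m\<ge>B. \<forall>f\<in>PF a b Z (m + k) (m + k).
     \<exists>h\<in>J (m + k). \<exists>g\<in>PF a b Z m m. f = (\<lambda>p. h p + u p * g p))"

lemma hideal_sub: "hideal a b Z J ==> f \<in> J m ==> f \<in> PF a b Z m m" unfolding hideal_def by blast

lemma hideal_subspace: "hideal a b Z J ==> fs.subspace (J m)" unfolding hideal_def by blast

lemma hideal_add: "hideal a b Z J ==> f \<in> J m ==> g \<in> J m ==> (\<lambda>p. f p + g p) \<in> J m"
  using hideal_subspace[of a b Z J m] unfolding fs_subspace_iff by blast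

lemma hideal_scale: "hideal a b Z J ==> f \<in> J m ==> (\<lambda>p. c * f p) \<in> J m"
  using hideal_subspace[of a b Z J m] unfolding fs_subspace_iff by blast

lemma hideal_zero: "hideal a b Z J ==> (\<lambda>p. 0) \<in> J m"
  using hideal_subspace[of a b Z J m] unfolding fs_subspace_iff by blast

lemma hideal_mult:
  assumes "hideal a b Z J" "f \<in> J m" "g \<in> PF a b Z k k" "n = m + k"
  shows "(\<lambda>p. f p * g p) \<in> J n" using assms unfolding hideal_def by blast

lemma PF_Suc_split:
  assumes "f \<in> PF a b Z (Suc m) (Suc m)"
  shows "\<exists>h. (\<forall>i j. h i j \<in> PF a b Z m m) \<and>
    f = (\<lambda>p. \<Sum>i\<le>a. \<Sum>j\<le>b. res Z (\<lambda>x y. x i * y j) p * h i j p)"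
proof -
  obtain F where F: "biform a b (Suc m) (Suc m) F" "f = res Z F" using PF_E[OF assms] .
  obtain H where H: "\<forall>i. biform a b m (Suc m) (H i)" "F = (\<lambda>x y. \<Sum>i\<le>a. x i * H i x y)"
    using biform_split_x[OF F(1) refl] by blast
  have "\<forall>i. \<exists>G. (\<forall>j. biform a b m m (G j)) \<and> H i = (\<lambda>x y. \<Sum>j\<le>b. y j * G j x y)"
    using biform_split_y H(1) by blast
  from choice[OF this] obtain G where
    G: "\<And>i. (\<forall>j. biform a b m m (G i j)) \<and> H i = (\<lambda>x y. \<Sum>j\<le>b. y j * G i j x y)" by blast
  show ?thesis
  proof (intro exI conjI allI)
    show "(\<lambda>i j. res Z (G i j)) i j \<in> PF a b Z m m" for i j using G by (auto intro: PF_I)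
    show "f = (\<lambda>p. \<Sum>i\<le>a. \<Sum>j\<le>b. res Z (\<lambda>x y. x i * y j) p * (\<lambda>i j. res Z (G i j)) i j p)"
      by (rule ext) (simp add: F(2) H(2) conjunct2[OF G] res_def sum_distrib_left mult.assoc)
  qed
qed

lemma gen_PF: "i \<le> a ==> j \<le> b ==> res Z (\<lambda>x y. x i * y j) \<in> PF a b Z 1 1"
  by (rule PF_I) (use biform_coords[of i a j b 1 1] in simp)

text \<open>Forms of degree \<open>Suc m\<close> are combinations of the products
  \<open>x_i y_j\<close> with coefficients of degree \<open>m\<close>.\<close>

lemma hideal_full_Suc:
  assumes J: "hideal a b Z J" "J m = PF a b Z m m"
  shows "J (Suc m) = PF a b Z (Suc m) (Suc m)"
proof
  show "J (Suc m) \<subseteq> PF a b Z (Suc m) (Suc m)" using hideal_sub[OF J(1)] by blast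
  show "PF a b Z (Suc m) (Suc m) \<subseteq> J (Suc m)"
  proof
    fix f assume "f \<in> PF a b Z (Suc m) (Suc m)"
    from PF_Suc_split[OF this] obtain h where h: "\<And>i j. h i j \<in> PF a b Z m m"
      "f = (\<lambda>p. \<Sum>i\<le>a. \<Sum>j\<le>b. res Z (\<lambda>x y. x i * y j) p * h i j p)" by blast
    have 1: "(\<lambda>p. h i j p * res Z (\<lambda>x y. x i * y j) p) \<in> J (Suc m)" if "i \<in> {..a}" "j \<in> {..b}" for i j
      by (rule hideal_mult[OF J(1) _ gen_PF]) (use h(1) J(2) that in auto)
    have 2: "(\<lambda>p. \<Sum>j\<le>b. 1 * (h i j p * res Z (\<lambda>x y. x i * y j) p)) \<in> J (Suc m)" if "i \<in> {..a}" for i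
      by (rule fs_subspace_sum[OF hideal_subspace[OF J(1)]]) (rule 1[OF that])
    have 3: "(\<lambda>p. \<Sum>i\<le>a. 1 * (\<Sum>j\<le>b. 1 * (h i j p * res Z (\<lambda>x y. x i * y j) p))) \<in> J (Suc m)"
      by (rule fs_subspace_sum[OF hideal_subspace[OF J(1)]]) (rule 2)
    thus "f \<in> J (Suc m)" unfolding h(2) by (simp add: mult.commute)
  qed
qed

lemma hideal_full_mono:
  assumes J: "hideal a b Z J" "J m = PF a b Z m m" and "m \<le> n"
  shows "J n = PF a b Z n n" using assms(3)
proof (induction n rule: dec_induct)
  case base
  show ?case by (rule J(2))
next
  case (step k)
  show ?case by (rule hideal_full_Suc[OF J(1) step.IH])
qed

text \<open>The ideal \<open>J + (w)\<close> for \<open>w\<close> of degree 1. The disjunction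
  permits only the cofactor 0 in degree 0, where there is no degree \<open>m - 1\<close>.\<close>

definition jadd :: "nat => nat => 'k::field pt set => (nat => ('k pt => 'k) set) =>
    ('k pt => 'k) => nat => ('k pt => 'k) set" where
  "jadd a b Z J w m = {\<lambda>p. h p + w p * g p | h g. h \<in> J m \<and>
     (g = (\<lambda>_. 0) \<or> (\<exists>k. m = Suc k \<and> g \<in> PF a b Z k k))}"

lemma jadd_I: "h \<in> J (Suc k) ==> g \<in> PF a b Z k k ==> (\<lambda>p. h p + w p * g p) \<in> jadd a b Z J w (Suc k)"
  unfolding jadd_def by blast

lemma jadd_base: "h \<in> J m ==> h \<in> jadd a b Z J w m"
  unfolding jadd_def by (rule CollectI, rule exI[of _ h], rule exI[of _ "\<lambda>_. 0"]) simp

lemma jadd_E: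
  assumes "f \<in> jadd a b Z J w m"
  obtains h g where "h \<in> J m" "g = (\<lambda>_. 0) \<or> (\<exists>k. m = Suc k \<and> g \<in> PF a b Z k k)"
    "f = (\<lambda>p. h p + w p * g p)" using assms unfolding jadd_def by blast

lemma hideal_jadd:
  assumes J: "hideal a b Z J" and w: "w \<in> PF a b Z 1 1"
  shows "hideal a b Z (jadd a b Z J w)" unfolding hideal_def
proof (intro conjI allI ballI subsetI)
  fix m f assume "f \<in> jadd a b Z J w m"
  then obtain h g where hg: "h \<in> J m" "g = (\<lambda>_. 0) \<or> (\<exists>k. m = Suc k \<and> g \<in> PF a b Z k k)"
    "f = (\<lambda>p. h p + w p * g p)" by (rule jadd_E)
  show "f \<in> PF a b Z m m" using hg(2)
  proof (elim disjE exE conjE)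
    assume "g = (\<lambda>_. 0)" thus ?thesis using hideal_sub[OF J hg(1)] hg(3) by simp
  next
    fix k assume k: "m = Suc k" "g \<in> PF a b Z k k"
    have "(\<lambda>p. w p * g p) \<in> PF a b Z m m" using PF_mult[OF w k(2)] k(1) by simp
    thus ?thesis unfolding hg(3) by (intro PF_add hideal_sub[OF J hg(1)])
  qed
next
  fix m
  show "fs.subspace (jadd a b Z J w m)" unfolding fs_subspace_iff
  proof (intro conjI ballI allI)
    show "(\<lambda>_. 0) \<in> jadd a b Z J w m" by (rule jadd_base[OF hideal_zero[OF J]])
  next
    fix f f' assume f: "f \<in> jadd a b Z J w m" "f' \<in> jadd a b Z J w m"
    obtain h g where hg: "h \<in> J m" "g = (\<lambda>_. 0) \<or> (\<exists>k. m = Suc k \<and> g \<in> PF a b Z k k)"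
      "f = (\<lambda>p. h p + w p * g p)" using f(1) by (rule jadd_E)
    obtain h' g' where hg': "h' \<in> J m" "g' = (\<lambda>_. 0) \<or> (\<exists>k. m = Suc k \<and> g' \<in> PF a b Z k k)"
      "f' = (\<lambda>p. h' p + w p * g' p)" using f(2) by (rule jadd_E)
    have eq: "(\<lambda>p. f p + f' p) = (\<lambda>p. (h p + h' p) + w p * (g p + g' p))"
      unfolding hg(3) hg'(3) by (simp add: algebra_simps)
    have s: "(\<lambda>p. g p + g' p) = (\<lambda>_. 0) \<or> (\<exists>k. m = Suc k \<and> (\<lambda>p. g p + g' p) \<in> PF a b Z k k)"
      using hg(2) hg'(2)
    proof (elim disjE exE conjE)
      fix k k' assume "m = Suc k" "g \<in> PF a b Z k k" "m = Suc k'" "g' \<in> PF a b Z k' k'"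
      thus ?thesis using PF_add by blast
    qed simp_all
    show "(\<lambda>p. f p + f' p) \<in> jadd a b Z J w m" unfolding jadd_def
      by (rule CollectI, rule exI[of _ "\<lambda>p. h p + h' p"], rule exI[of _ "\<lambda>p. g p + g' p"])
        (intro conjI eq s hideal_add[OF J hg(1) hg'(1)])
  next
    fix c f assume f: "f \<in> jadd a b Z J w m"
    obtain h g where hg: "h \<in> J m" "g = (\<lambda>_. 0) \<or> (\<exists>k. m = Suc k \<and> g \<in> PF a b Z k k)"
      "f = (\<lambda>p. h p + w p * g p)" using f(1) by (rule jadd_E)
    have eq: "(\<lambda>p. c * f p) = (\<lambda>p. (c * h p) + w p * (c * g p))"
      unfolding hg(3) by (simp add: algebra_simps)
    have s: "(\<lambda>p. c * g p) = (\<lambda>_. 0) \<or> (\<exists>k. m = Suc k \<and> (\<lambda>p. c * g p) \<in> PF a b Z k k)" using hg(2)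
    proof (elim disjE exE conjE)
      fix k assume "m = Suc k" "g \<in> PF a b Z k k"
      thus ?thesis using PF_scale by blast
    qed simp
    show "(\<lambda>p. c * f p) \<in> jadd a b Z J w m" unfolding jadd_def
      by (rule CollectI, rule exI[of _ "\<lambda>p. c * h p"], rule exI[of _ "\<lambda>p. c * g p"])
        (intro conjI eq s hideal_scale[OF J hg(1)])
  qed
next
  fix m k f u assume f: "f \<in> jadd a b Z J w m" and u: "u \<in> PF a b Z k k"
  obtain h g where hg: "h \<in> J m" "g = (\<lambda>_. 0) \<or> (\<exists>k. m = Suc k \<and> g \<in> PF a b Z k k)"
    "f = (\<lambda>p. h p + w p * g p)" using f by (rule jadd_E)
  have eq: "(\<lambda>p. f p * u p) = (\<lambda>p. (h p * u p) + w p * (g p * u p))"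
    unfolding hg(3) by (simp add: algebra_simps)
  have s: "(\<lambda>p. g p * u p) = (\<lambda>_. 0) \<or> (\<exists>k'. m + k = Suc k' \<and> (\<lambda>p. g p * u p) \<in> PF a b Z k' k')"
    using hg(2)
  proof (elim disjE exE conjE)
    fix l assume "m = Suc l" "g \<in> PF a b Z l l"
    thus ?thesis using PF_mult[OF _ u, of g l l] by auto
  qed simp
  show "(\<lambda>p. f p * u p) \<in> jadd a b Z J w (m + k)" unfolding jadd_def
    by (rule CollectI, rule exI[of _ "\<lambda>p. h p * u p"], rule exI[of _ "\<lambda>p. g p * u p"])
      (intro conjI eq s hideal_mult[OF J hg(1) u refl])
qed

lemma proper_jadd:
  assumes J: "hideal a b Z J" and w: "w \<in> PF a b Z 1 1" and n: "\<not> full_mod a b Z J 1 w"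
  shows "proper a b Z (jadd a b Z J w)"
proof (rule ccontr)
  assume "\<not> ?thesis"
  then obtain m where m: "jadd a b Z J w m = PF a b Z m m" by (auto simp: proper_def)
  have "full_mod a b Z J 1 w" unfolding full_mod_def
  proof (intro exI allI impI ballI)
    fix k f assume k: "m \<le> k" and f: "f \<in> PF a b Z (k + 1) (k + 1)"
    have "f \<in> jadd a b Z J w (Suc k)"
      using hideal_full_mono[OF hideal_jadd[OF J w] m, of "Suc k"] k f by simp
    then obtain h g where hg: "h \<in> J (Suc k)" "g = (\<lambda>_. 0) \<or> (\<exists>l. Suc k = Suc l \<and> g \<in> PF a b Z l l)"
      "f = (\<lambda>p. h p + w p * g p)" by (rule jadd_E)
    have "g \<in> PF a b Z k k" using hg(2) PF_zero by auto
    thus "\<exists>h\<in>J (k + 1). \<exists>g\<in>PF a b Z k k. f = (\<lambda>p. h p + w p * g p)" using hg by auto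
  qed
  thus False using n by contradiction
qed

lemma full_mod_mult:
  assumes J: "hideal a b Z J" and u: "full_mod a b Z J k u" "u \<in> PF a b Z k k"
    and v: "full_mod a b Z J l v"
  shows "full_mod a b Z J (k + l) (\<lambda>p. u p * v p)"
proof -
  obtain B where B: "\<And>m f. m \<ge> B ==> f \<in> PF a b Z (m + k) (m + k) ==>
     \<exists>h\<in>J (m + k). \<exists>g\<in>PF a b Z m m. f = (\<lambda>p. h p + u p * g p)" using u(1) unfolding full_mod_def by blast
  obtain B' where B': "\<And>m f. m \<ge> B' ==> f \<in> PF a b Z (m + l) (m + l) ==>
     \<exists>h\<in>J (m + l). \<exists>g\<in>PF a b Z m m. f = (\<lambda>p. h p + v p * g p)" using v unfolding full_mod_def by blast
  show ?thesis unfolding full_mod_def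
  proof (intro exI[of _ "B + B'"] allI impI ballI)
    fix m f assume m: "B + B' \<le> m" and f: "f \<in> PF a b Z (m + (k + l)) (m + (k + l))"
    have f': "f \<in> PF a b Z ((m + l) + k) ((m + l) + k)" using f by (simp add: ac_simps)
    have "\<exists>h\<in>J ((m + l) + k). \<exists>g\<in>PF a b Z (m + l) (m + l). f = (\<lambda>p. h p + u p * g p)"
      by (rule B[OF _ f']) (use m in simp)
    then obtain h g where hg: "h \<in> J (m + l + k)" "g \<in> PF a b Z (m + l) (m + l)"
      "f = (\<lambda>p. h p + u p * g p)" by blast
    have "\<exists>h\<in>J (m + l). \<exists>g'\<in>PF a b Z m m. g = (\<lambda>p. h p + v p * g' p)"
      by (rule B'[OF _ hg(2)]) (use m in simp)
    then obtain h' g' where hg': "h' \<in> J (m + l)" "g' \<in> PF a b Z m m"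
      "g = (\<lambda>p. h' p + v p * g' p)" by blast
    have "(\<lambda>p. h p + h' p * u p) \<in> J (m + (k + l))"
    proof (rule hideal_add[OF J])
      show "h \<in> J (m + (k + l))" using hg(1) by (simp add: ac_simps)
      show "(\<lambda>p. h' p * u p) \<in> J (m + (k + l))" by (rule hideal_mult[OF J hg'(1) u(2)]) simp
    qed
    moreover have "f = (\<lambda>p. (h p + h' p * u p) + (u p * v p) * g' p)"
      unfolding hg(3) hg'(3) by (simp add: algebra_simps)
    ultimately show "\<exists>h\<in>J (m + (k + l)). \<exists>g\<in>PF a b Z m m. f = (\<lambda>p. h p + (u p * v p) * g p)"
      using hg'(2) by (intro bexI[of _ "\<lambda>p. h p + h' p * u p"] bexI[of _ g'])
  qed
qed

lemma not_full_mod_mem: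
  assumes J: "hideal a b Z J" "proper a b Z J" and u: "u \<in> J k"
  shows "\<not> full_mod a b Z J k u"
proof
  assume "full_mod a b Z J k u"
  then obtain B where B: "\<And>m f. m \<ge> B ==> f \<in> PF a b Z (m + k) (m + k) ==>
     \<exists>h\<in>J (m + k). \<exists>g\<in>PF a b Z m m. f = (\<lambda>p. h p + u p * g p)" unfolding full_mod_def by blast
  have "PF a b Z (B + k) (B + k) \<subseteq> J (B + k)"
  proof
    fix f assume "f \<in> PF a b Z (B + k) (B + k)"
    from B[OF order_refl this] obtain h g where hg: "h \<in> J (B + k)" "g \<in> PF a b Z B B"
      "f = (\<lambda>p. h p + u p * g p)" by blast
    show "f \<in> J (B + k)" unfolding hg(3)
      by (rule hideal_add[OF J(1) hg(1) hideal_mult[OF J(1) u hg(2)]]) simp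
  qed
  hence "J (B + k) = PF a b Z (B + k) (B + k)" using hideal_sub[OF J(1)] by blast
  thus False using J(2) by (auto simp: proper_def)
qed

lemma full_mod_mono:
  assumes "full_mod a b Z J k u" "\<And>m. J m \<subseteq> J' m"
  shows "full_mod a b Z J' k u"
proof -
  obtain B where B: "\<And>m f. m \<ge> B ==> f \<in> PF a b Z (m + k) (m + k) ==>
     \<exists>h\<in>J (m + k). \<exists>g\<in>PF a b Z m m. f = (\<lambda>p. h p + u p * g p)"
    using assms(1) unfolding full_mod_def by blast
  have "\<exists>h\<in>J' (m + k). \<exists>g\<in>PF a b Z m m. f = (\<lambda>p. h p + u p * g p)"
    if "m \<ge> B" "f \<in> PF a b Z (m + k) (m + k)" for m f
    using B[OF that] assms(2)[of "m + k"] by (meson subsetD)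
  thus ?thesis unfolding full_mod_def by blast
qed

text \<open>Powers and products are cut off outside \<open>Z\<close>, where the empty product would be \<open>1\<close>.\<close>

lemma full_mod_one: "hideal a b Z J ==> full_mod a b Z J 0 (res Z (\<lambda>x y. 1))" unfolding full_mod_def
proof (intro exI allI impI ballI)
  fix m f assume J: "hideal a b Z J" and f: "f \<in> PF a b Z (m + 0) (m + 0)"
  obtain F where F: "f = res Z F" using f by (auto elim: PF_E)
  have "f = (\<lambda>p. 0 + res Z (\<lambda>x y. 1) p * f p)" unfolding F by (rule ext) (simp add: res_def)
  thus "\<exists>h\<in>J (m + 0). \<exists>g\<in>PF a b Z m m. f = (\<lambda>p. h p + res Z (\<lambda>x y. 1) p * g p)"
    using hideal_zero[OF J] f by (intro bexI[of _ "\<lambda>_. 0"] bexI[of _ f]) auto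
qed

lemma PF_one: "res Z (\<lambda>x y. c) \<in> PF a b Z 0 0" by (rule PF_I) (rule biform.const)

lemma full_mod_power:
  assumes J: "hideal a b Z J" and u: "full_mod a b Z J 1 u" "u \<in> PF a b Z 1 1"
  shows "full_mod a b Z J m (\<lambda>p. if p \<in> Z then u p ^ m else 0)"
proof (induction m)
  case 0
  have "(\<lambda>p. if p \<in> Z then u p ^ 0 else 0) = res Z (\<lambda>x y. 1)" by (rule ext) (simp add: res_def)
  thus ?case using full_mod_one[OF J] by simp
next
  case (Suc m)
  have "(\<lambda>p. if p \<in> Z then u p ^ Suc m else 0) = (\<lambda>p. u p * (if p \<in> Z then u p ^ m else 0))"
    by (rule ext) auto
  thus ?case using full_mod_mult[OF J u Suc] by simp
qed

lemma full_mod_prod_list: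
  assumes J: "hideal a b Z J"
    and u: "\<And>c. c \<in> set cs ==> full_mod a b Z J 1 (u c) \<and> u c \<in> PF a b Z 1 1"
  shows "full_mod a b Z J (length cs) (\<lambda>p. if p \<in> Z then (\<Prod>c\<leftarrow>cs. u c p) else 0)" using u
proof (induction cs)
  case Nil
  have "(\<lambda>p. if p \<in> Z then (\<Prod>c\<leftarrow>[]. u c p) else 0) = res Z (\<lambda>x y. 1)" by (rule ext) (simp add: res_def)
  thus ?case using full_mod_one[OF J] by simp
next
  case (Cons c cs)
  have "(\<lambda>p. if p \<in> Z then (\<Prod>c\<leftarrow>c # cs. u c p) else 0) =
      (\<lambda>p. u c p * (if p \<in> Z then (\<Prod>c\<leftarrow>cs. u c p) else 0))" by (rule ext) auto
  moreover have "full_mod a b Z J (1 + length cs) (\<lambda>p. u c p * (if p \<in> Z then (\<Prod>c\<leftarrow>cs. u c p) else 0))"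
    by (rule full_mod_mult[OF J]) (use Cons in auto)
  ultimately show ?case by simp
qed

text \<open>Dividing by \<open>w\<close> repeatedly modulo \<open>J\<close> returns every large
  degree to the fixed degree \<open>B\<close>. So modulo \<open>J\<close> the dimensions stay
  bounded by that of degree \<open>B\<close>, and this boundedness is what forces algebraic
  relations.\<close>

lemma full_mod_iterate:
  assumes J: "hideal a b Z J" and w: "w \<in> PF a b Z 1 1"
    and B: "\<And>m f. m \<ge> B ==> f \<in> PF a b Z (m + 1) (m + 1) ==>
     \<exists>h\<in>J (m + 1). \<exists>g\<in>PF a b Z m m. f = (\<lambda>p. h p + w p * g p)"
    and f: "f \<in> PF a b Z (B + n) (B + n)"
  shows "\<exists>h\<in>J (B + n). \<exists>g\<in>PF a b Z B B. f = (\<lambda>p. h p + (if p \<in> Z then w p ^ n else 0) * g p)"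
  using f
proof (induction n arbitrary: f)
  case 0
  then obtain F where F: "f = res Z F" by (auto elim: PF_E)
  have "f = (\<lambda>p. 0 + (if p \<in> Z then w p ^ 0 else 0) * f p)" unfolding F by (rule ext) (simp add: res_def)
  thus ?case using hideal_zero[OF J] 0 by (intro bexI[of _ "\<lambda>_. 0"] bexI[of _ f]) auto
next
  case (Suc n)
  have "f \<in> PF a b Z ((B + n) + 1) ((B + n) + 1)" using Suc.prems by simp
  from B[OF _ this] obtain h g where hg: "h \<in> J (B + n + 1)" "g \<in> PF a b Z (B + n) (B + n)"
    "f = (\<lambda>p. h p + w p * g p)" by auto
  from Suc.IH[OF hg(2)] obtain h' g' where hg': "h' \<in> J (B + n)" "g' \<in> PF a b Z B B"
    "g = (\<lambda>p. h' p + (if p \<in> Z then w p ^ n else 0) * g' p)" by blast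
  have "(\<lambda>p. h p + h' p * w p) \<in> J (B + Suc n)"
  proof (rule hideal_add[OF J])
    show "h \<in> J (B + Suc n)" using hg(1) by simp
    show "(\<lambda>p. h' p * w p) \<in> J (B + Suc n)" by (rule hideal_mult[OF J hg'(1) w]) simp
  qed
  moreover have "f = (\<lambda>p. (h p + h' p * w p) + (if p \<in> Z then w p ^ Suc n else 0) * g' p)"
    unfolding hg(3) hg'(3) by (rule ext) (simp add: algebra_simps)
  ultimately show ?case using hg'(2) by (intro bexI[of _ "\<lambda>p. h p + h' p * w p"] bexI[of _ g'])
qed

text \<open>Modulo \<open>J\<close>, the \<open>m + 1\<close> monomials of degree \<open>m\<close>
  in \<open>v\<close> and \<open>w\<close> are multiples of one power of \<open>w\<close> by
  elements of the span of \<open>S\<close>, so some nonzero binary form in \<open>v\<close> and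
  \<open>w\<close> lies in \<open>J\<close>. It splits into linear factors. If all
  \<open>v - c w\<close> were full modulo \<open>J\<close>, so would be their product, which
  contradicts its membership in the proper ideal \<open>J\<close>.\<close>

lemma exists_proper_shift:
  fixes Z :: "'k::alg_closed_field pt set"
  assumes J: "hideal a b Z J" "proper a b Z J" and w: "w \<in> PF a b Z 1 1" "full_mod a b Z J 1 w"
    and v: "v \<in> PF a b Z 1 1"
  shows "\<exists>c. \<not> full_mod a b Z J 1 (\<lambda>p. v p - c * w p)"
proof (rule ccontr)
  assume "\<not> ?thesis"
  hence all: "full_mod a b Z J 1 (\<lambda>p. v p - c * w p)" for c by blast
  obtain B where B: "\<And>m f. m \<ge> B ==> f \<in> PF a b Z (m + 1) (m + 1) ==>
     \<exists>h\<in>J (m + 1). \<exists>g\<in>PF a b Z m m. f = (\<lambda>p. h p + w p * g p)" using w(2) unfolding full_mod_def by blast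
  obtain S where S: "finite S" "PF a b Z B B \<subseteq> fs.span S"
    using PF_fin_dim[of a b Z B B] unfolding fin_dim_def by blast
  \<comment> \<open>Degree \<open>m\<close> exceeds \<open>B\<close> by the exponent of
    \<open>w\<close> that is split off, and the number \<open>m + 1\<close> of monomials exceeds
    \<open>card S\<close>.\<close>
  define m where "m = B + card S"
  have el: "(\<lambda>p. if p \<in> Z then v p ^ j * w p ^ (m - j) else 0) \<in> PF a b Z m m" if "j \<le> m" for j
  proof -
    have "(\<lambda>p. (if p \<in> Z then v p ^ j else 0) * (if p \<in> Z then w p ^ (m - j) else 0))
        \<in> PF a b Z (j * 1 + (m - j) * 1) (j * 1 + (m - j) * 1)"
      by (rule PF_mult[OF PF_power[OF v] PF_power[OF w(1)]])
    moreover have "(\<lambda>p. (if p \<in> Z then v p ^ j else 0) * (if p \<in> Z then w p ^ (m - j) else 0)) =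
        (\<lambda>p. if p \<in> Z then v p ^ j * w p ^ (m - j) else 0)" by (rule ext) simp
    ultimately show ?thesis using that by simp
  qed
  have "\<forall>j. \<exists>h g. j \<le> m --> h \<in> J m \<and> g \<in> PF a b Z B B \<and>
    (\<forall>p. (if p \<in> Z then v p ^ j * w p ^ (m - j) else 0) = h p + (if p \<in> Z then w p ^ card S else 0) * g p)"
  proof
    fix j
    show "\<exists>h g. j \<le> m --> h \<in> J m \<and> g \<in> PF a b Z B B \<and>
      (\<forall>p. (if p \<in> Z then v p ^ j * w p ^ (m - j) else 0) = h p + (if p \<in> Z then w p ^ card S else 0) * g p)"
    proof (cases "j \<le> m")
      case True
      have "\<exists>h\<in>J (B + card S). \<exists>g\<in>PF a b Z B B. (\<lambda>p. if p \<in> Z then v p ^ j * w p ^ (m - j) else 0)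
          = (\<lambda>p. h p + (if p \<in> Z then w p ^ card S else 0) * g p)"
        by (rule full_mod_iterate[OF J(1) w(1) B]) (use el[OF True] in \<open>auto simp: m_def\<close>)
      then obtain h g where hg: "h \<in> J (B + card S)" "g \<in> PF a b Z B B" "(\<lambda>p. if p \<in> Z then v p ^ j * w p ^ (m - j) else 0)
          = (\<lambda>p. h p + (if p \<in> Z then w p ^ card S else 0) * g p)" by blast
      show ?thesis using hg(1,2) fun_cong[OF hg(3)] by (intro exI[of _ h] exI[of _ g]) (auto simp: m_def)
    qed auto
  qed
  then obtain h g where hg: "\<And>j. j \<le> m ==> h j \<in> J m" "\<And>j. j \<le> m ==> g j \<in> PF a b Z B B"
    "\<And>j p. j \<le> m ==> (if p \<in> Z then v p ^ j * w p ^ (m - j) else 0) =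
       h j p + (if p \<in> Z then w p ^ card S else 0) * g j p" by metis
  have "\<exists>\<alpha>. (\<exists>i\<in>{..m}. \<alpha> i \<noteq> 0) \<and> (\<forall>x. (\<Sum>i\<in>{..m}. \<alpha> i * g i x) = 0)"
    by (rule family_dependent[OF S(1)]) (use hg(2) S(2) m_def in auto)
  then obtain \<alpha> where \<alpha>: "\<exists>j\<le>m. \<alpha> j \<noteq> 0" "\<And>x. (\<Sum>j\<le>m. \<alpha> j * g j x) = 0" by auto
  have rel: "(\<lambda>p. \<Sum>j\<le>m. \<alpha> j * h j p) \<in> J m"
    by (rule fs_subspace_sum[OF hideal_subspace[OF J(1)]]) (use hg(1) in auto)
  have eq: "(\<Sum>j\<le>m. \<alpha> j * h j p) = (if p \<in> Z then (\<Sum>j\<le>m. \<alpha> j * (v p ^ j * w p ^ (m - j))) else 0)" for p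
  proof -
    have "(\<Sum>j\<le>m. \<alpha> j * h j p) = (\<Sum>j\<le>m. \<alpha> j * (if p \<in> Z then v p ^ j * w p ^ (m - j) else 0)
        - (if p \<in> Z then w p ^ card S else 0) * (\<alpha> j * g j p))"
      by (rule sum.cong) (use hg(3) in \<open>auto simp: algebra_simps\<close>)
    also have "\<dots> = (\<Sum>j\<le>m. \<alpha> j * (if p \<in> Z then v p ^ j * w p ^ (m - j) else 0))"
      by (simp add: sum_subtractf sum_distrib_left[symmetric] \<alpha>(2))
    finally show ?thesis by simp
  qed
  obtain c e cs where c: "c \<noteq> 0" "e + length cs = m"
    "\<And>V W. (\<Sum>j\<le>m. \<alpha> j * (V ^ j * W ^ (m - j))) = c * W ^ e * (\<Prod>u\<leftarrow>cs. V - u * W)"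
    using binary_form_split[OF \<alpha>(1)] by blast
  let ?P = "\<lambda>p. (if p \<in> Z then w p ^ e else 0) * (if p \<in> Z then (\<Prod>u\<leftarrow>cs. v p - u * w p) else 0)"
  have "(\<lambda>p. inverse c * (\<Sum>j\<le>m. \<alpha> j * h j p)) \<in> J m" by (rule hideal_scale[OF J(1) rel])
  moreover have "(\<lambda>p. inverse c * (\<Sum>j\<le>m. \<alpha> j * h j p)) = ?P"
    by (rule ext) (use c(1) in \<open>simp add: eq c(3)\<close>)
  ultimately have "?P \<in> J m" by simp
  moreover have "full_mod a b Z J (e + length cs) ?P"
  proof (rule full_mod_mult[OF J(1) full_mod_power[OF J(1) w(2,1)]])
    show "(\<lambda>p. if p \<in> Z then w p ^ e else 0) \<in> PF a b Z e e" using PF_power[OF w(1), of e] by simp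
    show "full_mod a b Z J (length cs) (\<lambda>p. if p \<in> Z then \<Prod>u\<leftarrow>cs. v p - u * w p else 0)"
      by (rule full_mod_prod_list[OF J(1)]) (use all v w(1) PF_diff PF_scale in blast)
  qed
  ultimately show False using not_full_mod_mem[OF J] c(2) by blast
qed

text \<open>Generators are adjoined one by one as long as properness survives. Either the ideal ends
  up containing all of them, or some generator is nowhere zero on the locus and can serve as a
  denominator.\<close>

lemma ideal_absorb_generators:
  assumes "hideal a b Z J" "proper a b Z J" "set gs \<subseteq> PF a b Z 1 1"
  shows "\<exists>J'. hideal a b Z J' \<and> proper a b Z J' \<and> (\<forall>m. J m \<subseteq> J' m) \<and>
     (set gs \<subseteq> J' 1 \<or> (\<exists>g\<in>set gs. full_mod a b Z J' 1 g))" using assms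
proof (induction gs arbitrary: J)
  case Nil
  thus ?case by auto
next
  case (Cons g gs)
  show ?case
  proof (cases "full_mod a b Z J 1 g")
    case True
    thus ?thesis using Cons.prems by (intro exI[of _ J]) auto
  next
    case False
    have g: "g \<in> PF a b Z 1 1" using Cons.prems by simp
    define J1 where "J1 = jadd a b Z J g"
    have J1: "hideal a b Z J1" "proper a b Z J1"
      unfolding J1_def using hideal_jadd[OF Cons.prems(1) g] proper_jadd[OF Cons.prems(1) g False] by auto
    have sub: "J m \<subseteq> J1 m" for m unfolding J1_def using jadd_base by blast
    have "(\<lambda>p. 0 + g p * res Z (\<lambda>x y. 1) p) \<in> J1 (Suc 0)" unfolding J1_def
      by (rule jadd_I[OF hideal_zero[OF Cons.prems(1)] PF_one])
    moreover obtain F where "g = res Z F" using g by (rule PF_E)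
    hence "(\<lambda>p. 0 + g p * res Z (\<lambda>x y. 1) p) = g" by (intro ext) (simp add: res_def)
    ultimately have gJ: "g \<in> J1 1" by simp
    obtain J' where J': "hideal a b Z J'" "proper a b Z J'" "\<forall>m. J1 m \<subseteq> J' m"
      "set gs \<subseteq> J' 1 \<or> (\<exists>g\<in>set gs. full_mod a b Z J' 1 g)"
      using Cons.IH[OF J1] Cons.prems(3) by auto
    show ?thesis using J' gJ sub by (intro exI[of _ J']) auto
  qed
qed

text \<open>With \<open>w\<close> as denominator, \<open>exists_proper_shift\<close> makes each
  quotient \<open>v / w\<close> constant modulo a larger proper ideal; these constants become the
  coordinates of a point.\<close>

lemma ideal_shift_generators:
  fixes Z :: "'k::alg_closed_field pt set"
  assumes "hideal a b Z J" "proper a b Z J" "set vs \<subseteq> PF a b Z 1 1"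
    and "w \<in> PF a b Z 1 1" "full_mod a b Z J 1 w"
  shows "\<exists>J'. hideal a b Z J' \<and> proper a b Z J' \<and> (\<forall>m. J m \<subseteq> J' m) \<and>
     (\<forall>v\<in>set vs. \<exists>c. (\<lambda>p. v p - c * w p) \<in> J' 1)" using assms
proof (induction vs arbitrary: J)
  case Nil
  thus ?case by auto
next
  case (Cons v vs)
  have v: "v \<in> PF a b Z 1 1" using Cons.prems by simp
  obtain c where c: "\<not> full_mod a b Z J 1 (\<lambda>p. v p - c * w p)"
    using exists_proper_shift[OF Cons.prems(1,2,4,5) v] by blast
  define g where "g = (\<lambda>p. v p - c * w p)"
  have g: "g \<in> PF a b Z 1 1" unfolding g_def by (intro PF_diff v PF_scale Cons.prems(4))
  define J1 where "J1 = jadd a b Z J g"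
  have J1: "hideal a b Z J1" "proper a b Z J1" unfolding J1_def
    using hideal_jadd[OF Cons.prems(1) g] proper_jadd[OF Cons.prems(1) g] c[folded g_def] by auto
  have sub: "J m \<subseteq> J1 m" for m unfolding J1_def using jadd_base by blast
  have "(\<lambda>p. 0 + g p * res Z (\<lambda>x y. 1) p) \<in> J1 (Suc 0)" unfolding J1_def
    by (rule jadd_I[OF hideal_zero[OF Cons.prems(1)] PF_one])
  moreover obtain F where "g = res Z F" using g by (rule PF_E)
  hence "(\<lambda>p. 0 + g p * res Z (\<lambda>x y. 1) p) = g" by (intro ext) (simp add: res_def)
  ultimately have gJ: "g \<in> J1 1" by simp
  have w1: "full_mod a b Z J1 1 w" by (rule full_mod_mono[OF Cons.prems(5) sub])
  have "set vs \<subseteq> PF a b Z 1 1" using Cons.prems by simp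
  from Cons.IH[OF J1 this Cons.prems(4) w1]
  obtain J' where J': "hideal a b Z J'" "proper a b Z J'" "\<forall>m. J1 m \<subseteq> J' m"
    "\<forall>v\<in>set vs. \<exists>c. (\<lambda>p. v p - c * w p) \<in> J' 1" by blast
  have "g \<in> J' 1" using gJ J'(3) by blast
  hence "\<forall>v\<in>set (v # vs). \<exists>c. (\<lambda>p. v p - c * w p) \<in> J' 1" using J'(4) unfolding g_def by auto
  moreover have "\<forall>m. J m \<subseteq> J' m" using sub J'(3) by blast
  ultimately show ?case using J'(1,2) by blast
qed

text \<open>After enlarging \<open>J\<close> to \<open>J2\<close>, each product
  \<open>x_i y_j\<close> is congruent to a constant multiple of \<open>w = x_i0 y_j0\<close>. The
  constants with second index \<open>j0\<close> and those with first index \<open>i0\<close> are the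
  coordinates of the required zero.\<close>

lemma nullstellensatz:
  fixes Z :: "'k::alg_closed_field pt set"
  assumes J: "hideal a b Z J" "proper a b Z J"
  shows "\<exists>p\<in>biproj a b. \<forall>m F. biform a b m m F --> res Z F \<in> J m --> form_at F p = 0"
proof -
  define G where "G i j = res Z (\<lambda>x y :: nat => 'k. x i * y j)" for i j :: nat
  obtain gs where "set gs = (\<lambda>(i, j). G i j) ` ({..a} \<times> {..b})"
    using finite_list[of "(\<lambda>(i, j). G i j) ` ({..a} \<times> {..b})"] by auto
  hence set_gs: "set gs = {G i j | i j. i \<le> a \<and> j \<le> b}" by auto
  have GP: "G i j \<in> PF a b Z 1 1" if "i \<le> a" "j \<le> b" for i j
    unfolding G_def by (rule gen_PF[OF that])
  have gsP: "set gs \<subseteq> PF a b Z 1 1"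
  proof
    fix g assume "g \<in> set gs"
    then obtain i j where "g = G i j" "i \<le> a" "j \<le> b" using set_gs by blast
    thus "g \<in> PF a b Z 1 1" using GP by simp
  qed
  from ideal_absorb_generators[OF J gsP]
  obtain J1 where J1: "hideal a b Z J1" "proper a b Z J1" "\<forall>m. J m \<subseteq> J1 m"
     "set gs \<subseteq> J1 1 \<or> (\<exists>g\<in>set gs. full_mod a b Z J1 1 g)" by blast
  have "\<not> set gs \<subseteq> J1 1"
  proof
    assume gs: "set gs \<subseteq> J1 1"
    have "PF a b Z 1 1 \<subseteq> J1 1"
    proof
      fix f assume "f \<in> PF a b Z 1 1"
      hence "f \<in> PF a b Z (Suc 0) (Suc 0)" by simp
      from PF_Suc_split[OF this] obtain h where h: "\<forall>i j. h i j \<in> PF a b Z 0 0"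
        "f = (\<lambda>p. \<Sum>i\<le>a. \<Sum>j\<le>b. res Z (\<lambda>x y. x i * y j) p * h i j p)" by blast
      have 1: "(\<lambda>p. G i j p * h i j p) \<in> J1 1" if "i \<in> {..a}" "j \<in> {..b}" for i j
        by (rule hideal_mult[OF J1(1)]) (use gs set_gs that h(1) in auto)
      have 2: "(\<lambda>p. \<Sum>j\<le>b. 1 * (G i j p * h i j p)) \<in> J1 1" if "i \<in> {..a}" for i
        by (rule fs_subspace_sum[OF hideal_subspace[OF J1(1)]]) (rule 1[OF that])
      have 3: "(\<lambda>p. \<Sum>i\<le>a. 1 * (\<Sum>j\<le>b. 1 * (G i j p * h i j p))) \<in> J1 1"
        by (rule fs_subspace_sum[OF hideal_subspace[OF J1(1)]]) (rule 2)
      thus "f \<in> J1 1" unfolding h(2) G_def by simp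
    qed
    thus False using J1(2) hideal_sub[OF J1(1)] unfolding proper_def by blast
  qed
  with J1(4) obtain g0 where g0: "g0 \<in> set gs" "full_mod a b Z J1 1 g0" by blast
  from g0(1)[unfolded set_gs] obtain i0 j0 where "g0 = G i0 j0" "i0 \<le> a" "j0 \<le> b" by blast
  with g0(2) have ij: "i0 \<le> a" "j0 \<le> b" "full_mod a b Z J1 1 (G i0 j0)" by auto
  define w where "w = G i0 j0"
  have wP: "w \<in> PF a b Z 1 1" unfolding w_def by (rule GP[OF ij(1,2)])
  from ideal_shift_generators[OF J1(1,2) gsP wP ij(3)[folded w_def]]
  obtain J2 where J2: "hideal a b Z J2" "proper a b Z J2" "\<forall>m. J1 m \<subseteq> J2 m"
     "\<forall>v\<in>set gs. \<exists>c. (\<lambda>p. v p - c * w p) \<in> J2 1" by blast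
  have w2: "full_mod a b Z J2 1 w" unfolding w_def by (rule full_mod_mono[OF ij(3)]) (use J2(3) in blast)
  have pw: "full_mod a b Z J2 k (\<lambda>p. if p \<in> Z then w p ^ k else 0)" for k
    by (rule full_mod_power[OF J2(1) w2 wP])
  have pwP: "(\<lambda>p. if p \<in> Z then w p ^ k else 0) \<in> PF a b Z k k" for k
    using PF_power[OF wP, of k] by simp
  \<comment> \<open>This lets a constant be read off from a congruence modulo \<open>J2\<close>:
    powers of \<open>w\<close> are full and hence outside the proper ideal.\<close>
  have pwn: "c = 0" if "(\<lambda>p. c * (if p \<in> Z then w p ^ k else 0)) \<in> J2 k" for c k
  proof (rule ccontr)
    assume "c \<noteq> 0"
    have "(\<lambda>p. inverse c * (c * (if p \<in> Z then w p ^ k else 0))) \<in> J2 k"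
      by (rule hideal_scale[OF J2(1) that])
    hence "(\<lambda>p. if p \<in> Z then w p ^ k else 0) \<in> J2 k" using \<open>c \<noteq> 0\<close> by (simp flip: mult.assoc)
    thus False using not_full_mod_mem[OF J2(1,2)] pw by blast
  qed
  have "\<forall>v\<in>set gs. \<exists>c. (\<lambda>p. v p - c * w p) \<in> J2 1" by (rule J2(4))
  from bchoice[OF this] obtain C where C: "\<forall>v\<in>set gs. (\<lambda>p. v p - C v * w p) \<in> J2 1" by blast
  define cx where "cx i = (if i \<le> a then C (G i j0) else 0)" for i
  define cy where "cy j = (if j \<le> b then C (G i0 j) else 0)" for j
  have Cw: "C w = 1"
  proof -
    have "w \<in> set gs" using set_gs ij(1,2) w_def by blast
    from bspec[OF C this] have "(\<lambda>p. w p - C w * w p) \<in> J2 1" .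
    moreover obtain F where "w = res Z F" using wP by (rule PF_E)
    hence "(\<lambda>p. w p - C w * w p) = (\<lambda>p. (1 - C w) * (if p \<in> Z then w p ^ 1 else 0))"
      by (intro ext) (simp add: res_def algebra_simps)
    ultimately have "1 - C w = 0" using pwn[of "1 - C w" 1] by simp
    thus ?thesis by simp
  qed
  \<comment> \<open>The factor \<open>y_j0 ^ d * x_i0 ^ e\<close> makes a form of bidegree
    \<open>(d, e)\<close> diagonal, so that it can be compared with a power of \<open>w\<close>. On
    coordinates the congruence is the definition of \<open>cx\<close> and \<open>cy\<close>, and
    sums and products respect it.\<close>
  have cong: "biform a b d e F ==> (\<lambda>p. res Z (\<lambda>x y. y j0 ^ d * x i0 ^ e * F x y) p -
      F cx cy * (if p \<in> Z then w p ^ (d + e) else 0)) \<in> J2 (d + e)" for d e F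
  proof (induction rule: biform.induct)
    case (const c)
    have "(\<lambda>p. res Z (\<lambda>x y. y j0 ^ 0 * x i0 ^ 0 * c) p - c * (if p \<in> Z then w p ^ (0 + 0) else 0)) = (\<lambda>_. 0)"
      by (rule ext) (simp add: res_def)
    thus ?case using hideal_zero[OF J2(1), of 0] by simp
  next
    case (coord_x i)
    have "(\<lambda>p. G i j0 p - C (G i j0) * w p) \<in> J2 1" by (rule bspec[OF C]) (use coord_x ij set_gs in blast)
    moreover have "(\<lambda>p. G i j0 p - C (G i j0) * w p) = (\<lambda>p. res Z (\<lambda>x y. y j0 ^ 1 * x i0 ^ 0 * x i) p -
        cx i * (if p \<in> Z then w p ^ (1 + 0) else 0))"
      by (rule ext) (use coord_x in \<open>simp add: res_def G_def cx_def w_def mult.commute\<close>)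
    ultimately show ?case by simp
  next
    case (coord_y j)
    have "(\<lambda>p. G i0 j p - C (G i0 j) * w p) \<in> J2 1" by (rule bspec[OF C]) (use coord_y ij set_gs in blast)
    moreover have "(\<lambda>p. G i0 j p - C (G i0 j) * w p) = (\<lambda>p. res Z (\<lambda>x y. y j0 ^ 0 * x i0 ^ 1 * y j) p -
        cy j * (if p \<in> Z then w p ^ (0 + 1) else 0))"
      by (rule ext) (use coord_y in \<open>simp add: res_def G_def cy_def w_def mult.commute\<close>)
    ultimately show ?case by simp
  next
    case (add d e F G')
    have "(\<lambda>p. (res Z (\<lambda>x y. y j0 ^ d * x i0 ^ e * F x y) p - F cx cy * (if p \<in> Z then w p ^ (d + e) else 0)) +
       (res Z (\<lambda>x y. y j0 ^ d * x i0 ^ e * G' x y) p - G' cx cy * (if p \<in> Z then w p ^ (d + e) else 0)))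
       \<in> J2 (d + e)" by (rule hideal_add[OF J2(1) add.IH])
    moreover have "(\<lambda>p. (res Z (\<lambda>x y. y j0 ^ d * x i0 ^ e * F x y) p - F cx cy * (if p \<in> Z then w p ^ (d + e) else 0)) +
       (res Z (\<lambda>x y. y j0 ^ d * x i0 ^ e * G' x y) p - G' cx cy * (if p \<in> Z then w p ^ (d + e) else 0)))
      = (\<lambda>p. res Z (\<lambda>x y. y j0 ^ d * x i0 ^ e * (F x y + G' x y)) p -
       (F cx cy + G' cx cy) * (if p \<in> Z then w p ^ (d + e) else 0))"
      by (rule ext) (simp add: res_def algebra_simps)
    ultimately show ?case by simp
  next
    case (mult d e F d' e' G')
    let ?f = "\<lambda>p. res Z (\<lambda>x y. y j0 ^ d * x i0 ^ e * F x y) p - F cx cy * (if p \<in> Z then w p ^ (d + e) else 0)"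
    let ?g = "\<lambda>p. res Z (\<lambda>x y. y j0 ^ d' * x i0 ^ e' * G' x y) p - G' cx cy * (if p \<in> Z then w p ^ (d' + e') else 0)"
    have A: "res Z (\<lambda>x y. y j0 ^ d' * x i0 ^ e' * G' x y) \<in> PF a b Z (d' + e') (d' + e')"
    proof (rule PF_I)
      have "biform a b (0 + e' + d') (d' + 0 + e') (\<lambda>x y. y j0 ^ d' * x i0 ^ e' * G' x y)"
        by (intro biform.mult biform_coord_x_power biform_coord_y_power ij mult.hyps)
      thus "biform a b (d' + e') (d' + e') (\<lambda>x y. y j0 ^ d' * x i0 ^ e' * G' x y)"
        by (simp add: add.commute)
    qed
    have "(\<lambda>p. ?f p * res Z (\<lambda>x y. y j0 ^ d' * x i0 ^ e' * G' x y) p +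
       F cx cy * (?g p * (if p \<in> Z then w p ^ (d + e) else 0))) \<in> J2 (d + d' + (e + e'))"
    proof (rule hideal_add[OF J2(1)])
      show "(\<lambda>p. ?f p * res Z (\<lambda>x y. y j0 ^ d' * x i0 ^ e' * G' x y) p) \<in> J2 (d + d' + (e + e'))"
        by (rule hideal_mult[OF J2(1) mult.IH(1) A]) simp
      have "(\<lambda>p. ?g p * (if p \<in> Z then w p ^ (d + e) else 0)) \<in> J2 (d + d' + (e + e'))"
        by (rule hideal_mult[OF J2(1) mult.IH(2) pwP]) simp
      from hideal_scale[OF J2(1) this] 
      show "(\<lambda>p. F cx cy * (?g p * (if p \<in> Z then w p ^ (d + e) else 0))) \<in> J2 (d + d' + (e + e'))" .
    qed
    moreover have "(\<lambda>p. ?f p * res Z (\<lambda>x y. y j0 ^ d' * x i0 ^ e' * G' x y) p +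
       F cx cy * (?g p * (if p \<in> Z then w p ^ (d + e) else 0))) =
       (\<lambda>p. res Z (\<lambda>x y. y j0 ^ (d + d') * x i0 ^ (e + e') * (F x y * G' x y)) p -
        F cx cy * G' cx cy * (if p \<in> Z then w p ^ (d + d' + (e + e')) else 0))"
      by (rule ext) (simp add: res_def power_add algebra_simps)
    ultimately show ?case by simp
  qed
  have cx1: "cx i0 = 1" and cy1: "cy j0 = 1" using Cw ij unfolding cx_def cy_def w_def by auto
  have nz: "cx \<noteq> (\<lambda>_. 0)" "\<forall>i>a. cx i = 0" "cy \<noteq> (\<lambda>_. 0)" "\<forall>j>b. cy j = 0"
  proof -
    show "cx \<noteq> (\<lambda>_. 0)" using cx1 by (metis zero_neq_one)
    show "cy \<noteq> (\<lambda>_. 0)" using cy1 by (metis zero_neq_one)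
  qed (simp_all add: cx_def cy_def)
  show ?thesis
  proof (intro bexI[of _ "(ppoint cx, ppoint cy)"] allI impI)
    show "(ppoint cx, ppoint cy) \<in> biproj a b" by (rule biproj_pointI[OF nz])
    fix m F assume F: "biform a b m m F" "res Z F \<in> J m"
    have sub: "J m \<subseteq> J2 m" using J1(3) J2(3) by blast
    have A: "res Z (\<lambda>x y. y j0 ^ m * x i0 ^ m) \<in> PF a b Z m m"
    proof (rule PF_I)
      have "biform a b (0 + m) (m + 0) (\<lambda>x y. y j0 ^ m * x i0 ^ m)"
        by (intro biform.mult biform_coord_x_power biform_coord_y_power ij)
      thus "biform a b m m (\<lambda>x y. y j0 ^ m * x i0 ^ m)" by simp
    qed
    have 1: "(\<lambda>p. res Z F p * res Z (\<lambda>x y. y j0 ^ m * x i0 ^ m) p) \<in> J2 (m + m)"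
      by (rule hideal_mult[OF J2(1) subsetD[OF sub F(2)] A refl])
    have "(\<lambda>p. res Z F p * res Z (\<lambda>x y. y j0 ^ m * x i0 ^ m) p +
       (-1) * (res Z (\<lambda>x y. y j0 ^ m * x i0 ^ m * F x y) p -
         F cx cy * (if p \<in> Z then w p ^ (m + m) else 0))) \<in> J2 (m + m)"
      by (rule hideal_add[OF J2(1) 1 hideal_scale[OF J2(1) cong[OF F(1)]]])
    moreover have "(\<lambda>p. res Z F p * res Z (\<lambda>x y. y j0 ^ m * x i0 ^ m) p +
       (-1) * (res Z (\<lambda>x y. y j0 ^ m * x i0 ^ m * F x y) p -
         F cx cy * (if p \<in> Z then w p ^ (m + m) else 0))) =
       (\<lambda>p. F cx cy * (if p \<in> Z then w p ^ (m + m) else 0))" by (rule ext) (simp add: res_def)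
    ultimately have "(\<lambda>p. F cx cy * (if p \<in> Z then w p ^ (m + m) else 0)) \<in> J2 (m + m)" by simp
    from pwn[OF this] show "form_at F (ppoint cx, ppoint cy) = 0"
      using form_at_point_eq_0_iff[OF F(1) nz] by simp
  qed
qed

section \<open>Twisted sections and line bundles\<close>

definition V :: "nat => nat => 'k::field pt set => int => int => ('k pt => 'k) set" where
  "V a b Z d e = {f. tw a b Z d e f \<and> (\<forall>p. p \<notin> Z --> f p = 0)}"

lemma V_subspace:
  assumes "Z \<subseteq> biproj a b"
  shows "fs.subspace (V a b Z d e)"
  unfolding fs_subspace_iff V_def using tw_zero[OF assms] by (auto intro: tw_add tw_scale)

lemma V_mult_form:
  assumes f: "f \<in> V a b Z d e" and F: "biform a b d' e' F" and "D = int d' + d" "E = int e' + e"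
  shows "(\<lambda>p. form_at F p * f p) \<in> V a b Z D E"
proof -
  have "tw a b Z D E (\<lambda>p. form_at F p * f p)"
    by (rule tw_mult[OF tw_form[OF F]]) (use f assms in \<open>auto simp: V_def\<close>)
  thus ?thesis using f by (auto simp: V_def)
qed

lemma res_in_V: "biform a b d e F ==> res Z F \<in> V a b Z (int d) (int e)"
  using tw_form[of a b d e F Z] tw_cong[of Z "form_at F" "res Z F" a b "int d" "int e"]
  by (auto simp: V_def res_def)

text \<open>The forms \<open>F\<close> for which \<open>F f\<close> is again a form constitute an
  ideal. Its zeros can only lie on \<open>Z\<close>, because forms vanishing on \<open>Z\<close>
  belong to it; and at a point of \<open>Z\<close> a multiple of the local denominator of
  \<open>f\<close> belongs to it without vanishing there. By the Nullstellensatz the ideal is full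
  in large degrees.\<close>

lemma serre:
  fixes Z :: "'k::alg_closed_field pt set"
  assumes Z: "zclosed a b Z" and f: "tw a b Z d e f"
  shows "\<exists>M0. \<forall>m\<ge>M0. 0 \<le> int m + d \<and> 0 \<le> int m + e \<and> (\<forall>F. biform a b m m F -->
    (\<exists>G. biform a b (nat (int m + d)) (nat (int m + e)) G \<and> (\<forall>p\<in>Z. form_at F p * f p = form_at G p)))"
proof -
  define N where "N = nat (\<bar>d\<bar> + \<bar>e\<bar>)"
  have N: "0 \<le> int m + d" "0 \<le> int m + e" if "m \<ge> N" for m using that unfolding N_def by linarith+
  define P where "P m F \<longleftrightarrow> (\<exists>G. biform a b (nat (int m + d)) (nat (int m + e)) G \<and>
     (\<forall>p\<in>Z. form_at F p * f p = form_at G p))" for m F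
  \<comment> \<open>Below \<open>N\<close> the target degrees may be negative, where
    \<open>nat\<close> would truncate them, so the ideal is taken to be zero there.\<close>
  define J where "J m = (if m \<ge> N then {res Z F | F. biform a b m m F \<and> P m F} else {\<lambda>_. 0})" for m
  have JI: "res Z F \<in> J m" if "biform a b m m F" "P m F" "m \<ge> N" for m F
    unfolding J_def using that by auto
  have J0: "(\<lambda>_. 0) \<in> J m" for m
  proof -
    have "P m (\<lambda>_ _. 0)" unfolding P_def by (rule exI[of _ "\<lambda>_ _. 0"]) (simp add: biform_zero)
    moreover have "(\<lambda>_. 0) = res Z (\<lambda>_ _. 0)" by (rule ext) (simp add: res_def)
    ultimately show ?thesis using JI[OF biform_zero, of m] by (cases "m \<ge> N") (auto simp: J_def)
  qed
  have ideal: "hideal a b Z J" unfolding hideal_def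
  proof (intro conjI allI ballI)
    fix m show "J m \<subseteq> PF a b Z m m" unfolding J_def using PF_zero by (auto intro: PF_I)
    show "fs.subspace (J m)" unfolding fs_subspace_iff
    proof (intro conjI ballI allI)
      show "(\<lambda>_. 0) \<in> J m" by (rule J0)
    next
      fix g h assume gh: "g \<in> J m" "h \<in> J m"
      show "(\<lambda>x. g x + h x) \<in> J m"
      proof (cases "m \<ge> N")
        case True
        then obtain F H where F: "biform a b m m F" "P m F" "g = res Z F"
          and H: "biform a b m m H" "P m H" "h = res Z H" using gh unfolding J_def by auto
        obtain F' H' where F': "biform a b (nat (int m + d)) (nat (int m + e)) F'"
            "\<forall>p\<in>Z. form_at F p * f p = form_at F' p"
          and H': "biform a b (nat (int m + d)) (nat (int m + e)) H'"
            "\<forall>p\<in>Z. form_at H p * f p = form_at H' p" using F(2) H(2) unfolding P_def by blast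
        have "P m (\<lambda>x y. F x y + H x y)" unfolding P_def by (rule exI[of _ "\<lambda>x y. F' x y + H' x y"])
            (use F' H' in \<open>auto intro: biform.add simp: algebra_simps\<close>)
        moreover have "(\<lambda>x. g x + h x) = res Z (\<lambda>x y. F x y + H x y)"
          by (rule ext) (simp add: F H res_def)
        ultimately show ?thesis using JI[OF biform.add[OF F(1) H(1)] _ True] by simp
      qed (use gh in \<open>simp add: J_def\<close>)
    next
      fix c g assume g: "g \<in> J m"
      show "(\<lambda>x. c * g x) \<in> J m"
      proof (cases "m \<ge> N")
        case True
        then obtain F where F: "biform a b m m F" "P m F" "g = res Z F" using g unfolding J_def by auto
        obtain F' where F': "biform a b (nat (int m + d)) (nat (int m + e)) F'"
            "\<forall>p\<in>Z. form_at F p * f p = form_at F' p" using F(2) unfolding P_def by blast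
        have "P m (\<lambda>x y. c * F x y)" unfolding P_def by (rule exI[of _ "\<lambda>x y. c * F' x y"])
            (use F' in \<open>auto intro: biform_scale simp: mult.assoc\<close>)
        moreover have "(\<lambda>x. c * g x) = res Z (\<lambda>x y. c * F x y)" by (rule ext) (simp add: F res_def)
        ultimately show ?thesis using JI[OF biform_scale[OF F(1)] _ True] by simp
      qed (use g in \<open>simp add: J_def\<close>)
    qed
  next
    fix m k g h assume g: "g \<in> J m" and h: "h \<in> PF a b Z k k"
    show "(\<lambda>p. g p * h p) \<in> J (m + k)"
    proof (cases "m \<ge> N")
      case True
      then obtain F where F: "biform a b m m F" "P m F" "g = res Z F" using g unfolding J_def by auto
      obtain F' where F': "biform a b (nat (int m + d)) (nat (int m + e)) F'"
          "\<forall>p\<in>Z. form_at F p * f p = form_at F' p" using F(2) unfolding P_def by blast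
      obtain H where H: "biform a b k k H" "h = res Z H" using h by (rule PF_E)
      have eq: "nat (int m + d) + k = nat (int (m + k) + d)" "nat (int m + e) + k = nat (int (m + k) + e)"
        using N[OF True] by auto
      have "P (m + k) (\<lambda>x y. F x y * H x y)" unfolding P_def
        by (rule exI[of _ "\<lambda>x y. F' x y * H x y"])
          (use F' biform.mult[OF F'(1) H(1)] eq in \<open>auto simp: ac_simps\<close>)
      moreover have "(\<lambda>x. g x * h x) = res Z (\<lambda>x y. F x y * H x y)"
        by (rule ext) (simp add: F H res_def)
      ultimately show ?thesis using JI[OF biform.mult[OF F(1) H(1)]] True by simp
    next
      case False
      hence "(\<lambda>p. g p * h p) = (\<lambda>_. 0)" using g by (simp add: J_def)
      thus ?thesis using J0 by simp
    qed
  qed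
  have "\<not> proper a b Z J"
  proof
    assume "proper a b Z J"
    from nullstellensatz[OF ideal this] obtain p where p: "p \<in> biproj a b"
      "\<And>m F. biform a b m m F ==> res Z F \<in> J m ==> form_at F p = 0" by blast
    have "p \<in> Z"
    proof (rule ccontr)
      assume "p \<notin> Z"
      from zclosed_separate[OF Z p(1) this] obtain F d0 e0 where
        F: "biform a b d0 e0 F" "form_at F p \<noteq> 0" "\<forall>q\<in>Z. form_at F q = 0" by blast
      \<comment> \<open>Multiplication by \<open>H\<close> makes the separating form diagonal and
        lifts its degree to at least \<open>N\<close>.\<close>
      obtain H where H: "biform a b (N + e0) (N + d0) H" "form_at H p \<noteq> 0"
        using ex_form_nonzero_at[OF p(1)] by blast
      have B: "biform a b (N + d0 + e0) (N + d0 + e0) (\<lambda>x y. F x y * H x y)"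
        using biform.mult[OF F(1) H(1)] by (simp add: ac_simps)
      have "res Z (\<lambda>x y. F x y * H x y) = (\<lambda>_. 0)" by (rule ext) (simp add: res_def F(3))
      hence "res Z (\<lambda>x y. F x y * H x y) \<in> J (N + d0 + e0)" using J0 by simp
      from p(2)[OF B this] show False using F(2) H(2) by simp
    qed
    from twD[OF f this] obtain F G d1 e1 d2 e2 where "tw_at a b Z d e f p F G d1 e1 d2 e2" by blast
    note FG = tw_atD[OF this]
    obtain H where H: "biform a b (N + e2) (N + d2) H" "form_at H p \<noteq> 0"
      using ex_form_nonzero_at[OF p(1)] by blast
    define m where "m = N + d2 + e2"
    have B: "biform a b m m (\<lambda>x y. G x y * H x y)"
      unfolding m_def using biform.mult[OF FG(2) H(1)] by (simp add: ac_simps)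
    have eq: "d1 + (N + e2) = nat (int m + d)" "e1 + (N + d2) = nat (int m + e)"
      using FG(3,4) unfolding m_def by auto
    have "P m (\<lambda>x y. G x y * H x y)" unfolding P_def by (rule exI[of _ "\<lambda>x y. F x y * H x y"])
        (use biform.mult[OF FG(1) H(1)] eq FG(6) in \<open>auto simp: ac_simps\<close>)
    hence "res Z (\<lambda>x y. G x y * H x y) \<in> J m" using JI[OF B] by (simp add: m_def)
    from p(2)[OF B this] show False using FG(5) H(2) by simp
  qed
  then obtain m0 where m0: "J m0 = PF a b Z m0 m0" unfolding proper_def by blast
  show ?thesis
  proof (intro exI[of _ "max m0 N"] allI impI conjI)
    fix m assume m: "max m0 N \<le> m"
    show "0 \<le> int m + d" "0 \<le> int m + e" using N[of m] m by auto
    fix F :: "(nat => 'k) => (nat => 'k) => 'k" assume F: "biform a b m m F"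
    have "J m = PF a b Z m m" by (rule hideal_full_mono[OF ideal m0]) (use m in simp)
    hence "res Z F \<in> J m" using PF_I[OF F] by simp
    then obtain F1 where F1: "res Z F = res Z F1" "P m F1" using m unfolding J_def by auto
    obtain G where G: "biform a b (nat (int m + d)) (nat (int m + e)) G"
      "\<forall>p\<in>Z. form_at F1 p * f p = form_at G p" using F1(2) unfolding P_def by blast
    have "form_at F p = form_at F1 p" if "p \<in> Z" for p
      using fun_cong[OF F1(1), of p] that by (simp add: res_def)
    thus "\<exists>G. biform a b (nat (int m + d)) (nat (int m + e)) G \<and> (\<forall>p\<in>Z. form_at F p * f p = form_at G p)"
      using G by auto
  qed
qed

text \<open>\<open>L\<close> is isomorphic to \<open>O(d, e)\<close> on \<open>Z\<close>; \<open>\<psi> p\<close> is the image of the local generator over \<open>nbhd L p\<close>.\<close>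

definition has_type :: "nat => nat => 'k::field pt set => 'k lbundle => int => int => bool" where
  "has_type a b Z L d e \<longleftrightarrow> (\<forall>p\<in>Z. zopen a b (nbhd L p) \<and> p \<in> nbhd L p) \<and>
    (\<exists>\<psi>. (\<forall>p\<in>Z. tw a b (Z \<inter> nbhd L p) d e (\<psi> p) \<and> (\<forall>z\<in>Z \<inter> nbhd L p. \<psi> p z \<noteq> 0)) \<and>
      (\<forall>p\<in>Z. \<forall>q\<in>Z. \<forall>z\<in>Z \<inter> nbhd L p \<inter> nbhd L q. trans L p q z * \<psi> p z = \<psi> q z))"

lemma has_typeI:
  assumes "\<And>p. p \<in> Z ==> zopen a b (nbhd L p) \<and> p \<in> nbhd L p"
    and "\<And>p. p \<in> Z ==> tw a b (Z \<inter> nbhd L p) d e (\<psi> p)"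
    and "\<And>p z. p \<in> Z ==> z \<in> Z ==> z \<in> nbhd L p ==> \<psi> p z \<noteq> 0"
    and "\<And>p q z. p \<in> Z ==> q \<in> Z ==> z \<in> Z ==> z \<in> nbhd L p ==> z \<in> nbhd L q ==>
      trans L p q z * \<psi> p z = \<psi> q z"
  shows "has_type a b Z L d e" unfolding has_type_def using assms by (intro conjI exI[of _ \<psi>]) auto

lemma has_typeE:
  assumes "has_type a b Z L d e"
  obtains \<psi> where "\<And>p. p \<in> Z ==> zopen a b (nbhd L p) \<and> p \<in> nbhd L p"
    and "\<And>p. p \<in> Z ==> tw a b (Z \<inter> nbhd L p) d e (\<psi> p)"
    and "\<And>p z. p \<in> Z ==> z \<in> Z ==> z \<in> nbhd L p ==> \<psi> p z \<noteq> 0"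
    and "\<And>p q z. p \<in> Z ==> q \<in> Z ==> z \<in> Z ==> z \<in> nbhd L p ==> z \<in> nbhd L q ==>
      trans L p q z * \<psi> p z = \<psi> q z"
  using assms unfolding has_type_def by (elim conjE exE) (rule that, auto)

lemma has_type_subset:
  assumes "has_type a b X L d e" "Z \<subseteq> X"
  shows "has_type a b Z L d e"
proof -
  obtain \<psi> where \<psi>: "\<And>p. p \<in> X ==> zopen a b (nbhd L p) \<and> p \<in> nbhd L p"
    "\<And>p. p \<in> X ==> tw a b (X \<inter> nbhd L p) d e (\<psi> p)"
    "\<And>p z. p \<in> X ==> z \<in> X ==> z \<in> nbhd L p ==> \<psi> p z \<noteq> 0"
    "\<And>p q z. p \<in> X ==> q \<in> X ==> z \<in> X ==> z \<in> nbhd L p ==> z \<in> nbhd L q ==>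
      trans L p q z * \<psi> p z = \<psi> q z" by (rule has_typeE[OF assms(1)]) (rule that)
  show ?thesis
  proof (rule has_typeI[of _ _ _ _ _ _ \<psi>])
    fix p assume "p \<in> Z"
    hence p: "p \<in> X" using assms(2) by blast
    show "zopen a b (nbhd L p) \<and> p \<in> nbhd L p" by (rule \<psi>(1)[OF p])
    show "tw a b (Z \<inter> nbhd L p) d e (\<psi> p)" by (rule tw_subset[OF \<psi>(2)[OF p]]) (use assms(2) in blast)
  next
    fix p z assume "p \<in> Z" "z \<in> Z" "z \<in> nbhd L p"
    thus "\<psi> p z \<noteq> 0" using assms(2) by (intro \<psi>(3)) blast+
  next
    fix p q z assume "p \<in> Z" "q \<in> Z" "z \<in> Z" "z \<in> nbhd L p" "z \<in> nbhd L q"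
    thus "trans L p q z * \<psi> p z = \<psi> q z" using assms(2) by (intro \<psi>(4)) blast+
  qed
qed

lemma has_type_tensor:
  assumes "has_type a b X L d e" "has_type a b X L' d' e'"
  shows "has_type a b X (tensor L L') (d + d') (e + e')"
proof -
  obtain \<psi> where \<psi>: "\<And>p. p \<in> X ==> zopen a b (nbhd L p) \<and> p \<in> nbhd L p"
    "\<And>p. p \<in> X ==> tw a b (X \<inter> nbhd L p) d e (\<psi> p)"
    "\<And>p z. p \<in> X ==> z \<in> X ==> z \<in> nbhd L p ==> \<psi> p z \<noteq> 0"
    "\<And>p q z. p \<in> X ==> q \<in> X ==> z \<in> X ==> z \<in> nbhd L p ==> z \<in> nbhd L q ==>
      trans L p q z * \<psi> p z = \<psi> q z" by (rule has_typeE[OF assms(1)]) (rule that)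
  obtain \<psi>' where \<psi>': "\<And>p. p \<in> X ==> zopen a b (nbhd L' p) \<and> p \<in> nbhd L' p"
    "\<And>p. p \<in> X ==> tw a b (X \<inter> nbhd L' p) d' e' (\<psi>' p)"
    "\<And>p z. p \<in> X ==> z \<in> X ==> z \<in> nbhd L' p ==> \<psi>' p z \<noteq> 0"
    "\<And>p q z. p \<in> X ==> q \<in> X ==> z \<in> X ==> z \<in> nbhd L' p ==> z \<in> nbhd L' q ==>
      trans L' p q z * \<psi>' p z = \<psi>' q z" by (rule has_typeE[OF assms(2)]) (rule that)
  show ?thesis
  proof (rule has_typeI[of _ _ _ _ _ _ "\<lambda>p z. \<psi> p z * \<psi>' p z"])
    fix p assume p: "p \<in> X"
    show "zopen a b (nbhd (tensor L L') p) \<and> p \<in> nbhd (tensor L L') p"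
      using \<psi>(1)[OF p] \<psi>'(1)[OF p] by (auto simp: tensor_def intro: zopen_Int)
    show "tw a b (X \<inter> nbhd (tensor L L') p) (d + d') (e + e') (\<lambda>z. \<psi> p z * \<psi>' p z)"
      by (rule tw_mult[OF tw_subset[OF \<psi>(2)[OF p]] tw_subset[OF \<psi>'(2)[OF p]]])
        (auto simp: tensor_def)
  next
    fix p z assume "p \<in> X" "z \<in> X" "z \<in> nbhd (tensor L L') p"
    thus "\<psi> p z * \<psi>' p z \<noteq> 0" using \<psi>(3)[of p z] \<psi>'(3)[of p z] by (simp add: tensor_def)
  next
    fix p q z assume "p \<in> X" "q \<in> X" "z \<in> X" "z \<in> nbhd (tensor L L') p" "z \<in> nbhd (tensor L L') q"
    hence "trans L p q z * \<psi> p z = \<psi> q z" "trans L' p q z * \<psi>' p z = \<psi>' q z"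
      using \<psi>(4)[of p q z] \<psi>'(4)[of p q z] by (auto simp: tensor_def)
    thus "trans (tensor L L') p q z * (\<psi> p z * \<psi>' p z) = \<psi> q z * \<psi>' q z"
      by (simp add: tensor_def) (metis mult.assoc mult.left_commute)
  qed
qed

lemma has_type_tensor_power:
  assumes "has_type a b X L d e"
  shows "has_type a b X (tensor_power L m) (int m * d) (int m * e)"
proof -
  obtain \<psi> where \<psi>: "\<And>p. p \<in> X ==> zopen a b (nbhd L p) \<and> p \<in> nbhd L p"
    "\<And>p. p \<in> X ==> tw a b (X \<inter> nbhd L p) d e (\<psi> p)"
    "\<And>p z. p \<in> X ==> z \<in> X ==> z \<in> nbhd L p ==> \<psi> p z \<noteq> 0"
    "\<And>p q z. p \<in> X ==> q \<in> X ==> z \<in> X ==> z \<in> nbhd L p ==> z \<in> nbhd L q ==>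
      trans L p q z * \<psi> p z = \<psi> q z" by (rule has_typeE[OF assms(1)]) (rule that)
  show ?thesis
  proof (rule has_typeI[of _ _ _ _ _ _ "\<lambda>p z. \<psi> p z ^ m"])
    fix p assume p: "p \<in> X"
    show "zopen a b (nbhd (tensor_power L m) p) \<and> p \<in> nbhd (tensor_power L m) p"
      using \<psi>(1)[OF p] by (simp add: tensor_power_def)
    show "tw a b (X \<inter> nbhd (tensor_power L m) p) (int m * d) (int m * e) (\<lambda>z. \<psi> p z ^ m)"
      using tw_power[OF \<psi>(2)[OF p]] by (simp add: tensor_power_def)
  next
    fix p z assume "p \<in> X" "z \<in> X" "z \<in> nbhd (tensor_power L m) p"
    thus "\<psi> p z ^ m \<noteq> 0" using \<psi>(3)[of p z] by (simp add: tensor_power_def)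
  next
    fix p q z assume "p \<in> X" "q \<in> X" "z \<in> X" "z \<in> nbhd (tensor_power L m) p" "z \<in> nbhd (tensor_power L m) q"
    thus "trans (tensor_power L m) p q z * \<psi> p z ^ m = \<psi> q z ^ m"
      using \<psi>(4)[of p q z] by (simp add: tensor_power_def power_mult_distrib[symmetric])
  qed
qed

lemma has_type_O_bundle:
  assumes X: "X \<subseteq> biproj a b"
  shows "has_type a b X (O_bundle a b d e) d e"
proof (rule has_typeI[of _ _ _ _ _ _ "\<lambda>p z. xc z (ix p) powi d * yc z (jy p) powi e"])
  fix p assume "p \<in> X"
  hence p: "p \<in> biproj a b" using X by blast
  obtain i j where i: "i \<le> a" "xc p i \<noteq> 0" and j: "j \<le> b" "yc p j \<noteq> 0"
    using ex_xc_nonzero[OF p] ex_yc_nonzero[OF p] by blast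
  have ix: "ix p \<le> a" "xc p (ix p) \<noteq> 0" unfolding ix_def
    using order_trans[OF Least_le[of "\<lambda>i. xc p i \<noteq> 0", OF i(2)] i(1)]
      LeastI[of "\<lambda>i. xc p i \<noteq> 0", OF i(2)] by auto
  have jy: "jy p \<le> b" "yc p (jy p) \<noteq> 0" unfolding jy_def
    using order_trans[OF Least_le[of "\<lambda>j. yc p j \<noteq> 0", OF j(2)] j(1)]
      LeastI[of "\<lambda>j. yc p j \<noteq> 0", OF j(2)] by auto
  have "biform a b 1 1 (\<lambda>x y. x (ix p) * y (jy p))" using biform_coords[OF ix(1) jy(1), of 1 1] by simp
  from zopen_form[OF this]
  have "zopen a b {z \<in> biproj a b. xc z (ix p) \<noteq> 0 \<and> yc z (jy p) \<noteq> 0}" by simp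
  thus "zopen a b (nbhd (O_bundle a b d e) p) \<and> p \<in> nbhd (O_bundle a b d e) p"
    using p ix jy by (simp add: O_bundle_def)
  have "tw a b (X \<inter> nbhd (O_bundle a b d e) p) (d * 1) (d * 0) (\<lambda>z. xc z (ix p) powi d)"
    by (rule tw_powi[OF tw_x[OF ix(1)]]) (simp add: O_bundle_def)
  moreover have "tw a b (X \<inter> nbhd (O_bundle a b d e) p) (e * 0) (e * 1) (\<lambda>z. yc z (jy p) powi e)"
    by (rule tw_powi[OF tw_y[OF jy(1)]]) (simp add: O_bundle_def)
  ultimately show "tw a b (X \<inter> nbhd (O_bundle a b d e) p) d e (\<lambda>z. xc z (ix p) powi d * yc z (jy p) powi e)"
    by (rule tw_mult) auto
qed (auto simp: O_bundle_def power_int_divide_distrib)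

lemma has_type_tensor_list:
  assumes X: "X \<subseteq> biproj a b" and "list_all2 (\<lambda>L t. has_type a b X L (fst t) (snd t)) Ls ts"
  shows "has_type a b X (tensor_list a b Ls) (sum_list (map fst ts)) (sum_list (map snd ts))"
  using assms(2)
proof (induction Ls ts rule: list_all2_induct)
  case Nil
  show ?case using has_type_O_bundle[OF X, of 0 0] by (simp add: tensor_list_def)
next
  case (Cons L Ls t ts)
  show ?case using has_type_tensor[OF Cons(1) Cons.IH] by (simp add: tensor_list_def)
qed

lemma sections_eq_image:
  fixes \<psi> :: "'k::field pt => 'k pt => 'k"
  assumes Z: "Z \<subseteq> biproj a b"
    and \<psi>: "\<And>p. p \<in> Z ==> zopen a b (nbhd L p) \<and> p \<in> nbhd L p"
    "\<And>p. p \<in> Z ==> tw a b (Z \<inter> nbhd L p) d e (\<psi> p)"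
    "\<And>p z. p \<in> Z ==> z \<in> Z ==> z \<in> nbhd L p ==> \<psi> p z \<noteq> 0"
    "\<And>p q z. p \<in> Z ==> q \<in> Z ==> z \<in> Z ==> z \<in> nbhd L p ==> z \<in> nbhd L q ==> trans L p q z * \<psi> p z = \<psi> q z"
  shows "sections a b Z L = (\<lambda>f p z. if p \<in> Z \<and> z \<in> Z \<inter> nbhd L p then f z / \<psi> p z else 0) ` V a b Z d e"
    (is "_ = ?T ` _")
proof
  show "?T ` V a b Z d e \<subseteq> sections a b Z L"
  proof
    fix \<sigma> assume "\<sigma> \<in> ?T ` V a b Z d e"
    then obtain f where f: "f \<in> V a b Z d e" "\<sigma> = ?T f" by blast
    show "\<sigma> \<in> sections a b Z L" unfolding sections_def
    proof (rule CollectI, intro conjI ballI allI impI)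
      fix p assume p: "p \<in> Z"
      have "tw a b (Z \<inter> nbhd L p) 0 0 (\<lambda>z. f z * inverse (\<psi> p z))"
        by (rule tw_mult[OF tw_subset[of a b Z d e f] tw_inverse[OF \<psi>(2)[OF p]]])
          (use f(1) \<psi>(3)[OF p] in \<open>auto simp: V_def\<close>)
      moreover have "tw a b (Z \<inter> nbhd L p) 0 0 (\<sigma> p) \<longleftrightarrow>
          tw a b (Z \<inter> nbhd L p) 0 0 (\<lambda>z. f z * inverse (\<psi> p z))"
        by (rule tw_cong) (use p in \<open>simp add: f(2) divide_inverse\<close>)
      ultimately show "regular_on a b (Z \<inter> nbhd L p) (\<sigma> p)"
        using regular_on_iff_tw[of "Z \<inter> nbhd L p" a b "\<sigma> p"] Z by blast
      fix q z assume q: "q \<in> Z" and z: "z \<in> Z \<inter> nbhd L p \<inter> nbhd L q"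
      have "\<psi> p z \<noteq> 0" "\<psi> q z \<noteq> 0" "trans L p q z * \<psi> p z = \<psi> q z"
        using \<psi>(3)[OF p, of z] \<psi>(3)[OF q, of z] \<psi>(4)[OF p q, of z] z by auto
      thus "\<sigma> p z = trans L p q z * \<sigma> q z" using p q z by (auto simp: f(2) field_simps)
    qed (auto simp: f(2))
  qed
  show "sections a b Z L \<subseteq> ?T ` V a b Z d e"
  proof
    fix \<sigma> assume "\<sigma> \<in> sections a b Z L"
    note A = this[unfolded sections_def mem_Collect_eq]
    have \<sigma>1: "regular_on a b (Z \<inter> nbhd L p) (\<sigma> p)" if "p \<in> Z" for p
      using bspec[OF conjunct1[OF A] that] .
    have \<sigma>2: "\<sigma> p z = trans L p q z * \<sigma> q z"
      if "p \<in> Z" "q \<in> Z" "z \<in> Z \<inter> nbhd L p \<inter> nbhd L q" for p q z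
      using bspec[OF bspec[OF bspec[OF conjunct1[OF conjunct2[OF A]] that(1)] that(2)] that(3)] .
    have \<sigma>3: "\<sigma> p z = 0" if "p \<notin> Z \<or> z \<notin> Z \<inter> nbhd L p" for p z
      using conjunct2[OF conjunct2[OF A]] that by blast
    \<comment> \<open>The value at \<open>z\<close> is read in the trivialisation indexed by
      \<open>z\<close> itself; \<open>eq\<close> shows that any other one gives the same.\<close>
    define f where "f z = (if z \<in> Z then \<sigma> z z * \<psi> z z else 0)" for z
    have eq: "f z = \<sigma> p z * \<psi> p z" if "p \<in> Z" "z \<in> Z" "z \<in> nbhd L p" for p z
    proof -
      have zz: "z \<in> nbhd L z" using \<psi>(1) that by blast
      have "\<sigma> p z = trans L p z z * \<sigma> z z" by (rule \<sigma>2) (use that zz in auto)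
      moreover have "trans L p z z * \<psi> p z = \<psi> z z" by (rule \<psi>(4)) (use that zz in auto)
      ultimately show ?thesis using that by (simp add: f_def)
    qed
    have "tw a b Z d e f"
    proof (rule tw_local[OF Z])
      fix p assume p: "p \<in> Z"
      have "tw a b (Z \<inter> nbhd L p) d e (\<lambda>z. \<sigma> p z * \<psi> p z)" by (rule tw_mult[of _ _ _ 0 0])
          (use \<sigma>1[OF p] regular_on_iff_tw[of "Z \<inter> nbhd L p" a b "\<sigma> p"] Z \<psi>(2)[OF p] in auto)
      moreover have "tw a b (Z \<inter> nbhd L p) d e f \<longleftrightarrow> tw a b (Z \<inter> nbhd L p) d e (\<lambda>z. \<sigma> p z * \<psi> p z)"
        by (rule tw_cong) (use eq p in auto)
      ultimately show "\<exists>U. zopen a b U \<and> p \<in> U \<and> tw a b (Z \<inter> U) d e f" using \<psi>(1)[OF p] by blast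
    qed
    hence "f \<in> V a b Z d e" by (simp add: V_def f_def)
    moreover have "\<sigma> = ?T f"
    proof (intro ext)
      fix p z show "\<sigma> p z = ?T f p z"
        using \<sigma>3[of p z] eq[of p z] \<psi>(3)[of p z] by (cases "p \<in> Z \<and> z \<in> Z \<inter> nbhd L p") auto
    qed
    ultimately show "\<sigma> \<in> ?T ` V a b Z d e" by blast
  qed
qed

section \<open>Dimensions of spaces of sections and Hilbert polynomials\<close>

global_interpretation fs2: vector_space "\<lambda>(c::'k::field) (\<sigma>::'a => 'b => 'k) p z. c * \<sigma> p z"
  by (rule vector_space.intro) ((intro ext)?, simp add: algebra_simps)+

global_interpretation fs2_pair: vector_space_pair "\<lambda>(c::'k::field) (f::'c => 'k) x. c * f x"
  "\<lambda>(c::'k::field) (\<sigma>::'a => 'b => 'k) p z. c * \<sigma> p z" by unfold_locales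

lemma h0_eq_dim:
  assumes Z: "Z \<subseteq> biproj a b" and L: "has_type a b Z L d e" and fd: "fin_dim (V a b Z d e)"
  shows "h0 a b Z L = fs.dim (V a b Z d e)"
proof -
  obtain \<psi> where \<psi>: "\<And>p. p \<in> Z ==> zopen a b (nbhd L p) \<and> p \<in> nbhd L p"
    "\<And>p. p \<in> Z ==> tw a b (Z \<inter> nbhd L p) d e (\<psi> p)"
    "\<And>p z. p \<in> Z ==> z \<in> Z ==> z \<in> nbhd L p ==> \<psi> p z \<noteq> 0"
    "\<And>p q z. p \<in> Z ==> q \<in> Z ==> z \<in> Z ==> z \<in> nbhd L p ==> z \<in> nbhd L q ==>
      trans L p q z * \<psi> p z = \<psi> q z" by (rule has_typeE[OF L]) (rule that)
  define T where "T f p z = (if p \<in> Z \<and> z \<in> Z \<inter> nbhd L p then f z / \<psi> p z else 0)" for f p z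
  have S: "sections a b Z L = T ` V a b Z d e" unfolding T_def by (rule sections_eq_image[OF Z \<psi>])
  have lin: "Vector_Spaces.linear (\<lambda>(c::'a) (f::'a pt => 'a) x. c * f x)
    (\<lambda>(c::'a) (\<sigma>::'a pt => 'a pt => 'a) p z. c * \<sigma> p z) T" unfolding Vector_Spaces.linear_iff
    by (intro conjI allI fs.vector_space_axioms fs2.vector_space_axioms ext)
      (simp_all add: T_def add_divide_distrib)
  obtain B where B: "B \<subseteq> V a b Z d e" "finite B" "fs.independent B" "V a b Z d e \<subseteq> fs.span B"
    "card B = fs.dim (V a b Z d e)" using fin_dim_basis[OF fd] .
  have span: "fs.span B = V a b Z d e" using B(1,4) fs.span_minimal[OF _ V_subspace[OF Z]] by blast
  have inj: "inj_on T (V a b Z d e)"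
  proof (rule inj_onI, rule ext)
    fix f g z assume fg: "f \<in> V a b Z d e" "g \<in> V a b Z d e" "T f = T g"
    show "f z = g z"
    proof (cases "z \<in> Z")
      case True
      have "T f z z = T g z z" using fg(3) by simp
      thus ?thesis using True \<psi>(1)[OF True] \<psi>(3)[OF True True] by (simp add: T_def)
    next
      case False
      have "f z = 0" "g z = 0" using fg(1,2) False unfolding V_def by blast+
      thus ?thesis by simp
    qed
  qed
  have ind: "fs2.independent (T ` B)"
    by (rule fs2_pair.linear_independent_injective_image[OF lin B(3)]) (use inj span in simp)
  have "fs2.span (T ` B) = T ` fs.span B" by (rule fs2_pair.linear_span_image[OF lin])
  hence "fs2.dim (sections a b Z L) = card (T ` B)"
    unfolding S span[symmetric] using fs2.dim_span_eq_card_independent[OF ind] by simp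
  also have "\<dots> = card B" using card_image inj B(1) inj_on_subset by blast
  finally show ?thesis unfolding h0_def B(5) .
qed

text \<open>Adding \<open>m\<close> to both entries is the twist by O(1, 1) in
  \<open>hilbert_poly\<close>. Finite dimension is recorded because \<open>h0_eq_dim\<close> rests
  on it.\<close>

definition hilb :: "nat => nat => 'k::field pt set => int => int => real poly => bool" where
  "hilb a b Z d e P \<longleftrightarrow> (\<forall>\<^sub>F m in sequentially. fin_dim (V a b Z (d + int m) (e + int m)) \<and>
     poly P (real m) = real (fs.dim (V a b Z (d + int m) (e + int m))))"

lemma poly_eq_if_eventually:
  assumes "\<forall>\<^sub>F m in sequentially. poly P (real m) = poly Q (real m)"
  shows "P = Q"
proof (rule ccontr)
  assume "P \<noteq> Q"
  hence fin: "finite {x. poly (P - Q) x = 0}" by (intro poly_roots_finite) simp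
  obtain N where N: "\<And>m. m \<ge> N ==> poly P (real m) = poly Q (real m)"
    using assms unfolding eventually_sequentially by blast
  have "real ` {N..} \<subseteq> {x. poly (P - Q) x = 0}" using N by auto
  hence "finite (real ` {N..})" using fin finite_subset by blast
  hence "finite {N..}" by (rule finite_imageD) (simp add: inj_on_def)
  thus False by (simp add: infinite_Ici)
qed

lemma euler_char_eq:
  assumes Z: "Z \<subseteq> biproj a b" and L: "has_type a b Z L d e" and P: "hilb a b Z d e P"
  shows "euler_char a b Z L = poly P 0"
proof -
  have ev: "\<forall>\<^sub>F m in sequentially. poly P (real m) =
      real (h0 a b Z (tensor L (O_bundle a b (int m) (int m))))" using P unfolding hilb_def
  proof (rule eventually_mono)
    fix m assume m: "fin_dim (V a b Z (d + int m) (e + int m)) \<and>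
     poly P (real m) = real (fs.dim (V a b Z (d + int m) (e + int m)))"
    have "has_type a b Z (tensor L (O_bundle a b (int m) (int m))) (d + int m) (e + int m)"
      by (rule has_type_tensor[OF L has_type_O_bundle[OF Z]])
    from h0_eq_dim[OF Z this] m
    show "poly P (real m) = real (h0 a b Z (tensor L (O_bundle a b (int m) (int m))))" by simp
  qed
  have "hilbert_poly a b Z L = P" unfolding hilbert_poly_def
  proof (rule the_equality)
    show "\<forall>\<^sub>F m in sequentially. poly P (real m) =
      real (h0 a b Z (tensor L (O_bundle a b (int m) (int m))))" by (rule ev)
  next
    fix Q assume "\<forall>\<^sub>F m in sequentially. poly Q (real m) =
      real (h0 a b Z (tensor L (O_bundle a b (int m) (int m))))"
    with ev have "\<forall>\<^sub>F m in sequentially. poly Q (real m) = poly P (real m)" by eventually_elim simp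
    thus "Q = P" by (rule poly_eq_if_eventually)
  qed
  thus ?thesis by (simp add: euler_char_def)
qed

text \<open>Points are pairs of sets of coordinate vectors but are handled only through
  \<open>xc\<close> and \<open>yc\<close>; splitting quantifiers over points would break them into
  components.\<close>

declare split_paired_All [simp del] split_paired_Ex [simp del]

section \<open>Pencils without common zeros on curves\<close>

lemma irreducible_mult:
  assumes C: "irreducible_closed a b C" and F: "biform a b d e F" and G: "biform a b d' e' G"
    and z: "\<And>p. p \<in> C ==> form_at F p * form_at G p = 0"
  shows "(\<forall>p\<in>C. form_at F p = 0) \<or> (\<forall>p\<in>C. form_at G p = 0)"
proof -
  have cl: "zclosed a b C" using C by (simp add: irreducible_closed_def)
  let ?A = "C \<inter> {p \<in> biproj a b. form_at F p = 0}" and ?B = "C \<inter> {p \<in> biproj a b. form_at G p = 0}"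
  have A: "zclosed a b ?A" and B: "zclosed a b ?B"
    using zclosed_Int[OF cl zclosed_form[OF F]] zclosed_Int[OF cl zclosed_form[OF G]] by auto
  have "C = ?A \<union> ?B" using z zclosed_subset[OF cl] by fastforce
  hence "C = ?A \<or> C = ?B" using C A B unfolding irreducible_closed_def by blast
  thus ?thesis by blast
qed

text \<open>If \<open>f p\<close> is nonzero, the numerator of \<open>f\<close> at \<open>p\<close>
  is a form not vanishing at \<open>p\<close>, while its product with \<open>F\<close> vanishes on
  \<open>C\<close>; this reduces the claim to forms.\<close>

lemma irreducible_V_mult:
  assumes C: "irreducible_closed a b C" and F: "biform a b d' e' F" "\<exists>p\<in>C. form_at F p \<noteq> 0"
    and f: "f \<in> V a b C d e" and z: "\<And>p. p \<in> C ==> form_at F p * f p = 0"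
  shows "f = (\<lambda>_. 0)"
proof (rule ccontr)
  assume "f \<noteq> (\<lambda>_. 0)"
  then obtain p where p: "f p \<noteq> 0" by (meson ext)
  hence pC: "p \<in> C" using f unfolding V_def by blast
  have "tw a b C d e f" using f by (simp add: V_def)
  from twD[OF this pC] obtain H G d1 e1 d2 e2 where "tw_at a b C d e f p H G d1 e1 d2 e2" by blast
  note H = tw_atD(1,5,6)[OF this]
  have "(\<forall>p\<in>C. form_at F p = 0) \<or> (\<forall>p\<in>C. form_at H p = 0)"
  proof (rule irreducible_mult[OF C F(1) H(1)])
    fix q assume q: "q \<in> C"
    have "form_at F q * form_at H q = form_at G q * (form_at F q * f q)"
      using H(3) q by (metis mult.left_commute)
    thus "form_at F q * form_at H q = 0" using z[OF q] by simp
  qed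
  hence "form_at H p = 0" using F(2) pC by blast
  thus False using H(2,3) p pC by (metis mult_eq_0_iff)
qed

text \<open>A form of the transposed bidegree, nonzero at \<open>p\<close>, evens out the
  degrees.\<close>

lemma diag_separate:
  assumes Z: "zclosed a b Z" and p: "p \<in> biproj a b" "p \<notin> Z"
  shows "\<exists>m F. biform a b m m F \<and> form_at F p \<noteq> 0 \<and> (\<forall>q\<in>Z. form_at F q = 0)"
proof -
  from zclosed_separate[OF Z p] obtain F d e where
    F: "biform a b d e F" "form_at F p \<noteq> 0" "\<forall>q\<in>Z. form_at F q = 0" by blast
  obtain H where H: "biform a b e d H" "form_at H p \<noteq> 0" using ex_form_nonzero_at[OF p(1)] by blast
  have "biform a b (d + e) (d + e) (\<lambda>x y. F x y * H x y)"
    using biform.mult[OF F(1) H(1)] by (simp add: ac_simps)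
  thus ?thesis using F H by (intro exI[of _ "d + e"] exI[of _ "\<lambda>x y. F x y * H x y"]) simp
qed

text \<open>Compactness of chains. If the intersection were empty, the forms vanishing on some
  member of \<open>S\<close> would make an ideal without zeros, hence would include all
  \<open>x_i ^ m * y_j ^ m\<close> for one \<open>m\<close>. Finitely many members are involved, and
  on the smallest of them all these products would vanish, which no point allows.\<close>

lemma chain_Inter_nonempty:
  fixes S :: "'k::alg_closed_field pt set set"
  assumes S: "S \<noteq> {}" "\<And>Z. Z \<in> S ==> zclosed a b Z" "\<And>Z. Z \<in> S ==> Z \<noteq> {}"
    and chain: "\<And>Y Z. Y \<in> S ==> Z \<in> S ==> Y \<subseteq> Z \<or> Z \<subseteq> Y"
  shows "\<Inter>S \<noteq> {}"
proof
  assume empty: "\<Inter>S = {}"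
  let ?X = "biproj a b :: 'k pt set"
  define J where "J m = {f \<in> PF a b ?X m m. \<exists>Z\<in>S. \<forall>p\<in>Z. f p = 0}" for m
  have ideal: "hideal a b ?X J" unfolding hideal_def
  proof (intro conjI allI ballI)
    fix m show "J m \<subseteq> PF a b ?X m m" unfolding J_def by blast
    show "fs.subspace (J m)" unfolding fs_subspace_iff
    proof (intro conjI ballI allI)
      show "(\<lambda>_. 0) \<in> J m" unfolding J_def using PF_zero S(1) by auto
    next
      fix f g assume f: "f \<in> J m" and g: "g \<in> J m"
      obtain Y where Y: "Y \<in> S" "\<forall>p\<in>Y. f p = 0" using f unfolding J_def by blast
      obtain Z where Z: "Z \<in> S" "\<forall>p\<in>Z. g p = 0" using g unfolding J_def by blast
      have "\<exists>W\<in>S. \<forall>p\<in>W. f p + g p = 0"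
      proof (cases "Y \<subseteq> Z")
        case True
        thus ?thesis using Y Z by (intro bexI[of _ Y]) auto
      next
        case False
        hence "Z \<subseteq> Y" using chain Y(1) Z(1) by blast
        thus ?thesis using Y Z by (intro bexI[of _ Z]) auto
      qed
      thus "(\<lambda>x. f x + g x) \<in> J m" using f g PF_add unfolding J_def by blast
    next
      fix c f assume f: "f \<in> J m"
      obtain Y where Y: "Y \<in> S" "\<forall>p\<in>Y. f p = 0" using f unfolding J_def by blast
      have "(\<lambda>x. c * f x) \<in> PF a b ?X m m" by (rule PF_scale) (use f in \<open>simp add: J_def\<close>)
      thus "(\<lambda>x. c * f x) \<in> J m" using Y unfolding J_def by auto
    qed
  next
    fix m k f g assume f: "f \<in> J m" and g: "g \<in> PF a b ?X k k"
    obtain Y where Y: "Y \<in> S" "\<forall>p\<in>Y. f p = 0" using f unfolding J_def by blast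
    have "(\<lambda>x. f x * g x) \<in> PF a b ?X (m + k) (m + k)"
      by (rule PF_mult[OF _ g]) (use f in \<open>simp add: J_def\<close>)
    thus "(\<lambda>p. f p * g p) \<in> J (m + k)" using Y unfolding J_def by auto
  qed
  have "\<not> proper a b ?X J"
  proof
    assume "proper a b ?X J"
    from nullstellensatz[OF ideal this] obtain p where p: "p \<in> biproj a b"
      "\<And>m F. biform a b m m F ==> res ?X F \<in> J m ==> form_at F p = 0" by blast
    obtain Z where Z: "Z \<in> S" "p \<notin> Z" using empty by blast
    from diag_separate[OF S(2)[OF Z(1)] p(1) Z(2)] obtain m F where
      F: "biform a b m m F" "form_at F p \<noteq> 0" "\<forall>q\<in>Z. form_at F q = 0" by blast
    have "\<forall>q\<in>Z. res ?X F q = 0" using F(3) by (simp add: res_def)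
    hence "res ?X F \<in> J m" unfolding J_def using PF_I[OF F(1)] Z(1) by blast
    thus False using p(2)[OF F(1)] F(2) by blast
  qed
  then obtain m where m: "J m = PF a b ?X m m" unfolding proper_def by blast
  define M where "M i j = res ?X (\<lambda>x y. x i ^ m * y j ^ m)" for i j
  have ex: "\<exists>Z\<in>S. \<forall>p\<in>Z. M i j p = 0" if "i \<le> a" "j \<le> b" for i j
  proof -
    have "M i j \<in> J m" unfolding m M_def by (rule PF_I[OF biform_coords[OF that]])
    thus ?thesis unfolding J_def by blast
  qed
  have "\<forall>i. \<exists>W. \<forall>j. i \<le> a --> j \<le> b --> W j \<in> S \<and> (\<forall>p\<in>W j. M i j p = 0)"
  proof (rule allI, rule choice, rule allI)
    fix i j
    show "\<exists>Z. i \<le> a --> j \<le> b --> Z \<in> S \<and> (\<forall>p\<in>Z. M i j p = 0)" using ex[of i j] by blast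
  qed
  from choice[OF this] obtain W where
    W: "\<And>i j. i \<le> a ==> j \<le> b ==> W i j \<in> S \<and> (\<forall>p\<in>W i j. M i j p = 0)" by blast
  have low: "\<exists>Z\<in>S. \<forall>Y\<in>T. Z \<subseteq> Y" if "finite T" "T \<noteq> {}" "T \<subseteq> S" for T using that
  proof (induction T rule: finite_ne_induct)
    case (singleton Y)
    thus ?case by auto
  next
    case (insert Y T)
    then obtain Z where "Z \<in> S" "\<forall>Y\<in>T. Z \<subseteq> Y" by auto
    moreover have "Y \<in> S" using insert by simp
    ultimately show ?case using chain[of Y Z] by (metis insert_iff order_trans order_refl)
  qed
  have "\<exists>Z\<in>S. \<forall>Y\<in>(\<lambda>(i, j). W i j) ` ({..a} \<times> {..b}). Z \<subseteq> Y"
  proof (rule low)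
    show "(\<lambda>(i, j). W i j) ` ({..a} \<times> {..b}) \<subseteq> S" using W by fastforce
  qed auto
  then obtain Z where Z: "Z \<in> S" "\<And>i j. i \<le> a ==> j \<le> b ==> Z \<subseteq> W i j" by auto
  obtain p where p: "p \<in> Z" using S(3)[OF Z(1)] by blast
  have pX: "p \<in> ?X" using zclosed_subset[OF S(2)[OF Z(1)]] p by blast
  obtain i j where ij: "i \<le> a" "xc p i \<noteq> 0" "j \<le> b" "yc p j \<noteq> 0"
    using ex_xc_nonzero[OF pX] ex_yc_nonzero[OF pX] by blast
  have "M i j p = 0" using W[OF ij(1,3)] Z(2)[OF ij(1,3)] p by blast
  thus False using ij pX by (simp add: M_def res_def)
qed

text \<open>The ideal generated by \<open>F\<close> and \<open>G\<close> in the coordinate ring of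
  \<open>Z\<close> has no zero, so by the Nullstellensatz it contains all forms of large
  degree.\<close>

lemma pencil_full:
  fixes Z :: "'k::alg_closed_field pt set"
  assumes Z: "zclosed a b Z" and F: "biform a b 1 1 F" and G: "biform a b 1 1 G"
    and nz: "\<And>p. p \<in> Z ==> form_at F p \<noteq> 0 \<or> form_at G p \<noteq> 0"
  shows "\<exists>B. \<forall>m\<ge>B. \<forall>h\<in>PF a b Z (Suc m) (Suc m). \<exists>u\<in>PF a b Z m m. \<exists>v\<in>PF a b Z m m.
    h = (\<lambda>p. res Z F p * u p + res Z G p * v p)"
proof -
  define J0 where "J0 m = {\<lambda>_::'k pt. 0 :: 'k}" for m :: nat
  have J0: "hideal a b Z J0" unfolding hideal_def J0_def
    by (auto simp: fs_subspace_iff intro: PF_zero)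
  define J1 where "J1 = jadd a b Z J0 (res Z F)"
  define J where "J = jadd a b Z J1 (res Z G)"
  have J1: "hideal a b Z J1" unfolding J1_def by (rule hideal_jadd[OF J0 PF_I[OF F]])
  have J: "hideal a b Z J" unfolding J_def by (rule hideal_jadd[OF J1 PF_I[OF G]])
  have mem: "res Z H \<in> jadd a b Z J' (res Z H) 1" if "hideal a b Z J'" for J' H
  proof -
    have "(\<lambda>p. 0 + res Z H p * res Z (\<lambda>x y. 1) p) \<in> jadd a b Z J' (res Z H) (Suc 0)"
      by (rule jadd_I[OF hideal_zero[OF that] PF_one])
    moreover have "(\<lambda>p. 0 + res Z H p * res Z (\<lambda>x y. 1) p) = res Z H"
      by (rule ext) (simp add: res_def)
    ultimately show ?thesis by simp
  qed
  have FJ: "res Z F \<in> J 1" unfolding J_def by (rule jadd_base) (use mem[OF J0] in \<open>simp add: J1_def\<close>)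
  have GJ: "res Z G \<in> J 1" unfolding J_def by (rule mem[OF J1])
  have "\<not> proper a b Z J"
  proof
    assume "proper a b Z J"
    from nullstellensatz[OF J this] obtain p where p: "p \<in> biproj a b"
      "\<And>m F. biform a b m m F ==> res Z F \<in> J m ==> form_at F p = 0" by blast
    have "p \<in> Z"
    proof (rule ccontr)
      assume "p \<notin> Z"
      from diag_separate[OF Z p(1) this] obtain m H where
        H: "biform a b m m H" "form_at H p \<noteq> 0" "\<forall>q\<in>Z. form_at H q = 0" by blast
      have "res Z H = (\<lambda>_. 0)" by (rule ext) (simp add: res_def H(3))
      hence "res Z H \<in> J m" using hideal_zero[OF J] by simp
      thus False using p(2)[OF H(1)] H(2) by blast
    qed
    from nz[OF this] show False using p(2)[OF F FJ] p(2)[OF G GJ] by blast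
  qed
  then obtain B where B: "J B = PF a b Z B B" unfolding proper_def by blast
  show ?thesis
  proof (intro exI[of _ B] allI impI ballI)
    fix m h assume m: "B \<le> m" and "h \<in> PF a b Z (Suc m) (Suc m)"
    hence "h \<in> J (Suc m)" using hideal_full_mono[OF J B, of "Suc m"] by simp
    then obtain g v where g: "g \<in> J1 (Suc m)" and v: "v = (\<lambda>_. 0) \<or> (\<exists>k. Suc m = Suc k \<and> v \<in> PF a b Z k k)"
      and h: "h = (\<lambda>p. g p + res Z G p * v p)" unfolding J_def by (rule jadd_E)
    from g obtain z u where z: "z \<in> J0 (Suc m)" and u: "u = (\<lambda>_. 0) \<or> (\<exists>k. Suc m = Suc k \<and> u \<in> PF a b Z k k)"
      and g': "g = (\<lambda>p. z p + res Z F p * u p)" unfolding J1_def by (rule jadd_E)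
    have "u \<in> PF a b Z m m" "v \<in> PF a b Z m m" using u v PF_zero by auto
    moreover have "h = (\<lambda>p. res Z F p * u p + res Z G p * v p)" using z unfolding h g' J0_def by simp
    ultimately show "\<exists>u\<in>PF a b Z m m. \<exists>v\<in>PF a b Z m m. h = (\<lambda>p. res Z F p * u p + res Z G p * v p)"
      by blast
  qed
qed

lemma mult_span:
  assumes u: "u \<in> fs.span T" and T: "\<And>t. t \<in> T ==> (\<lambda>p. g p * t p) \<in> fs.span T'"
  shows "(\<lambda>p. g p * u p) \<in> fs.span T'" using u
proof (induction rule: fs.span_induct_alt)
  case base
  have "(\<lambda>_. 0) \<in> fs.span T'" using fs.span_zero by (simp add: zero_fun_def)
  thus ?case by simp
next
  case (step c t v)
  have "(\<lambda>p. c * (g p * t p)) \<in> fs.span T'" by (rule fs.span_scale[OF T[OF step(1)]])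
  from fs.span_add[OF this step(2)]
  have "(\<lambda>p. c * (g p * t p) + g p * v p) \<in> fs.span T'" by (simp add: plus_fun_def)
  moreover have "(\<lambda>p. g p * ((\<lambda>x. c * t x) + v) p) = (\<lambda>p. c * (g p * t p) + g p * v p)"
    by (rule ext) (simp add: algebra_simps)
  ultimately show ?case by simp
qed

text \<open>Iterating \<open>pencil_full\<close> expresses a form of degree \<open>B + n\<close>
  through the \<open>n + 1\<close> monomials in \<open>F\<close> and \<open>G\<close> and a fixed
  finite set \<open>S\<close>, so dimensions grow at most linearly.\<close>

lemma pencil_growth:
  fixes Z :: "'k::alg_closed_field pt set"
  assumes Z: "zclosed a b Z" and F: "biform a b 1 1 F" and G: "biform a b 1 1 G"
    and nz: "\<And>p. p \<in> Z ==> form_at F p \<noteq> 0 \<or> form_at G p \<noteq> 0"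
  shows "\<exists>B S. finite S \<and> (\<forall>n. PF a b Z (B + n) (B + n) \<subseteq>
    fs.span {\<lambda>p. form_at F p ^ i * form_at G p ^ (n - i) * s p | i s. i \<le> n \<and> s \<in> S})"
proof -
  obtain B where B: "\<And>m h. m \<ge> B ==> h \<in> PF a b Z (Suc m) (Suc m) ==>
    \<exists>u\<in>PF a b Z m m. \<exists>v\<in>PF a b Z m m. h = (\<lambda>p. res Z F p * u p + res Z G p * v p)"
    using pencil_full[OF assms] by blast
  obtain S where S: "S \<subseteq> PF a b Z B B" "finite S" "PF a b Z B B \<subseteq> fs.span S"
    using fin_dim_basis[OF PF_fin_dim[of a b Z B B]] by metis
  define T where "T n = {\<lambda>p. form_at F p ^ i * form_at G p ^ (n - i) * s p | i s. i \<le> n \<and> s \<in> S}" for n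
  have TI: "(\<lambda>p. form_at F p ^ i * form_at G p ^ (n - i) * s p) \<in> T n" if "i \<le> n" "s \<in> S" for i n s
    unfolding T_def using that by blast
  have off: "s p = 0" if "s \<in> S" "p \<notin> Z" for s p
  proof -
    obtain H where "s = res Z H" using S(1) \<open>s \<in> S\<close> by (blast elim: PF_E)
    thus ?thesis using that(2) by (simp add: res_def)
  qed
  have main: "PF a b Z (B + n) (B + n) \<subseteq> fs.span (T n)" for n
  proof (induction n)
    case 0
    have "S \<subseteq> T 0"
    proof
      fix s assume "s \<in> S"
      from TI[OF _ this, of 0 0] show "s \<in> T 0" by simp
    qed
    hence "fs.span S \<subseteq> fs.span (T 0)" by (rule fs.span_mono)
    thus ?case using S(3) by simp
  next
    case (Suc n)
    show ?case
    proof
      fix h assume "h \<in> PF a b Z (B + Suc n) (B + Suc n)"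
      hence "h \<in> PF a b Z (Suc (B + n)) (Suc (B + n))" by simp
      from B[OF _ this] obtain u v where uv: "u \<in> PF a b Z (B + n) (B + n)" "v \<in> PF a b Z (B + n) (B + n)"
        "h = (\<lambda>p. res Z F p * u p + res Z G p * v p)" by auto
      have 1: "(\<lambda>p. res Z F p * u p) \<in> fs.span (T (Suc n))"
      proof (rule mult_span[of _ "T n"])
        fix t assume "t \<in> T n"
        then obtain i s where t: "t = (\<lambda>p. form_at F p ^ i * form_at G p ^ (n - i) * s p)" "i \<le> n" "s \<in> S"
          unfolding T_def by blast
        have "(\<lambda>p. res Z F p * t p) = (\<lambda>p. form_at F p ^ Suc i * form_at G p ^ (Suc n - Suc i) * s p)"
          by (rule ext) (simp add: t(1) res_def off[OF t(3)])
        also have "\<dots> \<in> T (Suc n)" by (rule TI) (use t in auto)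
        finally show "(\<lambda>p. res Z F p * t p) \<in> fs.span (T (Suc n))" by (rule fs.span_base)
      qed (use Suc uv in blast)
      have 2: "(\<lambda>p. res Z G p * v p) \<in> fs.span (T (Suc n))"
      proof (rule mult_span[of _ "T n"])
        fix t assume "t \<in> T n"
        then obtain i s where t: "t = (\<lambda>p. form_at F p ^ i * form_at G p ^ (n - i) * s p)" "i \<le> n" "s \<in> S"
          unfolding T_def by blast
        have "(\<lambda>p. res Z G p * t p) = (\<lambda>p. form_at F p ^ i * form_at G p ^ (Suc n - i) * s p)"
          by (rule ext) (use t(2) in \<open>simp add: t(1) res_def off[OF t(3)] Suc_diff_le\<close>)
        also have "\<dots> \<in> T (Suc n)" by (rule TI) (use t in auto)
        finally show "(\<lambda>p. res Z G p * t p) \<in> fs.span (T (Suc n))" by (rule fs.span_base)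
      qed (use Suc uv in blast)
      from fs.span_add[OF 1 2] show "h \<in> fs.span (T (Suc n))" unfolding uv(3) by (simp add: plus_fun_def)
    qed
  qed
  show ?thesis by (intro exI[of _ B] exI[of _ S] conjI S(2) allI main[unfolded T_def])
qed

text \<open>For the degenerate pencil \<open>F\<close>, \<open>F\<close> the dimensions stay at most
  \<open>card S\<close>. So the powers of \<open>G / F\<close> satisfy a polynomial relation on
  \<open>Z\<close>, and the ratio takes its values among finitely many roots.\<close>

lemma form_ratio_finite:
  fixes Z :: "'k::{alg_closed_field} pt set"
  assumes Z: "zclosed a b Z" and F: "biform a b 1 1 F" and G: "biform a b 1 1 G"
    and nz: "\<And>p. p \<in> Z ==> form_at F p \<noteq> 0"
  shows "finite ((\<lambda>p. form_at G p / form_at F p) ` Z)"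
proof -
  obtain B S where BS: "finite S" "\<And>n. PF a b Z (B + n) (B + n) \<subseteq>
    fs.span {\<lambda>p. form_at F p ^ i * form_at F p ^ (n - i) * s p | i s. i \<le> n \<and> s \<in> S}"
    using pencil_growth[OF Z F F] nz by blast
  define n where "n = card S"
  define m where "m = B + n"
  let ?T = "(\<lambda>s p. form_at F p ^ n * s p) ` S"
  have sub: "{\<lambda>p. form_at F p ^ i * form_at F p ^ (n - i) * s p | i s. i \<le> n \<and> s \<in> S} \<subseteq> ?T"
  proof
    fix t assume "t \<in> {\<lambda>p. form_at F p ^ i * form_at F p ^ (n - i) * s p | i s. i \<le> n \<and> s \<in> S}"
    then obtain i s where t: "t = (\<lambda>p. form_at F p ^ i * form_at F p ^ (n - i) * s p)" "i \<le> n" "s \<in> S" by blast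
    have "t = (\<lambda>p. form_at F p ^ n * s p)" unfolding t(1) using t(2) by (simp flip: power_add)
    thus "t \<in> ?T" using t(3) by blast
  qed
  have span: "PF a b Z m m \<subseteq> fs.span ?T"
    using BS(2)[of n] fs.span_mono[OF sub] unfolding m_def by blast
  define g where "g j = res Z (\<lambda>x y. G x y ^ j * F x y ^ (m - j))" for j
  have gP: "g j \<in> PF a b Z m m" if "j \<le> m" for j
  proof -
    have "biform a b (j * 1 + (m - j) * 1) (j * 1 + (m - j) * 1) (\<lambda>x y. G x y ^ j * F x y ^ (m - j))"
      by (intro biform.mult biform_power F G)
    thus ?thesis unfolding g_def using that by (intro PF_I) simp
  qed
  have "\<exists>\<alpha>. (\<exists>i\<in>{..m}. \<alpha> i \<noteq> 0) \<and> (\<forall>x. (\<Sum>i\<in>{..m}. \<alpha> i * g i x) = 0)"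
  proof (rule family_dependent[of ?T])
    show "finite ?T" using BS(1) by simp
    have "card ?T \<le> n" unfolding n_def by (rule card_image_le[OF BS(1)])
    thus "card ?T < card {..m}" by (simp add: m_def)
  qed (use gP span in auto)
  then obtain \<alpha> where \<alpha>: "\<exists>j\<le>m. \<alpha> j \<noteq> 0" "\<And>p. (\<Sum>j\<le>m. \<alpha> j * g j p) = 0" by auto
  define P where "P = (\<Sum>j\<le>m. monom (\<alpha> j) j)"
  have "coeff P j = (if j \<le> m then \<alpha> j else 0)" for j by (simp add: P_def coeff_sum)
  hence "P \<noteq> 0" using \<alpha>(1) by (metis coeff_0)
  hence fin: "finite {x. poly P x = 0}" by (rule poly_roots_finite)
  have "poly P (form_at G p / form_at F p) = 0" if p: "p \<in> Z" for p
  proof -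
    have "form_at F p ^ m * poly P (form_at G p / form_at F p) = (\<Sum>j\<le>m. \<alpha> j * g j p)"
      unfolding P_def poly_sum poly_monom sum_distrib_left
    proof (rule sum.cong)
      fix j assume "j \<in> {..m}"
      hence "form_at F p ^ m = form_at F p ^ j * form_at F p ^ (m - j)" by (simp flip: power_add)
      thus "form_at F p ^ m * (\<alpha> j * (form_at G p / form_at F p) ^ j) = \<alpha> j * g j p"
        using nz[OF p] p by (simp add: g_def res_def field_simps)
    qed simp
    thus ?thesis using \<alpha>(2) nz[OF p] by simp
  qed
  hence "(\<lambda>p. form_at G p / form_at F p) ` Z \<subseteq> {x. poly P x = 0}" by blast
  from finite_subset[OF this fin] show ?thesis .
qed

text \<open>\<open>F + t G\<close> can vanish at a point of either set only if \<open>t\<close> is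
  determined by the ratio of \<open>F\<close> and \<open>G\<close> there;
  \<open>form_ratio_finite\<close> leaves finitely many such \<open>t\<close> in an infinite
  field.\<close>

lemma common_nonvanishing_form:
  fixes Z :: "'k::{alg_closed_field,field_char_0} pt set"
  assumes Z: "zclosed a b Z" "zclosed a b Z'"
    and F: "biform a b 1 1 F" "\<And>p. p \<in> Z ==> form_at F p \<noteq> 0"
    and G: "biform a b 1 1 G" "\<And>p. p \<in> Z' ==> form_at G p \<noteq> 0"
  shows "\<exists>H. biform a b 1 1 H \<and> (\<forall>p\<in>Z \<union> Z'. form_at H p \<noteq> 0)"
proof -
  have fin: "finite ((\<lambda>t. - inverse t) ` (\<lambda>p. form_at G p / form_at F p) ` Z \<union> (\<lambda>t. - t) ` (\<lambda>p. form_at F p / form_at G p) ` Z')"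
    using form_ratio_finite[OF Z(1) F(1) G(1) F(2)] form_ratio_finite[OF Z(2) G(1) F(1) G(2)] by blast
  obtain t where t: "t \<notin> (\<lambda>t. - inverse t) ` (\<lambda>p. form_at G p / form_at F p) ` Z \<union>
     (\<lambda>t. - t) ` (\<lambda>p. form_at F p / form_at G p) ` Z'"
    using ex_new_if_finite[OF _ fin] infinite_UNIV_char_0 by blast
  have "form_at F p + t * form_at G p \<noteq> 0" if "p \<in> Z \<union> Z'" for p
  proof
    assume z: "form_at F p + t * form_at G p = 0"
    show False using that
    proof
      assume p: "p \<in> Z"
      have "form_at G p \<noteq> 0" using z F(2)[OF p] by auto
      hence "t = - inverse (form_at G p / form_at F p)"
        using z F(2)[OF p] by (simp add: field_simps eq_neg_iff_add_eq_0)
      thus False using t p by blast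
    next
      assume p: "p \<in> Z'"
      have "t = - (form_at F p / form_at G p)"
        using z G(2)[OF p] by (simp add: field_simps eq_neg_iff_add_eq_0)
      thus False using t p by blast
    qed
  qed
  thus ?thesis using biform.add[OF F(1) biform_scale[OF G(1), of t]]
    by (intro exI[of _ "\<lambda>x y. F x y + t * G x y"]) simp
qed

text \<open>
  A closed set that meets every hyperplane and is minimal with this property is irreducible and not
  a point.  Minimal ones exist by compactness of chains, so no Noetherian argument is needed.
\<close>

lemma exists_pencil:
  fixes C :: "'k::{alg_closed_field,field_char_0} pt set"
  assumes C: "curve a b C" and F: "biform a b 1 1 F" "\<exists>p\<in>C. form_at F p \<noteq> 0"
  shows "\<exists>G. biform a b 1 1 G \<and> (\<forall>p\<in>C. form_at F p \<noteq> 0 \<or> form_at G p \<noteq> 0)"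
proof (rule ccontr)
  assume no: "\<not> ?thesis"
  have cl: "zclosed a b C" using C by (simp add: curve_def irreducible_closed_def)
  define M where "M Z \<longleftrightarrow> zclosed a b Z \<and> Z \<subseteq> C \<inter> {p \<in> biproj a b. form_at F p = 0} \<and>
     (\<forall>G. biform a b 1 1 G --> (\<exists>p\<in>Z. form_at G p = 0))" for Z
  let ?Z0 = "C \<inter> {p \<in> biproj a b. form_at F p = 0}"
  have M0: "M ?Z0" unfolding M_def
  proof (intro conjI allI impI)
    show "zclosed a b ?Z0" by (rule zclosed_Int[OF cl zclosed_form[OF F(1)]])
    fix G :: "(nat => 'k) => (nat => 'k) => 'k" assume "biform a b 1 1 G"
    with no obtain p where "p \<in> C" "form_at F p = 0" "form_at G p = 0" by blast
    thus "\<exists>p\<in>?Z0. form_at G p = 0" using zclosed_subset[OF cl] by blast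
  qed simp
  \<comment> \<open>Zorn's lemma provides maximal sets, so it is applied to complements.\<close>
  have "\<exists>N\<in>uminus ` Collect M. \<forall>X\<in>uminus ` Collect M. N \<subseteq> X --> X = N"
  proof (rule subset_Zorn_nonempty)
    show "uminus ` Collect M \<noteq> {}" using M0 by blast
    fix \<C> assume ne: "\<C> \<noteq> {}" and ch: "subset.chain (uminus ` Collect M) \<C>"
    define S where "S = uminus ` \<C>"
    have S: "M Z" if "Z \<in> S" for Z using that ch unfolding S_def subset.chain_def by fastforce
    have chS: "Y \<subseteq> Z \<or> Z \<subseteq> Y" if "Y \<in> S" "Z \<in> S" for Y Z
      using that ch unfolding S_def subset.chain_def by blast
    have neS: "S \<noteq> {}" using ne unfolding S_def by blast
    have "M (\<Inter>S)" unfolding M_def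
    proof (intro conjI allI impI)
      show "zclosed a b (\<Inter>S)" by (rule zclosed_Inter[OF _ neS]) (use S in \<open>simp add: M_def\<close>)
      show "\<Inter>S \<subseteq> ?Z0" using neS S unfolding M_def by blast
      fix G :: "(nat => 'k) => (nat => 'k) => 'k" assume G: "biform a b 1 1 G"
      let ?W = "{p \<in> biproj a b. form_at G p = 0}"
      have "\<Inter>((\<lambda>Z. Z \<inter> ?W) ` S) \<noteq> {}"
      proof (rule chain_Inter_nonempty[of _ a b])
        show "(\<lambda>Z. Z \<inter> ?W) ` S \<noteq> {}" using neS by blast
        fix Z assume "Z \<in> (\<lambda>Z. Z \<inter> ?W) ` S"
        then obtain Y where Y: "Y \<in> S" "Z = Y \<inter> ?W" by blast
        have MY: "zclosed a b Y" "\<exists>p\<in>Y. form_at G p = 0" using S[OF Y(1)] G unfolding M_def by blast+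
        show "zclosed a b Z" unfolding Y(2) by (rule zclosed_Int[OF MY(1) zclosed_form[OF G]])
        show "Z \<noteq> {}" using MY zclosed_subset[OF MY(1)] unfolding Y(2) by blast
      next
        fix Y Z assume "Y \<in> (\<lambda>Z. Z \<inter> ?W) ` S" "Z \<in> (\<lambda>Z. Z \<inter> ?W) ` S"
        then obtain Y' Z' where "Y' \<in> S" "Y = Y' \<inter> ?W" "Z' \<in> S" "Z = Z' \<inter> ?W" by blast
        thus "Y \<subseteq> Z \<or> Z \<subseteq> Y" using chS[of Y' Z'] by blast
      qed
      thus "\<exists>p\<in>\<Inter>S. form_at G p = 0" using neS by blast
    qed
    moreover have "\<Union>\<C> = - \<Inter>S" unfolding S_def by auto
    ultimately show "\<Union>\<C> \<in> uminus ` Collect M" by blast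
  qed
  then obtain Z where Z: "M Z" "\<And>Y. M Y ==> Y \<subseteq> Z ==> Y = Z" by fastforce
  have Zcl: "zclosed a b Z" and ZC: "Z \<subseteq> ?Z0" using Z(1) unfolding M_def by blast+
  have Zm: "\<exists>p\<in>Z. form_at G p = 0" if "biform a b 1 1 G" for G using Z(1) that unfolding M_def by blast
  have Zne: "Z \<noteq> {}" using Zm[OF biform_zero] by blast
  have "irreducible_closed a b Z" unfolding irreducible_closed_def
  proof (intro conjI allI impI)
    show "zclosed a b Z" "Z \<noteq> {}" by fact+
    fix Z1 Z2 assume Z12: "zclosed a b Z1" "zclosed a b Z2" "Z = Z1 \<union> Z2"
    show "Z = Z1 \<or> Z = Z2"
    proof (rule ccontr)
      assume ne: "\<not> ?thesis"
      have "\<not> M Z1" using Z(2)[of Z1] Z12(3) ne by blast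
      then obtain G1 where G1: "biform a b 1 1 G1" "\<And>p. p \<in> Z1 ==> form_at G1 p \<noteq> 0"
        using Z12 ZC unfolding M_def by blast
      have "\<not> M Z2" using Z(2)[of Z2] Z12(3) ne by blast
      then obtain G2 where G2: "biform a b 1 1 G2" "\<And>p. p \<in> Z2 ==> form_at G2 p \<noteq> 0"
        using Z12 ZC unfolding M_def by blast
      obtain H where "biform a b 1 1 H" "\<forall>p\<in>Z1 \<union> Z2. form_at H p \<noteq> 0"
        using common_nonvanishing_form[OF Z12(1,2) G1 G2] by blast
      thus False using Zm[of H] Z12(3) by blast
    qed
  qed
  \<comment> \<open>A proper irreducible closed subset of a curve is a point, and some form of
    bidegree (1, 1) does not vanish there; this contradicts that every such form has a zero on
    \<open>Z\<close>.\<close>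
  moreover have "Z \<subset> C" using ZC F(2) by blast
  ultimately obtain p where p: "Z = {p}" using C unfolding curve_def by blast
  have "p \<in> biproj a b" using p ZC by blast
  from ex_form_nonzero_at[OF this, of 1 1] obtain G where "biform a b 1 1 G" "form_at G p \<noteq> 0" by blast
  thus False using Zm[of G] p by blast
qed

section \<open>Hilbert polynomials of curves\<close>

text \<open>The hypothesis \<open>pullback\<close> says that \<open>T\<close> is injective from
  \<open>W\<close> modulo \<open>U\<close> to functions modulo \<open>U'\<close>; in particular
  distinct elements of \<open>Q\<close> keep distinct images.\<close>

lemma indep_mod_image:
  assumes U: "fs.subspace U" and U': "fs.subspace U'" and W: "fs.subspace W" "Q \<subseteq> W" and T: "lin_on W T"
    and pullback: "\<And>s. s \<in> W ==> T s \<in> U' ==> s \<in> U" and Q: "indep_mod U Q"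
  shows "indep_mod U' (T ` Q)" "card (T ` Q) = card Q"
proof -
  have fin: "finite Q" using Q by (simp add: indep_mod_def)
  have QD: "\<forall>q\<in>Q. c q = 0" if "(\<lambda>x. \<Sum>q\<in>Q. c q * q x) \<in> U" for c
    using Q that unfolding indep_mod_def by blast
  have main: "\<forall>q\<in>Q. c q = 0" if c: "(\<lambda>x. \<Sum>q\<in>Q. c q * T q x) \<in> U'" for c
  proof (rule QD, rule pullback)
    show "(\<lambda>x. \<Sum>q\<in>Q. c q * q x) \<in> W" by (rule fs_subspace_sum[OF W(1)]) (use W(2) in blast)
    have "T (\<lambda>x. \<Sum>q\<in>Q. c q * q x) = (\<lambda>x. \<Sum>q\<in>Q. c q * T q x)"
      by (rule lin_on_sum[OF T W(1) fin]) (use W(2) in blast)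
    thus "T (\<lambda>x. \<Sum>q\<in>Q. c q * q x) \<in> U'" using c by simp
  qed
  have inj: "inj_on T Q"
  proof (rule inj_onI, rule ccontr)
    fix p q assume pq: "p \<in> Q" "q \<in> Q" "T p = T q" "p \<noteq> q"
    let ?c = "\<lambda>r. (if r = p then 1 else 0) - (if r = q then 1 else 0)"
    have "(\<Sum>r\<in>Q. ?c r * T r x) = 0" for x
    proof -
      have "(\<Sum>r\<in>Q. ?c r * T r x) = (\<Sum>r\<in>Q. (if r = p then T p x else 0) - (if r = q then T q x else 0))"
        by (rule sum.cong) auto
      thus ?thesis using pq fin by (simp add: sum_subtractf)
    qed
    hence "(\<lambda>x. \<Sum>r\<in>Q. ?c r * T r x) \<in> U'" using U' by (simp add: fs_subspace_iff)
    from bspec[OF main[OF this] pq(1)] pq(4) show False by simp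
  qed
  show "card (T ` Q) = card Q" by (rule card_image[OF inj])
  show "indep_mod U' (T ` Q)" unfolding indep_mod_def
  proof (intro conjI allI impI ballI)
    show "finite (T ` Q)" using fin by simp
    fix c r assume c: "(\<lambda>x. \<Sum>q\<in>T ` Q. c q * q x) \<in> U'" and r: "r \<in> T ` Q"
    have "(\<lambda>x. \<Sum>q\<in>T ` Q. c q * q x) = (\<lambda>x. \<Sum>q\<in>Q. c (T q) * T q x)"
      by (rule ext) (simp add: sum.reindex[OF inj])
    with c have "(\<lambda>x. \<Sum>q\<in>Q. c (T q) * T q x) \<in> U'" by simp
    from main[OF this] r show "c r = 0" by blast
  qed
qed

lemma indep_mod_antimono: "indep_mod U Q ==> U' \<subseteq> U ==> indep_mod U' Q"
  unfolding indep_mod_def by (meson subsetD)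

lemma dim_zero_space: "fs.dim {\<lambda>_::'a. 0 :: 'k::field} = 0"
proof -
  have "fs.dim {\<lambda>_::'a. 0 :: 'k} \<le> card ({} :: ('a => 'k) set)"
    by (rule fs.dim_le_card) (auto simp: zero_fun_def)
  thus ?thesis by simp
qed

lemma lin_on_subspace_image:
  assumes T: "lin_on A T" and A: "fs.subspace A"
  shows "fs.subspace (T ` A)" unfolding fs_subspace_iff
proof (intro conjI ballI allI)
  have "T (\<lambda>x. \<Sum>i\<in>{}. undefined i * undefined i x) = (\<lambda>_. 0)"
    using lin_on_sum[OF T A, of "{}"] by simp
  hence "T (\<lambda>_. 0) = (\<lambda>_. 0)" by simp
  moreover have "(\<lambda>_. 0) \<in> A" using A by (simp add: fs_subspace_iff)
  ultimately show "(\<lambda>_. 0) \<in> T ` A" by (metis imageI)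
next
  fix f g assume "f \<in> T ` A" "g \<in> T ` A"
  then obtain u v where uv: "u \<in> A" "v \<in> A" "f = T u" "g = T v" by blast
  have "T (\<lambda>x. u x + v x) = (\<lambda>x. f x + g x)" unfolding uv(3,4) by (rule lin_on_add[OF T uv(1,2)])
  moreover have "(\<lambda>x. u x + v x) \<in> A" using A uv by (simp add: fs_subspace_iff)
  ultimately show "(\<lambda>x. f x + g x) \<in> T ` A" by (metis imageI)
next
  fix c f assume "f \<in> T ` A"
  then obtain u where u: "u \<in> A" "f = T u" by blast
  have "T (\<lambda>x. c * u x) = (\<lambda>x. c * f x)" unfolding u(2) by (rule lin_on_scale[OF T u(1)])
  moreover have "(\<lambda>x. c * u x) \<in> A" using A u by (simp add: fs_subspace_iff)
  ultimately show "(\<lambda>x. c * f x) \<in> T ` A" by (metis imageI)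
qed

abbreviation fmul :: "((nat => 'k::field) => (nat => 'k) => 'k) => ('k pt => 'k) => 'k pt => 'k" where
  "fmul F f \<equiv> (\<lambda>p. form_at F p * f p)"

text \<open>What the dimension counts use of a curve: irreducibility, more than one point, and a
  pencil without base points. The minimality in the definition of a curve is spent on constructing
  \<open>G\<close>.\<close>

locale curve_pencil =
  fixes a b :: nat and C :: "'k::{alg_closed_field,field_char_0} pt set"
    and F G :: "(nat => 'k) => (nat => 'k) => 'k"
  assumes irr: "irreducible_closed a b C" and no_point: "\<nexists>p. C = {p}"
    and F: "biform a b 1 1 F" and G: "biform a b 1 1 G"
    and no_common_zero: "\<And>p. p \<in> C ==> form_at F p \<noteq> 0 \<or> form_at G p \<noteq> 0"
    and F_nonzero: "\<exists>p\<in>C. form_at F p \<noteq> 0"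
begin

lemma closed: "zclosed a b C" and nonempty: "C \<noteq> {}"
  using irr by (simp_all add: irreducible_closed_def)

lemma sub: "C \<subseteq> biproj a b" using zclosed_subset[OF closed] .

lemma V_off: "f \<in> V a b C d e ==> p \<notin> C ==> f p = 0" unfolding V_def by blast

lemma fmul_inj:
  assumes H: "biform a b d' e' H" "\<exists>p\<in>C. form_at H p \<noteq> 0" and f: "f \<in> V a b C d e"
    and z: "fmul H f = (\<lambda>_. 0)"
  shows "f = (\<lambda>_. 0)" by (rule irreducible_V_mult[OF irr H f]) (use fun_cong[OF z] in simp)

lemma fmul_V_subspace: "fs.subspace (fmul H ` V a b C d e)"
  by (rule lin_on_subspace_image[OF lin_on_mult V_subspace[OF sub]])

text \<open>\<open>s / F\<close> and \<open>t / G\<close> agree where both make sense, and their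
  domains cover \<open>C\<close> as \<open>F\<close> and \<open>G\<close> have no common zero; the
  glued function is a section.\<close>

lemma koszul:
  assumes s: "s \<in> V a b C (d + 1) (e + 1)" and t: "t \<in> V a b C (d + 1) (e + 1)"
    and eq: "fmul G s = fmul F t"
  shows "s \<in> fmul F ` V a b C d e"
proof -
  define u where "u p = (if p \<notin> C then 0 else if form_at F p \<noteq> 0 then s p / form_at F p
     else t p / form_at G p)" for p
  have eq': "form_at G p * s p = form_at F p * t p" for p using fun_cong[OF eq] by simp
  have Fu: "form_at F p * u p = s p" if "p \<in> C" for p
    using eq'[of p] no_common_zero[OF that] that by (auto simp: u_def)
  have Gu: "form_at G p * u p = t p" if "p \<in> C" for p
    using eq'[of p] no_common_zero[OF that] that by (auto simp: u_def field_simps)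
  have key: "\<exists>A B d1 e1 d2 e2. tw_at a b C d e u p A B d1 e1 d2 e2"
    if p: "p \<in> C" and H: "biform a b 1 1 H" "form_at H p \<noteq> 0" and r: "r \<in> V a b C (d + 1) (e + 1)"
      and Hu: "\<And>q. q \<in> C ==> form_at H q * u q = r q" for p H r
  proof -
    have "tw a b C (d + 1) (e + 1) r" using r by (simp add: V_def)
    from twD[OF this p] obtain A B d1 e1 d2 e2 where "tw_at a b C (d + 1) (e + 1) r p A B d1 e1 d2 e2" by blast
    note A = tw_atD[OF this]
    show ?thesis unfolding tw_at_def
    proof (intro exI conjI ballI)
      show "biform a b d1 e1 A" by (rule A(1))
      show "biform a b (d2 + 1) (e2 + 1) (\<lambda>x y. B x y * H x y)" by (rule biform.mult[OF A(2) H(1)])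
      show "form_at (\<lambda>x y. B x y * H x y) p \<noteq> 0" using A(5) H(2) by simp
      fix q assume "q \<in> C"
      thus "form_at (\<lambda>x y. B x y * H x y) q * u q = form_at A q"
        using A(6) Hu[of q] by (simp add: mult.assoc)
    qed (use A(3,4) in auto)
  qed
  have "tw a b C d e u"
  proof (rule twI)
    fix p assume p: "p \<in> C"
    show "\<exists>A B d1 e1 d2 e2. tw_at a b C d e u p A B d1 e1 d2 e2"
    proof (cases "form_at F p = 0")
      case False
      show ?thesis by (rule key[OF p F False s Fu])
    next
      case True
      hence Gp: "form_at G p \<noteq> 0" using no_common_zero[OF p] by blast
      show ?thesis by (rule key[OF p G Gp t Gu])
    qed
  qed
  hence "u \<in> V a b C d e" by (simp add: V_def u_def)
  moreover have "s = fmul F u"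
  proof
    fix p show "s p = form_at F p * u p"
      using Fu[of p] V_off[OF s, of p] by (cases "p \<in> C") (auto simp: u_def)
  qed
  ultimately show ?thesis by blast
qed

text \<open>By \<open>koszul\<close>, multiplication by \<open>G\<close> is injective from the
  cokernel of \<open>F\<close> into the next cokernel. This makes the increments of the dimension
  nondecreasing.\<close>

lemma indep_step:
  assumes Q: "Q \<subseteq> V a b C (d + 1) (e + 1)" "indep_mod (fmul F ` V a b C d e) Q"
  shows "fmul G ` Q \<subseteq> V a b C (d + 1 + 1) (e + 1 + 1)"
    "indep_mod (fmul F ` V a b C (d + 1) (e + 1)) (fmul G ` Q)" "card (fmul G ` Q) = card Q"
proof -
  show "fmul G ` Q \<subseteq> V a b C (d + 1 + 1) (e + 1 + 1)"
  proof
    fix g assume "g \<in> fmul G ` Q"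
    then obtain f where f: "f \<in> V a b C (d + 1) (e + 1)" "g = fmul G f" using Q(1) by blast
    show "g \<in> V a b C (d + 1 + 1) (e + 1 + 1)" unfolding f(2) by (rule V_mult_form[OF f(1) G]) auto
  qed
  have pullback: "s \<in> fmul F ` V a b C d e"
    if s: "s \<in> V a b C (d + 1) (e + 1)" "fmul G s \<in> fmul F ` V a b C (d + 1) (e + 1)" for s
  proof -
    obtain t where t: "t \<in> V a b C (d + 1) (e + 1)" "fmul G s = fmul F t" using s(2) by blast
    show ?thesis by (rule koszul[OF s(1) t])
  qed
  note * = indep_mod_image[OF fmul_V_subspace fmul_V_subspace V_subspace[OF sub] Q(1) lin_on_mult pullback Q(2)]
  show "indep_mod (fmul F ` V a b C (d + 1) (e + 1)) (fmul G ` Q)" by (rule *(1))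
  show "card (fmul G ` Q) = card Q" by (rule *(2))
qed

text \<open>At each level \<open>l\<close> the elements \<open>G ^ l q\<close> are independent
  modulo multiples of \<open>F\<close>. Peeling off powers of \<open>F\<close> therefore gives
  \<open>l + 1\<close> layers of \<open>card Q\<close> independent elements.\<close>

lemma indep_chain:
  assumes Q: "Q \<subseteq> V a b C (d + 1) (e + 1)" "indep_mod (fmul F ` V a b C d e) Q"
  defines "T \<equiv> \<lambda>l. {\<lambda>p. form_at F p ^ i * form_at G p ^ (l - i) * q p | i q. i \<le> l \<and> q \<in> Q}"
  shows "fs.span (T l) \<subseteq> V a b C (d + int l + 1) (e + int l + 1) \<and> fin_dim (fs.span (T l)) \<and>
     Suc l * card Q \<le> fs.dim (fs.span (T l))"
proof -
  have TI: "(\<lambda>p. form_at F p ^ i * form_at G p ^ (l - i) * q p) \<in> T l" if "i \<le> l" "q \<in> Q" for i l q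
    unfolding T_def using that by blast
  define GQ where "GQ l = (\<lambda>q p. form_at G p ^ l * q p) ` Q" for l :: nat
  have GQ_Suc: "GQ (Suc l) = fmul G ` GQ l" for l
    unfolding GQ_def by (simp add: image_image mult.assoc)
  have GQ: "GQ l \<subseteq> V a b C (d + int l + 1) (e + int l + 1) \<and>
      indep_mod (fmul F ` V a b C (d + int l) (e + int l)) (GQ l) \<and> card (GQ l) = card Q" for l
  proof (induction l)
    case 0
    show ?case using Q by (simp add: GQ_def)
  next
    case (Suc l)
    note * = indep_step[of "GQ l" "d + int l" "e + int l"]
    have eq: "d + int (Suc l) = d + int l + 1" "e + int (Suc l) = e + int l + 1" by auto
    show ?case unfolding GQ_Suc eq using * Suc by auto
  qed
  have finQ: "finite Q" using Q(2) by (simp add: indep_mod_def)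
  have finT: "finite (T l)" for l
  proof -
    have "T l = (\<lambda>(i, q) p. form_at F p ^ i * form_at G p ^ (l - i) * q p) ` ({..l} \<times> Q)"
      unfolding T_def by auto
    thus ?thesis using finQ by simp
  qed
  have GQT: "GQ l \<subseteq> T l" for l
  proof
    fix g assume "g \<in> GQ l"
    then obtain q where q: "q \<in> Q" "g = (\<lambda>p. form_at G p ^ l * q p)" unfolding GQ_def by blast
    from TI[OF _ q(1), of 0 l] show "g \<in> T l" unfolding q(2) by simp
  qed
  have fd: "fin_dim (fs.span (T l))" for l unfolding fin_dim_def using finT by blast
  have TV: "T l \<subseteq> V a b C (d + int l + 1) (e + int l + 1)" for l
  proof
    fix t assume "t \<in> T l"
    then obtain i q where t: "t = (\<lambda>p. form_at F p ^ i * form_at G p ^ (l - i) * q p)" "i \<le> l" "q \<in> Q"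
      unfolding T_def by blast
    have B: "biform a b (i * 1 + (l - i) * 1) (i * 1 + (l - i) * 1) (\<lambda>x y. F x y ^ i * G x y ^ (l - i))"
      by (intro biform.mult biform_power F G)
    have "fmul (\<lambda>x y. F x y ^ i * G x y ^ (l - i)) q \<in> V a b C (d + int l + 1) (e + int l + 1)"
      by (rule V_mult_form[OF _ B]) (use t Q(1) in auto)
    thus "t \<in> V a b C (d + int l + 1) (e + int l + 1)" unfolding t(1) by simp
  qed
  have AV: "fs.span (T l) \<subseteq> V a b C (d + int l + 1) (e + int l + 1)" for l
    by (rule fs.span_minimal[OF TV V_subspace[OF sub]])
  have "Suc l * card Q \<le> fs.dim (fs.span (T l))"
  proof (induction l)
    case 0
    have "fs.dim {\<lambda>_::'k pt. 0 :: 'k} + card (GQ 0) \<le> fs.dim (fs.span (T 0))"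
    proof (rule indep_mod_dim_le)
      show "fs.subspace {\<lambda>_::'k pt. 0 :: 'k}" by (simp add: fs_subspace_iff)
      show "{\<lambda>_. 0} \<subseteq> fs.span (T 0)" using fs.span_zero[of "T 0"] by (simp add: zero_fun_def)
      show "GQ 0 \<subseteq> fs.span (T 0)" using GQT fs.span_superset by blast
      have "(\<lambda>_. 0) \<in> fmul F ` V a b C (d + int 0) (e + int 0)"
        using fmul_V_subspace[of F "d + int 0" "e + int 0"] by (simp add: fs_subspace_iff)
      thus "indep_mod {\<lambda>_. 0} (GQ 0)" using GQ[of 0] by (auto intro: indep_mod_antimono)
    qed (rule fd)
    thus ?case using GQ[of 0] by (simp add: dim_zero_space)
  next
    case (Suc l)
    let ?U = "fmul F ` fs.span (T l)"
    have FT: "?U \<subseteq> fs.span (T (Suc l))"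
    proof
      fix g assume "g \<in> ?U"
      then obtain u where u: "u \<in> fs.span (T l)" "g = fmul F u" by blast
      show "g \<in> fs.span (T (Suc l))" unfolding u(2)
      proof (rule mult_span[OF u(1)])
        fix t assume "t \<in> T l"
        then obtain i q where t: "t = (\<lambda>p. form_at F p ^ i * form_at G p ^ (l - i) * q p)" "i \<le> l" "q \<in> Q"
          unfolding T_def by blast
        have "(\<lambda>p. form_at F p * t p) = (\<lambda>p. form_at F p ^ Suc i * form_at G p ^ (Suc l - Suc i) * q p)"
          by (rule ext) (simp add: t(1))
        also have "\<dots> \<in> T (Suc l)" by (rule TI) (use t in auto)
        finally show "(\<lambda>p. form_at F p * t p) \<in> fs.span (T (Suc l))" by (rule fs.span_base)
      qed
    qed
    have dimU: "fs.dim ?U = fs.dim (fs.span (T l))"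
    proof (rule lin_on_dim(2)[OF lin_on_mult fs.subspace_span _ fd])
      fix f assume "f \<in> fs.span (T l)" and z: "fmul F f = (\<lambda>_. 0)"
      hence "f \<in> V a b C (d + int l + 1) (e + int l + 1)" using AV by blast
      from fmul_inj[OF F F_nonzero this z] show "f = (\<lambda>_. 0)" .
    qed
    have "fs.dim ?U + card (GQ (Suc l)) \<le> fs.dim (fs.span (T (Suc l)))"
    proof (rule indep_mod_dim_le[OF _ FT fd])
      show "fs.subspace ?U" by (rule lin_on_subspace_image[OF lin_on_mult fs.subspace_span])
      show "GQ (Suc l) \<subseteq> fs.span (T (Suc l))" using GQT fs.span_superset by blast
      have "?U \<subseteq> fmul F ` V a b C (d + int (Suc l)) (e + int (Suc l))"
        using AV[of l] by (intro image_mono) (simp add: algebra_simps)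
      thus "indep_mod ?U (GQ (Suc l))" using GQ[of "Suc l"] by (blast intro: indep_mod_antimono)
    qed
    thus ?case using Suc GQ[of "Suc l"] dimU by simp
  qed
  thus ?thesis using AV fd by blast
qed

lemma nonzero_form: "\<exists>H. biform a b d e H \<and> (\<exists>p\<in>C. form_at H p \<noteq> 0)"
  using nonempty sub ex_form_nonzero_at by blast

lemma nonzero_mult:
  assumes "biform a b d e H" "\<exists>p\<in>C. form_at H p \<noteq> 0" "biform a b d' e' H'" "\<exists>p\<in>C. form_at H' p \<noteq> 0"
  shows "\<exists>p\<in>C. form_at (\<lambda>x y. H x y * H' x y) p \<noteq> 0"
  using irreducible_mult[OF irr assms(1,3)] assms(2,4) by auto

lemma nonzero_power:
  assumes "biform a b d e H" "\<exists>p\<in>C. form_at H p \<noteq> 0"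
  shows "\<exists>p\<in>C. form_at (\<lambda>x y. H x y ^ m) p \<noteq> 0" using assms(2) by auto

text \<open>\<open>serre\<close> turns each section into a form after multiplication by a power of
  \<open>F\<close>; a form of the transposed bidegree then makes the results diagonal.\<close>

lemma common_denominator:
  assumes Q: "finite Q" "Q \<subseteq> V a b C d e"
  shows "\<exists>N k l H. biform a b k l H \<and> (\<exists>p\<in>C. form_at H p \<noteq> 0) \<and> (\<forall>q\<in>Q. fmul H q \<in> PF a b C N N)"
proof -
  have "\<forall>\<^sub>F m in sequentially. \<forall>q\<in>Q. 0 \<le> int m + d \<and> 0 \<le> int m + e \<and> (\<forall>H. biform a b m m H -->
    (\<exists>K. biform a b (nat (int m + d)) (nat (int m + e)) K \<and> (\<forall>p\<in>C. form_at H p * q p = form_at K p)))"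
  proof (rule eventually_ball_finite[OF Q(1)], rule ballI)
    fix q assume "q \<in> Q"
    hence "tw a b C d e q" using Q(2) unfolding V_def by blast
    from serre[OF closed this] show "\<forall>\<^sub>F m in sequentially. 0 \<le> int m + d \<and> 0 \<le> int m + e \<and>
      (\<forall>H. biform a b m m H --> (\<exists>K. biform a b (nat (int m + d)) (nat (int m + e)) K \<and>
      (\<forall>p\<in>C. form_at H p * q p = form_at K p)))" unfolding eventually_sequentially .
  qed
  then obtain M where M: "\<And>q H. q \<in> Q ==> biform a b M M H ==>
    \<exists>K. biform a b (nat (int M + d)) (nat (int M + e)) K \<and> (\<forall>p\<in>C. form_at H p * q p = form_at K p)"
    unfolding eventually_sequentially by (meson order_refl)
  define d1 e1 where "d1 = nat (int M + d)" and "e1 = nat (int M + e)"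
  obtain H where H: "biform a b e1 d1 H" "\<exists>p\<in>C. form_at H p \<noteq> 0" using nonzero_form by blast
  have FM: "biform a b M M (\<lambda>x y. F x y ^ M)" using biform_power[OF F, of M] by simp
  show ?thesis
  proof (intro exI conjI ballI)
    show "biform a b (e1 + M) (d1 + M) (\<lambda>x y. H x y * F x y ^ M)" by (rule biform.mult[OF H(1) FM])
    show "\<exists>p\<in>C. form_at (\<lambda>x y. H x y * F x y ^ M) p \<noteq> 0"
      by (rule nonzero_mult[OF H FM nonzero_power[OF F F_nonzero]])
    fix q assume q: "q \<in> Q"
    from M[OF q FM] obtain K where K: "biform a b d1 e1 K"
      "\<forall>p\<in>C. form_at (\<lambda>x y. F x y ^ M) p * q p = form_at K p" unfolding d1_def e1_def by blast
    have "biform a b (d1 + e1) (d1 + e1) (\<lambda>x y. H x y * K x y)"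
      using biform.mult[OF H(1) K(1)] by (simp add: ac_simps)
    from PF_I[OF this] have "res C (\<lambda>x y. H x y * K x y) \<in> PF a b C (d1 + e1) (d1 + e1)" .
    moreover have "res C (\<lambda>x y. H x y * K x y) = fmul (\<lambda>x y. H x y * F x y ^ M) q"
    proof
      fix p
      have "q p = 0" if "p \<notin> C" using V_off[OF subsetD[OF Q(2) q] that] .
      thus "res C (\<lambda>x y. H x y * K x y) p = form_at (\<lambda>x y. H x y * F x y ^ M) p * q p"
        using K(2) by (cases "p \<in> C") (auto simp: res_def mult.assoc)
    qed
    ultimately show "fmul (\<lambda>x y. H x y * F x y ^ M) q \<in> PF a b C (d1 + e1) (d1 + e1)" by simp
  qed
qed

text \<open>\<open>indep_chain\<close> produces at least \<open>(n + 1) * card Q\<close> independent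
  sections, which a fixed multiplier \<open>H\<close> embeds into the forms of degree
  \<open>N + n\<close>. Their dimension grows at most like \<open>n * card S\<close> by
  \<open>pencil_growth\<close>, so \<open>card Q \<le> card S\<close>, and \<open>S\<close> depends
  on neither \<open>d\<close> nor \<open>e\<close>.\<close>

lemma increment_bound:
  "\<exists>K. \<forall>d e Q. Q \<subseteq> V a b C (d + 1) (e + 1) --> indep_mod (fmul F ` V a b C d e) Q --> card Q \<le> K"
proof -
  obtain B S where BS: "finite S" "\<And>n. PF a b C (B + n) (B + n) \<subseteq>
    fs.span {\<lambda>p. form_at F p ^ i * form_at G p ^ (n - i) * s p | i s. i \<le> n \<and> s \<in> S}"
    using pencil_growth[OF closed F G no_common_zero] by blast
  have growth: "fs.dim (PF a b C (B + n) (B + n)) \<le> Suc n * card S" for n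
  proof -
    let ?T = "{\<lambda>p. form_at F p ^ i * form_at G p ^ (n - i) * s p | i s. i \<le> n \<and> s \<in> S}"
    have T: "?T = (\<lambda>(i, s) p. form_at F p ^ i * form_at G p ^ (n - i) * s p) ` ({..n} \<times> S)" by auto
    have "fs.dim (PF a b C (B + n) (B + n)) \<le> card ?T"
      by (rule fs.dim_le_card[OF BS(2)]) (unfold T, use BS(1) in simp)
    also have "\<dots> \<le> card ({..n} \<times> S)" unfolding T by (rule card_image_le) (use BS(1) in simp)
    finally show ?thesis by (simp add: card_cartesian_product)
  qed
  show ?thesis
  proof (intro exI[of _ "card S"] allI impI)
    fix d e Q assume Q: "Q \<subseteq> V a b C (d + 1) (e + 1)" "indep_mod (fmul F ` V a b C d e) Q"
    have finQ: "finite Q" using Q(2) by (simp add: indep_mod_def)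
    obtain N k l H where H: "biform a b k l H" "\<exists>p\<in>C. form_at H p \<noteq> 0"
      "\<forall>q\<in>Q. fmul H q \<in> PF a b C N N" using common_denominator[OF finQ Q(1)] by blast
    \<comment> \<open>\<open>N * card S \<le> n\<close> absorbs the offset in the final comparison,
      and \<open>B \<le> n\<close> makes the growth bound applicable to degree
      \<open>N + n\<close>.\<close>
    define n where "n = B + N * card S"
    let ?T = "{\<lambda>p. form_at F p ^ i * form_at G p ^ (n - i) * q p | i q. i \<le> n \<and> q \<in> Q}"
    note chain = indep_chain[OF Q, of n]
    have sub: "fmul H ` fs.span ?T \<subseteq> PF a b C (N + n) (N + n)"
    proof
      fix g assume "g \<in> fmul H ` fs.span ?T"
      then obtain u where u: "u \<in> fs.span ?T" "g = fmul H u" by blast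
      have "g \<in> fs.span (PF a b C (N + n) (N + n))" unfolding u(2)
      proof (rule mult_span[OF u(1)], rule fs.span_base)
        fix t assume "t \<in> ?T"
        then obtain i q where t: "t = (\<lambda>p. form_at F p ^ i * form_at G p ^ (n - i) * q p)" "i \<le> n" "q \<in> Q"
          by blast
        have Bf: "biform a b (i * 1 + (n - i) * 1) (i * 1 + (n - i) * 1) (\<lambda>x y. F x y ^ i * G x y ^ (n - i))"
          by (intro biform.mult biform_power F G)
        have "(\<lambda>p. fmul H q p * res C (\<lambda>x y. F x y ^ i * G x y ^ (n - i)) p) \<in>
            PF a b C (N + (i * 1 + (n - i) * 1)) (N + (i * 1 + (n - i) * 1))"
          by (rule PF_mult[OF _ PF_I[OF Bf]]) (use H(3) t(3) in blast)
        moreover have "(\<lambda>p. fmul H q p * res C (\<lambda>x y. F x y ^ i * G x y ^ (n - i)) p) = fmul H t"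
        proof
          fix p
          have "q p = 0" if "p \<notin> C" using V_off[OF subsetD[OF Q(1) t(3)] that] .
          thus "fmul H q p * res C (\<lambda>x y. F x y ^ i * G x y ^ (n - i)) p = fmul H t p"
            by (simp add: t(1) res_def)
        qed
        ultimately show "fmul H t \<in> PF a b C (N + n) (N + n)" using t(2) by simp
      qed
      thus "g \<in> PF a b C (N + n) (N + n)" using fs.span_eq_iff PF_subspace by blast
    qed
    have "fs.dim (fmul H ` fs.span ?T) = fs.dim (fs.span ?T)"
    proof (rule lin_on_dim(2)[OF lin_on_mult fs.subspace_span])
      fix f assume "f \<in> fs.span ?T" and z: "fmul H f = (\<lambda>_. 0)"
      hence "f \<in> V a b C (d + int n + 1) (e + int n + 1)" using chain by blast
      from fmul_inj[OF H(1,2) this z] show "f = (\<lambda>_. 0)" .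
    qed (use chain in blast)
    moreover have "fs.dim (fmul H ` fs.span ?T) \<le> fs.dim (PF a b C (N + n) (N + n))"
      by (rule fin_dim_dim_mono[OF PF_fin_dim sub])
    moreover have "fs.dim (PF a b C (N + n) (N + n)) \<le> Suc (N + n - B) * card S"
    proof -
      have "B + (N + n - B) = N + n" by (simp add: n_def)
      with growth[of "N + n - B"] show ?thesis by simp
    qed
    ultimately have le: "Suc n * card Q \<le> Suc (N + n - B) * card S" using chain by linarith
    show "card Q \<le> card S"
    proof (rule ccontr)
      assume "\<not> card Q \<le> card S"
      hence "Suc (card S) \<le> card Q" by simp
      hence "Suc n * Suc (card S) \<le> Suc n * card Q" by (rule mult_le_mono2)
      also have "\<dots> \<le> Suc (N + n) * card S" using le mult_le_mono1[of "Suc (N + n - B)" "Suc (N + n)" "card S"]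
        by linarith
      also have "\<dots> = Suc n * card S + N * card S" by (simp add: algebra_simps)
      also have "\<dots> \<le> Suc n * card S + n" by (simp add: n_def)
      finally show False by simp
    qed
  qed
qed

end

section \<open>Eventually linear Hilbert functions\<close>

lemma affine_sandwich:
  fixes \<alpha> \<beta> \<alpha>' \<beta>' :: real and N :: nat
  assumes "\<And>m. m \<ge> N ==> \<alpha> * real m + \<beta> \<le> \<alpha>' * real m + \<beta>' \<and> \<alpha>' * real m + \<beta>' \<le> \<alpha> * (real m + 1) + \<beta>"
  shows "\<alpha> = \<alpha>'"
proof (rule ccontr)
  assume "\<alpha> \<noteq> \<alpha>'"
  then consider "\<alpha>' - \<alpha> > 0" | "\<alpha> - \<alpha>' > 0" by linarith
  thus False
  proof cases
    case 1
    obtain m0 :: nat where m0: "\<alpha> + \<beta> - \<beta>' < m0 * (\<alpha>' - \<alpha>)" using reals_Archimedean3[OF 1] by blast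
    have "real m0 * (\<alpha>' - \<alpha>) \<le> real (m0 + N) * (\<alpha>' - \<alpha>)" using 1 by (intro mult_right_mono) auto
    with m0 have "\<alpha> + \<beta> - \<beta>' < real (m0 + N) * (\<alpha>' - \<alpha>)" by linarith
    moreover have "\<alpha>' * real (m0 + N) + \<beta>' \<le> \<alpha> * (real (m0 + N) + 1) + \<beta>"
      using assms[of "m0 + N"] by simp
    ultimately show False by (simp add: algebra_simps)
  next
    case 2
    obtain m0 :: nat where m0: "\<beta>' - \<beta> < m0 * (\<alpha> - \<alpha>')" using reals_Archimedean3[OF 2] by blast
    have "real m0 * (\<alpha> - \<alpha>') \<le> real (m0 + N) * (\<alpha> - \<alpha>')" using 2 by (intro mult_right_mono) auto
    with m0 have "\<beta>' - \<beta> < real (m0 + N) * (\<alpha> - \<alpha>')" by linarith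
    moreover have "\<alpha> * real (m0 + N) + \<beta> \<le> \<alpha>' * real (m0 + N) + \<beta>'" using assms[of "m0 + N"] by simp
    ultimately show False by (simp add: algebra_simps)
  qed
qed

lemma bounded_mono_nat_stabilizes:
  fixes \<delta> :: "nat => nat"
  assumes "\<And>k. \<delta> k \<le> \<delta> (Suc k)" "\<And>k. \<delta> k \<le> K"
  shows "\<exists>k1. \<forall>k\<ge>k1. \<delta> k = \<delta> k1"
proof -
  have "finite (range \<delta>)" by (rule finite_subset[of _ "{..K}"]) (use assms(2) in auto)
  hence "Max (range \<delta>) \<in> range \<delta>" by (intro Max_in) auto
  then obtain k1 where k1: "\<delta> k1 = Max (range \<delta>)" by auto
  have "\<delta> k = \<delta> k1" if "k \<ge> k1" for k
  proof (rule antisym)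
    show "\<delta> k \<le> \<delta> k1" unfolding k1 by (rule Max_ge) (use \<open>finite (range \<delta>)\<close> in auto)
    show "\<delta> k1 \<le> \<delta> k" using that assms(1) by (rule lift_Suc_mono_le[rotated])
  qed
  thus ?thesis by blast
qed

lemma hilb_unique: "hilb a b Z d e P ==> hilb a b Z d e Q ==> P = Q"
proof (rule poly_eq_if_eventually)
  assume "hilb a b Z d e P" "hilb a b Z d e Q"
  thus "\<forall>\<^sub>F m in sequentially. poly P (real m) = poly Q (real m)"
    unfolding hilb_def by eventually_elim simp
qed

context curve_pencil
begin

lemma PF_subset_V: "PF a b C k l \<subseteq> V a b C (int k) (int l)"
proof
  fix f assume "f \<in> PF a b C k l"
  then obtain H where "biform a b k l H" "f = res C H" by (rule PF_E)
  thus "f \<in> V a b C (int k) (int l)" using res_in_V by blast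
qed

lemma dim_PF_mono: "fs.dim (PF a b C k k) \<le> fs.dim (PF a b C (Suc k) (Suc k))"
proof -
  have eq: "fs.dim (fmul F ` PF a b C k k) = fs.dim (PF a b C k k)"
  proof (rule lin_on_dim(2)[OF lin_on_mult PF_subspace _ PF_fin_dim])
    fix f assume "f \<in> PF a b C k k" and z: "fmul F f = (\<lambda>_. 0)"
    hence "f \<in> V a b C (int k) (int k)" using PF_subset_V by blast
    from fmul_inj[OF F F_nonzero this z] show "f = (\<lambda>_. 0)" .
  qed
  have "fmul F ` PF a b C k k \<subseteq> PF a b C (Suc k) (Suc k)"
  proof
    fix g assume "g \<in> fmul F ` PF a b C k k"
    then obtain H where H: "biform a b k k H" "g = fmul F (res C H)" by (auto elim: PF_E)
    have "g = res C (\<lambda>x y. F x y * H x y)" unfolding H(2) by (rule ext) (simp add: res_def)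
    thus "g \<in> PF a b C (Suc k) (Suc k)" using PF_I[OF biform.mult[OF F H(1)]] by simp
  qed
  from fin_dim_dim_mono[OF PF_fin_dim this] show ?thesis unfolding eq .
qed

text \<open>An irreducible set on which a product of forms vanishes lies in the zero locus of one
  factor; factors are split off one at a time.\<close>

lemma irreducible_prod_list:
  assumes v: "biform a b 1 1 v" and H: "biform a b d e H" "\<exists>p\<in>C. form_at H p \<noteq> 0"
    and z: "\<And>p. p \<in> C ==> form_at H p * (\<Prod>u\<leftarrow>us. form_at v p - u * form_at F p) = 0"
  shows "\<exists>u. \<forall>p\<in>C. form_at v p = u * form_at F p" using H z
proof (induction us arbitrary: H d e)
  case Nil
  thus ?case by auto
next
  case (Cons u us)
  let ?K = "\<lambda>x y. v x y - u * F x y"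
  have K: "biform a b 1 1 ?K" by (rule biform_diff[OF v biform_scale[OF F]])
  show ?case
  proof (cases "\<exists>p\<in>C. form_at (\<lambda>x y. H x y * ?K x y) p \<noteq> 0")
    case True
    show ?thesis
    proof (rule Cons.IH[OF biform.mult[OF Cons.prems(1) K] True])
      fix p assume "p \<in> C"
      from Cons.prems(3)[OF this]
      show "form_at (\<lambda>x y. H x y * ?K x y) p * (\<Prod>u\<leftarrow>us. form_at v p - u * form_at F p) = 0"
        by (simp add: form_at_def)
    qed
  next
    case False
    hence "form_at H p * form_at ?K p = 0" if "p \<in> C" for p using that by simp
    from irreducible_mult[OF irr Cons.prems(1) K this] Cons.prems(2)
    have "\<forall>p\<in>C. form_at ?K p = 0" by blast
    thus ?thesis by (intro exI[of _ u]) (simp add: form_at_def)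
  qed
qed

text \<open>If the dimensions were bounded by \<open>K\<close>, the \<open>K + 1\<close> monomials
  of degree \<open>K\<close> in \<open>v\<close> and \<open>F\<close> would be dependent on
  \<open>C\<close>, so that some factor \<open>v - u F\<close> vanishes on \<open>C\<close>. Applied
  to all products \<open>x_i y_j\<close>, this makes the ratios of coordinates constant and
  \<open>C\<close> a point.\<close>

lemma dim_PF_unbounded: "\<exists>k. K < fs.dim (PF a b C k k)"
proof (rule ccontr)
  assume "\<not> ?thesis"
  hence bd: "fs.dim (PF a b C k k) \<le> K" for k by (meson not_le)
  have prp: "\<exists>u. \<forall>p\<in>C. form_at v p = u * form_at F p" if v: "biform a b 1 1 v" for v
  proof -
    obtain S where S: "finite S" "PF a b C K K \<subseteq> fs.span S" "card S = fs.dim (PF a b C K K)"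
      using fin_dim_basis[OF PF_fin_dim[of a b C K K]] by metis
    define g where "g j = res C (\<lambda>x y. v x y ^ j * F x y ^ (K - j))" for j
    have gP: "g j \<in> PF a b C K K" if "j \<le> K" for j
    proof -
      have "biform a b (j * 1 + (K - j) * 1) (j * 1 + (K - j) * 1) (\<lambda>x y. v x y ^ j * F x y ^ (K - j))"
        by (intro biform.mult biform_power v F)
      thus ?thesis unfolding g_def using that by (intro PF_I) simp
    qed
    have "\<exists>\<alpha>. (\<exists>i\<in>{..K}. \<alpha> i \<noteq> 0) \<and> (\<forall>x. (\<Sum>i\<in>{..K}. \<alpha> i * g i x) = 0)"
    proof (rule family_dependent[OF S(1)])
      show "card S < card {..K}" using bd[of K] S(3) by simp
    qed (use gP S(2) in auto)
    then obtain \<alpha> where \<alpha>: "\<exists>j\<le>K. \<alpha> j \<noteq> 0" "\<And>p. (\<Sum>j\<le>K. \<alpha> j * g j p) = 0" by auto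
    obtain c e us where c: "c \<noteq> 0" "e + length us = K"
      "\<And>V W. (\<Sum>j\<le>K. \<alpha> j * (V ^ j * W ^ (K - j))) = c * W ^ e * (\<Prod>u\<leftarrow>us. V - u * W)"
      using binary_form_split[OF \<alpha>(1)] by blast
    show ?thesis
    proof (rule irreducible_prod_list[OF v biform_power[OF F, of e] nonzero_power[OF F F_nonzero]])
      fix p assume p: "p \<in> C"
      have "c * form_at F p ^ e * (\<Prod>u\<leftarrow>us. form_at v p - u * form_at F p) = (\<Sum>j\<le>K. \<alpha> j * g j p)"
        unfolding c(3)[symmetric] using p by (simp add: g_def res_def)
      thus "form_at (\<lambda>x y. F x y ^ e) p * (\<Prod>u\<leftarrow>us. form_at v p - u * form_at F p) = 0"
        using \<alpha>(2) c(1) by (simp add: mult.assoc)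
    qed
  qed
  have "\<forall>i j. \<exists>u. i \<le> a --> j \<le> b --> (\<forall>p\<in>C. xc p i * yc p j = u * form_at F p)"
  proof (intro allI)
    fix i j
    show "\<exists>u. i \<le> a --> j \<le> b --> (\<forall>p\<in>C. xc p i * yc p j = u * form_at F p)"
    proof (cases "i \<le> a \<and> j \<le> b")
      case True
      hence "biform a b 1 1 (\<lambda>x y. x i * y j)" using biform_coords[of i a j b 1 1] by simp
      from prp[OF this] show ?thesis by simp
    qed auto
  qed
  then obtain u where u: "\<And>i j p. i \<le> a ==> j \<le> b ==> p \<in> C ==> xc p i * yc p j = u i j * form_at F p"
    by metis
  have Fp: "form_at F p \<noteq> 0" if "p \<in> C" for p
  proof -
    have "p \<in> biproj a b" using that sub by blast
    then obtain i j where "i \<le> a" "xc p i \<noteq> 0" "j \<le> b" "yc p j \<noteq> 0"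
      using ex_xc_nonzero ex_yc_nonzero by metis
    thus ?thesis using u[of i j p] that by auto
  qed
  obtain p0 where p0: "p0 \<in> C" using nonempty by blast
  have p0X: "p0 \<in> biproj a b" using p0 sub by blast
  obtain i0 j0 where ij: "i0 \<le> a" "xc p0 i0 \<noteq> 0" "j0 \<le> b" "yc p0 j0 \<noteq> 0"
    using ex_xc_nonzero[OF p0X] ex_yc_nonzero[OF p0X] by metis
  have "q = p0" if q: "q \<in> C" for q
  proof -
    have qX: "q \<in> biproj a b" using q sub by blast
    have "u i0 j0 \<noteq> 0" using u[OF ij(1,3) p0] ij by auto
    hence qn: "xc q i0 \<noteq> 0" "yc q j0 \<noteq> 0" using u[OF ij(1,3) q] Fp[OF q] by auto
    show ?thesis
    proof (rule biproj_eqI[OF qX p0X])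
      show "yc p0 j0 * form_at F q / (yc q j0 * form_at F p0) \<noteq> 0"
        "xc p0 i0 * form_at F q / (xc q i0 * form_at F p0) \<noteq> 0"
        using ij qn Fp[OF q] Fp[OF p0] by auto
      fix i
      show "xc q i = yc p0 j0 * form_at F q / (yc q j0 * form_at F p0) * xc p0 i"
      proof (cases "i \<le> a")
        case True
        have "xc q i * yc q j0 * form_at F p0 = form_at F q * (xc p0 i * yc p0 j0)"
          using u[OF True ij(3) q] u[OF True ij(3) p0] by simp
        thus ?thesis using qn Fp[OF p0] by (simp add: field_simps)
      qed (simp add: xc_zero[OF qX] xc_zero[OF p0X])
      show "yc q i = xc p0 i0 * form_at F q / (xc q i0 * form_at F p0) * yc p0 i"
      proof (cases "i \<le> b")
        case True
        have "xc q i0 * yc q i * form_at F p0 = form_at F q * (xc p0 i0 * yc p0 i)"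
          using u[OF ij(1) True q] u[OF ij(1) True p0] by simp
        thus ?thesis using qn Fp[OF p0] by (simp add: field_simps)
      qed (simp add: yc_zero[OF qX] yc_zero[OF p0X])
    qed
  qed
  hence "C = {p0}" using p0 by blast
  thus False using no_point by blast
qed

text \<open>Multiplication by a form makes both degrees equal to \<open>- m\<close>. A nonzero
  section of this degree would multiply forms of large degree \<open>k\<close> injectively into
  forms of degree \<open>k - m\<close>, so the dimensions could not be unbounded.\<close>

lemma V_negative:
  assumes f: "f \<in> V a b C d e" and neg: "d < 0" "e < 0"
  shows "f = (\<lambda>_. 0)"
proof (rule ccontr)
  assume f0: "f \<noteq> (\<lambda>_. 0)"
  define m where "m = nat (min (- d) (- e))"
  have m: "m \<ge> 1" "int m \<le> - d" "int m \<le> - e" using neg unfolding m_def by auto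
  obtain H where H: "biform a b (nat (- d - int m)) (nat (- e - int m)) H" "\<exists>p\<in>C. form_at H p \<noteq> 0"
    using nonzero_form by blast
  have f': "fmul H f \<in> V a b C (- int m) (- int m)" by (rule V_mult_form[OF f H(1)]) (use m in auto)
  have f'0: "fmul H f \<noteq> (\<lambda>_. 0)" using fmul_inj[OF H f] f0 by blast
  have "tw a b C (- int m) (- int m) (fmul H f)" using f' by (simp add: V_def)
  from serre[OF closed this] obtain M0 where S: "\<forall>M\<ge>M0. 0 \<le> int M + - int m \<and> 0 \<le> int M + - int m \<and>
    (\<forall>\<Phi>. biform a b M M \<Phi> --> (\<exists>\<Psi>. biform a b (nat (int M + - int m)) (nat (int M + - int m)) \<Psi> \<and>
      (\<forall>p\<in>C. form_at \<Phi> p * fmul H f p = form_at \<Psi> p)))" by (elim exE)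
  have M0: "0 \<le> int M + - int m" "\<exists>\<Psi>. biform a b (nat (int M + - int m)) (nat (int M + - int m)) \<Psi> \<and>
      (\<forall>p\<in>C. form_at \<Phi> p * fmul H f p = form_at \<Psi> p)" if "M \<ge> M0" "biform a b M M \<Phi>" for M \<Phi>
    using S[THEN spec, of M, THEN mp, OF that(1)] that(2) by blast+
  have le: "fs.dim (PF a b C (Suc M) (Suc M)) \<le> fs.dim (PF a b C M M)" if M: "M \<ge> M0" for M
  proof -
    have "int (Suc M) \<ge> int m" using M0(1)[OF _ biform_zero, of "Suc M"] M by simp
    hence eq: "nat (int (Suc M) + - int m) = Suc M - m" by linarith
    let ?T = "\<lambda>g p. fmul H f p * g p"
    have eq2: "fs.dim (?T ` PF a b C (Suc M) (Suc M)) = fs.dim (PF a b C (Suc M) (Suc M))"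
    proof (rule lin_on_dim(2)[OF lin_on_mult PF_subspace _ PF_fin_dim])
      fix g assume g: "g \<in> PF a b C (Suc M) (Suc M)" and z: "?T g = (\<lambda>_. 0)"
      obtain \<Phi> where \<Phi>: "biform a b (Suc M) (Suc M) \<Phi>" "g = res C \<Phi>" using g by (rule PF_E)
      show "g = (\<lambda>_. 0)"
      proof (cases "\<exists>p\<in>C. form_at \<Phi> p \<noteq> 0")
        case True
        have "fmul \<Phi> (fmul H f) = (\<lambda>_. 0)"
        proof
          fix p
          show "fmul \<Phi> (fmul H f) p = 0"
            using fun_cong[OF z, of p] V_off[OF f', of p] \<Phi>(2) by (cases "p \<in> C") (auto simp: res_def)
        qed
        from fmul_inj[OF \<Phi>(1) True f' this] f'0 show ?thesis by blast
      next
        case False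
        thus ?thesis unfolding \<Phi>(2) by (intro ext) (simp add: res_def)
      qed
    qed
    have "?T ` PF a b C (Suc M) (Suc M) \<subseteq> PF a b C (Suc M - m) (Suc M - m)"
    proof
      fix h assume "h \<in> ?T ` PF a b C (Suc M) (Suc M)"
      then obtain \<Phi> where \<Phi>: "biform a b (Suc M) (Suc M) \<Phi>" "h = ?T (res C \<Phi>)" by (auto elim: PF_E)
      obtain \<Psi> where \<Psi>: "biform a b (Suc M - m) (Suc M - m) \<Psi>"
        "\<forall>p\<in>C. form_at \<Phi> p * fmul H f p = form_at \<Psi> p"
        using M0(2)[OF le_SucI[OF M] \<Phi>(1)] unfolding eq by blast
      have "h = res C \<Psi>" unfolding \<Phi>(2)
        by (rule ext) (use \<Psi>(2) V_off[OF f'] in \<open>auto simp: res_def mult.commute\<close>)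
      thus "h \<in> PF a b C (Suc M - m) (Suc M - m)" using PF_I[OF \<Psi>(1)] by simp
    qed
    from fin_dim_dim_mono[OF PF_fin_dim this]
    have "fs.dim (PF a b C (Suc M) (Suc M)) \<le> fs.dim (PF a b C (Suc M - m) (Suc M - m))" unfolding eq2 .
    also have "\<dots> \<le> fs.dim (PF a b C M M)"
      by (rule lift_Suc_mono_le[of "\<lambda>k. fs.dim (PF a b C k k)", OF dim_PF_mono]) (use m in auto)
    finally show ?thesis .
  qed
  have "fs.dim (PF a b C M M) \<le> fs.dim (PF a b C M0 M0)" if "M \<ge> M0" for M
    using that by (induction M rule: dec_induct) (use le order_trans in blast)+
  moreover have "fs.dim (PF a b C M M) \<le> fs.dim (PF a b C M0 M0)" if "M \<le> M0" for M
    by (rule lift_Suc_mono_le[of "\<lambda>k. fs.dim (PF a b C k k)", OF dim_PF_mono that])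
  ultimately have "fs.dim (PF a b C M M) \<le> fs.dim (PF a b C M0 M0)" for M
    using nat_le_linear[of M M0] by blast
  thus False using dim_PF_unbounded[of "fs.dim (PF a b C M0 M0)"] by (meson not_le)
qed

lemma fmul_image_subset:
  "biform a b d' e' H ==> D = int d' + d ==> E = int e' + e ==> fmul H ` V a b C d e \<subseteq> V a b C D E"
  using V_mult_form[of _ a b C d e d' e' H D E] by blast

lemma increment:
  assumes fd: "fin_dim (V a b C d e)"
    and K: "\<And>Q. Q \<subseteq> V a b C (d + 1) (e + 1) ==> indep_mod (fmul F ` V a b C d e) Q ==> card Q \<le> K"
  shows "fin_dim (V a b C (d + 1) (e + 1))"
    and "\<exists>Q. Q \<subseteq> V a b C (d + 1) (e + 1) \<and> indep_mod (fmul F ` V a b C d e) Q \<and>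
      fs.dim (V a b C (d + 1) (e + 1)) = fs.dim (V a b C d e) + card Q"
proof -
  let ?U = "fmul F ` V a b C d e" and ?W = "V a b C (d + 1) (e + 1)"
  have UW: "?U \<subseteq> ?W" by (rule fmul_image_subset[OF F]) auto
  have dimU: "fin_dim ?U" "fs.dim ?U = fs.dim (V a b C d e)"
    using lin_on_dim[OF lin_on_mult V_subspace[OF sub] fmul_inj[OF F F_nonzero] fd] by auto
  have "\<exists>Q. Q \<subseteq> ?W \<and> indep_mod ?U Q \<and> (\<forall>w\<in>?W. \<exists>u\<in>?U. \<exists>c. w = (\<lambda>x. u x + (\<Sum>q\<in>Q. c q * q x)))"
  proof (rule indep_mod_maximal[OF fmul_V_subspace UW V_subspace[OF sub] K])
    fix Q assume "Q \<subseteq> ?W" "indep_mod ?U Q"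
      "\<And>w. w \<in> ?W ==> \<exists>u\<in>?U. \<exists>c. w = (\<lambda>x. u x + (\<Sum>q\<in>Q. c q * q x))"
    thus "\<exists>Q. Q \<subseteq> ?W \<and> indep_mod ?U Q \<and> (\<forall>w\<in>?W. \<exists>u\<in>?U. \<exists>c. w = (\<lambda>x. u x + (\<Sum>q\<in>Q. c q * q x)))"
      by (intro exI[of _ Q] conjI ballI)
  qed
  then obtain Q where Q: "Q \<subseteq> ?W" "indep_mod ?U Q"
    "\<forall>w\<in>?W. \<exists>u\<in>?U. \<exists>c. w = (\<lambda>x. u x + (\<Sum>q\<in>Q. c q * q x))" by (elim exE conjE)
  note * = indep_mod_dim_eq[OF fmul_V_subspace UW dimU(1) Q(1,2) bspec[OF Q(3)]]
  show "fin_dim ?W" by (rule *(1))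
  show "\<exists>Q. Q \<subseteq> ?W \<and> indep_mod ?U Q \<and> fs.dim ?W = fs.dim (V a b C d e) + card Q"
    using *(2) Q(1,2) dimU(2) by auto
qed

text \<open>Starting from negative degrees, where 0 is the only section, each diagonal step enlarges
  the dimension by at most \<open>K\<close>.\<close>

lemma V_fin_dim: "fin_dim (V a b C d e)"
proof -
  define n where "n = nat (max d e) + 1"
  have neg: "d - int n < 0" "e - int n < 0" unfolding n_def by auto
  obtain K where K: "\<And>d e Q. Q \<subseteq> V a b C (d + 1) (e + 1) ==> indep_mod (fmul F ` V a b C d e) Q ==> card Q \<le> K"
    using increment_bound by blast
  have "fin_dim (V a b C (d - int n + int k) (e - int n + int k))" for k
  proof (induction k)
    case 0
    have "V a b C (d - int n) (e - int n) \<subseteq> fs.span {}"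
    proof
      fix f assume "f \<in> V a b C (d - int n) (e - int n)"
      from V_negative[OF this neg] show "f \<in> fs.span {}" by (simp add: zero_fun_def)
    qed
    thus ?case unfolding fin_dim_def by (intro exI[of _ "{}"]) simp
  next
    case (Suc k)
    have eq: "d - int n + int (Suc k) = d - int n + int k + 1" "e - int n + int (Suc k) = e - int n + int k + 1" by auto
    show ?case unfolding eq by (rule increment(1)[OF Suc K])
  qed
  from this[of n] show ?thesis by simp
qed

text \<open>The increments \<open>card (Q k)\<close> are nondecreasing by \<open>indep_step\<close>
  and bounded by \<open>increment_bound\<close>; their eventual value is the slope.\<close>

lemma hilb_linear: "\<exists>\<alpha> \<beta>. hilb a b C d e [:\<beta>, \<alpha>:]"
proof -
  obtain K where K: "\<And>d e Q. Q \<subseteq> V a b C (d + 1) (e + 1) ==> indep_mod (fmul F ` V a b C d e) Q ==> card Q \<le> K"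
    using increment_bound by blast
  define h where "h k = fs.dim (V a b C (d + int k) (e + int k))" for k
  have "\<forall>k. \<exists>Q. Q \<subseteq> V a b C (d + int k + 1) (e + int k + 1) \<and>
    indep_mod (fmul F ` V a b C (d + int k) (e + int k)) Q \<and>
    fs.dim (V a b C (d + int k + 1) (e + int k + 1)) = fs.dim (V a b C (d + int k) (e + int k)) + card Q"
    by (intro allI increment(2)[OF V_fin_dim K])
  from choice[OF this] obtain Q where Q: "\<And>k. Q k \<subseteq> V a b C (d + int k + 1) (e + int k + 1)"
    "\<And>k. indep_mod (fmul F ` V a b C (d + int k) (e + int k)) (Q k)"
    "\<And>k. fs.dim (V a b C (d + int k + 1) (e + int k + 1)) = h k + card (Q k)" unfolding h_def by blast
  have dS: "d + int (Suc k) = d + int k + 1" "e + int (Suc k) = e + int k + 1" for k by auto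
  have hS: "h (Suc k) = h k + card (Q k)" for k using Q(3)[of k] unfolding h_def dS .
  have mono: "card (Q k) \<le> card (Q (Suc k))" for k
  proof -
    note st = indep_step[OF Q(1,2)[of k]]
    have UW: "fmul F ` V a b C (d + int k + 1) (e + int k + 1) \<subseteq> V a b C (d + int k + 1 + 1) (e + int k + 1 + 1)"
      by (rule fmul_image_subset[OF F]) auto
    have "fs.dim (fmul F ` V a b C (d + int k + 1) (e + int k + 1)) + card (fmul G ` Q k)
      \<le> fs.dim (V a b C (d + int k + 1 + 1) (e + int k + 1 + 1))"
      by (rule indep_mod_dim_le[OF fmul_V_subspace UW V_fin_dim st(1,2)])
    moreover have "fs.dim (fmul F ` V a b C (d + int k + 1) (e + int k + 1)) = h (Suc k)"
      using lin_on_dim(2)[OF lin_on_mult V_subspace[OF sub] fmul_inj[OF F F_nonzero] V_fin_dim, of "d + int k + 1" "e + int k + 1"]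
      unfolding h_def dS .
    moreover have "fs.dim (V a b C (d + int k + 1 + 1) (e + int k + 1 + 1)) = h (Suc (Suc k))"
      unfolding h_def dS ..
    ultimately show ?thesis using hS[of "Suc k"] st(3) by linarith
  qed
  obtain k1 where k1: "\<And>k. k \<ge> k1 ==> card (Q k) = card (Q k1)"
    using bounded_mono_nat_stabilizes[of "\<lambda>k. card (Q k)" K, OF mono K[OF Q(1,2)]] by blast
  have lin: "real (h k) = real (card (Q k1)) * real k + (real (h k1) - real (card (Q k1)) * real k1)" if "k \<ge> k1" for k
    using that
  proof (induction k rule: dec_induct)
    case base
    show ?case by simp
  next
    case (step n)
    have "real (h (Suc n)) = real (h n) + real (card (Q k1))" using hS[of n] k1[OF step.hyps(1)] by simp
    thus ?case using step.IH by (simp add: algebra_simps)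
  qed
  have "hilb a b C d e [:real (h k1) - real (card (Q k1)) * real k1, real (card (Q k1)):]"
    unfolding hilb_def eventually_sequentially
  proof (intro exI[of _ k1] allI impI conjI)
    fix k assume k: "k1 \<le> k"
    show "fin_dim (V a b C (d + int k) (e + int k))" by (rule V_fin_dim)
    show "poly [:real (h k1) - real (card (Q k1)) * real k1, real (card (Q k1)):] (real k) =
      real (fs.dim (V a b C (d + int k) (e + int k)))"
      using lin[OF k] by (simp add: h_def mult.commute)
  qed
  thus ?thesis by blast
qed

lemma dim_mult_le:
  assumes H: "biform a b d' e' H" "\<exists>p\<in>C. form_at H p \<noteq> 0"
  shows "fs.dim (V a b C d e) \<le> fs.dim (V a b C (int d' + d) (int e' + e))"
    and "(\<exists>p\<in>C. form_at H p = 0) ==> 0 \<le> int d' + d ==> 0 \<le> int e' + e ==>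
      Suc (fs.dim (V a b C d e)) \<le> fs.dim (V a b C (int d' + d) (int e' + e))"
proof -
  let ?U = "fmul H ` V a b C d e" and ?W = "V a b C (int d' + d) (int e' + e)"
  have UW: "?U \<subseteq> ?W" by (rule fmul_image_subset[OF H(1)]) auto
  have dimU: "fs.dim ?U = fs.dim (V a b C d e)"
    using lin_on_dim(2)[OF lin_on_mult V_subspace[OF sub] fmul_inj[OF H] V_fin_dim] .
  show "fs.dim (V a b C d e) \<le> fs.dim ?W" using fin_dim_dim_mono[OF V_fin_dim UW] dimU by simp
  assume z: "\<exists>p\<in>C. form_at H p = 0" and nn: "0 \<le> int d' + d" "0 \<le> int e' + e"
  obtain p where p: "p \<in> C" "form_at H p = 0" using z by blast
  \<comment> \<open>Sections in the image of \<open>H\<close> vanish at \<open>p\<close> but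
    \<open>A\<close> does not, so \<open>A\<close> adds one dimension; the target degrees are
    nonnegative to allow such a form.\<close>
  obtain A where A: "biform a b (nat (int d' + d)) (nat (int e' + e)) A" "form_at A p \<noteq> 0"
    using ex_form_nonzero_at p(1) sub by blast
  have AW: "res C A \<in> ?W" using res_in_V[OF A(1), of C] nn by simp
  have "indep_mod ?U {res C A}" unfolding indep_mod_def
  proof (intro conjI allI impI ballI)
    fix c q assume c: "(\<lambda>x. \<Sum>q\<in>{res C A}. c q * q x) \<in> ?U" and q: "q \<in> {res C A}"
    then obtain f where "(\<lambda>x. \<Sum>q\<in>{res C A}. c q * q x) = fmul H f" by blast
    from fun_cong[OF this, of p] p have "c (res C A) * res C A p = 0" by simp
    thus "c q = 0" using q A(2) p(1) by (simp add: res_def)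
  qed simp
  from indep_mod_dim_le[OF fmul_V_subspace UW V_fin_dim _ this] AW dimU
  show "Suc (fs.dim (V a b C d e)) \<le> fs.dim ?W" by simp
qed

text \<open>A form \<open>H'\<close> of the complementary bidegree \<open>(1 - d', 1 - e')\<close>
  gives the sandwich \<open>?h m \<le> ?h' m \<le> ?h (Suc m)\<close>, so both linear functions have
  the same slope and only their constants differ.\<close>

lemma hilb_compare:
  assumes P: "hilb a b C d e [:\<beta>, \<alpha>:]" and P': "hilb a b C (int d' + d) (int e' + e) [:\<beta>', \<alpha>':]"
    and de: "d' \<le> 1" "e' \<le> 1" and H: "biform a b d' e' H" "\<exists>p\<in>C. form_at H p \<noteq> 0"
  shows "\<alpha> = \<alpha>'" "\<beta> \<le> \<beta>'" "(\<exists>p\<in>C. form_at H p = 0) ==> \<beta> + 1 \<le> \<beta>'"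
proof -
  let ?h = "\<lambda>m. real (fs.dim (V a b C (d + int m) (e + int m)))"
  let ?h' = "\<lambda>m. real (fs.dim (V a b C (int d' + d + int m) (int e' + e + int m)))"
  obtain N where N: "\<And>m. m \<ge> N ==> \<alpha> * real m + \<beta> = ?h m" "\<And>m. m \<ge> N ==> \<alpha>' * real m + \<beta>' = ?h' m"
  proof -
    have "\<forall>\<^sub>F m in sequentially. \<alpha> * real m + \<beta> = ?h m \<and> \<alpha>' * real m + \<beta>' = ?h' m"
      using P P' unfolding hilb_def by eventually_elim (auto simp: mult.commute add.commute)
    thus ?thesis using that unfolding eventually_sequentially by blast
  qed
  obtain H' where H': "biform a b (1 - d') (1 - e') H'" "\<exists>p\<in>C. form_at H' p \<noteq> 0" using nonzero_form by blast
  have 1: "?h m \<le> ?h' m" for m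
    using dim_mult_le(1)[OF H, of "d + int m" "e + int m"] by (simp add: add.assoc)
  have 2: "?h' m \<le> ?h (Suc m)" for m
    using dim_mult_le(1)[OF H', of "int d' + d + int m" "int e' + e + int m"] de
    by (simp add: of_nat_diff algebra_simps)
  show eq: "\<alpha> = \<alpha>'"
  proof (rule affine_sandwich)
    fix m :: nat assume m: "N \<le> m"
    have "\<alpha> * real (Suc m) + \<beta> = ?h (Suc m)" by (rule N(1)) (use m in simp)
    thus "\<alpha> * real m + \<beta> \<le> \<alpha>' * real m + \<beta>' \<and> \<alpha>' * real m + \<beta>' \<le> \<alpha> * (real m + 1) + \<beta>"
      using 1[of m] 2[of m] N[OF m] by (simp add: add.commute)
  qed
  show "\<beta> \<le> \<beta>'" using 1[of N] N[of N] eq by simp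
  assume z: "\<exists>p\<in>C. form_at H p = 0"
  define m where "m = N + nat \<bar>d\<bar> + nat \<bar>e\<bar>"
  have "?h m + 1 \<le> ?h' m"
    using dim_mult_le(2)[OF H z, of "d + int m" "e + int m"] unfolding m_def by (simp add: add.assoc)
  moreover have "\<alpha> * real m + \<beta> = ?h m" "\<alpha>' * real m + \<beta>' = ?h' m" by (rule N, simp add: m_def)+
  ultimately show "\<beta> + 1 \<le> \<beta>'" using eq by simp
qed

text \<open>The coordinate \<open>y_j\<close> has no zero on \<open>C\<close>, so division by it
  inverts the multiplication.\<close>

lemma dim_mult_eq:
  assumes j: "j \<le> b" "\<And>p. p \<in> C ==> yc p j \<noteq> 0"
  shows "fs.dim (V a b C d (e + 1)) = fs.dim (V a b C d e)"
proof -
  have H: "biform a b 0 1 (\<lambda>x y. y j)" by (rule biform.coord_y[OF j(1)])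
  have Hn: "\<exists>p\<in>C. form_at (\<lambda>x y. y j) p \<noteq> 0" using j(2) nonempty by auto
  have "V a b C d (e + 1) \<subseteq> fmul (\<lambda>x y. y j) ` V a b C d e"
  proof
    fix f assume f: "f \<in> V a b C d (e + 1)"
    have "tw a b C (- 0) (- 1) (\<lambda>q. inverse (yc q j))" by (rule tw_inverse[OF tw_y[OF j(1)] j(2)])
    hence "tw a b C d e (\<lambda>q. inverse (yc q j) * f q)"
      by (rule tw_mult[where d' = d and e' = "e + 1"]) (use f in \<open>auto simp: V_def\<close>)
    hence mem: "(\<lambda>q. inverse (yc q j) * f q) \<in> V a b C d e" using V_off[OF f] by (simp add: V_def)
    have eq: "f = fmul (\<lambda>x y. y j) (\<lambda>q. inverse (yc q j) * f q)"
    proof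
      fix p show "f p = fmul (\<lambda>x y. y j) (\<lambda>q. inverse (yc q j) * f q) p"
        using j(2)[of p] V_off[OF f, of p] by (cases "p \<in> C") auto
    qed
    show "f \<in> fmul (\<lambda>x y. y j) ` V a b C d e"
    proof (rule image_eqI)
      show "f = fmul (\<lambda>x y. y j) (\<lambda>q. inverse (yc q j) * f q)" by (rule eq)
    qed (rule mem)
  qed
  moreover have "fmul (\<lambda>x y. y j) ` V a b C d e \<subseteq> V a b C d (e + 1)"
    by (rule fmul_image_subset[OF H]) auto
  ultimately have eq: "V a b C d (e + 1) = fmul (\<lambda>x y. y j) ` V a b C d e" by (rule antisym)
  show ?thesis unfolding eq
    by (rule lin_on_dim(2)[OF lin_on_mult V_subspace[OF sub] fmul_inj[OF H Hn] V_fin_dim])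
qed

end

text \<open>\<open>f d e\<close> is the constant term of the linear Hilbert polynomial. The
  monotonicity clauses serve nefness on arbitrary curves; the last two clauses are for the line in a
  fibre, where one twist is trivial and the other has positive degree.\<close>

theorem curve_euler_char:
  fixes C :: "'k::{alg_closed_field,field_char_0} pt set"
  assumes C: "curve a b C"
  shows "\<exists>f. (\<forall>L d e. has_type a b C L d e --> euler_char a b C L = f d e) \<and>
    (\<forall>d e. f d e \<le> f (d + 1) e) \<and> (\<forall>d e. f d e \<le> f d (e + 1)) \<and>
    (\<forall>j\<le>b. (\<forall>p\<in>C. yc p j \<noteq> 0) --> (\<forall>d e. f d (e + 1) = f d e)) \<and>
    (\<forall>i\<le>a. (\<exists>p\<in>C. xc p i \<noteq> 0) --> (\<exists>p\<in>C. xc p i = 0) --> (\<forall>d e. f d e + 1 \<le> f (d + 1) e))"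
proof -
  have irr: "irreducible_closed a b C" and np: "\<nexists>p. C = {p}" using C by (auto simp: curve_def)
  have cl: "zclosed a b C" "C \<noteq> {}" using irr by (auto simp: irreducible_closed_def)
  have sub: "C \<subseteq> biproj a b" by (rule zclosed_subset[OF cl(1)])
  obtain p where "p \<in> C" using cl(2) by blast
  then obtain F where F: "biform a b 1 1 F" "\<exists>p\<in>C. form_at F p \<noteq> 0"
    using ex_form_nonzero_at sub by blast
  obtain G where G: "biform a b 1 1 G" "\<forall>p\<in>C. form_at F p \<noteq> 0 \<or> form_at G p \<noteq> 0"
    using exists_pencil[OF C F] by blast
  interpret curve_pencil a b C F G by unfold_locales (use irr np F G in auto)
  define f where "f d e = (SOME \<beta>. \<exists>\<alpha>. hilb a b C d e [:\<beta>, \<alpha>:])" for d e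
  have f: "\<exists>\<alpha>. hilb a b C d e [:f d e, \<alpha>:]" for d e
    unfolding f_def by (rule someI_ex) (use hilb_linear[of d e] in blast)
  show ?thesis
  proof (intro exI[of _ f] conjI allI impI)
    fix L d e assume L: "has_type a b C L d e"
    obtain \<alpha> where "hilb a b C d e [:f d e, \<alpha>:]" using f by blast
    from euler_char_eq[OF sub L this] show "euler_char a b C L = f d e" by simp
  next
    fix d e
    obtain \<alpha> where A: "hilb a b C d e [:f d e, \<alpha>:]" using f by blast
    obtain \<alpha>' where A': "hilb a b C (d + 1) e [:f (d + 1) e, \<alpha>':]" using f by blast
    obtain H where H: "biform a b 1 0 H" "\<exists>p\<in>C. form_at H p \<noteq> 0" using nonzero_form by blast
    from hilb_compare(2)[OF A _ _ _ H] A' show "f d e \<le> f (d + 1) e" by (simp add: add.commute)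
    fix i assume i: "i \<le> a" "\<exists>p\<in>C. xc p i \<noteq> 0" "\<exists>p\<in>C. xc p i = 0"
    have X: "biform a b 1 0 (\<lambda>x y. x i)" by (rule biform.coord_x[OF i(1)])
    from hilb_compare(3)[OF A _ _ _ X] A' i show "f d e + 1 \<le> f (d + 1) e" by (simp add: add.commute)
  next
    fix d e
    obtain \<alpha> where A: "hilb a b C d e [:f d e, \<alpha>:]" using f by blast
    obtain \<alpha>' where A': "hilb a b C d (e + 1) [:f d (e + 1), \<alpha>':]" using f by blast
    obtain H where H: "biform a b 0 1 H" "\<exists>p\<in>C. form_at H p \<noteq> 0" using nonzero_form by blast
    from hilb_compare(2)[OF A _ _ _ H] A' show "f d e \<le> f d (e + 1)" by (simp add: add.commute)
    fix j assume j: "j \<le> b" "\<forall>p\<in>C. yc p j \<noteq> 0"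
    have "hilb a b C d (e + 1) [:f d e, \<alpha>:]"
    proof -
      have eq: "e + 1 + int m = (e + int m) + 1" for m by simp
      have "fs.dim (V a b C (d + int m) (e + 1 + int m)) = fs.dim (V a b C (d + int m) (e + int m))" for m
        unfolding eq using dim_mult_eq[OF j(1), of "d + int m" "e + int m"] j(2) by simp
      thus ?thesis using A V_fin_dim unfolding hilb_def by simp
    qed
    from hilb_unique[OF this A'] show "f d (e + 1) = f d e" by simp
  qed
qed

section \<open>Cox coordinates on the blow-up\<close>

text \<open>Vanishing is assumed only where all coordinates are nonzero. For fixed values of the
  other variables the sum is a polynomial in the last one with infinitely many roots, so its
  coefficients vanish, and the induction hypothesis applies to each of them.\<close>

lemma monomials_independent:
  fixes c :: "(nat => nat) => 'k::field_char_0"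
  assumes "finite A" "\<And>\<alpha> k. \<alpha> \<in> A ==> k \<ge> N ==> \<alpha> k = 0"
    and "\<And>\<zeta>. (\<forall>k<N. \<zeta> k \<noteq> 0) ==> (\<Sum>\<alpha>\<in>A. c \<alpha> * (\<Prod>k<N. \<zeta> k ^ \<alpha> k)) = 0"
  shows "\<forall>\<alpha>\<in>A. c \<alpha> = 0" using assms
proof (induction N arbitrary: A c)
  case 0
  show ?case
  proof
    fix \<alpha> assume a: "\<alpha> \<in> A"
    have "A \<subseteq> {\<lambda>_. 0}" using 0(2) by (auto simp: fun_eq_iff)
    hence "A = {\<alpha>}" using a by blast
    thus "c \<alpha> = 0" using 0(3) by simp
  qed
next
  case (Suc N)
  show ?case
  proof
    fix \<alpha>0 assume a0: "\<alpha>0 \<in> A"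
    define j where "j = \<alpha>0 N"
    define A' where "A' = (\<lambda>\<alpha>. \<alpha>(N := 0)) ` {\<alpha>\<in>A. \<alpha> N = j}"
    have inj: "inj_on (\<lambda>\<alpha>. \<alpha>(N := 0)) {\<alpha>\<in>A. \<alpha> N = j}"
    proof (rule inj_onI, rule ext)
      fix \<alpha> \<beta> k assume h: "\<alpha> \<in> {\<alpha>\<in>A. \<alpha> N = j}" "\<beta> \<in> {\<alpha>\<in>A. \<alpha> N = j}" "\<alpha>(N := 0) = \<beta>(N := 0)"
      show "\<alpha> k = \<beta> k" using fun_cong[OF h(3), of k] h(1,2) by (cases "k = N") auto
    qed
    have "\<forall>\<alpha>\<in>A'. (\<lambda>\<beta>. c (\<beta>(N := j))) \<alpha> = 0"
    proof (rule Suc.IH)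
      show "finite A'" unfolding A'_def using Suc.prems(1) by simp
      fix \<alpha> k assume "\<alpha> \<in> A'" "k \<ge> N"
      thus "\<alpha> k = 0" unfolding A'_def using Suc.prems(2)[of _ k] by (cases "k = N") auto
    next
      fix \<zeta> :: "nat => 'k" assume z: "\<forall>k<N. \<zeta> k \<noteq> 0"
      define p where "p = (\<Sum>\<alpha>\<in>A. monom (c \<alpha> * (\<Prod>k<N. \<zeta> k ^ \<alpha> k)) (\<alpha> N))"
      have "poly p t = 0" if t: "t \<noteq> 0" for t
      proof -
        have "(\<Sum>\<alpha>\<in>A. c \<alpha> * (\<Prod>k<Suc N. (\<zeta>(N := t)) k ^ \<alpha> k)) = 0"
          by (rule Suc.prems(3)) (use z t in \<open>auto simp: less_Suc_eq\<close>)
        moreover have "(\<Prod>k<Suc N. (\<zeta>(N := t)) k ^ \<alpha> k) = (\<Prod>k<N. \<zeta> k ^ \<alpha> k) * t ^ \<alpha> N" for \<alpha> by simp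
        ultimately show ?thesis by (simp add: p_def poly_sum poly_monom mult.assoc)
      qed
      hence "UNIV - {0} \<subseteq> {t. poly p t = 0}" by auto
      moreover have "infinite (UNIV - {0::'k})" using infinite_UNIV_char_0 by simp
      ultimately have "p = 0" using poly_roots_finite finite_subset by blast
      hence "0 = coeff p j" by simp
      also have "\<dots> = (\<Sum>\<alpha>\<in>A. if \<alpha> N = j then c \<alpha> * (\<Prod>k<N. \<zeta> k ^ \<alpha> k) else 0)"
        unfolding p_def coeff_sum by (rule sum.cong) auto
      also have "\<dots> = (\<Sum>\<alpha>\<in>{\<alpha>\<in>A. \<alpha> N = j}. c \<alpha> * (\<Prod>k<N. \<zeta> k ^ \<alpha> k))"
        by (rule sum.inter_filter[OF Suc.prems(1), symmetric])
      also have "\<dots> = (\<Sum>\<alpha>\<in>{\<alpha>\<in>A. \<alpha> N = j}. c ((\<alpha>(N := 0))(N := j)) * (\<Prod>k<N. \<zeta> k ^ (\<alpha>(N := 0)) k))"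
      proof (rule sum.cong[OF refl], goal_cases)
        case (1 \<alpha>)
        hence "(\<alpha>(N := 0))(N := j) = \<alpha>" by (auto simp: fun_eq_iff)
        moreover have "(\<Prod>k<N. \<zeta> k ^ (\<alpha>(N := 0)) k) = (\<Prod>k<N. \<zeta> k ^ \<alpha> k)" by (rule prod.cong) auto
        ultimately show ?case by simp
      qed
      also have "\<dots> = (\<Sum>\<alpha>\<in>A'. c (\<alpha>(N := j)) * (\<Prod>k<N. \<zeta> k ^ \<alpha> k))"
        unfolding A'_def by (subst sum.reindex[OF inj]) simp
      finally show "(\<Sum>\<alpha>\<in>A'. c (\<alpha>(N := j)) * (\<Prod>k<N. \<zeta> k ^ \<alpha> k)) = 0" by simp
    qed
    moreover have "\<alpha>0(N := 0) \<in> A'" unfolding A'_def using a0 j_def by blast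
    ultimately have "c ((\<alpha>0(N := 0))(N := j)) = 0" by blast
    moreover have "(\<alpha>0(N := 0))(N := j) = \<alpha>0" by (auto simp: fun_eq_iff j_def)
    ultimately show "c \<alpha>0 = 0" by simp
  qed
qed

locale blowup =
  fixes r s :: nat
  assumes r1: "r \<ge> 1" and s1: "s \<ge> 1"
begin

abbreviation n :: nat where "n \<equiv> r + s"
abbreviation N :: nat where "N \<equiv> r + s + 2"

text \<open>
  Cox coordinates \<open>\<zeta>\<close>: \<open>\<zeta> 0\<close> is the equation of the exceptional divisor, \<open>\<zeta> 1, ..., \<zeta> r\<close> are the last
  \<open>r\<close> coordinates of \<open>P^(r+s)\<close>, and \<open>\<zeta> (r+1), ..., \<zeta> (r+s+1)\<close> are the coordinates of \<open>P^s\<close>.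
\<close>

definition px :: "(nat => 'k::field) => nat => 'k" where
  "px \<zeta> i = (if i \<le> s then \<zeta> 0 * \<zeta> (r + 1 + i) else if i \<le> n then \<zeta> (i - s) else 0)"

definition py :: "(nat => 'k::field) => nat => 'k" where
  "py \<zeta> j = (if j \<le> s then \<zeta> (r + 1 + j) else 0)"

text \<open>A right inverse of \<open>pnt\<close> on \<open>PE\<close>: there
  \<open>(x_0, ..., x_s)\<close> is a multiple of \<open>y\<close>, and \<open>cc q 0\<close> is the
  factor.\<close>

definition cc :: "'k::field pt => nat => 'k" where
  "cc q k = (if k = 0 then xc q (jy q) / yc q (jy q) else if k \<le> r then xc q (s + k)
     else if k \<le> n + 1 then yc q (k - r - 1) else 0)"

text \<open>Weights of the Cox coordinates under the torus of rank two; \<open>cc_tw\<close>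
  identifies them as types of twisted functions.\<close>

definition wd :: "nat => int" where "wd k = (if k \<le> r then 1 else 0)"
definition we :: "nat => int" where "we k = (if k = 0 then - 1 else if k \<le> r then 0 else 1)"

text \<open>Complement of the irrelevant locus of the Cox ring: these vectors define points.\<close>

definition good :: "(nat => 'k::field) => bool" where
  "good \<zeta> \<longleftrightarrow> (\<exists>k\<le>r. \<zeta> k \<noteq> 0) \<and> (\<exists>j\<le>s. \<zeta> (r + 1 + j) \<noteq> 0)"

definition pnt :: "(nat => 'k::field) => 'k pt" where
  "pnt \<zeta> = (ppoint (px \<zeta>), ppoint (py \<zeta>))"

definition mon :: "(nat => nat) => (nat => 'k::field) => 'k" where
  "mon \<alpha> \<zeta> = (\<Prod>k<N. \<zeta> k ^ \<alpha> k)"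

definition Exps :: "int => int => (nat => nat) set" where
  "Exps d e = {\<alpha>. (\<forall>k\<ge>N. \<alpha> k = 0) \<and> (\<Sum>k<N. int (\<alpha> k) * wd k) = d \<and> (\<Sum>k<N. int (\<alpha> k) * we k) = e}"

text \<open>A graded piece of the Cox ring, as functions on the coordinate space.\<close>

definition CP :: "int => int => ((nat => 'k::field) => 'k) set" where
  "CP d e = fs.span (mon ` Exps d e)"

lemma PE_iff:
  "q \<in> PE r s \<longleftrightarrow> q \<in> biproj n s \<and> (\<exists>z. \<forall>i\<le>s. xc q i = z * yc q i)"
proof
  assume q: "q \<in> PE r s"
  hence qX: "q \<in> biproj n s" and sub: "fst q \<subseteq> dual_fibre r s (snd q)" by (auto simp: PE_def)
  have "xc q \<in> fst q" unfolding fst_biproj[OF qX] by (rule ppoint_self)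
  then obtain w c where w: "w \<in> snd q" "\<forall>i\<le>s. xc q i = c * w i"
    using sub unfolding dual_fibre_def by blast
  obtain c' where "w = (\<lambda>i. c' * yc q i)" using w(1) unfolding snd_biproj[OF qX] ppoint_def by blast
  hence "\<forall>i\<le>s. xc q i = (c * c') * yc q i" using w(2) by simp
  thus "q \<in> biproj n s \<and> (\<exists>z. \<forall>i\<le>s. xc q i = z * yc q i)" using qX by blast
next
  assume "q \<in> biproj n s \<and> (\<exists>z. \<forall>i\<le>s. xc q i = z * yc q i)"
  then obtain z where q: "q \<in> biproj n s" "\<forall>i\<le>s. xc q i = z * yc q i" by blast
  have "fst q \<subseteq> dual_fibre r s (snd q)"
  proof
    fix v assume "v \<in> fst q"
    then obtain c where c: "v = (\<lambda>i. c * xc q i)" unfolding fst_biproj[OF q(1)] ppoint_def by blast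
    have "yc q \<in> snd q" unfolding snd_biproj[OF q(1)] by (rule ppoint_self)
    moreover have "\<forall>i\<le>s. v i = (c * z) * yc q i" using q(2) c by simp
    moreover have "\<forall>i>n. v i = 0" using c xc_zero[OF q(1)] by simp
    ultimately show "v \<in> dual_fibre r s (snd q)" unfolding dual_fibre_def by blast
  qed
  thus "q \<in> PE r s" using q(1) unfolding PE_def by (cases q) auto
qed

lemma PE_sub: "PE r s \<subseteq> biproj n s" using PE_iff by blast

lemma jy_nonzero:
  assumes "q \<in> biproj a s"
  shows "jy q \<le> s" "yc q (jy q) \<noteq> 0"
proof -
  obtain j where j: "j \<le> s" "yc q j \<noteq> 0" using ex_yc_nonzero[OF assms] by blast
  show "yc q (jy q) \<noteq> 0" unfolding jy_def by (rule LeastI[of "\<lambda>j. yc q j \<noteq> 0"]) (rule j(2))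
  show "jy q \<le> s" unfolding jy_def using Least_le[of "\<lambda>j. yc q j \<noteq> 0", OF j(2)] j(1) by simp
qed

lemma cc_spec:
  assumes q: "q \<in> PE r s"
  shows "px (cc q) = xc q" "py (cc q) = yc q" "good (cc q)"
proof -
  obtain z where qX: "q \<in> biproj n s" and z: "\<forall>i\<le>s. xc q i = z * yc q i" using q PE_iff by blast
  have c0: "cc q 0 = z" using z jy_nonzero[OF qX] by (simp add: cc_def)
  have ck: "cc q k = xc q (s + k)" if "0 < k" "k \<le> r" for k using that by (simp add: cc_def)
  have cy: "cc q (r + 1 + j) = yc q j" if "j \<le> s" for j using that by (simp add: cc_def)
  show x: "px (cc q) = xc q"
  proof
    fix i show "px (cc q) i = xc q i"
      using z cy[of i] c0 ck[of "i - s"] xc_zero[OF qX, of i] unfolding px_def by auto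
  qed
  show y: "py (cc q) = yc q"
  proof
    fix j show "py (cc q) j = yc q j" using cy[of j] yc_zero[OF qX, of j] unfolding py_def by auto
  qed
  obtain j where j: "j \<le> s" "yc q j \<noteq> 0" using ex_yc_nonzero[OF qX] by blast
  obtain i where i: "i \<le> n" "xc q i \<noteq> 0" using ex_xc_nonzero[OF qX] by blast
  have "\<exists>k\<le>r. cc q k \<noteq> 0"
  proof (cases "i \<le> s")
    case True
    hence "cc q 0 \<noteq> 0" using i z c0 by auto
    thus ?thesis by blast
  next
    case False
    hence "cc q (i - s) \<noteq> 0" using ck[of "i - s"] i by simp
    thus ?thesis using i by (intro exI[of _ "i - s"]) auto
  qed
  moreover have "\<exists>j\<le>s. cc q (r + 1 + j) \<noteq> 0" using cy[OF j(1)] j by (intro exI[of _ j]) simp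
  ultimately show "good (cc q)" unfolding good_def by blast
qed

text \<open>The representatives chosen by \<open>xc\<close> and \<open>yc\<close> differ from
  \<open>px \<zeta>\<close> and \<open>py \<zeta>\<close> by scalars \<open>l\<close> and
  \<open>m\<close>, so \<open>cc\<close> recovers \<open>\<zeta>\<close> up to the corresponding
  torus element.\<close>

lemma pnt_spec:
  assumes g: "good \<zeta>"
  shows "pnt \<zeta> \<in> PE r s"
    and "\<exists>l m. l \<noteq> 0 \<and> m \<noteq> 0 \<and> xc (pnt \<zeta>) = (\<lambda>i. l * px \<zeta> i) \<and> yc (pnt \<zeta>) = (\<lambda>i. m * py \<zeta> i) \<and>
      (\<forall>k<N. cc (pnt \<zeta>) k = (l ^ nat (wd k) * m powi we k) * \<zeta> k)"
proof -
  obtain k where k: "k \<le> r" "\<zeta> k \<noteq> 0" using g by (auto simp: good_def)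
  obtain j where j: "j \<le> s" "\<zeta> (r + 1 + j) \<noteq> 0" using g by (auto simp: good_def)
  have y0: "py \<zeta> \<noteq> (\<lambda>_. 0)" using j by (auto simp: py_def fun_eq_iff)
  have x0: "px \<zeta> \<noteq> (\<lambda>_. 0)"
  proof (cases "k = 0")
    case True
    hence "px \<zeta> j \<noteq> 0" using j k by (simp add: px_def)
    thus ?thesis by auto
  next
    case False
    hence "px \<zeta> (s + k) \<noteq> 0" using k by (simp add: px_def)
    thus ?thesis by auto
  qed
  have pad: "\<forall>i>n. px \<zeta> i = 0" "\<forall>j>s. py \<zeta> j = 0" by (simp_all add: px_def py_def)
  note P = biproj_pointI[OF x0 pad(1) y0 pad(2), folded pnt_def]
  obtain l where l: "l \<noteq> 0" "xc (pnt \<zeta>) = (\<lambda>i. l * px \<zeta> i)" using P(2) by (elim exE conjE)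
  obtain m where m: "m \<noteq> 0" "yc (pnt \<zeta>) = (\<lambda>i. m * py \<zeta> i)" using P(3) by (elim exE conjE)
  have rel: "xc (pnt \<zeta>) i = (l * \<zeta> 0 / m) * yc (pnt \<zeta>) i" if "i \<le> s" for i
    using l m that by (simp add: px_def py_def)
  show X: "pnt \<zeta> \<in> PE r s" unfolding PE_iff using P(1) rel by blast
  note jj = jy_nonzero[OF P(1)]
  have "cc (pnt \<zeta>) k = (l ^ nat (wd k) * m powi we k) * \<zeta> k" if k: "k < N" for k
  proof -
    consider "k = 0" | "0 < k" "k \<le> r" | "r < k" by linarith
    thus ?thesis
    proof cases
      case 1
      have "cc (pnt \<zeta>) 0 = l * \<zeta> 0 / m" using rel[OF jj(1)] jj(2) by (simp add: cc_def)
      thus ?thesis using 1 m(1) by (simp add: wd_def we_def power_int_minus field_simps)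
    next
      case 2
      thus ?thesis using l by (simp add: cc_def wd_def we_def px_def)
    next
      case 3
      hence "r + 1 + (k - r - 1) = k" by simp
      thus ?thesis using 3 k m by (simp add: cc_def wd_def we_def py_def)
    qed
  qed
  thus "\<exists>l m. l \<noteq> 0 \<and> m \<noteq> 0 \<and> xc (pnt \<zeta>) = (\<lambda>i. l * px \<zeta> i) \<and> yc (pnt \<zeta>) = (\<lambda>i. m * py \<zeta> i) \<and>
      (\<forall>k<N. cc (pnt \<zeta>) k = (l ^ nat (wd k) * m powi we k) * \<zeta> k)" using l m by blast
qed

lemma PE_closed: "zclosed n s (PE r s :: 'k::field pt set)"
proof (rule zclosedI[OF PE_sub])
  fix p :: "'k pt" assume p: "p \<in> biproj n s" "p \<notin> PE r s"
  have j: "jy p \<le> s" "yc p (jy p) \<noteq> 0" using jy_nonzero[OF p(1)] by auto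
  have "\<exists>i\<le>s. xc p i \<noteq> (xc p (jy p) / yc p (jy p)) * yc p i" using p PE_iff by blast
  then obtain i where i: "i \<le> s" "xc p i \<noteq> (xc p (jy p) / yc p (jy p)) * yc p i" by blast
  let ?F = "\<lambda>(x :: nat => 'k) (y :: nat => 'k). x i * y (jy p) - x (jy p) * y i"
  have 1: "biform n s (1 + 0) (0 + 1) (\<lambda>x y. x i * y (jy p))"
    by (rule biform.mult[OF biform.coord_x biform.coord_y]) (use i j in simp_all)
  have 2: "biform n s (1 + 0) (0 + 1) (\<lambda>x y. x (jy p) * y i)"
    by (rule biform.mult[OF biform.coord_x biform.coord_y]) (use i j in simp_all)
  have "biform n s (1 + 0) (0 + 1) ?F" by (rule biform_diff[OF 1 2])
  moreover have "form_at ?F p \<noteq> 0" using i(2) j(2) by (simp add: field_simps)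
  moreover have "\<forall>q\<in>PE r s. form_at ?F q = 0"
  proof
    fix q :: "'k pt" assume "q \<in> PE r s"
    then obtain z where "\<forall>i\<le>s. xc q i = z * yc q i" using PE_iff by blast
    thus "form_at ?F q = 0" using i(1) j(1) by simp
  qed
  ultimately show "\<exists>F d e. biform n s d e F \<and> form_at F p \<noteq> 0 \<and> (\<forall>q\<in>PE r s. form_at F q = 0)"
    by (intro exI[of _ ?F] exI[of _ "1 + 0"] exI[of _ "0 + 1"]) auto
qed

text \<open>The weight \<open>we\<close> is negative on the coordinate 0 and bounds nothing by
  itself: \<open>wd\<close> bounds the first \<open>r + 1\<close> exponents, and
  \<open>wd + we\<close>, which is nonnegative, the remaining ones.\<close>

lemma finite_Exps: "finite (Exps d e)"
proof -
  let ?M = "nat (\<bar>d\<bar> + \<bar>e\<bar>)"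
  have "Exps d e \<subseteq> {\<alpha>. (\<forall>k. (k \<in> {..<N} --> \<alpha> k \<in> {..?M}) \<and> (k \<notin> {..<N} --> \<alpha> k = 0))}"
  proof
    fix \<alpha> assume a: "\<alpha> \<in> Exps d e"
    have D: "(\<Sum>k<N. int (\<alpha> k) * wd k) = d" and E: "(\<Sum>k<N. int (\<alpha> k) * we k) = e"
      using a by (auto simp: Exps_def)
    have le1: "int (\<alpha> k) \<le> d" if "k \<le> r" for k
    proof -
      have "int (\<alpha> k) * wd k \<le> (\<Sum>k<N. int (\<alpha> k) * wd k)"
        by (rule member_le_sum) (use that in \<open>auto simp: wd_def\<close>)
      thus ?thesis using D that by (simp add: wd_def)
    qed
    have le2: "int (\<alpha> k) \<le> d + e" if "r < k" "k < N" for k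
    proof -
      have "int (\<alpha> k) * (wd k + we k) \<le> (\<Sum>k<N. int (\<alpha> k) * (wd k + we k))"
        by (rule member_le_sum) (use that in \<open>auto simp: wd_def we_def\<close>)
      also have "\<dots> = d + e" using D E by (simp add: algebra_simps sum.distrib)
      finally show ?thesis using that by (simp add: wd_def we_def)
    qed
    have "\<alpha> k \<le> ?M" if "k < N" for k
      using le1[of k] le2[of k] that by (cases "k \<le> r") (auto simp: nat_le_iff le_nat_iff)
    thus "\<alpha> \<in> {\<alpha>. (\<forall>k. (k \<in> {..<N} --> \<alpha> k \<in> {..?M}) \<and> (k \<notin> {..<N} --> \<alpha> k = 0))}"
      using a by (auto simp: Exps_def)
  qed
  moreover have "finite {\<alpha>. (\<forall>k. (k \<in> {..<N} --> \<alpha> k \<in> {..?M}) \<and> (k \<notin> {..<N} --> \<alpha> k = 0))}"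
    by (rule finite_set_of_finite_funs) auto
  ultimately show ?thesis by (rule finite_subset)
qed

lemma mon_mult: "mon \<alpha> \<zeta> * mon \<beta> \<zeta> = mon (\<lambda>k. \<alpha> k + \<beta> k) \<zeta>"
  by (simp add: mon_def prod.distrib[symmetric] power_add)

lemma Exps_add: "\<alpha> \<in> Exps d e ==> \<beta> \<in> Exps d' e' ==> (\<lambda>k. \<alpha> k + \<beta> k) \<in> Exps (d + d') (e + e')"
  by (auto simp: Exps_def algebra_simps sum.distrib)

lemma CP_mon: "\<alpha> \<in> Exps d e ==> mon \<alpha> \<in> CP d e" unfolding CP_def by (rule fs.span_base) blast

lemma CP_subspace: "fs.subspace (CP d e)" unfolding CP_def by (rule fs.subspace_span)

lemma CP_mult:
  assumes f: "f \<in> CP d e" and g: "g \<in> CP d' e'" and "D = d + d'" "E = e + e'"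
  shows "(\<lambda>\<zeta>. f \<zeta> * g \<zeta>) \<in> CP D E"
proof -
  have 1: "(\<lambda>\<zeta>. f \<zeta> * t \<zeta>) \<in> CP D E" if t: "t \<in> mon ` Exps d' e'" for t
  proof -
    obtain \<beta> where \<beta>: "\<beta> \<in> Exps d' e'" "t = mon \<beta>" using t by blast
    have "(\<lambda>\<zeta>. mon \<beta> \<zeta> * f \<zeta>) \<in> fs.span (mon ` Exps D E)"
    proof (rule mult_span[OF f[unfolded CP_def]], rule fs.span_base)
      fix u assume "u \<in> (mon :: (nat => nat) => (nat => 'a) => 'a) ` Exps d e"
      then obtain \<alpha> where \<alpha>: "\<alpha> \<in> Exps d e" "u = mon \<alpha>" by blast
      have "(\<lambda>\<zeta>. mon \<beta> \<zeta> * u \<zeta>) = mon (\<lambda>k. \<alpha> k + \<beta> k)"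
        by (rule ext) (simp add: \<alpha>(2) mon_mult add.commute)
      thus "(\<lambda>\<zeta>. mon \<beta> \<zeta> * u \<zeta>) \<in> mon ` Exps D E" using Exps_add[OF \<alpha>(1) \<beta>(1)] assms by simp
    qed
    thus ?thesis by (simp add: \<beta>(2) CP_def mult.commute)
  qed
  have "(\<lambda>\<zeta>. f \<zeta> * g \<zeta>) \<in> fs.span (mon ` Exps D E)"
    by (rule mult_span[OF g[unfolded CP_def]]) (use 1 in \<open>simp add: CP_def\<close>)
  thus ?thesis by (simp add: CP_def)
qed

lemma CP_coord:
  assumes "k < N"
  shows "(\<lambda>\<zeta> :: nat => 'k::field. \<zeta> k) \<in> CP (wd k) (we k)"
proof -
  let ?\<alpha> = "\<lambda>i. if i = k then 1 else (0::nat)"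
  have 1: "?\<alpha> \<in> Exps (wd k) (we k)" unfolding Exps_def using assms
    by (auto simp: if_distrib[of int] if_distrib[of "\<lambda>x. x * _"] cong: if_cong)
  have 2: "mon ?\<alpha> = (\<lambda>\<zeta> :: nat => 'k. \<zeta> k)"
  proof
    fix \<zeta> :: "nat => 'k"
    have "mon ?\<alpha> \<zeta> = (\<Prod>i<N. if i = k then \<zeta> k else 1)" unfolding mon_def by (rule prod.cong) auto
    thus "mon ?\<alpha> \<zeta> = \<zeta> k" using assms by simp
  qed
  show ?thesis unfolding 2[symmetric] by (rule CP_mon[OF 1])
qed

lemma CP_const: "(\<lambda>\<zeta>. c) \<in> CP 0 0"
proof -
  have "(\<lambda>_. 0) \<in> Exps 0 0" by (simp add: Exps_def)
  from fs.subspace_scale[OF CP_subspace CP_mon[OF this], of c] show ?thesis by (simp add: mon_def)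
qed

lemma CP_pullback: "biform n s d e F ==> (\<lambda>\<zeta>. F (px \<zeta>) (py \<zeta>)) \<in> CP (int d) (int e)"
proof (induction rule: biform.induct)
  case (const c)
  show ?case using CP_const by simp
next
  case (coord_x i)
  show ?case
  proof (cases "i \<le> s")
    case True
    have "(\<lambda>\<zeta>. \<zeta> 0 * \<zeta> (r + 1 + i)) \<in> CP (int 1) (int 0)"
      by (rule CP_mult[OF CP_coord CP_coord]) (use True in \<open>auto simp: wd_def we_def\<close>)
    thus ?thesis using True by (simp add: px_def)
  next
    case False
    have "(\<lambda>\<zeta>. \<zeta> (i - s)) \<in> CP (wd (i - s)) (we (i - s))" by (rule CP_coord) (use coord_x in simp)
    moreover have "i - s \<le> r" "i - s \<noteq> 0" using False coord_x by auto
    ultimately show ?thesis using False coord_x by (simp add: px_def wd_def we_def)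
  qed
next
  case (coord_y j)
  have "(\<lambda>\<zeta>. \<zeta> (r + 1 + j)) \<in> CP (wd (r + 1 + j)) (we (r + 1 + j))" by (rule CP_coord) (use coord_y in simp)
  thus ?case using coord_y by (simp add: py_def wd_def we_def)
next
  case (add d e F G)
  from fs.subspace_add[OF CP_subspace add.IH] show ?case by (simp add: plus_fun_def)
next
  case (mult d e F d' e' G)
  show ?case by (rule CP_mult[OF mult.IH]) auto
qed

lemma CP_expand:
  assumes "f \<in> CP d e"
  obtains c where "f = (\<lambda>\<zeta>. \<Sum>\<alpha>\<in>Exps d e. c \<alpha> * mon \<alpha> \<zeta>)"
proof -
  have "\<exists>c. f = (\<lambda>\<zeta>. \<Sum>\<alpha>\<in>Exps d e. c \<alpha> * mon \<alpha> \<zeta>)" using assms unfolding CP_def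
  proof (induction rule: fs.span_induct_alt)
    case base
    show ?case by (intro exI[of _ "\<lambda>_. 0"]) (simp add: zero_fun_def)
  next
    case (step c t v)
    obtain \<beta> where \<beta>: "\<beta> \<in> Exps d e" "t = mon \<beta>" using step(1) by blast
    obtain c' where c': "v = (\<lambda>\<zeta>. \<Sum>\<alpha>\<in>Exps d e. c' \<alpha> * mon \<alpha> \<zeta>)" using step(2) by blast
    show ?case
    proof (intro exI ext)
      fix \<zeta>
      have "(\<Sum>\<alpha>\<in>Exps d e. (c' \<alpha> + (if \<alpha> = \<beta> then c else 0)) * mon \<alpha> \<zeta>) =
        (\<Sum>\<alpha>\<in>Exps d e. c' \<alpha> * mon \<alpha> \<zeta> + (if \<alpha> = \<beta> then c * mon \<beta> \<zeta> else 0))"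
        by (rule sum.cong) (auto simp: algebra_simps)
      also have "\<dots> = v \<zeta> + c * t \<zeta>" using \<beta> finite_Exps by (simp add: sum.distrib c')
      finally show "((\<lambda>x. c * t x) + v) \<zeta> =
          (\<Sum>\<alpha>\<in>Exps d e. (c' \<alpha> + (if \<alpha> = \<beta> then c else 0)) * mon \<alpha> \<zeta>)" by simp
    qed
  qed
  thus ?thesis using that by blast
qed

lemma CP_zero:
  fixes f :: "(nat => 'k::field_char_0) => 'k"
  assumes f: "f \<in> CP d e" and z: "\<And>\<zeta>. (\<forall>k<N. \<zeta> k \<noteq> 0) ==> f \<zeta> = 0"
  shows "f \<zeta> = 0"
proof -
  obtain c where c: "f = (\<lambda>\<zeta>. \<Sum>\<alpha>\<in>Exps d e. c \<alpha> * mon \<alpha> \<zeta>)" using CP_expand[OF f] by blast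
  have "\<forall>\<alpha>\<in>Exps d e. c \<alpha> = 0" by (rule monomials_independent[OF finite_Exps, where N = "N"])
      (use z in \<open>auto simp: c mon_def Exps_def\<close>)
  thus ?thesis by (simp add: c)
qed

lemma mon_scale:
  assumes "\<alpha> \<in> Exps d e" "l \<noteq> 0" "m \<noteq> 0"
    and "\<And>k. k < N ==> \<zeta>' k = (l ^ nat (wd k) * m powi we k) * \<zeta> k"
  shows "mon \<alpha> \<zeta>' = l powi d * m powi e * mon \<alpha> \<zeta>"
proof -
  have P: "(\<Prod>k\<in>K. l powi (int (\<alpha> k) * wd k)) = l powi (\<Sum>k\<in>K. int (\<alpha> k) * wd k)" if "finite K" for K
    using that by (induction K rule: finite_induct) (simp_all add: power_int_add assms(2))
  have Q: "(\<Prod>k\<in>K. m powi (int (\<alpha> k) * we k)) = m powi (\<Sum>k\<in>K. int (\<alpha> k) * we k)" if "finite K" for K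
    using that by (induction K rule: finite_induct) (simp_all add: power_int_add assms(3))
  have "mon \<alpha> \<zeta>' = (\<Prod>k<N. l powi (int (\<alpha> k) * wd k) * m powi (int (\<alpha> k) * we k) * \<zeta> k ^ \<alpha> k)"
    unfolding mon_def
  proof (rule prod.cong[OF refl])
    fix k assume "k \<in> {..<N}"
    hence "\<zeta>' k ^ \<alpha> k = (l ^ nat (wd k)) ^ \<alpha> k * (m powi we k) ^ \<alpha> k * \<zeta> k ^ \<alpha> k"
      using assms(4) by (simp add: power_mult_distrib)
    moreover have "(l ^ nat (wd k)) ^ \<alpha> k = l powi (int (\<alpha> k) * wd k)" by (simp add: wd_def)
    moreover have "(m powi we k) ^ \<alpha> k = m powi (int (\<alpha> k) * we k)"
      by (simp add: power_int_power' mult.commute)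
    ultimately show "\<zeta>' k ^ \<alpha> k = l powi (int (\<alpha> k) * wd k) * m powi (int (\<alpha> k) * we k) * \<zeta> k ^ \<alpha> k"
      by simp
  qed
  also have "\<dots> = l powi d * m powi e * mon \<alpha> \<zeta>"
  proof -
    have D: "(\<Sum>k<N. int (\<alpha> k) * wd k) = d" and E: "(\<Sum>k<N. int (\<alpha> k) * we k) = e"
      using assms(1) unfolding Exps_def by blast+
    show ?thesis unfolding prod.distrib P[OF finite_lessThan] Q[OF finite_lessThan] D E mon_def ..
  qed
  finally show ?thesis .
qed

lemma CP_scale:
  assumes f: "f \<in> CP d e" and "l \<noteq> 0" "m \<noteq> 0"
    and "\<And>k. k < N ==> \<zeta>' k = (l ^ nat (wd k) * m powi we k) * \<zeta> k"
  shows "f \<zeta>' = l powi d * m powi e * f \<zeta>"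
proof -
  obtain c where c: "f = (\<lambda>\<zeta>. \<Sum>\<alpha>\<in>Exps d e. c \<alpha> * mon \<alpha> \<zeta>)" using CP_expand[OF f] by blast
  have "(\<Sum>\<alpha>\<in>Exps d e. c \<alpha> * mon \<alpha> \<zeta>') = (\<Sum>\<alpha>\<in>Exps d e. l powi d * m powi e * (c \<alpha> * mon \<alpha> \<zeta>))"
    by (rule sum.cong) (simp_all add: mon_scale[OF _ assms(2-4)])
  thus ?thesis by (simp add: c sum_distrib_left)
qed

text \<open>In \<open>cc q 0\<close> the index \<open>jy q\<close> varies with \<open>q\<close>. On
  \<open>PE\<close> the ratio does not depend on it, so near \<open>p\<close> it is the quotient of
  the coordinates with the fixed index \<open>jy p\<close>.\<close>

lemma cc_tw:
  assumes "k < N"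
  shows "tw n s (PE r s) (wd k) (we k) (\<lambda>q. cc q k)"
proof -
  consider "k = 0" | "0 < k" "k \<le> r" | "r < k" by linarith
  thus ?thesis
  proof cases
    case 1
    show ?thesis unfolding 1
    proof (rule twI)
      fix p :: "'a pt" assume p: "p \<in> PE r s"
      hence pX: "p \<in> biproj n s" using PE_sub by blast
      note j = jy_nonzero[OF pX]
      show "\<exists>F G d1 e1 d2 e2. tw_at n s (PE r s) (wd 0) (we 0) (\<lambda>q. cc q 0) p F G d1 e1 d2 e2"
        unfolding tw_at_def
      proof (intro exI conjI ballI)
        show "biform n s 1 0 (\<lambda>x y. x (jy p))" by (rule biform.coord_x) (use j in simp)
        show "biform n s 0 1 (\<lambda>x y. y (jy p))" by (rule biform.coord_y) (use j in simp)
        show "form_at (\<lambda>x y. y (jy p)) p \<noteq> 0" using j by simp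
        fix q :: "'a pt" assume q: "q \<in> PE r s"
        have "xc q (jy p) = cc q 0 * cc q (r + 1 + jy p)"
          using fun_cong[OF cc_spec(1)[OF q], of "jy p"] j(1) by (simp add: px_def)
        moreover have "yc q (jy p) = cc q (r + 1 + jy p)"
          using fun_cong[OF cc_spec(2)[OF q], of "jy p"] j(1) by (simp add: py_def)
        ultimately show "form_at (\<lambda>x y. y (jy p)) q * cc q 0 = form_at (\<lambda>x y. x (jy p)) q"
          by (simp add: mult.commute)
      qed (simp_all add: wd_def we_def)
    qed
  next
    case 2
    have "tw n s (PE r s) 1 0 (\<lambda>q. xc q (s + k))" by (rule tw_x) (use 2 in simp)
    thus ?thesis using 2 by (simp add: cc_def wd_def we_def)
  next
    case 3
    have "tw n s (PE r s) 0 1 (\<lambda>q. yc q (k - r - 1))" by (rule tw_y) (use 3 assms in simp)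
    thus ?thesis using 3 assms by (simp add: cc_def wd_def we_def)
  qed
qed

lemma mon_tw:
  assumes "\<alpha> \<in> Exps d e"
  shows "tw n s (PE r s) d e (\<lambda>q. mon \<alpha> (cc q))"
proof -
  have "tw n s (PE r s) (\<Sum>k\<in>{..<N}. int (\<alpha> k) * wd k) (\<Sum>k\<in>{..<N}. int (\<alpha> k) * we k)
    (\<lambda>q. \<Prod>k\<in>{..<N}. cc q k ^ \<alpha> k)"
  proof (rule tw_prod)
    fix k assume "k \<in> {..<N}"
    hence "k < N" by simp
    from tw_power[OF cc_tw[OF this]]
    show "tw n s (PE r s) (int (\<alpha> k) * wd k) (int (\<alpha> k) * we k) (\<lambda>q. cc q k ^ \<alpha> k)" .
  qed simp
  moreover have "(\<Sum>k<N. int (\<alpha> k) * wd k) = d" "(\<Sum>k<N. int (\<alpha> k) * we k) = e"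
    using assms unfolding Exps_def by blast+
  ultimately show ?thesis unfolding mon_def by simp
qed

lemma CP_tw:
  assumes "f \<in> CP d e"
  shows "tw n s (PE r s) d e (\<lambda>q. f (cc q))"
proof -
  obtain c where c: "f = (\<lambda>\<zeta>. \<Sum>\<alpha>\<in>Exps d e. c \<alpha> * mon \<alpha> \<zeta>)" using CP_expand[OF assms] by blast
  show ?thesis unfolding c by (rule tw_sum[OF PE_sub]) (intro tw_scale mon_tw)
qed

lemma form_at_cc: "q \<in> PE r s ==> form_at F q = F (px (cc q)) (py (cc q))"
  by (simp add: form_at_def cc_spec)

lemma nonzero_good: "(\<forall>k<N. \<zeta> k \<noteq> 0) ==> good \<zeta>" unfolding good_def by (intro conjI exI[of _ 0]) auto

lemma pnt_nonzero:
  assumes "\<forall>k<N. \<zeta> k \<noteq> 0"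
  shows "\<forall>k<N. cc (pnt \<zeta>) k \<noteq> 0"
proof -
  obtain l m where "l \<noteq> 0" "m \<noteq> 0" "\<forall>k<N. cc (pnt \<zeta>) k = (l ^ nat (wd k) * m powi we k) * \<zeta> k"
    using pnt_spec(2)[OF nonzero_good[OF assms]] by blast
  thus ?thesis using assms by simp
qed

text \<open>A vector with nonzero entries defines a point of \<open>PE\<close> whose Cox coordinates
  are again nonzero, and \<open>f\<close> changes only by a nonzero factor, so
  \<open>CP_zero\<close> applies.\<close>

lemma CP_zero_on_PE:
  fixes f :: "(nat => 'k::field_char_0) => 'k"
  assumes f: "f \<in> CP d e" and z: "\<And>q. q \<in> PE r s ==> (\<forall>k<N. cc q k \<noteq> 0) ==> f (cc q) = 0"
  shows "f \<zeta> = 0"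
proof (rule CP_zero[OF f])
  fix \<zeta> :: "nat => 'k" assume n: "\<forall>k<N. \<zeta> k \<noteq> 0"
  obtain l m where lm: "l \<noteq> 0" "m \<noteq> 0" "\<forall>k<N. cc (pnt \<zeta>) k = (l ^ nat (wd k) * m powi we k) * \<zeta> k"
    using pnt_spec(2)[OF nonzero_good[OF n]] by blast
  have "f (cc (pnt \<zeta>)) = l powi d * m powi e * f \<zeta>"
    by (rule CP_scale[OF f lm(1,2)]) (use lm(3) in blast)
  moreover have "f (cc (pnt \<zeta>)) = 0" by (rule z[OF pnt_spec(1)[OF nonzero_good[OF n]] pnt_nonzero[OF n]])
  ultimately show "f \<zeta> = 0" using lm(1,2) by simp
qed

lemma form_zero_on_PE:
  fixes F :: "(nat => 'k::field_char_0) => (nat => 'k) => 'k"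
  assumes F: "biform n s d e F"
    and z: "\<And>q. q \<in> PE r s ==> (\<forall>k<N. cc q k \<noteq> 0) ==> form_at F q = 0"
  shows "q \<in> PE r s ==> form_at F q = 0"
  using CP_zero_on_PE[OF CP_pullback[OF F], of "cc q"] z form_at_cc by metis

text \<open>Identity principle: the points with nonzero Cox coordinates are dense in
  \<open>PE\<close>. Multiplying the numerator of \<open>h\<close> by a form that vanishes off
  \<open>U\<close> gives a form that vanishes at all these points.\<close>

lemma tw_zero_dense:
  fixes h :: "'k::field_char_0 pt => 'k"
  assumes U: "zopen n s U" and h: "tw n s (PE r s \<inter> U) d e h"
    and z: "\<And>q. q \<in> PE r s \<inter> U ==> (\<forall>k<N. cc q k \<noteq> 0) ==> h q = 0"
    and p: "p \<in> PE r s \<inter> U"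
  shows "h p = 0"
proof -
  from twD[OF h p] obtain F G d1 e1 d2 e2 where "tw_at n s (PE r s \<inter> U) d e h p F G d1 e1 d2 e2"
    by blast
  note F = tw_atD(1,5,6)[OF this]
  have "p \<in> U" using p by blast
  from zopen_separate[OF U this] obtain H d0 e0 where H: "biform n s d0 e0 H" "form_at H p \<noteq> 0"
    "\<forall>q\<in>biproj n s - U. form_at H q = 0" by blast
  have "form_at (\<lambda>x y. H x y * F x y) p = 0"
  proof (rule form_zero_on_PE[OF biform.mult[OF H(1) F(1)]])
    fix q :: "'k pt" assume q: "q \<in> PE r s" "\<forall>k<N. cc q k \<noteq> 0"
    show "form_at (\<lambda>x y. H x y * F x y) q = 0"
    proof (cases "q \<in> U")
      case True
      hence "h q = 0" using z q by blast
      hence "form_at F q = 0" using F(3) q(1) True by (metis IntI mult_zero_right)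
      thus ?thesis by simp
    next
      case False
      hence "form_at H q = 0" using H(3) q(1) PE_sub by blast
      thus ?thesis by simp
    qed
  qed (use p in blast)
  hence "form_at F p = 0" using H(2) by simp
  thus ?thesis using F(2,3) p by (metis mult_eq_0_iff)
qed


text \<open>Monomials are independent on the torus, so the exponent \<open>\<alpha> + u\<close>
  occurring on the left must occur as \<open>\<beta> + w\<close> on the right.\<close>

lemma monomial_divides:
  fixes a b :: "(nat => nat) => 'k::field_char_0"
  assumes S: "finite S" "\<And>\<alpha> k. \<alpha> \<in> S ==> k \<ge> N ==> \<alpha> k = 0"
    and S': "finite S'" "\<And>\<alpha> k. \<alpha> \<in> S' ==> k \<ge> N ==> \<alpha> k = 0"
    and uw: "\<And>k. k \<ge> N ==> u k = 0" "\<And>k. k \<ge> N ==> w k = 0"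
    and eq: "\<And>\<zeta>. (\<forall>k<N. \<zeta> k \<noteq> 0) ==>
      mon u \<zeta> * (\<Sum>\<alpha>\<in>S. a \<alpha> * mon \<alpha> \<zeta>) = mon w \<zeta> * (\<Sum>\<alpha>\<in>S'. b \<alpha> * mon \<alpha> \<zeta>)"
    and \<alpha>: "\<alpha> \<in> S" "a \<alpha> \<noteq> 0"
  shows "w k \<le> \<alpha> k + u k"
proof -
  let ?pu = "\<lambda>\<alpha> k. \<alpha> k + u k" and ?pw = "\<lambda>\<alpha> k. \<alpha> k + w k"
  let ?mu = "\<lambda>\<gamma> k. \<gamma> k - u k" and ?mw = "\<lambda>\<gamma> k. \<gamma> k - w k"
  define T where "T = ?pu ` S \<union> ?pw ` S'"
  have finT: "finite T" unfolding T_def using S(1) S'(1) by simp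
  define c where "c \<gamma> = (if \<gamma> \<in> ?pu ` S then a (?mu \<gamma>) else 0) - (if \<gamma> \<in> ?pw ` S' then b (?mw \<gamma>) else 0)" for \<gamma>
  have inj: "inj_on (\<lambda>\<alpha> k. \<alpha> k + v k) R" for v :: "nat => nat" and R
    by (rule inj_onI) (auto simp: fun_eq_iff)
  have sum1: "(\<Sum>\<gamma>\<in>T. (if \<gamma> \<in> (\<lambda>\<alpha> k. \<alpha> k + v k) ` R then x (\<lambda>k. \<gamma> k - v k) else 0) * mon \<gamma> \<zeta>) =
      mon v \<zeta> * (\<Sum>\<alpha>\<in>R. x \<alpha> * mon \<alpha> \<zeta>)" if "(\<lambda>\<alpha> k. \<alpha> k + v k) ` R \<subseteq> T"
      for v R and x :: "(nat => nat) => 'k" and \<zeta>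
  proof -
    have "(\<Sum>\<gamma>\<in>T. (if \<gamma> \<in> (\<lambda>\<alpha> k. \<alpha> k + v k) ` R then x (\<lambda>k. \<gamma> k - v k) else 0) * mon \<gamma> \<zeta>) =
       (\<Sum>\<gamma>\<in>T. if \<gamma> \<in> (\<lambda>\<alpha> k. \<alpha> k + v k) ` R then x (\<lambda>k. \<gamma> k - v k) * mon \<gamma> \<zeta> else 0)"
      by (rule sum.cong) auto
    also have "\<dots> = (\<Sum>\<gamma>\<in>T \<inter> (\<lambda>\<alpha> k. \<alpha> k + v k) ` R. x (\<lambda>k. \<gamma> k - v k) * mon \<gamma> \<zeta>)"
      by (rule sum.inter_restrict[OF finT, symmetric])
    also have "T \<inter> (\<lambda>\<alpha> k. \<alpha> k + v k) ` R = (\<lambda>\<alpha> k. \<alpha> k + v k) ` R" using that by blast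
    also have "(\<Sum>\<gamma>\<in>(\<lambda>\<alpha> k. \<alpha> k + v k) ` R. x (\<lambda>k. \<gamma> k - v k) * mon \<gamma> \<zeta>) =
        (\<Sum>\<alpha>\<in>R. x \<alpha> * mon (\<lambda>k. \<alpha> k + v k) \<zeta>)" by (subst sum.reindex[OF inj]) simp
    also have "\<dots> = mon v \<zeta> * (\<Sum>\<alpha>\<in>R. x \<alpha> * mon \<alpha> \<zeta>)"
      unfolding sum_distrib_left by (rule sum.cong) (simp_all add: mon_mult[symmetric] ac_simps)
    finally show ?thesis .
  qed
  have "\<forall>\<gamma>\<in>T. c \<gamma> = 0"
  proof (rule monomials_independent[OF finT])
    fix \<gamma> k assume "\<gamma> \<in> T" "N \<le> k"
    thus "\<gamma> k = 0" unfolding T_def using S(2) S'(2) uw by auto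
  next
    fix \<zeta> :: "nat => 'k" assume z: "\<forall>k<N. \<zeta> k \<noteq> 0"
    have "(\<Sum>\<gamma>\<in>T. c \<gamma> * mon \<gamma> \<zeta>) = (\<Sum>\<gamma>\<in>T. (if \<gamma> \<in> ?pu ` S then a (?mu \<gamma>) else 0) * mon \<gamma> \<zeta>) -
       (\<Sum>\<gamma>\<in>T. (if \<gamma> \<in> ?pw ` S' then b (?mw \<gamma>) else 0) * mon \<gamma> \<zeta>)"
      unfolding c_def by (simp add: sum_subtractf left_diff_distrib)
    also have "\<dots> = 0" using sum1[of u S a \<zeta>] sum1[of w S' b \<zeta>] eq[OF z] by (simp add: T_def)
    finally show "(\<Sum>\<gamma>\<in>T. c \<gamma> * (\<Prod>k<N. \<zeta> k ^ \<gamma> k)) = 0" by (simp add: mon_def)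
  qed
  moreover have mem: "?pu \<alpha> \<in> ?pu ` S" using \<alpha>(1) by blast
  ultimately have "c (?pu \<alpha>) = 0" unfolding T_def by blast
  hence "?pu \<alpha> \<in> ?pw ` S'" using mem \<alpha>(2) unfolding c_def by (auto split: if_splits)
  then obtain \<beta> where "?pu \<alpha> = ?pw \<beta>" by blast
  from fun_cong[OF this, of k] show ?thesis by simp
qed

text \<open>By \<open>serre\<close>, \<open>f\<close> becomes a Cox polynomial after multiplication
  by either of two monomials. These share no Cox coordinate, so in
  \<open>mon u * A = mon w * B\<close> the monomial \<open>mon w\<close> must divide
  \<open>A\<close>, and the quotient represents \<open>f\<close>.\<close>

lemma sections_PE:
  fixes f :: "'k::{alg_closed_field,field_char_0} pt => 'k"
  assumes f: "tw n s (PE r s) d e f"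
  shows "\<exists>g\<in>CP d e. \<forall>q\<in>PE r s. f q = g (cc q)"
proof -
  from serre[OF PE_closed f] obtain m where S: "0 \<le> int m + d" "0 \<le> int m + e"
    "\<And>F. biform n s m m F ==> \<exists>G. biform n s (nat (int m + d)) (nat (int m + e)) G \<and>
       (\<forall>p\<in>PE r s. form_at F p * f p = form_at G p)" by blast
  \<comment> \<open>In Cox coordinates this form is
    \<open>\<zeta> 1 ^ m * \<zeta> (r + 1) ^ m\<close>, and the second one is
    \<open>\<zeta> 0 ^ m * \<zeta> (r + 2) ^ (2 * m)\<close>. The indices exist because
    \<open>r\<close> and \<open>s\<close> are positive.\<close>
  have "biform n s m m (\<lambda>x y. x (s + 1) ^ m * y 0 ^ m)" by (rule biform_coords) (use r1 in auto)
  from S(3)[OF this] obtain G1 where G1: "biform n s (nat (int m + d)) (nat (int m + e)) G1"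
    "\<forall>p\<in>PE r s. form_at (\<lambda>x y. x (s + 1) ^ m * y 0 ^ m) p * f p = form_at G1 p" by blast
  have "biform n s m m (\<lambda>x y. x 1 ^ m * y 1 ^ m)" by (rule biform_coords) (use s1 in auto)
  from S(3)[OF this] obtain G2 where G2: "biform n s (nat (int m + d)) (nat (int m + e)) G2"
    "\<forall>p\<in>PE r s. form_at (\<lambda>x y. x 1 ^ m * y 1 ^ m) p * f p = form_at G2 p" by blast
  define A where "A = (\<lambda>\<zeta>. G1 (px \<zeta>) (py \<zeta>))"
  define B where "B = (\<lambda>\<zeta>. G2 (px \<zeta>) (py \<zeta>))"
  have A: "A \<in> CP (int m + d) (int m + e)" using CP_pullback[OF G1(1)] S(1,2) by (simp add: A_def)
  have B: "B \<in> CP (int m + d) (int m + e)" using CP_pullback[OF G2(1)] S(1,2) by (simp add: B_def)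
  define u where "u k = (if k = 0 then m else if k = r + 2 then 2 * m else 0)" for k :: nat
  define w where "w k = (if k = 1 then m else if k = r + 1 then m else 0)" for k :: nat
  have pick2: "(\<Prod>k<N. h k) = h i * h j" if "i < N" "j < N" "i \<noteq> j"
    "\<And>k. k \<noteq> i ==> k \<noteq> j ==> h k = 1" for i j and h :: "nat => 'k"
  proof -
    have "(\<Prod>k<N. h k) = (\<Prod>k\<in>{i, j}. h k)" by (rule prod.mono_neutral_right) (use that in auto)
    thus ?thesis using that by simp
  qed
  have mu: "mon u \<zeta> = \<zeta> 0 ^ m * \<zeta> (r + 2) ^ (2 * m)" for \<zeta> :: "nat => 'k"
    unfolding mon_def by (subst pick2[of 0 "r + 2"]) (use s1 in \<open>auto simp: u_def\<close>)
  have mw: "mon w \<zeta> = \<zeta> 1 ^ m * \<zeta> (r + 1) ^ m" for \<zeta> :: "nat => 'k"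
    unfolding mon_def by (subst pick2[of 1 "r + 1"]) (use r1 in \<open>auto simp: w_def\<close>)
  have u0: "u k = 0" "w k = 0" if "k \<ge> N" for k using that s1 r1 by (auto simp: u_def w_def)
  have A_f: "mon w (cc q) * f q = A (cc q)" if q: "q \<in> PE r s" for q
  proof -
    have eq: "form_at (\<lambda>x y. x (s + 1) ^ m * y 0 ^ m) q = mon w (cc q)"
      unfolding form_at_cc[OF q] mw using r1 by (simp add: px_def py_def)
    show ?thesis using bspec[OF G1(2) q] unfolding eq A_def form_at_cc[OF q, of G1] .
  qed
  have B_f: "mon u (cc q) * f q = B (cc q)" if q: "q \<in> PE r s" for q
  proof -
    have eq: "form_at (\<lambda>x y. x 1 ^ m * y 1 ^ m) q = mon u (cc q)"
      unfolding form_at_cc[OF q] mu using s1 by (simp add: px_def py_def power_mult_distrib power_mult power2_eq_square)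
    show ?thesis using bspec[OF G2(2) q] unfolding eq B_def form_at_cc[OF q, of G2] .
  qed
  obtain d1 e1 where u_Exps: "u \<in> Exps d1 e1" using u0 by (auto simp: Exps_def)
  have pick2s: "(\<Sum>k<N. h k) = h i + h j" if "i < N" "j < N" "i \<noteq> j"
    "\<And>k. k \<noteq> i ==> k \<noteq> j ==> h k = 0" for i j and h :: "nat => int"
  proof -
    have "(\<Sum>k<N. h k) = (\<Sum>k\<in>{i, j}. h k)" by (rule sum.mono_neutral_right) (use that in auto)
    thus ?thesis using that by simp
  qed
  have wsum: "(\<Sum>k<N. int (w k) * wd k) = int m" "(\<Sum>k<N. int (w k) * we k) = int m"
    by (subst pick2s[of 1 "r + 1"]; use r1 in \<open>auto simp: w_def wd_def we_def\<close>)+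
  have w_Exps: "w \<in> Exps (int m) (int m)" using u0 wsum by (simp add: Exps_def)
  have \<open>d1 = (\<Sum>k<N. int (u k) * wd k)\<close> \<open>e1 = (\<Sum>k<N. int (u k) * we k)\<close>
    using u_Exps by (auto simp: Exps_def)
  have usum: "d1 = int m" "e1 = int m" unfolding \<open>d1 = _\<close> \<open>e1 = _\<close>
    by (subst pick2s[of 0 "r + 2"]; use s1 in \<open>auto simp: u_def wd_def we_def\<close>)+
  have dif: "(\<lambda>\<zeta>. mon u \<zeta> * A \<zeta> - mon w \<zeta> * B \<zeta>) \<in> CP (int m + (int m + d)) (int m + (int m + e))"
  proof -
    have "(\<lambda>\<zeta>. mon u \<zeta> * A \<zeta>) \<in> CP (int m + (int m + d)) (int m + (int m + e))"
      by (rule CP_mult[OF CP_mon[OF u_Exps] A]) (simp_all add: usum)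
    moreover have "(\<lambda>\<zeta>. mon w \<zeta> * B \<zeta>) \<in> CP (int m + (int m + d)) (int m + (int m + e))"
      by (rule CP_mult[OF CP_mon[OF w_Exps] B]) simp_all
    ultimately have "(\<lambda>\<zeta>. mon u \<zeta> * A \<zeta>) - (\<lambda>\<zeta>. mon w \<zeta> * B \<zeta>) \<in> CP (int m + (int m + d)) (int m + (int m + e))"
      by (rule fs.subspace_diff[OF CP_subspace])
    thus ?thesis by (simp add: fun_diff_def)
  qed
  have eq: "mon u \<zeta> * A \<zeta> = mon w \<zeta> * B \<zeta>" for \<zeta>
  proof -
    have "mon u \<zeta> * A \<zeta> - mon w \<zeta> * B \<zeta> = 0"
    proof (rule CP_zero_on_PE[OF dif])
      fix q :: "'k pt" assume q: "q \<in> PE r s"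
      show "mon u (cc q) * A (cc q) - mon w (cc q) * B (cc q) = 0"
        unfolding A_f[OF q, symmetric] B_f[OF q, symmetric] by simp
    qed
    thus ?thesis by simp
  qed
  obtain a where a: "A = (\<lambda>\<zeta>. \<Sum>\<alpha>\<in>Exps (int m + d) (int m + e). a \<alpha> * mon \<alpha> \<zeta>)" by (rule CP_expand[OF A])
  obtain b where b: "B = (\<lambda>\<zeta>. \<Sum>\<alpha>\<in>Exps (int m + d) (int m + e). b \<alpha> * mon \<alpha> \<zeta>)" by (rule CP_expand[OF B])
  have div: "w k \<le> \<alpha> k" if \<alpha>: "\<alpha> \<in> Exps (int m + d) (int m + e)" "a \<alpha> \<noteq> 0" for \<alpha> k
  proof -
    have "w k \<le> \<alpha> k + u k"
    proof (rule monomial_divides[where S = "Exps (int m + d) (int m + e)" and S' = "Exps (int m + d) (int m + e)"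
        and a = a and b = b and u = u and w = w and k = k and \<alpha> = \<alpha>])
      show "finite (Exps (int m + d) (int m + e))" by (rule finite_Exps)
      show "finite (Exps (int m + d) (int m + e))" by (rule finite_Exps)
      show "\<And>\<alpha> k. \<alpha> \<in> Exps (int m + d) (int m + e) ==> N \<le> k ==> \<alpha> k = 0" by (simp add: Exps_def)
      show "\<And>\<alpha> k. \<alpha> \<in> Exps (int m + d) (int m + e) ==> N \<le> k ==> \<alpha> k = 0" by (simp add: Exps_def)
      fix \<zeta> :: "nat => 'k"
      show "mon u \<zeta> * (\<Sum>\<alpha>\<in>Exps (int m + d) (int m + e). a \<alpha> * mon \<alpha> \<zeta>) =
          mon w \<zeta> * (\<Sum>\<alpha>\<in>Exps (int m + d) (int m + e). b \<alpha> * mon \<alpha> \<zeta>)" using eq[of \<zeta>] unfolding a b .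
    qed (use u0 \<alpha> in auto)
    moreover have "w k = 0 \<or> u k = 0" using r1 by (auto simp: u_def w_def)
    ultimately show ?thesis by auto
  qed
  define g where "g = (\<lambda>\<zeta>. \<Sum>\<alpha>\<in>{\<alpha>\<in>Exps (int m + d) (int m + e). a \<alpha> \<noteq> 0}. a \<alpha> * mon (\<lambda>k. \<alpha> k - w k) \<zeta>)"
  have g: "g \<in> CP d e" unfolding g_def
  proof (rule fs_subspace_sum[OF CP_subspace], rule CP_mon)
    fix \<alpha> assume \<alpha>: "\<alpha> \<in> {\<alpha>\<in>Exps (int m + d) (int m + e). a \<alpha> \<noteq> 0}"
    have int: "int (\<alpha> k - w k) = int (\<alpha> k) - int (w k)" for k using div \<alpha> by (simp add: of_nat_diff)
    have "(\<Sum>k<N. int (\<alpha> k) * wd k) = int m + d" "(\<Sum>k<N. int (\<alpha> k) * we k) = int m + e"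
      using \<alpha> unfolding Exps_def by blast+
    hence "(\<Sum>k<N. int (\<alpha> k - w k) * wd k) = d" "(\<Sum>k<N. int (\<alpha> k - w k) * we k) = e"
      unfolding int left_diff_distrib sum_subtractf using wsum by auto
    thus "(\<lambda>k. \<alpha> k - w k) \<in> Exps d e" using \<alpha> unfolding Exps_def by auto
  qed
  have wg: "mon w \<zeta> * g \<zeta> = A \<zeta>" for \<zeta>
  proof -
    have "mon w \<zeta> * g \<zeta> = (\<Sum>\<alpha>\<in>{\<alpha>\<in>Exps (int m + d) (int m + e). a \<alpha> \<noteq> 0}. a \<alpha> * mon \<alpha> \<zeta>)"
      unfolding g_def sum_distrib_left
    proof (rule sum.cong[OF refl])
      fix \<alpha> assume \<alpha>: "\<alpha> \<in> {\<alpha>\<in>Exps (int m + d) (int m + e). a \<alpha> \<noteq> 0}"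
      have "(\<lambda>k. w k + (\<alpha> k - w k)) = \<alpha>" using div \<alpha> by (auto simp: fun_eq_iff)
      hence "mon w \<zeta> * mon (\<lambda>k. \<alpha> k - w k) \<zeta> = mon \<alpha> \<zeta>" by (simp add: mon_mult)
      thus "mon w \<zeta> * (a \<alpha> * mon (\<lambda>k. \<alpha> k - w k) \<zeta>) = a \<alpha> * mon \<alpha> \<zeta>" by (simp add: mult.left_commute)
    qed
    also have "\<dots> = A \<zeta>" unfolding a by (rule sum.mono_neutral_left) (use finite_Exps in auto)
    finally show ?thesis .
  qed
  have twd: "tw n s (PE r s \<inter> biproj n s) d e (\<lambda>q. f q + (-1) * g (cc q))"
    by (rule tw_subset[OF tw_add[OF f tw_scale[OF CP_tw[OF g]]]]) blast
  have "f q = g (cc q)" if q: "q \<in> PE r s" for q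
  proof -
    have "f q + (-1) * g (cc q) = 0"
    proof (rule tw_zero_dense[OF zopen_biproj twd])
      fix q :: "'k pt" assume q: "q \<in> PE r s \<inter> biproj n s" "\<forall>k<N. cc q k \<noteq> 0"
      have "mon w (cc q) \<noteq> 0" unfolding mw using q(2) r1 by auto
      moreover have "mon w (cc q) * f q = mon w (cc q) * g (cc q)" using A_f wg q(1) by simp
      ultimately show "f q + (-1) * g (cc q) = 0" by simp
    qed (use q PE_sub in blast)
    thus ?thesis by simp
  qed
  thus ?thesis using g by blast
qed

lemma mon_inj: "inj_on (mon :: _ => (nat => 'k::field_char_0) => 'k) (Exps d e)"
proof (rule inj_onI, rule ccontr)
  fix \<alpha> \<beta> assume ab: "\<alpha> \<in> Exps d e" "\<beta> \<in> Exps d e" "(mon \<alpha> :: (nat => 'k) => 'k) = mon \<beta>" "\<alpha> \<noteq> \<beta>"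
  let ?c = "\<lambda>\<gamma>. (if \<gamma> = \<alpha> then 1 else -1) :: 'k"
  have "\<forall>\<gamma>\<in>{\<alpha>, \<beta>}. ?c \<gamma> = 0"
  proof (rule monomials_independent[where N = "N"])
    fix \<zeta> :: "nat => 'k"
    have "(\<Sum>\<gamma>\<in>{\<alpha>, \<beta>}. ?c \<gamma> * mon \<gamma> \<zeta>) = 0" using ab(3,4) by simp
    thus "(\<Sum>\<gamma>\<in>{\<alpha>, \<beta>}. ?c \<gamma> * (\<Prod>k<N. \<zeta> k ^ \<gamma> k)) = 0" by (simp add: mon_def)
  qed (use ab in \<open>auto simp: Exps_def\<close>)
  hence "?c \<alpha> = 0" by blast
  thus False by simp
qed

lemma dim_CP: "fin_dim (CP d e :: ((nat => 'k::field_char_0) => 'k) set)"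
  "fs.dim (CP d e :: ((nat => 'k::field_char_0) => 'k) set) = card (Exps d e)"
proof -
  let ?B = "mon ` Exps d e :: ((nat => 'k) => 'k) set"
  have fin: "finite ?B" using finite_Exps by simp
  show "fin_dim (CP d e :: ((nat => 'k::field_char_0) => 'k) set)"
    unfolding fin_dim_def CP_def by (intro exI[of _ ?B] conjI fin order_refl)
  have "fs.independent ?B"
  proof (rule notI)
    assume dep: "fs.dependent ?B"
    have "\<exists>u. (\<exists>v\<in>?B. u v \<noteq> 0) \<and> (\<lambda>x. \<Sum>v\<in>?B. u v * v x) = (\<lambda>_. 0)"
      using dep unfolding fs_dependent_finite[OF fin] .
    then obtain u where u: "\<exists>v\<in>?B. u v \<noteq> 0" "(\<lambda>x. \<Sum>v\<in>?B. u v * v x) = (\<lambda>_. 0)" by (elim exE conjE)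
    have "\<forall>\<alpha>\<in>Exps d e. u (mon \<alpha>) = 0"
    proof (rule monomials_independent[OF finite_Exps, where N = "N"])
      fix \<zeta> :: "nat => 'k"
      have "(\<Sum>\<alpha>\<in>Exps d e. u (mon \<alpha>) * mon \<alpha> \<zeta>) = (\<Sum>v\<in>?B. u v * v \<zeta>)"
        by (simp add: sum.reindex[OF mon_inj])
      also have "\<dots> = 0" by (rule fun_cong[OF u(2)])
      finally show "(\<Sum>\<alpha>\<in>Exps d e. u (mon \<alpha>) * (\<Prod>k<N. \<zeta> k ^ \<alpha> k)) = 0" by (simp add: mon_def)
    qed (simp add: Exps_def)
    thus False using u(1) by blast
  qed
  from fs.dim_span_eq_card_independent[OF this]
  show "fs.dim (CP d e :: ((nat => 'k::field_char_0) => 'k) set) = card (Exps d e)"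
    unfolding CP_def by (simp add: card_image[OF mon_inj])
qed

text \<open>Composition with \<open>cc\<close> maps a graded piece of the Cox ring onto the sections
  by \<open>sections_PE\<close>, and injectively by \<open>CP_zero_on_PE\<close>.\<close>

lemma dim_V_PE:
  shows "fin_dim (V n s (PE r s :: 'k::{alg_closed_field,field_char_0} pt set) d e)"
    and "fs.dim (V n s (PE r s :: 'k pt set) d e) = card (Exps d e)"
proof -
  let ?X = "PE r s :: 'k pt set"
  define T where "T f q = (if q \<in> ?X then f (cc q) else (0::'k))" for f q
  have lin: "lin_on (CP d e) T" unfolding lin_on_def T_def by (auto simp: fun_eq_iff)
  have im: "T ` CP d e = V n s ?X d e"
  proof
    show "T ` CP d e \<subseteq> V n s ?X d e"
    proof
      fix f assume "f \<in> T ` CP d e"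
      then obtain g where g: "g \<in> CP d e" "f = T g" by blast
      have "tw n s ?X d e f \<longleftrightarrow> tw n s ?X d e (\<lambda>q. g (cc q))" by (rule tw_cong) (simp add: g(2) T_def)
      thus "f \<in> V n s ?X d e" using CP_tw[OF g(1)] unfolding V_def by (simp add: g(2) T_def)
    qed
    show "V n s ?X d e \<subseteq> T ` CP d e"
    proof
      fix f assume f: "f \<in> V n s ?X d e"
      hence "tw n s ?X d e f" by (simp add: V_def)
      from sections_PE[OF this] obtain g where g: "g \<in> CP d e" "\<forall>q\<in>?X. f q = g (cc q)" by blast
      have "f = T g"
      proof
        fix q
        have "f q = 0" if "q \<notin> ?X" using f that unfolding V_def by blast
        thus "f q = T g q" using g(2) by (simp add: T_def)
      qed
      thus "f \<in> T ` CP d e" using g(1) by blast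
    qed
  qed
  have inj: "f = (\<lambda>_. 0)" if f: "f \<in> CP d e" "T f = (\<lambda>_. 0)" for f
  proof
    fix \<zeta> show "f \<zeta> = 0"
    proof (rule CP_zero_on_PE[OF f(1)])
      fix q assume "q \<in> ?X"
      thus "f (cc q) = 0" using fun_cong[OF f(2), of q] by (simp add: T_def)
    qed
  qed
  note * = lin_on_dim[OF lin CP_subspace inj dim_CP(1), unfolded im]
  show "fin_dim (V n s ?X d e)" by (rule *(1))
  show "fs.dim (V n s ?X d e) = card (Exps d e)" using *(2) dim_CP(2) by simp
qed

end

section \<open>Counting Cox monomials and the Hilbert polynomial of the blow-up\<close>

lemma multiset_vandermonde:
  fixes p q :: real
  shows "(\<Sum>k\<le>n. ((of_nat k + p - 1) gchoose k) * ((of_nat (n - k) + q - 1) gchoose (n - k))) =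
    ((of_nat n + p + q - 1) gchoose n)"
proof -
  \<comment> \<open>Negating the upper index turns multiset coefficients into binomials at
    \<open>- p\<close> and \<open>- q\<close>, to which the Vandermonde convolution applies.\<close>
  have neg: "(- a gchoose k) = (-1) ^ k * ((of_nat k + a - 1) gchoose k)" for a :: real and k
    by (subst gbinomial_negated_upper) simp
  have "(-1) ^ n * (\<Sum>k\<le>n. ((of_nat k + p - 1) gchoose k) * ((of_nat (n - k) + q - 1) gchoose (n - k)))
    = (\<Sum>k\<le>n. (- p gchoose k) * (- q gchoose (n - k)))" unfolding sum_distrib_left
  proof (rule sum.cong[OF refl])
    fix k assume "k \<in> {..n}"
    hence "(-1::real) ^ n = (-1) ^ k * (-1) ^ (n - k)" by (simp flip: power_add)
    thus "(-1) ^ n * (((of_nat k + p - 1) gchoose k) * ((of_nat (n - k) + q - 1) gchoose (n - k)))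
      = (- p gchoose k) * (- q gchoose (n - k))" unfolding neg by simp
  qed
  also have "\<dots> = (- p + - q) gchoose n" unfolding atMost_atLeast0 by (rule gbinomial_Vandermonde)
  also have "\<dots> = (-1) ^ n * ((of_nat n + p + q - 1) gchoose n)"
    using neg[of "p + q" n] by (simp add: algebra_simps)
  finally show ?thesis by simp
qed

lemma sum_lessThan_add:
  fixes a b :: nat
  shows "(\<Sum>i<a + b. f i) = (\<Sum>i<a. f i) + (\<Sum>j<b. f (a + j) :: 'a::comm_monoid_add)"
  by (induction b) (simp_all add: add.assoc)

context blowup
begin

text \<open>\<open>k\<close> is the exponent of the coordinate 0. The weights then ask for
  \<open>r\<close> exponents with sum \<open>d - k\<close> and \<open>s + 1\<close> exponents with
  sum \<open>e + k\<close>, both counted by stars and bars.\<close>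

lemma card_Exps:
  "card (Exps (int d) (int e)) = (\<Sum>k\<le>d. ((d - k + r - 1) choose (d - k)) * ((e + k + s) choose (e + k)))"
proof -
  define L where "L m N = {l :: nat list. length l = m \<and> sum_list l = N}" for m N
  define g where "g = (\<lambda>(k, xs, ys) i. if i = 0 then k else if i \<le> r then xs ! (i - 1)
     else if i \<le> n + 1 then ys ! (i - r - 1) else (0::nat))"
  have finL: "finite (L m N)" for m N
  proof -
    have "L m N \<subseteq> {l. set l \<subseteq> {..N} \<and> length l = m}" unfolding L_def by (auto intro: member_le_sum_list)
    thus ?thesis using finite_lists_length_eq[of "{..N}" m] finite_subset by auto
  qed
  have weights: "(\<Sum>k<N. int (\<alpha> k) * wd k) = int (\<alpha> 0 + (\<Sum>i<r. \<alpha> (Suc i)))"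
    "(\<Sum>k<N. int (\<alpha> k) * we k) = int (\<Sum>j<s + 1. \<alpha> (Suc r + j)) - int (\<alpha> 0)" for \<alpha>
  proof -
    have split: "(\<Sum>k<N. h k) = h 0 + (\<Sum>i<r. h (Suc i)) + (\<Sum>j<s + 1. h (Suc r + j))" for h :: "nat => int"
      using sum_lessThan_add[of h "Suc r" "s + 1"] sum.lessThan_Suc_shift[of h r] by simp
    show "(\<Sum>k<N. int (\<alpha> k) * wd k) = int (\<alpha> 0 + (\<Sum>i<r. \<alpha> (Suc i)))"
      unfolding split by (simp add: wd_def)
    show "(\<Sum>k<N. int (\<alpha> k) * we k) = int (\<Sum>j<s + 1. \<alpha> (Suc r + j)) - int (\<alpha> 0)"
      unfolding split by (simp add: we_def)
  qed
  let ?S = "SIGMA k:{..d}. L r (d - k) \<times> L (s + 1) (e + k)"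
  have "bij_betw g ?S (Exps (int d) (int e))"
  proof (rule bij_betwI[where g = "\<lambda>\<alpha>. (\<alpha> 0, map (\<lambda>i. \<alpha> (Suc i)) [0..<r], map (\<lambda>j. \<alpha> (Suc r + j)) [0..<s + 1])"])
    show "g \<in> ?S \<rightarrow> Exps (int d) (int e)"
    proof
      fix t assume "t \<in> ?S"
      then obtain k xs ys where t: "t = (k, xs, ys)" "k \<le> d" "length xs = r" "sum_list xs = d - k"
        "length ys = s + 1" "sum_list ys = e + k" by (auto simp: L_def)
      have g0: "g t 0 = k" by (simp add: t(1) g_def)
      have "(\<Sum>i<r. g t (Suc i)) = (\<Sum>i<r. xs ! i)" by (rule sum.cong) (auto simp: t(1) g_def)
      hence s1: "(\<Sum>i<r. g t (Suc i)) = d - k" using t(3,4) by (simp add: sum_list_sum_nth lessThan_atLeast0)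
      have "(\<Sum>j<s + 1. g t (Suc r + j)) = (\<Sum>j<s + 1. ys ! j)" by (rule sum.cong) (auto simp: t(1) g_def)
      also have "\<dots> = e + k" using t(5,6) by (simp add: sum_list_sum_nth lessThan_atLeast0)
      finally have s2: "(\<Sum>j<s + 1. g t (Suc r + j)) = e + k" .
      have "(\<Sum>k<N. int (g t k) * wd k) = int d" unfolding weights g0 s1 using t(2) by simp
      moreover have "(\<Sum>k<N. int (g t k) * we k) = int e" unfolding weights g0 s2 by simp
      moreover have "\<forall>k\<ge>N. g t k = 0" by (simp add: t(1) g_def)
      ultimately show "g t \<in> Exps (int d) (int e)" unfolding Exps_def by blast
    qed
  next
    show "(\<lambda>\<alpha>. (\<alpha> 0, map (\<lambda>i. \<alpha> (Suc i)) [0..<r], map (\<lambda>j. \<alpha> (Suc r + j)) [0..<s + 1]))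
        \<in> Exps (int d) (int e) \<rightarrow> ?S"
    proof
      fix \<alpha> assume "\<alpha> \<in> Exps (int d) (int e)"
      hence "int (\<alpha> 0 + (\<Sum>i<r. \<alpha> (Suc i))) = int d" "int (\<Sum>j<s + 1. \<alpha> (Suc r + j)) - int (\<alpha> 0) = int e"
        unfolding Exps_def weights by blast+
      hence h: "\<alpha> 0 + (\<Sum>i<r. \<alpha> (Suc i)) = d" "(\<Sum>j<s + 1. \<alpha> (Suc r + j)) = e + \<alpha> 0" by linarith+
      have 1: "sum_list (map (\<lambda>i. \<alpha> (Suc i)) [0..<r]) = (\<Sum>i<r. \<alpha> (Suc i))"
        by (simp add: interv_sum_list_conv_sum_set_nat lessThan_atLeast0)
      have 2: "sum_list (map (\<lambda>j. \<alpha> (Suc r + j)) [0..<s + 1]) = (\<Sum>j<s + 1. \<alpha> (Suc r + j))"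
        by (simp only: interv_sum_list_conv_sum_set_nat lessThan_atLeast0 set_upt)
      show "(\<alpha> 0, map (\<lambda>i. \<alpha> (Suc i)) [0..<r], map (\<lambda>j. \<alpha> (Suc r + j)) [0..<s + 1]) \<in> ?S"
        unfolding L_def mem_Sigma_iff mem_Collect_eq mem_Times_iff fst_conv snd_conv 1 2 using h by auto
    qed
  next
    fix t assume "t \<in> ?S"
    then obtain k xs ys where t: "t = (k, xs, ys)" "length xs = r" "length ys = s + 1" by (auto simp: L_def)
    have "map (\<lambda>i. g t (Suc i)) [0..<r] = xs" by (rule nth_equalityI) (use t in \<open>auto simp: g_def\<close>)
    moreover have "map (\<lambda>j. g t (Suc r + j)) [0..<s + 1] = ys"
      by (rule nth_equalityI) (use t in \<open>auto simp: g_def simp del: upt_Suc\<close>)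
    moreover have "g t 0 = k" by (simp add: t(1) g_def)
    ultimately show "(g t 0, map (\<lambda>i. g t (Suc i)) [0..<r], map (\<lambda>j. g t (Suc r + j)) [0..<s + 1]) = t"
      using t(1) by simp
  next
    fix \<alpha> assume \<alpha>: "\<alpha> \<in> Exps (int d) (int e)"
    show "g (\<alpha> 0, map (\<lambda>i. \<alpha> (Suc i)) [0..<r], map (\<lambda>j. \<alpha> (Suc r + j)) [0..<s + 1]) = \<alpha>"
    proof
      fix i
      have "\<alpha> i = 0" if "i > n + 1" using \<alpha> that by (simp add: Exps_def)
      thus "g (\<alpha> 0, map (\<lambda>i. \<alpha> (Suc i)) [0..<r], map (\<lambda>j. \<alpha> (Suc r + j)) [0..<s + 1]) i = \<alpha> i"
        by (auto simp: g_def simp del: upt_Suc)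
    qed
  qed
  hence "card (Exps (int d) (int e)) = card ?S" by (simp add: bij_betw_same_card)
  also have "\<dots> = (\<Sum>k\<le>d. card (L r (d - k) \<times> L (s + 1) (e + k)))"
    by (rule card_SigmaI) (auto intro: finL)
  also have "\<dots> = (\<Sum>k\<le>d. ((d - k + r - 1) choose (d - k)) * ((e + k + s) choose (e + k)))"
    by (rule sum.cong[OF refl]) (simp add: card_cartesian_product L_def card_length_sum_list)
  finally show ?thesis .
qed

text \<open>The Euler characteristic of \<open>O(d, e)\<close>, for all real \<open>d\<close> and \<open>e\<close>.\<close>

definition Q :: "real => real => real" where
  "Q d e = (\<Sum>j\<le>s. ((e + real j - 1) gchoose j) * ((d + real (n - j)) gchoose (n - j)))"

text \<open>The count in \<open>card_Exps\<close> has \<open>d + 1\<close> summands and is not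
  visibly polynomial. Splitting the second binomial by Vandermonde introduces
  \<open>j \<le> s\<close>; the sum over \<open>k\<close> is then again a Vandermonde sum, which
  leaves a number of summands independent of \<open>d\<close> and \<open>e\<close>.\<close>

lemma card_Exps_Q: "real (card (Exps (int d) (int e))) = Q (real d) (real e)"
proof -
  have 1: "real ((e + k + s) choose (e + k)) =
    (\<Sum>j\<le>s. ((real j + real e - 1) gchoose j) * ((real (s - j) + (real k + 1) - 1) gchoose (s - j)))" for k
  proof -
    have "real ((e + k + s) choose (e + k)) = real ((e + k + s) choose s)"
      by (subst binomial_symmetric) auto
    also have "\<dots> = ((real s + real e + (real k + 1) - 1) gchoose s)"
      by (simp add: binomial_gbinomial algebra_simps)
    also have "\<dots> = (\<Sum>j\<le>s. ((real j + real e - 1) gchoose j) * ((real (s - j) + (real k + 1) - 1) gchoose (s - j)))"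
      by (rule multiset_vandermonde[symmetric])
    finally show ?thesis .
  qed
  have 2: "(\<Sum>k\<le>d. real ((d - k + r - 1) choose (d - k)) * ((real (s - j) + (real k + 1) - 1) gchoose (s - j))) =
     ((real d + real (n - j)) gchoose (n - j))" if j: "j \<le> s" for j
  proof -
    have a: "real ((d - k + r - 1) choose (d - k)) = ((real (d - k) + real r - 1) gchoose (d - k))" for k
      using r1 by (simp add: binomial_gbinomial of_nat_diff)
    have b: "((real (s - j) + (real k + 1) - 1) gchoose (s - j)) = ((real k + (real (s - j) + 1) - 1) gchoose k)" for k
    proof -
      have "((real (s - j) + (real k + 1) - 1) gchoose (s - j)) = real ((s - j + k) choose (s - j))"
        by (simp add: binomial_gbinomial)
      also have "\<dots> = real ((s - j + k) choose k)" by (subst binomial_symmetric) auto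
      also have "\<dots> = ((real k + (real (s - j) + 1) - 1) gchoose k)" by (simp add: binomial_gbinomial add.commute)
      finally show ?thesis .
    qed
    have "(\<Sum>k\<le>d. real ((d - k + r - 1) choose (d - k)) * ((real (s - j) + (real k + 1) - 1) gchoose (s - j))) =
      (\<Sum>k\<le>d. ((real k + (real (s - j) + 1) - 1) gchoose k) * ((real (d - k) + real r - 1) gchoose (d - k)))"
      unfolding a b by (simp add: mult.commute)
    also have "\<dots> = ((real d + (real (s - j) + 1) + real r - 1) gchoose d)" by (rule multiset_vandermonde)
    also have "\<dots> = real ((d + (n - j)) choose d)" using j by (simp add: binomial_gbinomial of_nat_diff algebra_simps)
    also have "\<dots> = real ((d + (n - j)) choose (n - j))" by (subst binomial_symmetric) auto
    also have "\<dots> = ((real d + real (n - j)) gchoose (n - j))" by (simp add: binomial_gbinomial)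
    finally show ?thesis .
  qed
  have "real (card (Exps (int d) (int e))) =
    (\<Sum>k\<le>d. \<Sum>j\<le>s. real ((d - k + r - 1) choose (d - k)) * (((real j + real e - 1) gchoose j) * ((real (s - j) + (real k + 1) - 1) gchoose (s - j))))"
    unfolding card_Exps of_nat_sum of_nat_mult 1 by (simp add: sum_distrib_left)
  also have "\<dots> = (\<Sum>j\<le>s. ((real j + real e - 1) gchoose j) *
     (\<Sum>k\<le>d. real ((d - k + r - 1) choose (d - k)) * ((real (s - j) + (real k + 1) - 1) gchoose (s - j))))"
    by (subst sum.swap) (simp add: sum_distrib_left mult.left_commute)
  also have "\<dots> = Q (real d) (real e)" unfolding Q_def
  proof (rule sum.cong[OF refl])
    fix j assume "j \<in> {..s}"
    hence "j \<le> s" by simp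
    from 2[OF this] show "((real j + real e - 1) gchoose j) *
        (\<Sum>k\<le>d. real ((d - k + r - 1) choose (d - k)) * ((real (s - j) + (real k + 1) - 1) gchoose (s - j))) =
        ((real e + real j - 1) gchoose j) * ((real d + real (n - j)) gchoose (n - j))"
      by (simp only: add.commute)
  qed
  finally show ?thesis .
qed

lemma gchoose_poly: "\<exists>p :: real poly. \<forall>x. poly p x = (c + x) gchoose k"
proof (intro exI allI)
  fix x
  show "poly (Polynomial.smult (1 / fact k) (\<Prod>i<k. [:c - real i, 1:])) x = (c + x) gchoose k"
    by (simp add: gbinomial_prod_rev poly_prod lessThan_atLeast0 algebra_simps)
qed

lemma Q_poly: "\<exists>P. \<forall>x. poly P x = Q (d + x) (e + x)"
proof -
  have "\<forall>j. \<exists>P :: real poly. \<forall>x. poly P x =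
    ((e + x + real j - 1) gchoose j) * ((d + x + real (n - j)) gchoose (n - j))"
  proof
    fix j
    obtain p1 :: "real poly" where p1: "\<forall>x. poly p1 x = (e + real j - 1 + x) gchoose j" using gchoose_poly by blast
    obtain p2 :: "real poly" where p2: "\<forall>x. poly p2 x = (d + real (n - j) + x) gchoose (n - j)"
      using gchoose_poly by blast
    show "\<exists>P :: real poly. \<forall>x. poly P x =
      ((e + x + real j - 1) gchoose j) * ((d + x + real (n - j)) gchoose (n - j))"
      by (rule exI[of _ "p1 * p2"]) (simp add: p1 p2 algebra_simps)
  qed
  from choice[OF this] obtain P :: "nat => real poly" where P: "\<And>j x. poly (P j) x =
    ((e + x + real j - 1) gchoose j) * ((d + x + real (n - j)) gchoose (n - j))" by blast
  show ?thesis by (rule exI[of _ "\<Sum>j\<le>s. P j"]) (simp add: poly_sum P Q_def)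
qed

lemma euler_char_PE:
  fixes L :: "'k::{alg_closed_field,field_char_0} lbundle"
  assumes L: "has_type n s (PE r s) L d e"
  shows "euler_char n s (PE r s) L = Q (real_of_int d) (real_of_int e)"
proof -
  obtain P where P: "\<And>x. poly P x = Q (real_of_int d + x) (real_of_int e + x)" using Q_poly by blast
  have "hilb n s (PE r s :: 'k pt set) d e P" unfolding hilb_def eventually_sequentially
  proof (intro exI[of _ "nat (\<bar>d\<bar> + \<bar>e\<bar>)"] allI impI conjI dim_V_PE(1))
    fix m assume m: "nat (\<bar>d\<bar> + \<bar>e\<bar>) \<le> m"
    hence i: "d + int m = int (nat (d + int m))" "e + int m = int (nat (e + int m))" by auto
    have "real (fs.dim (V n s (PE r s :: 'k pt set) (d + int m) (e + int m))) =
      real (card (Exps (int (nat (d + int m))) (int (nat (e + int m)))))" by (subst dim_V_PE(2)) (use i in simp)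
    also have "\<dots> = Q (real (nat (d + int m))) (real (nat (e + int m)))" by (rule card_Exps_Q)
    also have "\<dots> = poly P (real m)" using m by (simp add: P)
    finally show "poly P (real m) = real (fs.dim (V n s (PE r s :: 'k pt set) (d + int m) (e + int m)))" by simp
  qed
  from euler_char_eq[OF PE_sub L this] show ?thesis by (simp add: P)
qed

text \<open>In second degree 0 only the summand \<open>j = 0\<close> of \<open>Q\<close> survives.
  It is the binomial coefficient that counts forms of degree \<open>m\<close> on projective
  \<open>n\<close>-space, and it is at least \<open>m ^ n / n!\<close>.\<close>

lemma big_taut: "big n s (PE r s) n (taut r s :: 'k::{alg_closed_field,field_char_0} lbundle)"
  unfolding big_def eventually_sequentially
proof (intro exI conjI allI impI)
  let ?n = "n"
  show "(0::real) < 1 / fact ?n" by simp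
  fix m :: nat assume "0 \<le> m"
  have T: "has_type ?n s (PE r s) (tensor_power (taut r s) m :: 'k lbundle) (int m) (int 0)"
    using has_type_tensor_power[OF has_type_O_bundle[OF PE_sub, of 1 0], of m] by (simp add: taut_def)
  have "real (h0 ?n s (PE r s) (tensor_power (taut r s) m :: 'k lbundle)) = Q (real m) (real 0)"
    unfolding h0_eq_dim[OF PE_sub T dim_V_PE(1)] dim_V_PE(2) by (rule card_Exps_Q)
  also have "\<dots> = (\<Sum>j\<le>s. if j = 0 then (real m + real ?n) gchoose ?n else 0)" unfolding Q_def
  proof (rule sum.cong[OF refl])
    fix j
    show "((real 0 + real j - 1) gchoose j) * ((real m + real (?n - j)) gchoose (?n - j)) =
      (if j = 0 then (real m + real ?n) gchoose ?n else 0)"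
    proof (cases j)
      case (Suc i)
      have "(real i gchoose j) = real (i choose j)" by (simp add: binomial_gbinomial)
      thus ?thesis using Suc by simp
    qed simp
  qed
  also have "\<dots> = real ((m + ?n) choose ?n)" by (simp add: binomial_gbinomial)
  also have "\<dots> \<ge> 1 / fact ?n * real m ^ ?n"
  proof -
    have "real m ^ ?n \<le> (\<Prod>i<?n. (real m + real ?n) - real i)"
    proof -
      have "(\<Prod>i<?n. real m) \<le> (\<Prod>i<?n. (real m + real ?n) - real i)" by (rule prod_mono) auto
      thus ?thesis by simp
    qed
    thus ?thesis by (simp add: binomial_gbinomial gbinomial_prod_rev lessThan_atLeast0 divide_right_mono)
  qed
  finally show "1 / fact ?n * real m ^ ?n \<le> real (h0 ?n s (PE r s) (tensor_power (taut r s) m :: 'k lbundle))" .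
qed

end

section \<open>Mixed differences\<close>

text \<open>The iterated difference of \<open>g\<close> at the origin along the steps in
  \<open>ts\<close>; this recursive form of the alternating sum in
  \<open>intersection_number\<close> permits induction on the list of bundles.\<close>

fun mdiff :: "(real \<times> real) list => (real => real => real) => real" where
  "mdiff [] g = g 0 0"
| "mdiff (t # ts) g = mdiff ts (\<lambda>x y. g (x + fst t) (y + snd t)) - mdiff ts g"

lemma mdiff_add: "mdiff ts (\<lambda>x y. g x y + h x y) = mdiff ts g + mdiff ts h"
  by (induction ts arbitrary: g h) simp_all

lemma mdiff_zero: "mdiff ts (\<lambda>x y. 0) = 0" by (induction ts) simp_all

lemma mdiff_sum: "finite A ==> mdiff ts (\<lambda>x y. \<Sum>i\<in>A. g i x y) = (\<Sum>i\<in>A. mdiff ts (g i))"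
  by (induction A rule: finite_induct) (simp_all add: mdiff_zero mdiff_add)

lemma mdiff_diff: "mdiff ts (\<lambda>x y. g x y - h x y) = mdiff ts g - mdiff ts h"
proof (induction ts arbitrary: g h)
  case (Cons t ts)
  show ?case by (simp add: Cons.IH[of "\<lambda>x y. g (x + fst t) (y + snd t)" "\<lambda>x y. h (x + fst t) (y + snd t)"] Cons.IH[of g h])
qed simp

lemma Pow_lessThan_Suc_shift:
  "Pow {..<Suc n} = (`) Suc ` Pow {..<n} \<union> (\<lambda>J. insert 0 (Suc ` J)) ` Pow {..<n}"
proof -
  have "{..<Suc n} = insert 0 (Suc ` {..<n})" by (rule lessThan_Suc_eq_insert_0)
  thus ?thesis by (simp add: Pow_insert image_Pow_surj[OF refl, symmetric] image_image)
qed

text \<open>Index sets are split according to whether they contain 0, the index of the head; the two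
  kinds account for the two terms of the recursion.\<close>

lemma sum_Pow_mdiff:
  "(\<Sum>I\<in>Pow {..<length ts}. (-1) ^ (length ts - card I) *
      g (sum_list (map fst (nths ts I))) (sum_list (map snd (nths ts I)))) = mdiff ts g"
proof (induction ts arbitrary: g)
  case (Cons t ts)
  let ?N = "length ts"
  let ?F = "\<lambda>I. (-1::real) ^ (length (t # ts) - card I) *
      g (sum_list (map fst (nths (t # ts) I))) (sum_list (map snd (nths (t # ts) I)))"
  have inj1: "inj_on ((`) Suc) (Pow {..<?N})" by (rule inj_on_image_Pow) simp
  have inj2: "inj_on (\<lambda>J. insert 0 (Suc ` J)) (Pow {..<?N})"
  proof (rule inj_onI)
    fix I J assume "insert 0 (Suc ` I) = insert 0 (Suc ` J)"
    hence "Suc ` I = Suc ` J" by (metis Diff_insert_absorb Zero_not_Suc imageE)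
    thus "I = J" by (simp add: inj_image_eq_iff)
  qed
  have disj: "(`) Suc ` Pow {..<?N} \<inter> (\<lambda>J. insert 0 (Suc ` J)) ` Pow {..<?N} = {}" by auto
  have "(\<Sum>I\<in>Pow {..<length (t # ts)}. ?F I) =
      (\<Sum>J\<in>Pow {..<?N}. ?F (Suc ` J)) + (\<Sum>J\<in>Pow {..<?N}. ?F (insert 0 (Suc ` J)))"
    unfolding list.size(4) add_Suc_right add_0_right Pow_lessThan_Suc_shift
    by (subst sum.union_disjoint[OF _ _ disj]) (simp_all add: sum.reindex[OF inj1] sum.reindex[OF inj2])
  also have "(\<Sum>J\<in>Pow {..<?N}. ?F (Suc ` J)) = (\<Sum>J\<in>Pow {..<?N}. - ((-1) ^ (?N - card J) *
      g (sum_list (map fst (nths ts J))) (sum_list (map snd (nths ts J)))))"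
  proof (rule sum.cong[OF refl])
    fix J assume "J \<in> Pow {..<?N}"
    hence "card J \<le> ?N" using card_mono[of "{..<?N}" J] by simp
    moreover have "{j. Suc j \<in> Suc ` J} = J" by auto
    ultimately show "?F (Suc ` J) = - ((-1) ^ (?N - card J) *
      g (sum_list (map fst (nths ts J))) (sum_list (map snd (nths ts J))))"
      by (simp add: nths_Cons card_image Suc_diff_le image_iff)
  qed
  also have "\<dots> = - mdiff ts g" unfolding sum_negf Cons.IH ..
  also have "(\<Sum>J\<in>Pow {..<?N}. ?F (insert 0 (Suc ` J))) = (\<Sum>J\<in>Pow {..<?N}. (-1) ^ (?N - card J) *
      (\<lambda>x y. g (x + fst t) (y + snd t)) (sum_list (map fst (nths ts J))) (sum_list (map snd (nths ts J))))"
  proof (rule sum.cong[OF refl])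
    fix J assume "J \<in> Pow {..<?N}"
    hence "finite J" using finite_subset by auto
    hence "card (insert 0 (Suc ` J)) = Suc (card J)" by (simp add: card_image image_iff)
    moreover have "{j. Suc j \<in> insert 0 (Suc ` J)} = J" by auto
    ultimately show "?F (insert 0 (Suc ` J)) = (-1) ^ (?N - card J) *
      (\<lambda>x y. g (x + fst t) (y + snd t)) (sum_list (map fst (nths ts J))) (sum_list (map snd (nths ts J)))"
      by (simp add: nths_Cons add.commute)
  qed
  also have "\<dots> = mdiff ts (\<lambda>x y. g (x + fst t) (y + snd t))" by (rule Cons.IH)
  finally show ?case by simp
qed simp

section \<open>Differences of polynomials and their leading coefficients\<close>

lemma poly_shift_degree:
  fixes q :: "real poly"
  shows "\<exists>h. degree h \<le> degree q \<and> coeff h (degree q) = coeff q (degree q) \<and> (\<forall>x. poly h x = poly q (x + d))"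
proof (intro exI conjI allI)
  show "degree (q \<circ>\<^sub>p [:d, 1:]) \<le> degree q" by (simp add: degree_pcompose)
  show "coeff (q \<circ>\<^sub>p [:d, 1:]) (degree q) = coeff q (degree q)"
    using lead_coeff_comp[of "[:d, 1:]" q] by (simp add: degree_pcompose)
  show "poly (q \<circ>\<^sub>p [:d, 1:]) x = poly q (x + d)" for x by (simp add: poly_pcompose add.commute)
qed

lemma poly_shift:
  fixes q :: "real poly"
  assumes "degree q \<le> i"
  shows "\<exists>h. degree h \<le> i \<and> coeff h i = coeff q i \<and> (\<forall>x. poly h x = poly q (x + d))"
proof -
  obtain h where h: "degree h \<le> degree q" "coeff h (degree q) = coeff q (degree q)" "\<forall>x. poly h x = poly q (x + d)"
    using poly_shift_degree by blast
  moreover have "coeff h i = coeff q i"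
    by (cases "degree q = i") (use h(1,2) assms in \<open>auto simp: coeff_eq_0\<close>)
  ultimately show ?thesis using assms by (intro exI[of _ h]) auto
qed

lemma poly_difference:
  fixes q :: "real poly"
  assumes "degree q \<le> Suc i"
  shows "\<exists>h. degree h \<le> i \<and> coeff h i = real (Suc i) * d * coeff q (Suc i) \<and>
    (\<forall>x. poly h x = poly q (x + d) - poly q x)" using assms
proof (induction i arbitrary: q)
  case 0
  obtain a q' where q': "q = pCons a q'" by (cases q)
  hence "degree q' = 0" using 0 by (cases "q' = 0") auto
  then obtain b where q: "q = [:a, b:]" using q' by (metis degree_eq_zeroE)
  show ?case by (intro exI[of _ "[:d * b:]"]) (simp add: q algebra_simps)
next
  case (Suc i)
  obtain a q' where q: "q = pCons a q'" by (cases q)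
  have d: "degree q' \<le> Suc i" using Suc.prems by (cases "q' = 0") (auto simp: q)
  obtain h where h: "degree h \<le> i" "coeff h i = real (Suc i) * d * coeff q' (Suc i)"
    "\<forall>x. poly h x = poly q' (x + d) - poly q' x" using Suc.IH[OF d] by blast
  obtain g where g: "degree g \<le> Suc i" "coeff g (Suc i) = coeff q' (Suc i)" "\<forall>x. poly g x = poly q' (x + d)"
    using poly_shift[OF d] by blast
  \<comment> \<open>With \<open>q = a + x q'\<close>, the difference of \<open>q\<close> is
    \<open>x\<close> times the difference of \<open>q'\<close> plus \<open>d\<close> times the
    shifted \<open>q'\<close>.\<close>
  show ?case
  proof (intro exI[of _ "pCons 0 h + Polynomial.smult d g"] conjI allI)
    have "degree (pCons 0 h) \<le> Suc i" using h(1) by (simp add: degree_pCons_eq_if)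
    thus "degree (pCons 0 h + Polynomial.smult d g) \<le> Suc i"
      using g(1) by (intro degree_add_le) (auto intro: order_trans[OF degree_smult_le])
    show "coeff (pCons 0 h + Polynomial.smult d g) (Suc i) = real (Suc (Suc i)) * d * coeff q (Suc (Suc i))"
      using h(2) g(2) by (simp add: q algebra_simps)
    show "poly (pCons 0 h + Polynomial.smult d g) x = poly q (x + d) - poly q x" for x
      unfolding q by (simp add: h(3)[rule_format] g(3)[rule_format] algebra_simps)
  qed
qed

text \<open>The variable marks the second entry of a type: the coefficient of degree
  \<open>j\<close> collects the choices of \<open>j\<close> second entries and
  \<open>length ts - j\<close> first ones.\<close>

definition typoly :: "(real \<times> real) list => real poly" where
  "typoly ts = prod_list (map (\<lambda>t. [:fst t, snd t:]) ts)"

lemma degree_typoly: "degree (typoly ts) \<le> length ts"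
proof (induction ts)
  case (Cons t ts)
  have "degree ([:fst t, snd t:] * typoly ts) \<le> degree [:fst t, snd t:] + degree (typoly ts)"
    by (rule degree_mult_le)
  also have "\<dots> \<le> length (t # ts)" using Cons by auto
  finally show ?case by (simp add: typoly_def)
qed (simp add: typoly_def)

text \<open>Each step lowers the total degree by one, so only the leading coefficients survive. A
  step differences either in \<open>x\<close> or in \<open>y\<close>, which mirrors multiplication
  of \<open>typoly ts\<close> by the linear polynomial of \<open>t\<close>.\<close>

lemma mdiff_poly:
  "degree q \<le> i ==> degree p \<le> j ==> i + j \<le> length ts ==>
    mdiff ts (\<lambda>x y. poly q x * poly p y) = (if i + j = length ts
      then fact i * fact j * coeff q i * coeff p j * coeff (typoly ts) j else 0)"
proof (induction ts arbitrary: q p i j)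
  case Nil
  thus ?case by (simp add: typoly_def poly_0_coeff_0)
next
  case (Cons t ts)
  obtain p' where p': "degree p' \<le> j" "coeff p' j = coeff p j" "\<forall>y. poly p' y = poly p (y + snd t)"
    using poly_shift[OF Cons.prems(2)] by blast
  \<comment> \<open>The difference of the product is the difference in \<open>x\<close>, taken at
    the shifted \<open>y\<close>, plus the difference in \<open>y\<close> at the old
    \<open>x\<close>.\<close>
  have "mdiff (t # ts) (\<lambda>x y. poly q x * poly p y) =
     mdiff ts (\<lambda>x y. (poly q (x + fst t) - poly q x) * poly p' y) +
     mdiff ts (\<lambda>x y. poly q x * (poly p (y + snd t) - poly p y))"
    by (simp add: p'(3) flip: mdiff_add mdiff_diff) (simp add: algebra_simps)
  also have "mdiff ts (\<lambda>x y. (poly q (x + fst t) - poly q x) * poly p' y) =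
      (if i + j = length (t # ts) then fact i * fact j * coeff q i * coeff p j * (fst t * coeff (typoly ts) j) else 0)"
  proof (cases i)
    case 0
    then obtain a where "q = [:a:]" using Cons.prems(1) by (metis degree_eq_zeroE le_zero_eq)
    moreover have "coeff (typoly ts) j = 0" if "i + j = length (t # ts)"
      by (rule coeff_eq_0) (use degree_typoly[of ts] that 0 in simp)
    ultimately show ?thesis by (simp add: mdiff_zero)
  next
    case (Suc i')
    obtain h where h: "degree h \<le> i'" "coeff h i' = real (Suc i') * fst t * coeff q (Suc i')"
      "\<forall>x. poly h x = poly q (x + fst t) - poly q x" using poly_difference Cons.prems(1) Suc by blast
    have "mdiff ts (\<lambda>x y. poly h x * poly p' y) = (if i' + j = length ts
      then fact i' * fact j * coeff h i' * coeff p' j * coeff (typoly ts) j else 0)"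
      by (rule Cons.IH[OF h(1) p'(1)]) (use Cons.prems(3) Suc in simp)
    thus ?thesis using h(2,3) p'(2) Suc by (simp add: mult_ac)
  qed
  also have "mdiff ts (\<lambda>x y. poly q x * (poly p (y + snd t) - poly p y)) =
      (if i + j = length (t # ts) then fact i * fact j * coeff q i * coeff p j *
        (case j of 0 => 0 | Suc j' => snd t * coeff (typoly ts) j') else 0)"
  proof (cases j)
    case 0
    then obtain a where "p = [:a:]" using Cons.prems(2) by (metis degree_eq_zeroE le_zero_eq)
    thus ?thesis using 0 by (simp add: mdiff_zero)
  next
    case (Suc j')
    obtain h where h: "degree h \<le> j'" "coeff h j' = real (Suc j') * snd t * coeff p (Suc j')"
      "\<forall>y. poly h y = poly p (y + snd t) - poly p y" using poly_difference Cons.prems(2) Suc by blast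
    have "mdiff ts (\<lambda>x y. poly q x * poly h y) = (if i + j' = length ts
      then fact i * fact j' * coeff q i * coeff h j' * coeff (typoly ts) j' else 0)"
      by (rule Cons.IH[OF Cons.prems(1) h(1)]) (use Cons.prems(3) Suc in simp)
    thus ?thesis using h(2,3) Suc by (simp add: mult_ac)
  qed
  finally show ?case by (simp add: typoly_def coeff_pCons distrib_left split: nat.splits)
qed

lemma gchoose_poly_lead:
  "\<exists>p :: real poly. degree p \<le> k \<and> coeff p k = 1 / fact k \<and> (\<forall>x. poly p x = (x + c) gchoose k)"
proof (intro exI conjI allI)
  let ?P = "\<Prod>i<k. [:c - real i, 1:]"
  have deg: "degree ?P = k" by (subst degree_prod_eq_sum_degree) auto
  have "lead_coeff ?P = 1" by (simp add: lead_coeff_prod)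
  thus "coeff (Polynomial.smult (1 / fact k) ?P) k = 1 / fact k" using deg by simp
  show "degree (Polynomial.smult (1 / fact k) ?P) \<le> k" using deg by (metis degree_smult_le)
  show "poly (Polynomial.smult (1 / fact k) ?P) x = (x + c) gchoose k" for x
    by (simp add: gbinomial_prod_rev poly_prod lessThan_atLeast0 algebra_simps)
qed

context blowup
begin

text \<open>Encodes the top intersection numbers of the blow-up: a term of degree \<open>j\<close>
  counts once for \<open>j \<le> s\<close>, whereas more than \<open>s\<close> general hyperplanes
  pulled back from \<open>P^s\<close> have empty intersection.\<close>

definition top :: "real poly => real" where
  "top P = (\<Sum>j\<le>s. coeff P j)"

text \<open>Each summand of \<open>Q\<close> is a product of univariate polynomials with leading
  coefficients \<open>1 / j!\<close> and \<open>1 / (n - j)!\<close>, which cancel the factorials of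
  \<open>mdiff_poly\<close>.\<close>

lemma mdiff_Q:
  assumes "length ts = n"
  shows "mdiff ts Q = top (typoly ts)"
proof -
  have "mdiff ts (\<lambda>d e. ((e + real j - 1) gchoose j) * ((d + real (n - j)) gchoose (n - j))) = coeff (typoly ts) j"
    if j: "j \<le> s" for j
  proof -
    obtain p :: "real poly" where p: "degree p \<le> j" "coeff p j = 1 / fact j" "\<forall>x. poly p x = (x + (real j - 1)) gchoose j"
      using gchoose_poly_lead by blast
    obtain q :: "real poly" where q: "degree q \<le> n - j" "coeff q (n - j) = 1 / fact (n - j)"
      "\<forall>x. poly q x = (x + real (n - j)) gchoose (n - j)" using gchoose_poly_lead by blast
    have "mdiff ts (\<lambda>d e. poly q d * poly p e) = coeff (typoly ts) j"
      using mdiff_poly[OF q(1) p(1), of ts] q(2) p(2) j assms by simp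
    moreover have "(\<lambda>d e. poly q d * poly p e) =
      (\<lambda>d e. ((e + real j - 1) gchoose j) * ((d + real (n - j)) gchoose (n - j)))"
      using p(3) q(3) by (simp add: mult.commute add_diff_eq)
    ultimately show ?thesis by simp
  qed
  thus ?thesis unfolding top_def Q_def[abs_def] by (subst mdiff_sum) simp_all
qed

end

section \<open>Intersection numbers of classes that have a type\<close>

definition rtype :: "int \<times> int => real \<times> real" where
  "rtype t = (real_of_int (fst t), real_of_int (snd t))"

lemma sum_list_rtype: "sum_list (map fst (map rtype ts)) = real_of_int (sum_list (map fst ts))"
  "sum_list (map snd (map rtype ts)) = real_of_int (sum_list (map snd ts))"
  by (induction ts) (simp_all add: rtype_def)

lemma intersection_number_mdiff:
  assumes X: "X \<subseteq> biproj a b" and T: "list_all2 (\<lambda>L t. has_type a b X L (fst t) (snd t)) Ls ts"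
    and chi: "\<And>L d e. has_type a b X L d e ==> euler_char a b X L = g (real_of_int d) (real_of_int e)"
  shows "intersection_number a b X Ls = mdiff (map rtype ts) g"
proof -
  have len: "length Ls = length (map rtype ts)" using T by (simp add: list_all2_lengthD)
  have "euler_char a b X (tensor_list a b (nths Ls I)) =
    g (sum_list (map fst (nths (map rtype ts) I))) (sum_list (map snd (nths (map rtype ts) I)))" for I
  proof -
    have "list_all2 (\<lambda>L t. has_type a b X L (fst t) (snd t)) (nths Ls I) (nths ts I)"
      using T by (induction Ls ts arbitrary: I rule: list_all2_induct) (simp_all add: nths_Cons)
    from chi[OF has_type_tensor_list[OF X this]] show ?thesis unfolding nths_map sum_list_rtype .
  qed
  thus ?thesis unfolding intersection_number_def len sum_Pow_mdiff[of "map rtype ts" g, symmetric] by simp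
qed

text \<open>The type of a formal real combination of bundles, extended linearly from
  \<open>has_type\<close>.\<close>

definition class_type :: "nat => nat => 'k::field pt set => 'k rclass => real => real => bool" where
  "class_type a b X A D E \<longleftrightarrow> (\<exists>ts. list_all2 (\<lambda>(c, B) t. has_type a b X B (fst t) (snd t)) A ts \<and>
     D = (\<Sum>((c, B), t)\<leftarrow>zip A ts. c * fst (rtype t)) \<and> E = (\<Sum>((c, B), t)\<leftarrow>zip A ts. c * snd (rtype t)))"

lemma class_type_cls:
  assumes "has_type a b X L d e"
  shows "class_type a b X (cls L) (real_of_int d) (real_of_int e)"
  unfolding class_type_def cls_def by (rule exI[of _ "[(d, e)]"]) (use assms in \<open>simp add: rtype_def\<close>)

lemma class_type_sub_mult:
  assumes "has_type a b X L d e" "has_type a b X L' d' e'"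
  shows "class_type a b X (sub_mult (cls L) t (cls L')) (real_of_int d - t * real_of_int d') (real_of_int e - t * real_of_int e')"
  unfolding class_type_def cls_def sub_mult_def
  by (rule exI[of _ "[(d, e), (d', e')]"]) (use assms in \<open>simp add: rtype_def\<close>)

context blowup
begin

lemma top_add: "top (P + P') = top P + top P'" by (simp add: top_def sum.distrib)

lemma top_smult: "top (Polynomial.smult c P) = c * top P" by (simp add: top_def sum_distrib_left)

text \<open>\<open>Bs\<close> holds the bundles already picked from earlier classes. Each summand of
  the next class contributes a linear factor, and since \<open>top\<close> is linear these add up to
  the factor of the class.\<close>

lemma intersect_acc_PE:
  fixes As :: "'k::{alg_closed_field,field_char_0} rclass list"
  assumes "list_all2 (\<lambda>A u. class_type n s (PE r s) A (fst u) (snd u)) As us"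
    and "list_all2 (\<lambda>L t. has_type n s (PE r s) L (fst t) (snd t)) Bs ts"
    and "length As + length Bs = n"
  shows "intersect_acc n s (PE r s) As Bs = top (typoly (map rtype ts) * typoly us)" using assms
proof (induction As us arbitrary: Bs ts rule: list_all2_induct)
  case Nil
  have "intersection_number n s (PE r s) Bs = mdiff (map rtype ts) Q"
    by (rule intersection_number_mdiff[OF PE_sub Nil(1)]) (rule euler_char_PE)
  also have "\<dots> = top (typoly (map rtype ts))"
    by (rule mdiff_Q) (use Nil list_all2_lengthD[OF Nil(1)] in simp)
  finally show ?case by (simp add: typoly_def)
next
  case (Cons A As u us)
  let ?R = "typoly (map rtype ts) * typoly us"
  have step: "intersect_acc n s (PE r s) As (Bs @ [B]) = top (?R * [:fst (rtype t), snd (rtype t):])"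
    if "has_type n s (PE r s) B (fst t) (snd t)" for B t
  proof -
    have "intersect_acc n s (PE r s) As (Bs @ [B]) = top (typoly (map rtype (ts @ [t])) * typoly us)"
    proof (rule Cons.IH)
      show "list_all2 (\<lambda>L t. has_type n s (PE r s) L (fst t) (snd t)) (Bs @ [B]) (ts @ [t])"
        using Cons.prems(1) that by (simp add: list_all2_appendI)
      show "length As + length (Bs @ [B]) = n" using Cons.prems(2) by simp
    qed
    thus ?thesis by (simp add: typoly_def mult_ac del: mult_pCons_left mult_pCons_right)
  qed
  obtain vs where vs: "list_all2 (\<lambda>(c, B) t. has_type n s (PE r s) B (fst t) (snd t)) A vs"
    "fst u = (\<Sum>((c, B), t)\<leftarrow>zip A vs. c * fst (rtype t))" "snd u = (\<Sum>((c, B), t)\<leftarrow>zip A vs. c * snd (rtype t))"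
    using Cons.hyps(1) unfolding class_type_def by blast
  have "(\<Sum>(c, B)\<leftarrow>A. c * intersect_acc n s (PE r s) As (Bs @ [B])) =
    top (?R * [:\<Sum>((c, B), t)\<leftarrow>zip A vs. c * fst (rtype t), \<Sum>((c, B), t)\<leftarrow>zip A vs. c * snd (rtype t):])"
    using vs(1)
  proof (induction A vs rule: list_all2_induct)
    case Nil
    show ?case by (simp add: top_def)
  next
    case (Cons x A v vs)
    obtain c B where x: "x = (c, B)" by (cases x)
    have 1: "intersect_acc n s (PE r s) As (Bs @ [B]) = top (?R * [:fst (rtype v), snd (rtype v):])"
      by (rule step) (use Cons.hyps(1) x in simp)
    have "[:\<Sum>((c, B), t)\<leftarrow>zip (x # A) (v # vs). c * fst (rtype t), \<Sum>((c, B), t)\<leftarrow>zip (x # A) (v # vs). c * snd (rtype t):] =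
      Polynomial.smult c [:fst (rtype v), snd (rtype v):] +
      [:\<Sum>((c, B), t)\<leftarrow>zip A vs. c * fst (rtype t), \<Sum>((c, B), t)\<leftarrow>zip A vs. c * snd (rtype t):]"
      by (simp add: x)
    thus ?case using Cons.IH 1
      by (simp only: x list.map sum_list.Cons prod.case distrib_left top_add mult_smult_right top_smult)
  qed
  hence "intersect_acc n s (PE r s) (A # As) Bs = top (?R * [:fst u, snd u:])" by (simp add: vs(2,3))
  thus ?case by (simp add: typoly_def mult_ac del: mult_pCons_left mult_pCons_right)
qed

lemma intersect_PE:
  fixes As :: "'k::{alg_closed_field,field_char_0} rclass list"
  assumes "list_all2 (\<lambda>A u. class_type n s (PE r s) A (fst u) (snd u)) As us" "length As = n"
  shows "intersect n s (PE r s) As = top (typoly us)"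
  unfolding intersect_def by (subst intersect_acc_PE[OF assms(1), where ts = "[]"]) (use assms(2) in \<open>simp_all add: typoly_def\<close>)

end

section \<open>The exceptional bundle\<close>

lemma finite_common_nbhd:
  assumes "finite J" "p \<in> biproj a b"
    and "\<And>j. j \<in> J ==> \<exists>U. zopen a b U \<and> p \<in> U \<and> tw a b (X \<inter> U) d e (g j)"
  shows "\<exists>U. zopen a b U \<and> p \<in> U \<and> (\<forall>j\<in>J. tw a b (X \<inter> U) d e (g j))" using assms(1,3)
proof (induction J rule: finite_induct)
  case empty
  show ?case using zopen_biproj assms(2) by blast
next
  case (insert j J)
  obtain U where U: "zopen a b U" "p \<in> U" "\<forall>j\<in>J. tw a b (X \<inter> U) d e (g j)"
    using insert.IH[OF insert.prems[OF insertI2], simplified] by (elim exE conjE)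
  obtain U' where U': "zopen a b U'" "p \<in> U'" "tw a b (X \<inter> U') d e (g j)"
    using insert.prems[OF insertI1] by (elim exE conjE)
  show ?case
  proof (intro exI[of _ "U \<inter> U'"] conjI ballI zopen_Int U(1) U'(1))
    fix k assume k: "k \<in> insert j J"
    show "tw a b (X \<inter> (U \<inter> U')) d e (g k)"
    proof (cases "k = j")
      case True
      show ?thesis unfolding True by (rule tw_subset[OF U'(3)]) auto
    next
      case False
      hence "k \<in> J" using k by simp
      show ?thesis by (rule tw_subset[OF bspec[OF U(3) \<open>k \<in> J\<close>]]) auto
    qed
  qed (use U(2) U'(2) in blast)
qed

lemma line_bundleD:
  assumes L: "line_bundle a b X L" and X: "X \<subseteq> biproj a b" and "p \<in> X" "q \<in> X"
  shows "zopen a b (nbhd L p)" "p \<in> nbhd L p" "tw a b (X \<inter> nbhd L p \<inter> nbhd L q) 0 0 (trans L p q)"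
    "\<And>z. z \<in> X ==> z \<in> nbhd L p ==> z \<in> nbhd L q ==> trans L p q z \<noteq> 0"
proof -
  show "zopen a b (nbhd L p)" "p \<in> nbhd L p" using L assms(3) unfolding line_bundle_def by blast+
  have "regular_on a b (X \<inter> nbhd L p \<inter> nbhd L q) (trans L p q)"
    using L assms(3,4) unfolding line_bundle_def by blast
  moreover have "X \<inter> nbhd L p \<inter> nbhd L q \<subseteq> biproj a b" using X by blast
  ultimately show "tw a b (X \<inter> nbhd L p \<inter> nbhd L q) 0 0 (trans L p q)" using regular_on_iff_tw by blast
  show "\<And>z. z \<in> X ==> z \<in> nbhd L p ==> z \<in> nbhd L q ==> trans L p q z \<noteq> 0"
    using L assms(3,4) unfolding line_bundle_def by blast
qed

lemma local_ring_tw: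
  assumes X: "X \<subseteq> biproj a b" and "f \<in> local_ring a b X p"
  shows "\<exists>U. zopen a b U \<and> p \<in> U \<and> tw a b (X \<inter> U) 0 0 f"
proof -
  obtain U where U: "zopen a b U" "p \<in> U" "regular_on a b (X \<inter> U) f"
    using assms(2) unfolding local_ring_def by blast
  have "X \<inter> U \<subseteq> biproj a b" using X by blast
  thus ?thesis using U regular_on_iff_tw by blast
qed

context blowup
begin

abbreviation z0 :: "'k::field pt => 'k" where "z0 q \<equiv> cc q 0"

text \<open>The zero-scheme condition of \<open>exceptional_bundle\<close>, isolated as a property
  of the section alone.\<close>

definition exceptional_section :: "('k::field pt => 'k pt => 'k) => bool" where
  "exceptional_section \<sigma> \<longleftrightarrow> (\<forall>p\<in>PE r s. \<forall>i\<le>n. xc p i \<noteq> 0 -->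
        (\<exists>g. (\<forall>j\<le>s. g j \<in> local_ring n s (PE r s) p) \<and>
           same_germ n s (PE r s) p (\<sigma> p) (\<lambda>z. \<Sum>j\<le>s. g j z * (xc z j / xc z i))) \<and>
        (\<forall>j\<le>s. \<exists>h\<in>local_ring n s (PE r s) p.
           same_germ n s (PE r s) p (\<lambda>z. xc z j / xc z i) (\<lambda>z. h z * \<sigma> p z)))"

text \<open>On \<open>PE\<close> one has \<open>x_j = z0 y_j\<close> for \<open>j \<le> s\<close>,
  so the section is \<open>z0\<close> times a combination \<open>A\<close> of the quotients
  \<open>y_j / x_i\<close>. Conversely \<open>z0 y_j / x_i\<close> is a multiple of the section;
  cancelling \<open>z0\<close> shows that \<open>A\<close> does not vanish at
  \<open>p\<close>.\<close>

lemma exceptional_local_equation: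
  fixes E :: "'k::{alg_closed_field,field_char_0} lbundle" and \<sigma> :: "'k pt => 'k pt => 'k" and p :: "'k pt"
  assumes L: "line_bundle n s (PE r s) E" and p: "p \<in> PE r s"
    and \<sigma>: "exceptional_section \<sigma>"
  shows "\<exists>U A. zopen n s U \<and> p \<in> U \<and> tw n s (PE r s \<inter> U) (- 1) 1 A \<and> A p \<noteq> 0 \<and>
    (\<forall>z\<in>PE r s \<inter> U. \<sigma> p z = z0 z * A z)"
proof -
  let ?X = "PE r s :: 'k pt set" and ?n = "n"
  have pX: "p \<in> biproj ?n s" using p PE_sub by blast
  obtain i where i: "i \<le> ?n" "xc p i \<noteq> 0" using ex_xc_nonzero[OF pX] by blast
  note j = jy_nonzero[OF pX]
  note S = \<sigma>[unfolded exceptional_section_def, rule_format, OF p i]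
  obtain g where g: "\<forall>j\<le>s. g j \<in> local_ring ?n s ?X p"
      "same_germ ?n s ?X p (\<sigma> p) (\<lambda>z. \<Sum>j\<le>s. g j z * (xc z j / xc z i))" using conjunct1[OF S] by blast
  obtain h where h: "h \<in> local_ring ?n s ?X p"
      "same_germ ?n s ?X p (\<lambda>z. xc z (jy p) / xc z i) (\<lambda>z. h z * \<sigma> p z)" using conjunct2[OF S] j(1) by blast
  obtain U1 where U1: "zopen ?n s U1" "p \<in> U1" "\<forall>z\<in>?X \<inter> U1. \<sigma> p z = (\<Sum>j\<le>s. g j z * (xc z j / xc z i))"
    using g(2) unfolding same_germ_def by blast
  obtain U2 where U2: "zopen ?n s U2" "p \<in> U2" "\<forall>z\<in>?X \<inter> U2. xc z (jy p) / xc z i = h z * \<sigma> p z"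
    using h(2) unfolding same_germ_def by blast
  obtain U3 where U3: "zopen ?n s U3" "p \<in> U3" "\<forall>j\<in>{..s}. tw ?n s (?X \<inter> U3) 0 0 (g j)"
  proof -
    have "\<exists>U. zopen ?n s U \<and> p \<in> U \<and> (\<forall>j\<in>{..s}. tw ?n s (?X \<inter> U) 0 0 (g j))"
    proof (rule finite_common_nbhd[OF finite_atMost pX])
      fix j assume "j \<in> {..s}"
      hence "g j \<in> local_ring ?n s ?X p" using g(1) by simp
      thus "\<exists>U. zopen ?n s U \<and> p \<in> U \<and> tw ?n s (?X \<inter> U) 0 0 (g j)" by (rule local_ring_tw[OF PE_sub])
    qed
    thus thesis using that by blast
  qed
  obtain U4 where U4: "zopen ?n s U4" "p \<in> U4" "tw ?n s (?X \<inter> U4) 0 0 h"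
    using local_ring_tw[OF PE_sub h(1)] by blast
  let ?D = "{q \<in> biproj ?n s. form_at (\<lambda>x y. x i) q \<noteq> (0::'k)}"
  have D: "zopen ?n s ?D" by (rule zopen_form[OF biform.coord_x[OF i(1)]])
  define U where "U = U1 \<inter> U2 \<inter> U3 \<inter> U4 \<inter> ?D"
  have U: "zopen ?n s U" unfolding U_def by (intro zopen_Int U1 U2 U3 U4 D)
  have pU: "p \<in> U" unfolding U_def using U1 U2 U3 U4 i pX by simp
  have xi: "xc z i \<noteq> 0" if "z \<in> ?X \<inter> U" for z using that by (simp add: U_def)
  have inv: "tw ?n s (?X \<inter> U) (- 1) (- 0) (\<lambda>z. inverse (xc z i))"
    by (rule tw_inverse[OF tw_x[OF i(1)]]) (rule xi)
  have twg: "tw ?n s (?X \<inter> U) 0 0 (g k)" if "k \<le> s" for k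
    by (rule tw_subset[of _ _ "?X \<inter> U3"]) (use U3(3) that in \<open>auto simp: U_def\<close>)
  have twh: "tw ?n s (?X \<inter> U) 0 0 h" by (rule tw_subset[OF U4(3)]) (auto simp: U_def)
  define A where "A z = (\<Sum>j\<in>{..s}. g j z * (yc z j * inverse (xc z i)))" for z
  have A: "tw ?n s (?X \<inter> U) (- 1) 1 A" unfolding A_def
  proof (rule tw_sum)
    show "?X \<inter> U \<subseteq> biproj ?n s" using PE_sub by blast
    fix k assume "k \<in> {..s}"
    hence k: "k \<le> s" by simp
    have "tw ?n s (?X \<inter> U) (- 1) 1 (\<lambda>z. yc z k * inverse (xc z i))"
      by (rule tw_mult[OF tw_y[OF k] inv]) auto
    thus "tw ?n s (?X \<inter> U) (- 1) 1 (\<lambda>z. g k z * (yc z k * inverse (xc z i)))"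
      by (rule tw_mult[OF twg[OF k]]) auto
  qed
  have xz: "xc z k = z0 z * yc z k" if "z \<in> ?X" "k \<le> s" for z k
    using fun_cong[OF cc_spec(1)[OF that(1)], of k] fun_cong[OF cc_spec(2)[OF that(1)], of k] that(2)
    by (simp add: px_def py_def)
  have \<sigma>A: "\<sigma> p z = z0 z * A z" if z: "z \<in> ?X \<inter> U" for z
  proof -
    have "\<sigma> p z = (\<Sum>j\<le>s. g j z * (xc z j / xc z i))" using U1(3) z by (simp add: U_def)
    also have "\<dots> = (\<Sum>j\<le>s. z0 z * (g j z * (yc z j * inverse (xc z i))))"
    proof (rule sum.cong[OF refl])
      fix k assume "k \<in> {..s}"
      hence "xc z k = z0 z * yc z k" using xz z by simp
      thus "g k z * (xc z k / xc z i) = z0 z * (g k z * (yc z k * inverse (xc z i)))"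
        by (simp add: divide_inverse)
    qed
    finally show ?thesis by (simp add: A_def sum_distrib_left)
  qed
  have "A p \<noteq> 0"
  proof
    assume A0: "A p = 0"
    have dif: "tw ?n s (?X \<inter> U) (- 1) 1 (\<lambda>z. yc z (jy p) * inverse (xc z i) + (- 1) * (h z * A z))"
    proof (rule tw_add[OF _ tw_scale])
      show "tw ?n s (?X \<inter> U) (- 1) 1 (\<lambda>z. yc z (jy p) * inverse (xc z i))"
        by (rule tw_mult[OF tw_y[OF j(1)] inv]) auto
      show "tw ?n s (?X \<inter> U) (- 1) 1 (\<lambda>z. h z * A z)" by (rule tw_mult[OF twh A]) auto
    qed
    \<comment> \<open>The factor \<open>z0\<close> to be cancelled may vanish at \<open>p\<close>,
      so the cancellation is carried out where all Cox coordinates are nonzero and extended by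
      density.\<close>
    have "yc p (jy p) * inverse (xc p i) + (- 1) * (h p * A p) = 0"
    proof (rule tw_zero_dense[OF U dif])
      fix q assume q: "q \<in> ?X \<inter> U" "\<forall>k<N. cc q k \<noteq> 0"
      have "z0 q * (yc q (jy p) * inverse (xc q i)) = xc q (jy p) / xc q i"
        using xz[of q "jy p"] q(1) j(1) by (simp add: divide_inverse)
      also have "\<dots> = h q * \<sigma> p q" using U2(3) q(1) by (simp add: U_def)
      also have "\<dots> = z0 q * (h q * A q)" using \<sigma>A[OF q(1)] by simp
      finally have "z0 q * (yc q (jy p) * inverse (xc q i)) = z0 q * (h q * A q)" .
      moreover have "z0 q \<noteq> 0" using q(2) by simp
      ultimately have "yc q (jy p) * inverse (xc q i) = h q * A q" using mult_cancel_left by blast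
      thus "yc q (jy p) * inverse (xc q i) + (- 1) * (h q * A q) = 0" by simp
    qed (use p pU in blast)
    thus False using A0 j(2) i(2) by simp
  qed
  thus ?thesis using U pU A \<sigma>A by blast
qed

text \<open>Dividing the defining section by the Cox coordinate \<open>z0\<close> trivialises \<open>E \<otimes> O(-1, 1)\<close>.\<close>

lemma exceptional_type:
  fixes E :: "'k::{alg_closed_field,field_char_0} lbundle"
  assumes "exceptional_bundle r s E"
  shows "has_type n s (PE r s) E 1 (- 1)"
proof -
  let ?X = "PE r s :: 'k pt set" and ?n = "n"
  have L: "line_bundle ?n s ?X E" using assms unfolding exceptional_bundle_def by blast
  obtain \<sigma> where sec: "\<sigma> \<in> sections ?n s ?X E" and \<sigma>: "exceptional_section \<sigma>"
    using assms unfolding exceptional_bundle_def exceptional_section_def[symmetric] by (elim conjE bexE)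
  have glue: "\<sigma> p z = trans E p q z * \<sigma> q z" if "p \<in> ?X" "q \<in> ?X" "z \<in> ?X" "z \<in> nbhd E p" "z \<in> nbhd E q" for p q z
    using sec that unfolding sections_def by blast
  define R where "R p z U A \<longleftrightarrow> zopen ?n s U \<and> z \<in> U \<and> tw ?n s (?X \<inter> U) (- 1) 1 A \<and>
    (\<forall>w\<in>?X \<inter> U. \<sigma> p w = z0 w * A w)" for p z U A
  \<comment> \<open>The quotient of the section by \<open>z0\<close> at \<open>z\<close>. As
    \<open>z0\<close> may vanish there, the value is taken from any local factorisation
    \<open>R\<close>; \<open>unique\<close> shows that the choice is immaterial.\<close>
  define \<alpha> where "\<alpha> p z = (SOME c. \<exists>U A. R p z U A \<and> c = A z)" for p z
  have unique: "A z = A' z" if "R p z U A" "R p z U' A'" "z \<in> ?X" for p z U A U' A'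
  proof -
    have UU: "zopen ?n s (U \<inter> U')" using that(1,2) unfolding R_def by (intro zopen_Int) blast+
    have "tw ?n s (?X \<inter> (U \<inter> U')) (- 1) 1 A" "tw ?n s (?X \<inter> (U \<inter> U')) (- 1) 1 A'"
      using that(1,2) tw_subset[of ?n s "?X \<inter> U" "-1" 1 A "?X \<inter> (U \<inter> U')"]
        tw_subset[of ?n s "?X \<inter> U'" "-1" 1 A' "?X \<inter> (U \<inter> U')"] unfolding R_def by blast+
    from tw_add[OF this(1) tw_scale[OF this(2)]]
    have dif: "tw ?n s (?X \<inter> (U \<inter> U')) (- 1) 1 (\<lambda>w. A w + (- 1) * A' w)" .
    have "A z + (- 1) * A' z = 0"
    proof (rule tw_zero_dense[OF UU dif])
      fix q assume q: "q \<in> ?X \<inter> (U \<inter> U')" "\<forall>k<N. cc q k \<noteq> 0"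
      have "\<sigma> p q = z0 q * A q" "\<sigma> p q = z0 q * A' q" using that(1,2) q(1) unfolding R_def by blast+
      moreover have "z0 q \<noteq> 0" using q(2) by simp
      ultimately show "A q + (- 1) * A' q = 0" by simp
    next
      show "z \<in> ?X \<inter> (U \<inter> U')" using that unfolding R_def by blast
    qed
    thus ?thesis by simp
  qed
  have \<alpha>_eq: "\<alpha> p z = A z" if "R p z U A" "z \<in> ?X" for p z U A
  proof -
    have "\<exists>U A'. R p z U A' \<and> \<alpha> p z = A' z" unfolding \<alpha>_def
      by (rule someI[where x = "A z"]) (use that in blast)
    thus ?thesis using unique[OF that(1) _ that(2)] by metis
  qed
  have transfer: "\<exists>U'. R p z U' (\<lambda>w. trans E p q w * A w)"
    if R: "R q z U A" and "p \<in> ?X" "q \<in> ?X" "z \<in> nbhd E p" "z \<in> nbhd E q" for p q z U A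
  proof -
    let ?U = "U \<inter> nbhd E p \<inter> nbhd E q"
    have "tw ?n s (?X \<inter> ?U) (- 1) 1 (\<lambda>w. trans E p q w * A w)"
    proof (rule tw_mult)
      show "tw ?n s (?X \<inter> ?U) 0 0 (trans E p q)"
        by (rule tw_subset[OF line_bundleD(3)[OF L PE_sub that(2,3)]]) blast
      show "tw ?n s (?X \<inter> ?U) (- 1) 1 A"
        by (rule tw_subset[of _ _ "?X \<inter> U"]) (use R in \<open>auto simp: R_def\<close>)
    qed auto
    moreover have "zopen ?n s ?U"
      using R line_bundleD(1)[OF L PE_sub that(2,2)] line_bundleD(1)[OF L PE_sub that(3,3)]
      unfolding R_def by (intro zopen_Int) auto
    moreover have "\<sigma> p w = z0 w * (trans E p q w * A w)" if w: "w \<in> ?X \<inter> ?U" for w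
    proof -
      have "\<sigma> p w = trans E p q w * \<sigma> q w" by (rule glue) (use w \<open>p \<in> ?X\<close> \<open>q \<in> ?X\<close> in auto)
      moreover have "\<sigma> q w = z0 w * A w" using R w unfolding R_def by blast
      ultimately show ?thesis by simp
    qed
    ultimately have "R p z ?U (\<lambda>w. trans E p q w * A w)" using R that(4,5) unfolding R_def by blast
    thus ?thesis by blast
  qed
  have ex: "\<exists>U A. R p q U A \<and> A q \<noteq> 0" if pq: "p \<in> ?X" "q \<in> ?X" "q \<in> nbhd E p" for p q
  proof -
    obtain U A where U: "R q q U A" "A q \<noteq> 0"
      using exceptional_local_equation[OF L pq(2) \<sigma>] unfolding R_def by blast
    obtain U' where "R p q U' (\<lambda>w. trans E p q w * A w)"
      using transfer[OF U(1) pq(1,2,3) line_bundleD(2)[OF L PE_sub pq(2,2)]] by blast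
    moreover have "trans E p q q * A q \<noteq> 0"
      using U(2) line_bundleD(4)[OF L PE_sub pq(1,2) pq(2,3) line_bundleD(2)[OF L PE_sub pq(2,2)]] by simp
    ultimately show ?thesis by (intro exI[of _ U'] exI[of _ "\<lambda>w. trans E p q w * A w"] conjI)
  qed
  have \<alpha>_tw: "tw ?n s (?X \<inter> nbhd E p) (- 1) 1 (\<alpha> p)" if p: "p \<in> ?X" for p
  proof (rule tw_local)
    show "?X \<inter> nbhd E p \<subseteq> biproj ?n s" using PE_sub by blast
    fix q assume q: "q \<in> ?X \<inter> nbhd E p"
    then obtain U A where U: "R p q U A" using ex[OF p] by blast
    have "\<alpha> p w = A w" if "w \<in> ?X \<inter> nbhd E p \<inter> U" for w
      by (rule \<alpha>_eq[of _ _ U]) (use that U in \<open>auto simp: R_def\<close>)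
    hence "tw ?n s (?X \<inter> nbhd E p \<inter> U) (- 1) 1 (\<alpha> p) \<longleftrightarrow> tw ?n s (?X \<inter> nbhd E p \<inter> U) (- 1) 1 A"
      by (rule tw_cong)
    moreover have "tw ?n s (?X \<inter> nbhd E p \<inter> U) (- 1) 1 A"
      by (rule tw_subset[of _ _ "?X \<inter> U"]) (use U in \<open>auto simp: R_def\<close>)
    ultimately show "\<exists>U. zopen ?n s U \<and> q \<in> U \<and> tw ?n s (?X \<inter> nbhd E p \<inter> U) (- 1) 1 (\<alpha> p)"
      using U unfolding R_def by blast
  qed
  have \<alpha>_nz: "\<alpha> p z \<noteq> 0" if "p \<in> ?X" "z \<in> ?X" "z \<in> nbhd E p" for p z
    using ex[OF that] \<alpha>_eq that(2) by metis
  \<comment> \<open>\<open>\<alpha>\<close> transforms like a section, whereas the local generators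
    \<open>\<psi>\<close> transform inversely; so \<open>\<psi>\<close> is the inverse of
    \<open>\<alpha>\<close>, and the type changes sign.\<close>
  show ?thesis
  proof (rule has_typeI)
    fix p assume p: "p \<in> ?X"
    show "zopen ?n s (nbhd E p) \<and> p \<in> nbhd E p" using line_bundleD[OF L PE_sub p p] by blast
    have "tw ?n s (?X \<inter> nbhd E p) (- (- 1)) (- 1) (\<lambda>z. inverse (\<alpha> p z))"
      by (rule tw_inverse[OF \<alpha>_tw[OF p]]) (use \<alpha>_nz p in blast)
    thus "tw ?n s (?X \<inter> nbhd E p) 1 (- 1) (\<lambda>z. inverse (\<alpha> p z))" by simp
  next
    fix p z assume "p \<in> ?X" "z \<in> ?X" "z \<in> nbhd E p"
    thus "inverse (\<alpha> p z) \<noteq> 0" using \<alpha>_nz by simp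
  next
    fix p q z assume h: "p \<in> ?X" "q \<in> ?X" "z \<in> ?X" "z \<in> nbhd E p" "z \<in> nbhd E q"
    obtain U A where U: "R q z U A" using ex[OF h(2,3,5)] by blast
    obtain U' where U': "R p z U' (\<lambda>w. trans E p q w * A w)" using transfer[OF U h(1,2,4,5)] by blast
    have "\<alpha> p z = trans E p q z * \<alpha> q z" using \<alpha>_eq[OF U h(3)] \<alpha>_eq[OF U' h(3)] by simp
    thus "trans E p q z * inverse (\<alpha> p z) = inverse (\<alpha> q z)"
      using \<alpha>_nz[OF h(1,3,4)] by (auto simp: field_simps)
  qed
qed

end

section \<open>Derivatives along Cox coordinates\<close>

text \<open>Meaningful only if \<open>g\<close> is polynomial along the \<open>k\<close>-th coordinate line through \<open>\<zeta>\<close>.\<close>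

definition pd :: "nat => ((nat => 'k::field_char_0) => 'k) => (nat => 'k) => 'k" where
  "pd k g \<zeta> = poly (pderiv (SOME P. \<forall>t. poly P t = g (\<zeta>(k := t)))) (\<zeta> k)"

lemma pd_eq:
  fixes g :: "(nat => 'k::field_char_0) => 'k"
  assumes "\<And>t. poly P t = g (\<zeta>(k := t))"
  shows "pd k g \<zeta> = poly (pderiv P) (\<zeta> k)"
proof -
  have "\<forall>t. poly (SOME P. \<forall>t. poly P t = g (\<zeta>(k := t))) t = g (\<zeta>(k := t))"
    by (rule someI[of "\<lambda>P. \<forall>t. poly P t = g (\<zeta>(k := t))" P]) (use assms in blast)
  hence "poly (SOME P. \<forall>t. poly P t = g (\<zeta>(k := t))) = poly P" using assms by (auto simp: fun_eq_iff)
  hence "(SOME P. \<forall>t. poly P t = g (\<zeta>(k := t))) = P" by (simp add: poly_eq_poly_eq_iff)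
  thus ?thesis by (simp add: pd_def)
qed

context blowup
begin

text \<open>When \<open>\<alpha> k = 0\<close> the exponent \<open>\<alpha> k - 1\<close> is
  truncated to 0, but the factor \<open>of_nat (\<alpha> k)\<close> removes the term.\<close>

lemma mon_line:
  fixes \<zeta> :: "nat => 'k::field_char_0" and \<alpha> :: "nat => nat"
  assumes "k < N"
  defines "P \<equiv> monom (\<Prod>i\<in>{..<N} - {k}. \<zeta> i ^ \<alpha> i) (\<alpha> k)"
  shows "poly P t = mon \<alpha> (\<zeta>(k := t))"
    and "poly (pderiv P) (\<zeta> k) = of_nat (\<alpha> k) * mon (\<alpha>(k := \<alpha> k - 1)) \<zeta>"
proof -
  have k: "k \<in> {..<N}" using assms by simp
  have "mon \<alpha> (\<zeta>(k := t)) = t ^ \<alpha> k * (\<Prod>i\<in>{..<N} - {k}. (\<zeta>(k := t)) i ^ \<alpha> i)"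
    unfolding mon_def by (subst prod.remove[OF _ k]) simp_all
  also have "(\<Prod>i\<in>{..<N} - {k}. (\<zeta>(k := t)) i ^ \<alpha> i) = (\<Prod>i\<in>{..<N} - {k}. \<zeta> i ^ \<alpha> i)"
    by (rule prod.cong) auto
  finally show "poly P t = mon \<alpha> (\<zeta>(k := t))" unfolding P_def poly_monom by (simp only: mult.commute)
  have "mon (\<alpha>(k := \<alpha> k - 1)) \<zeta> = \<zeta> k ^ (\<alpha> k - 1) * (\<Prod>i\<in>{..<N} - {k}. \<zeta> i ^ (\<alpha>(k := \<alpha> k - 1)) i)"
    unfolding mon_def by (subst prod.remove[OF _ k]) simp_all
  also have "(\<Prod>i\<in>{..<N} - {k}. \<zeta> i ^ (\<alpha>(k := \<alpha> k - 1)) i) = (\<Prod>i\<in>{..<N} - {k}. \<zeta> i ^ \<alpha> i)"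
    by (rule prod.cong) auto
  finally show "poly (pderiv P) (\<zeta> k) = of_nat (\<alpha> k) * mon (\<alpha>(k := \<alpha> k - 1)) \<zeta>"
    unfolding P_def pderiv_monom poly_monom by (simp only: mult_ac)
qed

lemma CP_line:
  fixes f :: "(nat => 'k::field_char_0) => 'k"
  assumes f: "f = (\<lambda>\<zeta>. \<Sum>\<alpha>\<in>Exps d e. c \<alpha> * mon \<alpha> \<zeta>)" and k: "k < N"
  shows "\<exists>P. (\<forall>t. poly P t = f (\<zeta>(k := t))) \<and>
    poly (pderiv P) (\<zeta> k) = (\<Sum>\<alpha>\<in>Exps d e. c \<alpha> * (of_nat (\<alpha> k) * mon (\<alpha>(k := \<alpha> k - 1)) \<zeta>))"
proof (intro exI conjI allI)
  let ?P = "\<Sum>\<alpha>\<in>Exps d e. Polynomial.smult (c \<alpha>) (monom (\<Prod>i\<in>{..<N} - {k}. \<zeta> i ^ \<alpha> i) (\<alpha> k))"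
  show "poly ?P t = f (\<zeta>(k := t))" for t unfolding f poly_sum poly_smult mon_line(1)[OF k] ..
  show "poly (pderiv ?P) (\<zeta> k) = (\<Sum>\<alpha>\<in>Exps d e. c \<alpha> * (of_nat (\<alpha> k) * mon (\<alpha>(k := \<alpha> k - 1)) \<zeta>))"
    unfolding higher_pderiv_sum[of 1, simplified] poly_sum pderiv_smult poly_smult mon_line(2)[OF k] ..
qed

lemma CP_line_ex:
  fixes f :: "(nat => 'k::field_char_0) => 'k"
  assumes f: "f \<in> CP d e" and k: "k < N"
  shows "\<exists>P. (\<forall>t. poly P t = f (\<zeta>(k := t))) \<and> pd k f \<zeta> = poly (pderiv P) (\<zeta> k)"
proof -
  obtain c where c: "f = (\<lambda>\<zeta>. \<Sum>\<alpha>\<in>Exps d e. c \<alpha> * mon \<alpha> \<zeta>)" by (rule CP_expand[OF f])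
  obtain P where P: "\<forall>t. poly P t = f (\<zeta>(k := t))" using CP_line[OF c k] by blast
  show ?thesis by (intro exI[of _ P] conjI P pd_eq) (rule spec[OF P])
qed

lemma pd_add:
  fixes f g :: "(nat => 'k::field_char_0) => 'k"
  assumes "f \<in> CP d e" "g \<in> CP d' e'" "k < N"
  shows "pd k (\<lambda>\<zeta>. f \<zeta> + g \<zeta>) \<zeta> = pd k f \<zeta> + pd k g \<zeta>"
proof -
  obtain P Q where PQ: "\<forall>t. poly P t = f (\<zeta>(k := t))" "pd k f \<zeta> = poly (pderiv P) (\<zeta> k)"
    "\<forall>t. poly Q t = g (\<zeta>(k := t))" "pd k g \<zeta> = poly (pderiv Q) (\<zeta> k)"
    using CP_line_ex[OF assms(1,3), of \<zeta>] CP_line_ex[OF assms(2,3), of \<zeta>] by (elim exE conjE)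
  have "pd k (\<lambda>\<zeta>. f \<zeta> + g \<zeta>) \<zeta> = poly (pderiv (P + Q)) (\<zeta> k)"
    by (rule pd_eq) (simp add: PQ(1)[rule_format] PQ(3)[rule_format])
  thus ?thesis by (simp add: PQ(2,4) pderiv_add)
qed

lemma pd_mult:
  fixes f g :: "(nat => 'k::field_char_0) => 'k"
  assumes "f \<in> CP d e" "g \<in> CP d' e'" "k < N"
  shows "pd k (\<lambda>\<zeta>. f \<zeta> * g \<zeta>) \<zeta> = f \<zeta> * pd k g \<zeta> + g \<zeta> * pd k f \<zeta>"
proof -
  obtain P Q where PQ: "\<forall>t. poly P t = f (\<zeta>(k := t))" "pd k f \<zeta> = poly (pderiv P) (\<zeta> k)"
    "\<forall>t. poly Q t = g (\<zeta>(k := t))" "pd k g \<zeta> = poly (pderiv Q) (\<zeta> k)"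
    using CP_line_ex[OF assms(1,3), of \<zeta>] CP_line_ex[OF assms(2,3), of \<zeta>] by (elim exE conjE)
  have "pd k (\<lambda>\<zeta>. f \<zeta> * g \<zeta>) \<zeta> = poly (pderiv (P * Q)) (\<zeta> k)"
    by (rule pd_eq) (simp add: PQ(1)[rule_format] PQ(3)[rule_format])
  moreover have "poly P (\<zeta> k) = f \<zeta>" "poly Q (\<zeta> k) = g \<zeta>" using PQ(1,3) by simp_all
  ultimately show ?thesis by (simp add: PQ(2,4) pderiv_mult)
qed

lemma pd_const: "pd k (\<lambda>\<zeta>. c) \<zeta> = (0 :: 'k::field_char_0)" by (subst pd_eq[of "[:c:]"]) simp_all

lemma pd_coord: "pd k (\<lambda>\<zeta>. \<zeta> i) \<zeta> = (if i = k then 1 else 0 :: 'k::field_char_0)"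
  by (subst pd_eq[of "if i = k then [:0, 1:] else [:\<zeta> i:]"]) (auto simp: pderiv_pCons)

lemma Exps_lower:
  assumes \<alpha>: "\<alpha> \<in> Exps d e" and k: "k < N" "\<alpha> k \<noteq> 0"
  shows "\<alpha>(k := \<alpha> k - 1) \<in> Exps (d - wd k) (e - we k)"
proof -
  have "(\<Sum>i<N. int ((\<alpha>(k := \<alpha> k - 1)) i) * w i) = (\<Sum>i<N. int (\<alpha> i) * w i) - w k" for w
  proof -
    have "int ((\<alpha>(k := \<alpha> k - 1)) i) * w i = int (\<alpha> i) * w i - (if i = k then w k else 0)" for i
      using k(2) by (simp add: of_nat_diff left_diff_distrib)
    hence "(\<Sum>i<N. int ((\<alpha>(k := \<alpha> k - 1)) i) * w i) =
      (\<Sum>i<N. int (\<alpha> i) * w i - (if i = k then w k else 0))" by (intro sum.cong) auto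
    thus ?thesis using k(1) by (simp add: sum_subtractf)
  qed
  thus ?thesis using \<alpha> k(1) unfolding Exps_def by simp
qed

lemma pd_CP:
  fixes f :: "(nat => 'k::field_char_0) => 'k"
  assumes f: "f \<in> CP d e" and k: "k < N"
  shows "pd k f \<in> CP (d - wd k) (e - we k)"
proof -
  obtain c where c: "f = (\<lambda>\<zeta>. \<Sum>\<alpha>\<in>Exps d e. c \<alpha> * mon \<alpha> \<zeta>)" by (rule CP_expand[OF f])
  have eq: "pd k f = (\<lambda>\<zeta>. \<Sum>\<alpha>\<in>Exps d e. c \<alpha> * (of_nat (\<alpha> k) * mon (\<alpha>(k := \<alpha> k - 1)) \<zeta>))"
  proof
    fix \<zeta>
    obtain P where P: "\<forall>t. poly P t = f (\<zeta>(k := t))" "poly (pderiv P) (\<zeta> k) =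
      (\<Sum>\<alpha>\<in>Exps d e. c \<alpha> * (of_nat (\<alpha> k) * mon (\<alpha>(k := \<alpha> k - 1)) \<zeta>))" using CP_line[OF c k] by blast
    show "pd k f \<zeta> = (\<Sum>\<alpha>\<in>Exps d e. c \<alpha> * (of_nat (\<alpha> k) * mon (\<alpha>(k := \<alpha> k - 1)) \<zeta>))"
      using pd_eq[of P f \<zeta> k] P by simp
  qed
  show ?thesis unfolding eq
  proof (rule fs_subspace_sum[OF CP_subspace])
    fix \<alpha> assume \<alpha>: "\<alpha> \<in> Exps d e"
    show "(\<lambda>\<zeta>. of_nat (\<alpha> k) * mon (\<alpha>(k := \<alpha> k - 1)) \<zeta>) \<in> CP (d - wd k) (e - we k)"
    proof (cases "\<alpha> k = 0")
      case True
      show ?thesis using fs.subspace_0[OF CP_subspace[of "d - wd k" "e - we k"]] by (simp add: True zero_fun_def)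
    next
      case False
      show ?thesis by (rule fs.subspace_scale[OF CP_subspace CP_mon[OF Exps_lower[OF \<alpha> k False]]])
    qed
  qed
qed

lemma CP_add: "f \<in> CP d e ==> g \<in> CP d e ==> (\<lambda>\<zeta>. f \<zeta> + g \<zeta>) \<in> CP d e"
  using fs.subspace_add[OF CP_subspace, of f d e g] by (simp add: plus_fun_def)

text \<open>
  A twisted function \<open>f\<close> of type \<open>(d, e)\<close> is near \<open>z\<close> a quotient \<open>A / B\<close> of polynomials in the Cox
  coordinates; \<open>v\<close> is the \<open>k\<close>-th partial derivative of this quotient.
\<close>

definition der_at where
  "der_at d e f k z v U A B d' e' \<longleftrightarrow> zopen n s U \<and> z \<in> U \<and> A \<in> CP (d + d') (e + e') \<and>
     B \<in> CP d' e' \<and> B (cc z) \<noteq> 0 \<and> (\<forall>q\<in>PE r s \<inter> U. B (cc q) * f q = A (cc q)) \<and>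
     B (cc z) * v + pd k B (cc z) * f z = pd k A (cc z)"

definition der :: "int => int => ('k::field_char_0 pt => 'k) => nat => 'k pt => 'k => bool" where
  "der d e f k z v \<longleftrightarrow> (\<exists>U A B d' e'. der_at d e f k z v U A B d' e')"

lemma der_atD:
  assumes "der_at d e f k z v U A B d' e'" "z \<in> PE r s"
  shows "zopen n s U" "z \<in> U" "A \<in> CP (d + d') (e + e')" "B \<in> CP d' e'" "B (cc z) \<noteq> 0"
    "\<forall>q\<in>PE r s \<inter> U. B (cc q) * f q = A (cc q)"
    "B (cc z) * v + pd k B (cc z) * f z = pd k A (cc z)" "A (cc z) = B (cc z) * f z"
  using assms unfolding der_at_def by auto

text \<open>Two quotients \<open>A / B\<close> and \<open>A' / B'\<close> representing
  \<open>f\<close> agree near \<open>z\<close>. Multiplied by a form that vanishes outside the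
  common neighbourhood, \<open>A B' - A' B\<close> is zero as a Cox polynomial, so its derivative
  vanishes, and at \<open>z\<close> the product rule isolates \<open>v = v'\<close>.\<close>

lemma der_unique:
  fixes f :: "'k::field_char_0 pt => 'k"
  assumes "der d e f k z v" "der d e f k z v'" and z: "z \<in> PE r s" and k: "k < N"
  shows "v = v'"
proof -
  obtain U A B d1 e1 where "der_at d e f k z v U A B d1 e1"
    using assms(1) unfolding der_def by blast
  note U = der_atD[OF this z]
  obtain U' A' B' d2 e2 where "der_at d e f k z v' U' A' B' d2 e2"
    using assms(2) unfolding der_def by blast
  note U' = der_atD[OF this z]
  have "zopen n s (U \<inter> U')" "z \<in> U \<inter> U'" using U U' zopen_Int by auto
  from zopen_separate[OF this] obtain H d0 e0 where H: "biform n s d0 e0 H" "form_at H z \<noteq> 0"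
    "\<forall>q\<in>biproj n s - (U \<inter> U'). form_at H q = 0" by blast
  define h where "h = (\<lambda>\<zeta>. H (px \<zeta>) (py \<zeta>))"
  have h: "h \<in> CP (int d0) (int e0)" unfolding h_def by (rule CP_pullback[OF H(1)])
  have hz: "h (cc z) \<noteq> 0" using H(2) form_at_cc[OF z, of H] by (simp add: h_def)
  have AB: "(\<lambda>\<zeta>. A \<zeta> * B' \<zeta>) \<in> CP (d + d1 + d2) (e + e1 + e2)" by (rule CP_mult[OF U(3) U'(4)]) auto
  have mB: "(\<lambda>\<zeta>. (- 1) * B \<zeta>) \<in> CP d1 e1" using fs.subspace_scale[OF CP_subspace U(4)] .
  have AB': "(\<lambda>\<zeta>. A' \<zeta> * ((- 1) * B \<zeta>)) \<in> CP (d + d1 + d2) (e + e1 + e2)" by (rule CP_mult[OF U'(3) mB]) auto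
  define W where "W = (\<lambda>\<zeta>. A \<zeta> * B' \<zeta> + A' \<zeta> * ((- 1) * B \<zeta>))"
  have W: "W \<in> CP (d + d1 + d2) (e + e1 + e2)" unfolding W_def by (rule CP_add[OF AB AB'])
  have hW: "(\<lambda>\<zeta>. h \<zeta> * W \<zeta>) \<in> CP (int d0 + (d + d1 + d2)) (int e0 + (e + e1 + e2))"
    by (rule CP_mult[OF h W]) auto
  have "h \<zeta> * W \<zeta> = 0" for \<zeta>
  proof (rule CP_zero_on_PE[OF hW])
    fix q :: "'k pt" assume q: "q \<in> PE r s"
    show "h (cc q) * W (cc q) = 0"
    proof (cases "q \<in> U \<inter> U'")
      case True
      hence "B (cc q) * f q = A (cc q)" "B' (cc q) * f q = A' (cc q)" using U(6) U'(6) q by blast+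
      thus ?thesis by (simp add: W_def flip: \<open>B (cc q) * f q = A (cc q)\<close> \<open>B' (cc q) * f q = A' (cc q)\<close>)
    next
      case False
      hence "form_at H q = 0" using H(3) q PE_sub by blast
      thus ?thesis using form_at_cc[OF q, of H] by (simp add: h_def)
    qed
  qed
  hence "(\<lambda>\<zeta>. h \<zeta> * W \<zeta>) = (\<lambda>\<zeta>. 0)" by blast
  hence "h (cc z) * pd k W (cc z) + W (cc z) * pd k h (cc z) = 0"
    using pd_mult[OF h W k, of "cc z"] pd_const[of k 0 "cc z"] by simp
  moreover have "W (cc z) = 0" by (simp add: W_def U(8) U'(8))
  ultimately have "pd k W (cc z) = 0" using hz by simp
  moreover have "pd k (\<lambda>\<zeta>. (- 1) * B \<zeta>) (cc z) = - pd k B (cc z)"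
    using pd_mult[OF CP_const U(4) k, of "- 1" "cc z"] by (simp add: pd_const)
  ultimately have "A (cc z) * pd k B' (cc z) + B' (cc z) * pd k A (cc z) =
      A' (cc z) * pd k B (cc z) + B (cc z) * pd k A' (cc z)"
    unfolding W_def pd_add[OF AB AB' k] pd_mult[OF U(3) U'(4) k] pd_mult[OF U'(3) mB k]
    by (simp add: algebra_simps)
  hence "B (cc z) * B' (cc z) * v = B (cc z) * B' (cc z) * v'"
    unfolding U(7)[symmetric] U'(7)[symmetric] U(8) U'(8) by (simp add: algebra_simps)
  thus ?thesis using U(5) U'(5) by simp
qed

lemma der_ex:
  fixes f :: "'k::field_char_0 pt => 'k"
  assumes U: "zopen n s U" and f: "tw n s (PE r s \<inter> U) d e f" and z: "z \<in> PE r s \<inter> U"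
  shows "\<exists>v. der d e f k z v"
proof -
  from twD[OF f z] obtain F G d1 e1 d2 e2 where "tw_at n s (PE r s \<inter> U) d e f z F G d1 e1 d2 e2"
    by blast
  note F = tw_atD[OF this]
  define A where "A = (\<lambda>\<zeta>. F (px \<zeta>) (py \<zeta>))"
  define B where "B = (\<lambda>\<zeta>. G (px \<zeta>) (py \<zeta>))"
  have A: "A \<in> CP (d + int d2) (e + int e2)" using CP_pullback[OF F(1)] F(3,4) by (simp add: A_def)
  have B: "B \<in> CP (int d2) (int e2)" unfolding B_def by (rule CP_pullback[OF F(2)])
  have Bz: "B (cc z) \<noteq> 0" using F(5) form_at_cc[of z G] z by (simp add: B_def)
  have eq: "\<forall>q\<in>PE r s \<inter> U. B (cc q) * f q = A (cc q)"
    using F(6) form_at_cc[of _ G] form_at_cc[of _ F] by (simp add: A_def B_def)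
  show ?thesis unfolding der_def der_at_def
    by (intro exI[of _ "(pd k A (cc z) - pd k B (cc z) * f z) / B (cc z)"] exI[of _ U] exI[of _ A]
        exI[of _ B] exI[of _ "int d2"] exI[of _ "int e2"] conjI U A B Bz eq) (use z Bz in auto)
qed

lemma der_germ:
  fixes f :: "'k::field_char_0 pt => 'k"
  assumes "der d e f k z v" and U': "zopen n s U'" "z \<in> U'" "z \<in> PE r s"
    and eq: "\<And>q. q \<in> PE r s ==> q \<in> U' ==> g q = f q"
  shows "der d e g k z v"
proof -
  obtain U A B d1 e1 where "der_at d e f k z v U A B d1 e1"
    using assms(1) unfolding der_def by blast
  note U = der_atD[OF this assms(4)]
  show ?thesis unfolding der_def der_at_def
  proof (intro exI conjI)
    show "zopen n s (U \<inter> U')" by (rule zopen_Int[OF U(1) U'(1)])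
    show "\<forall>q\<in>PE r s \<inter> (U \<inter> U'). B (cc q) * g q = A (cc q)" using U(6) eq by simp
    show "B (cc z) * v + pd k B (cc z) * g z = pd k A (cc z)" using U(7) eq[OF U'(3,2)] by simp
  qed (use U U' in auto)
qed

lemma der_CP:
  fixes g :: "(nat => 'k::field_char_0) => 'k"
  assumes "g \<in> CP d e" "z \<in> PE r s"
  shows "der d e (\<lambda>q. g (cc q)) k z (pd k g (cc z))" unfolding der_def der_at_def
proof (intro exI conjI)
  show "zopen n s (biproj n s)" by (rule zopen_biproj)
  show "(\<lambda>\<zeta>. 1) \<in> CP 0 0" by (rule CP_const)
  show "g \<in> CP (d + 0) (e + 0)" using assms by simp
qed (use assms PE_sub in \<open>auto simp: pd_const\<close>)

lemma der_add:
  fixes f g :: "'k::field_char_0 pt => 'k"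
  assumes "der d e f k z v" "der d e g k z v'" and z: "z \<in> PE r s" and k: "k < N"
  shows "der d e (\<lambda>q. f q + g q) k z (v + v')"
proof -
  obtain U A B d1 e1 where "der_at d e f k z v U A B d1 e1"
    using assms(1) unfolding der_def by blast
  note U = der_atD[OF this z]
  obtain U' A' B' d2 e2 where "der_at d e g k z v' U' A' B' d2 e2"
    using assms(2) unfolding der_def by blast
  note U' = der_atD[OF this z]
  have AB: "(\<lambda>\<zeta>. A \<zeta> * B' \<zeta>) \<in> CP (d + (d1 + d2)) (e + (e1 + e2))" by (rule CP_mult[OF U(3) U'(4)]) auto
  have AB': "(\<lambda>\<zeta>. A' \<zeta> * B \<zeta>) \<in> CP (d + (d1 + d2)) (e + (e1 + e2))" by (rule CP_mult[OF U'(3) U(4)]) auto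
  show ?thesis unfolding der_def der_at_def
  proof (intro exI conjI)
    show "zopen n s (U \<inter> U')" by (rule zopen_Int[OF U(1) U'(1)])
    show "(\<lambda>\<zeta>. A \<zeta> * B' \<zeta> + A' \<zeta> * B \<zeta>) \<in> CP (d + (d1 + d2)) (e + (e1 + e2))" by (rule CP_add[OF AB AB'])
    show "(\<lambda>\<zeta>. B \<zeta> * B' \<zeta>) \<in> CP (d1 + d2) (e1 + e2)" by (rule CP_mult[OF U(4) U'(4)]) auto
    show "\<forall>q\<in>PE r s \<inter> (U \<inter> U'). B (cc q) * B' (cc q) * (f q + g q) = A (cc q) * B' (cc q) + A' (cc q) * B (cc q)"
    proof
      fix q assume "q \<in> PE r s \<inter> (U \<inter> U')"
      hence "A (cc q) = B (cc q) * f q" "A' (cc q) = B' (cc q) * g q" using U(6) U'(6) by auto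
      thus "B (cc q) * B' (cc q) * (f q + g q) = A (cc q) * B' (cc q) + A' (cc q) * B (cc q)"
        by (simp add: algebra_simps)
    qed
    show "B (cc z) * B' (cc z) * (v + v') + pd k (\<lambda>\<zeta>. B \<zeta> * B' \<zeta>) (cc z) * (f z + g z) =
        pd k (\<lambda>\<zeta>. A \<zeta> * B' \<zeta> + A' \<zeta> * B \<zeta>) (cc z)"
      unfolding pd_add[OF AB AB' k] pd_mult[OF U(3) U'(4) k] pd_mult[OF U'(3) U(4) k] pd_mult[OF U(4) U'(4) k]
        U(7)[symmetric] U'(7)[symmetric] U(8) U'(8) by (simp add: algebra_simps)
  qed (use U U' in auto)
qed

lemma der_mult:
  fixes f g :: "'k::field_char_0 pt => 'k"
  assumes "der d e f k z v" "der d' e' g k z v'" and z: "z \<in> PE r s" and k: "k < N"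
    and "D = d + d'" "E = e + e'"
  shows "der D E (\<lambda>q. f q * g q) k z (f z * v' + g z * v)"
proof -
  obtain U A B d1 e1 where "der_at d e f k z v U A B d1 e1"
    using assms(1) unfolding der_def by blast
  note U = der_atD[OF this z]
  obtain U' A' B' d2 e2 where "der_at d' e' g k z v' U' A' B' d2 e2"
    using assms(2) unfolding der_def by blast
  note U' = der_atD[OF this z]
  show ?thesis unfolding der_def der_at_def
  proof (intro exI conjI)
    show "zopen n s (U \<inter> U')" by (rule zopen_Int[OF U(1) U'(1)])
    show "(\<lambda>\<zeta>. A \<zeta> * A' \<zeta>) \<in> CP (D + (d1 + d2)) (E + (e1 + e2))"
      by (rule CP_mult[OF U(3) U'(3)]) (auto simp: assms)
    show "(\<lambda>\<zeta>. B \<zeta> * B' \<zeta>) \<in> CP (d1 + d2) (e1 + e2)" by (rule CP_mult[OF U(4) U'(4)]) auto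
    show "\<forall>q\<in>PE r s \<inter> (U \<inter> U'). B (cc q) * B' (cc q) * (f q * g q) = A (cc q) * A' (cc q)"
    proof
      fix q assume "q \<in> PE r s \<inter> (U \<inter> U')"
      hence "A (cc q) = B (cc q) * f q" "A' (cc q) = B' (cc q) * g q" using U(6) U'(6) by auto
      thus "B (cc q) * B' (cc q) * (f q * g q) = A (cc q) * A' (cc q)" by simp
    qed
    show "B (cc z) * B' (cc z) * (f z * v' + g z * v) + pd k (\<lambda>\<zeta>. B \<zeta> * B' \<zeta>) (cc z) * (f z * g z) =
        pd k (\<lambda>\<zeta>. A \<zeta> * A' \<zeta>) (cc z)" unfolding pd_mult[OF U(3) U'(3) k] pd_mult[OF U(4) U'(4) k]
        U(7)[symmetric] U'(7)[symmetric] U(8) U'(8) by (simp add: algebra_simps)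
  qed (use U U' in auto)
qed

lemma der_const: "z \<in> PE r s ==> der 0 0 (\<lambda>_. c) k z 0"
  using der_CP[OF CP_const, of z c k] by (simp add: pd_const)

lemma der_scale:
  assumes "der d e f k z v" "z \<in> PE r s" "k < N"
  shows "der d e (\<lambda>q. c * f q) k z (c * v)"
  using der_mult[OF der_const[OF assms(2), of c] assms(1-3)] by simp

lemma der_sum:
  assumes "finite I" "\<And>i. i \<in> I ==> der 0 0 (f i) k z (v i)" "z \<in> PE r s" "k < N"
  shows "der 0 0 (\<lambda>q. \<Sum>i\<in>I. f i q) k z (\<Sum>i\<in>I. v i)" using assms(1,2)
proof (induction I rule: finite_induct)
  case empty
  show ?case using der_const[OF assms(3)] by simp
next
  case (insert i I)
  have "der 0 0 (\<lambda>q. f i q + (\<Sum>i\<in>I. f i q)) k z (v i + (\<Sum>i\<in>I. v i))"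
  proof (rule der_add[OF _ _ assms(3,4)])
    show "der 0 0 (f i) k z (v i)" by (rule insert.prems) simp
    show "der 0 0 (\<lambda>q. \<Sum>i\<in>I. f i q) k z (\<Sum>i\<in>I. v i)" by (rule insert.IH, rule insert.prems) simp
  qed
  thus ?case using insert.hyps by simp
qed

text \<open>Leibniz rule: each summand is a product of two functions vanishing at
  \<open>z\<close>.\<close>

lemma der_max_ideal_sq:
  fixes f :: "'k::field_char_0 pt => 'k"
  assumes f: "f \<in> max_ideal_sq n s (PE r s) z" and z: "z \<in> PE r s" and k: "k < N"
  shows "der 0 0 f k z 0"
proof -
  obtain M :: nat and g h where M: "\<forall>m<M. g m \<in> max_ideal n s (PE r s) z \<and> h m \<in> max_ideal n s (PE r s) z"
    "same_germ n s (PE r s) z f (\<lambda>q. \<Sum>m<M. g m q * h m q)"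
    using f unfolding max_ideal_sq_def by blast
  have D: "\<exists>v. der 0 0 a k z v" "a z = 0" if "a \<in> max_ideal n s (PE r s) z" for a
  proof -
    have "a \<in> local_ring n s (PE r s) z" using that unfolding max_ideal_def by blast
    from local_ring_tw[OF PE_sub this] obtain U where "zopen n s U" "z \<in> U" "tw n s (PE r s \<inter> U) 0 0 a"
      by blast
    thus "\<exists>v. der 0 0 a k z v" using der_ex z by blast
    show "a z = 0" using that unfolding max_ideal_def by blast
  qed
  have "der 0 0 (\<lambda>q. \<Sum>m<M. g m q * h m q) k z (\<Sum>m<M. 0)"
  proof (rule der_sum[OF finite_lessThan _ z k])
    fix m assume "m \<in> {..<M}"
    hence gh: "g m \<in> max_ideal n s (PE r s) z" "h m \<in> max_ideal n s (PE r s) z" using M(1) by auto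
    obtain v w where "der 0 0 (g m) k z v" "der 0 0 (h m) k z w" using D(1)[OF gh(1)] D(1)[OF gh(2)] by blast
    from der_mult[OF this z k, of 0 0] show "der 0 0 (\<lambda>q. g m q * h m q) k z 0"
      by (simp add: D(2)[OF gh(1)] D(2)[OF gh(2)])
  qed
  moreover obtain U where "zopen n s U" "z \<in> U" "\<forall>q\<in>PE r s \<inter> U. f q = (\<Sum>m<M. g m q * h m q)"
    using M(2) unfolding same_germ_def by blast
  ultimately show ?thesis using der_germ[OF _ _ _ z, of 0 0 "\<lambda>q. \<Sum>m<M. g m q * h m q" k "\<Sum>m<M. 0" U f] by simp
qed

lemma der_differential:
  fixes f :: "'k::field_char_0 pt => 'k"
  assumes f: "has_differential n s (PE r s) z n u f c" and z: "z \<in> PE r s" and k: "k < N"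
    and u: "\<And>j. j < n ==> der 0 0 (u j) k z (v j)"
  shows "der 0 0 f k z (\<Sum>j<n. c j * v j)"
proof -
  let ?g = "\<lambda>q. f q - f z - (\<Sum>j<n. c j * (u j q - u j z))"
  have 1: "der 0 0 ?g k z 0"
    by (rule der_max_ideal_sq[OF _ z k]) (use f in \<open>simp add: has_differential_def\<close>)
  have "der 0 0 (\<lambda>q. \<Sum>j\<in>{..<n}. c j * (u j q + - u j z)) k z (\<Sum>j\<in>{..<n}. c j * (v j + 0))"
  proof (rule der_sum[OF finite_lessThan _ z k])
    fix j assume "j \<in> {..<n}"
    hence "der 0 0 (u j) k z (v j)" using u by simp
    thus "der 0 0 (\<lambda>q. c j * (u j q + - u j z)) k z (c j * (v j + 0))"
      by (intro der_scale[OF der_add[OF _ der_const[OF z] z k] z k])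
  qed
  from der_add[OF der_add[OF 1 der_const[OF z, of "f z"] z k] this z k]
  show ?thesis by (simp add: algebra_simps)
qed

definition D :: "int => int => ('k::field_char_0 pt => 'k) => nat => 'k pt => 'k" where
  "D d e f k z = (SOME v. der d e f k z v)"

lemma D_eq: "der d e f k z v ==> z \<in> PE r s ==> k < N ==> D d e f k z = v"
  unfolding D_def using der_unique someI[of "\<lambda>v. der d e f k z v" v] by blast

text \<open>By the quotient rule, near \<open>p\<close> the derivative is given by one formula in
  Cox polynomials \<open>A\<close> and \<open>B\<close>; differentiating lowers the weight by that
  of the coordinate.\<close>

lemma D_tw:
  fixes f :: "'k::field_char_0 pt => 'k"
  assumes U: "zopen n s U" and f: "tw n s (PE r s \<inter> U) d e f" and k: "k < N"
  shows "tw n s (PE r s \<inter> U) (d - wd k) (e - we k) (D d e f k)"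
proof (rule tw_local)
  show "PE r s \<inter> U \<subseteq> biproj n s" using PE_sub by blast
  fix p assume p: "p \<in> PE r s \<inter> U"
  from twD[OF f p] obtain F G d1 e1 d2 e2 where "tw_at n s (PE r s \<inter> U) d e f p F G d1 e1 d2 e2"
    by blast
  note F = tw_atD[OF this]
  define A where "A = (\<lambda>\<zeta>. F (px \<zeta>) (py \<zeta>))"
  define B where "B = (\<lambda>\<zeta>. G (px \<zeta>) (py \<zeta>))"
  have A: "A \<in> CP (d + int d2) (e + int e2)" using CP_pullback[OF F(1)] F(3,4) by (simp add: A_def)
  have B: "B \<in> CP (int d2) (int e2)" unfolding B_def by (rule CP_pullback[OF F(2)])
  have eq: "\<forall>q\<in>PE r s \<inter> U. B (cc q) * f q = A (cc q)"
    using F(6) form_at_cc[of _ G] form_at_cc[of _ F] by (simp add: A_def B_def)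
  let ?U' = "{q \<in> biproj n s. form_at G q \<noteq> 0}"
  let ?W = "PE r s \<inter> U \<inter> ?U'"
  have U': "zopen n s ?U'" by (rule zopen_form[OF F(2)])
  have Bq: "B (cc q) \<noteq> 0" if "q \<in> ?W" for q using that form_at_cc[of q G] by (simp add: B_def)
  let ?g = "\<lambda>q. (pd k A (cc q) + (- 1) * (pd k B (cc q) * f q)) * inverse (B (cc q))"
  have Dq: "D d e f k q = ?g q" if q: "q \<in> ?W" for q
  proof (rule D_eq)
    show "der d e f k q (?g q)" unfolding der_def der_at_def
      by (intro exI[of _ U] exI[of _ A] exI[of _ B] exI[of _ "int d2"] exI[of _ "int e2"] conjI U A B eq Bq[OF q])
        (use q Bq[OF q] in \<open>auto simp: field_simps\<close>)
  qed (use q k in auto)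
  have "tw n s ?W (d - wd k) (e - we k) ?g"
  proof (rule tw_mult)
    have W: "?W \<subseteq> PE r s" by blast
    show "tw n s ?W (- int d2) (- int e2) (\<lambda>q. inverse (B (cc q)))"
      by (rule tw_inverse[OF tw_subset[OF CP_tw[OF B] W]]) (rule Bq)
    show "tw n s ?W (d + int d2 - wd k) (e + int e2 - we k) (\<lambda>q. pd k A (cc q) + (- 1) * (pd k B (cc q) * f q))"
    proof (rule tw_add[OF tw_subset[OF CP_tw[OF pd_CP[OF A k]] W] tw_scale])
      show "tw n s ?W (d + int d2 - wd k) (e + int e2 - we k) (\<lambda>q. pd k B (cc q) * f q)"
        by (rule tw_mult[OF tw_subset[OF CP_tw[OF pd_CP[OF B k]] W] tw_subset[OF f]]) auto
    qed
  qed auto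
  hence "tw n s ?W (d - wd k) (e - we k) (D d e f k)" by (subst tw_cong[OF Dq])
  moreover have "p \<in> ?U'" using p F(5) PE_sub by blast
  ultimately show "\<exists>U'. zopen n s U' \<and> p \<in> U' \<and> tw n s (PE r s \<inter> U \<inter> U') (d - wd k) (e - we k) (D d e f k)"
    using U' by blast
qed

end

section \<open>The canonical bundle\<close>

lemma det_unit_block:
  fixes J :: "nat => nat => 'k::field"
  shows "Determinant.det (mat (n + 2) (n + 2) (\<lambda>(l, m). if l < n then (if m < n then J l m else 0)
      else if m < n then C l m else if l = m then 1 else 0)) = Determinant.det (mat n n (\<lambda>(l, m). J l m))"
proof -
  let ?C = "mat 2 n (\<lambda>(l, m). C (n + l) m)"
  have eq: "mat (n + 2) (n + 2) (\<lambda>(l, m). if l < n then (if m < n then J l m else 0)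
      else if m < n then C l m else if l = m then 1 else 0) =
    four_block_mat (mat n n (\<lambda>(l, m). J l m)) (0\<^sub>m n 2) ?C (1\<^sub>m 2)" by (rule eq_matI) auto
  show ?thesis unfolding eq
    by (subst det_four_block_mat_upper_right_zero[where n = n and m = 2]) auto
qed

context blowup
begin

text \<open>Together with \<open>yg\<close> these logarithmic gradients supply the two torus
  directions, along which functions on \<open>PE\<close> are constant.\<close>

definition xg :: "nat => 'k::field_char_0 pt => nat => 'k" where
  "xg i z k = pd k (\<lambda>\<zeta>. px \<zeta> i) (cc z) / xc z i"

definition yg :: "nat => 'k::field_char_0 pt => nat => 'k" where
  "yg j z k = pd k (\<lambda>\<zeta>. py \<zeta> j) (cc z) / yc z j"

text \<open>The gradients of \<open>n\<close> local coordinates and two logarithmic gradients give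
  \<open>n + 2\<close> rows for the \<open>n + 2\<close> Cox coordinates. The determinant of this
  square array compares the Jacobians in \<open>canonical_bundle\<close> with the grading of the Cox
  ring.\<close>

definition frame :: "(nat => 'k::field_char_0 pt => 'k) => nat => nat => 'k pt => nat => nat => 'k" where
  "frame u i j z l k = (if l < n then D 0 0 (u l) k z else if l = n then xg i z k else yg j z k)"

definition frame_mat :: "(nat => 'k::field_char_0 pt => 'k) => nat => nat => 'k pt => 'k mat" where
  "frame_mat u i j z = mat (N) (N) (\<lambda>(l, k). frame u i j z l k)"

text \<open>If \<open>f\<close> has type \<open>(d, e)\<close>, then
  \<open>f / (x_i ^ d * y_j ^ e)\<close> is a function whose gradient is a combination of those of
  the local coordinates \<open>u\<close>; clearing the denominator adds \<open>d f\<close> and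
  \<open>e f\<close> times the logarithmic gradients.\<close>

definition spanned :: "(nat => 'k::field_char_0 pt => 'k) => nat => nat => 'k pt => int => int =>
    ('k pt => 'k) => bool" where
  "spanned u i j z d e f \<longleftrightarrow> (\<exists>c. \<forall>k<N. der d e f k z ((\<Sum>l<n. c l * D 0 0 (u l) k z) +
     of_int d * f z * xg i z k + of_int e * f z * yg j z k))"

lemma CP_px: "i \<le> n ==> (\<lambda>\<zeta>. px \<zeta> i) \<in> CP 1 0" using CP_pullback[OF biform.coord_x, of i] by simp

lemma CP_py: "j \<le> s ==> (\<lambda>\<zeta>. py \<zeta> j) \<in> CP 0 1" using CP_pullback[OF biform.coord_y, of j] by simp

lemma px_cc: "z \<in> PE r s ==> px (cc z) i = xc z i" using cc_spec(1) fun_cong by metis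

lemma py_cc: "z \<in> PE r s ==> py (cc z) j = yc z j" using cc_spec(2) fun_cong by metis

lemma der_x:
  fixes z :: "'k::field_char_0 pt"
  assumes "i \<le> n" "z \<in> PE r s"
  shows "der 1 0 (\<lambda>q. xc q i) k z (pd k (\<lambda>\<zeta>. px \<zeta> i) (cc z))"
proof (rule der_germ[OF der_CP[OF CP_px[OF assms(1)] assms(2)] zopen_biproj _ assms(2)])
  show "z \<in> biproj n s" using assms(2) PE_sub by blast
  fix q :: "'k pt" assume "q \<in> PE r s"
  thus "xc q i = px (cc q) i" using px_cc by metis
qed

lemma der_y:
  fixes z :: "'k::field_char_0 pt"
  assumes "j \<le> s" "z \<in> PE r s"
  shows "der 0 1 (\<lambda>q. yc q j) k z (pd k (\<lambda>\<zeta>. py \<zeta> j) (cc z))"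
proof (rule der_germ[OF der_CP[OF CP_py[OF assms(1)] assms(2)] zopen_biproj _ assms(2)])
  show "z \<in> biproj n s" using assms(2) PE_sub by blast
  fix q :: "'k pt" assume "q \<in> PE r s"
  thus "yc q j = py (cc q) j" using py_cc by metis
qed

lemma der_inverse:
  fixes z :: "'k::field_char_0 pt"
  assumes F: "biform n s d e F" and z: "z \<in> PE r s" "form_at F z \<noteq> 0"
  shows "der (- int d) (- int e) (\<lambda>q. inverse (form_at F q)) k z
    (- pd k (\<lambda>\<zeta>. F (px \<zeta>) (py \<zeta>)) (cc z) * inverse (form_at F z) * inverse (form_at F z))"
  unfolding der_def der_at_def
proof (intro exI conjI)
  show "zopen n s {q \<in> biproj n s. form_at F q \<noteq> 0}" by (rule zopen_form[OF F])
  show "(\<lambda>\<zeta>. F (px \<zeta>) (py \<zeta>)) \<in> CP (int d) (int e)" by (rule CP_pullback[OF F])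
  show "(\<lambda>\<zeta>. 1) \<in> CP (- int d + int d) (- int e + int e)" using CP_const by simp
qed (use z PE_sub form_at_cc[of _ F] in \<open>auto simp: pd_const\<close>)

lemma spanned_mult:
  fixes z :: "'k::field_char_0 pt"
  assumes f: "spanned u i j z d e f" and g: "spanned u i j z d' e' g" and z: "z \<in> PE r s"
  shows "spanned u i j z (d + d') (e + e') (\<lambda>q. f q * g q)"
proof -
  obtain c where c: "\<forall>k<N. der d e f k z ((\<Sum>l<n. c l * D 0 0 (u l) k z) +
     of_int d * f z * xg i z k + of_int e * f z * yg j z k)" using f unfolding spanned_def by blast
  obtain c' where c': "\<forall>k<N. der d' e' g k z ((\<Sum>l<n. c' l * D 0 0 (u l) k z) +
     of_int d' * g z * xg i z k + of_int e' * g z * yg j z k)" using g unfolding spanned_def by blast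
  show ?thesis unfolding spanned_def
  proof (intro exI allI impI)
    fix k assume k: "k < N"
    have "(\<Sum>l<n. (f z * c' l + g z * c l) * D 0 0 (u l) k z) =
        f z * (\<Sum>l<n. c' l * D 0 0 (u l) k z) + g z * (\<Sum>l<n. c l * D 0 0 (u l) k z)"
      by (simp add: sum_distrib_left sum.distrib[symmetric] algebra_simps)
    hence eq: "(\<Sum>l<n. (f z * c' l + g z * c l) * D 0 0 (u l) k z) +
       of_int (d + d') * (f z * g z) * xg i z k + of_int (e + e') * (f z * g z) * yg j z k =
      f z * ((\<Sum>l<n. c' l * D 0 0 (u l) k z) + of_int d' * g z * xg i z k + of_int e' * g z * yg j z k) +
      g z * ((\<Sum>l<n. c l * D 0 0 (u l) k z) + of_int d * f z * xg i z k + of_int e * f z * yg j z k)"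
      by (simp add: algebra_simps)
    show "der (d + d') (e + e') (\<lambda>q. f q * g q) k z ((\<Sum>l<n. (f z * c' l + g z * c l) * D 0 0 (u l) k z) +
       of_int (d + d') * (f z * g z) * xg i z k + of_int (e + e') * (f z * g z) * yg j z k)"
      unfolding eq by (rule der_mult[OF c[rule_format, OF k] c'[rule_format, OF k] z k]) auto
  qed
qed

lemma spanned_germ:
  fixes z :: "'k::field_char_0 pt"
  assumes f: "spanned u i j z d e f" and U: "zopen n s U" "z \<in> U" "z \<in> PE r s"
    and eq: "\<And>q. q \<in> PE r s ==> q \<in> U ==> g q = f q"
  shows "spanned u i j z d e g"
proof -
  obtain c where c: "\<forall>k<N. der d e f k z ((\<Sum>l<n. c l * D 0 0 (u l) k z) +
     of_int d * f z * xg i z k + of_int e * f z * yg j z k)" using f unfolding spanned_def by blast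
  have gz: "g z = f z" by (rule eq[OF U(3,2)])
  show ?thesis unfolding spanned_def gz
    by (intro exI[of _ c] allI impI, rule der_germ[OF _ U eq], rule c[rule_format])
qed

lemma spanned_x:
  fixes z :: "'k::field_char_0 pt"
  assumes "i \<le> n" "z \<in> PE r s" "xc z i \<noteq> 0"
  shows "spanned u i j z 1 0 (\<lambda>q. xc q i)" "spanned u i j z (- 1) 0 (\<lambda>q. inverse (xc q i))"
proof -
  show "spanned u i j z 1 0 (\<lambda>q. xc q i)" unfolding spanned_def
    by (rule exI[of _ "\<lambda>_. 0"]) (use assms der_x[OF assms(1,2)] in \<open>simp add: xg_def\<close>)
  have "der (- 1) 0 (\<lambda>q. inverse (xc q i)) k z (- xg i z k * inverse (xc z i))" for k
    using der_inverse[OF biform.coord_x[OF assms(1)] assms(2), of k] assms(3)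
    by (simp add: xg_def divide_inverse mult_ac)
  thus "spanned u i j z (- 1) 0 (\<lambda>q. inverse (xc q i))" unfolding spanned_def
    by (intro exI[of _ "\<lambda>_. 0"]) (simp add: mult_ac)
qed

lemma spanned_y:
  fixes z :: "'k::field_char_0 pt"
  assumes "j \<le> s" "z \<in> PE r s" "yc z j \<noteq> 0"
  shows "spanned u i j z 0 1 (\<lambda>q. yc q j)" "spanned u i j z 0 (- 1) (\<lambda>q. inverse (yc q j))"
proof -
  show "spanned u i j z 0 1 (\<lambda>q. yc q j)" unfolding spanned_def
    by (rule exI[of _ "\<lambda>_. 0"]) (use assms der_y[OF assms(1,2)] in \<open>simp add: yg_def\<close>)
  have "der 0 (- 1) (\<lambda>q. inverse (yc q j)) k z (- yg j z k * inverse (yc z j))" for k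
    using der_inverse[OF biform.coord_y[OF assms(1)] assms(2), of k] assms(3)
    by (simp add: yg_def divide_inverse mult_ac)
  thus "spanned u i j z 0 (- 1) (\<lambda>q. inverse (yc q j))" unfolding spanned_def
    by (intro exI[of _ "\<lambda>_. 0"]) (simp add: mult_ac)
qed

definition all_spanned :: "(nat => 'k::field_char_0 pt => 'k) => nat => nat => 'k pt => int => int => bool" where
  "all_spanned u i j z d e \<longleftrightarrow> (\<forall>f U. zopen n s U --> z \<in> U --> tw n s (PE r s \<inter> U) d e f -->
     spanned u i j z d e f)"

text \<open>\<open>f\<close> is reduced to \<open>f h'\<close>, of type \<open>(d, e)\<close>; the
  product rule in \<open>spanned_mult\<close> then brings back the factor \<open>h\<close>.\<close>

lemma all_spanned_shift:
  fixes z :: "'k::field_char_0 pt"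
  assumes S: "all_spanned u i j z d e" and z: "z \<in> PE r s" and U0: "zopen n s U0" "z \<in> U0"
    and h: "spanned u i j z d' e' h" "tw n s (PE r s \<inter> U0) (- d') (- e') h'"
      "\<And>q. q \<in> PE r s ==> q \<in> U0 ==> h q * h' q = 1"
  shows "all_spanned u i j z (d + d') (e + e')" unfolding all_spanned_def
proof (intro allI impI)
  fix f U assume U: "zopen n s U" "z \<in> U" "tw n s (PE r s \<inter> U) (d + d') (e + e') f"
  have "tw n s (PE r s \<inter> (U \<inter> U0)) d e (\<lambda>q. f q * h' q)"
    by (rule tw_mult[OF tw_subset[OF U(3)] tw_subset[OF h(2)]]) auto
  hence "spanned u i j z d e (\<lambda>q. f q * h' q)"
    using S zopen_Int[OF U(1) U0(1)] U(2) U0(2) unfolding all_spanned_def by blast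
  from spanned_mult[OF this h(1) z]
  show "spanned u i j z (d + d') (e + e') f"
    by (rule spanned_germ[OF _ U0 z]) (use h(3) in \<open>simp add: mult.assoc mult.commute[of "h' _"]\<close>)
qed

text \<open>Type \<open>(0, 0)\<close> is the defining property of local coordinates. The others,
  the types of the Cox coordinates, are reached through \<open>x_i\<close> and \<open>y_j\<close>,
  which are units near \<open>z\<close>.\<close>

lemma spanned_types:
  fixes z :: "'k::field_char_0 pt" and u :: "nat => 'k pt => 'k"
  assumes lc: "local_coordinates n s (PE r s) n W u" and W: "W = PE r s \<inter> U0" "zopen n s U0"
    and z: "z \<in> W" and i: "i \<le> n" "xc z i \<noteq> 0" and j: "j \<le> s" "yc z j \<noteq> 0"
  shows "all_spanned u i j z 0 0" "all_spanned u i j z 1 0" "all_spanned u i j z 0 1" "all_spanned u i j z 1 (- 1)"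
proof -
  have zX: "z \<in> PE r s" "z \<in> U0" using z W by auto
  have der_u: "der 0 0 (u l) k z (D 0 0 (u l) k z)" if l: "l < n" and k: "k < N" for l k
  proof -
    have R: "regular_on n s W (u l)" using lc l unfolding local_coordinates_def by blast
    have "W \<subseteq> biproj n s" using W(1) PE_sub by blast
    hence "tw n s (PE r s \<inter> U0) 0 0 (u l)" using R regular_on_iff_tw W(1) by blast
    then obtain v where "der 0 0 (u l) k z v" using der_ex[OF W(2)] z W(1) by blast
    thus ?thesis using D_eq[OF _ zX(1) k] by metis
  qed
  show S0: "all_spanned u i j z 0 0" unfolding all_spanned_def
  proof (intro allI impI)
    fix f U assume U: "zopen n s U" "z \<in> U" "tw n s (PE r s \<inter> U) 0 0 f"
    have "PE r s \<inter> U \<subseteq> biproj n s" using PE_sub by blast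
    hence "f \<in> local_ring n s (PE r s) z" using U regular_on_iff_tw unfolding local_ring_def by blast
    then obtain c where c: "has_differential n s (PE r s) z n u f c"
      using lc z unfolding local_coordinates_def by blast
    have "der 0 0 f k z (\<Sum>l<n. c l * D 0 0 (u l) k z)" if "k < N" for k
      by (rule der_differential[OF c zX(1) that der_u[OF _ that]])
    thus "spanned u i j z 0 0 f" unfolding spanned_def by (intro exI[of _ c]) simp
  qed
  let ?Ux = "{q \<in> biproj n s. form_at (\<lambda>x y. x i) q \<noteq> (0::'k)}"
  let ?Uy = "{q \<in> biproj n s. form_at (\<lambda>x y. y j) q \<noteq> (0::'k)}"
  have Ux: "zopen n s ?Ux" "z \<in> ?Ux" using zopen_form[OF biform.coord_x[OF i(1)]] i(2) zX(1) PE_sub by auto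
  have Uy: "zopen n s ?Uy" "z \<in> ?Uy" using zopen_form[OF biform.coord_y[OF j(1)]] j(2) zX(1) PE_sub by auto
  have twx: "tw n s (PE r s \<inter> ?Ux) (- 1) (- 0) (\<lambda>q. inverse (xc q i))"
    by (rule tw_inverse[OF tw_x[OF i(1)]]) simp
  have twy: "tw n s (PE r s \<inter> ?Uy) (- 0) (- 1) (\<lambda>q. inverse (yc q j))"
    by (rule tw_inverse[OF tw_y[OF j(1)]]) simp
  show S1: "all_spanned u i j z 1 0"
    using all_spanned_shift[OF S0 zX(1) Ux spanned_x(1)[OF i(1) zX(1) i(2)] twx] by simp
  show "all_spanned u i j z 0 1"
    using all_spanned_shift[OF S0 zX(1) Uy spanned_y(1)[OF j(1) zX(1) j(2)] twy] by simp
  have "tw n s (PE r s \<inter> ?Uy) (- 0) (- (- 1)) (\<lambda>q. yc q j)" using tw_y[OF j(1)] by simp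
  from all_spanned_shift[OF S1 zX(1) Uy spanned_y(2)[OF j(1) zX(1) j(2)] this]
  show "all_spanned u i j z 1 (- 1)" by simp
qed

lemma sum_split_frame: "(\<Sum>m<N. g m) = (\<Sum>m<n. g m) + g n + (g (n + 1) :: 'k::comm_monoid_add)"
  by (simp add: numeral_2_eq_2)

text \<open>Passing from \<open>(i, j)\<close> to \<open>(i', j')\<close> alters the last two rows
  only by combinations of the gradients of \<open>u\<close>. So the change of frame is block
  triangular with an identity block, and its determinant is that of \<open>J\<close>.\<close>

lemma det_frame_change:
  fixes z :: "'k::field_char_0 pt" and u u' :: "nat => 'k pt => 'k"
  assumes lc: "local_coordinates n s (PE r s) n W u" and W: "W = PE r s \<inter> U0" "zopen n s U0"
    and z: "z \<in> W" and i: "i \<le> n" "xc z i \<noteq> 0" and j: "j \<le> s" "yc z j \<noteq> 0"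
    and i': "i' \<le> n" "xc z i' \<noteq> 0" and j': "j' \<le> s" "yc z j' \<noteq> 0"
    and J: "\<And>l k. l < n ==> k < N ==> der 0 0 (u' l) k z (\<Sum>m<n. J l m * D 0 0 (u m) k z)"
  shows "Determinant.det (frame_mat u' i' j' z) =
    Determinant.det (mat n n (\<lambda>(l, m). J l m)) * Determinant.det (frame_mat u i j z)"
proof -
  have zX: "z \<in> PE r s" using z W by auto
  note S = spanned_types[OF lc W z i j]
  have "spanned u i j z 1 0 (\<lambda>q. xc q i')"
    using S(2) zopen_biproj[of "n" s] zX PE_sub tw_x[OF i'(1), of s "PE r s \<inter> biproj n s"]
    unfolding all_spanned_def by blast
  then obtain c where c: "\<forall>k<N. der 1 0 (\<lambda>q. xc q i') k z ((\<Sum>l<n. c l * D 0 0 (u l) k z) +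
     of_int 1 * xc z i' * xg i z k + of_int 0 * xc z i' * yg j z k)" unfolding spanned_def by blast
  have "spanned u i j z 0 1 (\<lambda>q. yc q j')"
    using S(3) zopen_biproj[of "n" s] zX PE_sub tw_y[OF j'(1), of "n" "PE r s \<inter> biproj n s"]
    unfolding all_spanned_def by blast
  then obtain c' where c': "\<forall>k<N. der 0 1 (\<lambda>q. yc q j') k z ((\<Sum>l<n. c' l * D 0 0 (u l) k z) +
     of_int 0 * yc z j' * xg i z k + of_int 1 * yc z j' * yg j z k)" unfolding spanned_def by blast
  define C where "C l m = (if l = n then c m / xc z i' else c' m / yc z j')" for l m
  define T where "T = (\<lambda>l m. if l < n then (if m < n then J l m else 0)
      else if m < n then C l m else if l = m then 1 else 0)"
  have x: "xg i' z k = (\<Sum>l<n. C n l * D 0 0 (u l) k z) + xg i z k" if k: "k < N" for k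
  proof -
    have "pd k (\<lambda>\<zeta>. px \<zeta> i') (cc z) = (\<Sum>l<n. c l * D 0 0 (u l) k z) + xc z i' * xg i z k"
      using der_unique[OF der_x[OF i'(1) zX] c[rule_format, OF k] zX k] by simp
    thus ?thesis using i'(2) unfolding xg_def[of i'] C_def
      by (simp add: add_divide_distrib sum_divide_distrib)
  qed
  have y: "yg j' z k = (\<Sum>l<n. C (n + 1) l * D 0 0 (u l) k z) + yg j z k" if k: "k < N" for k
  proof -
    have "pd k (\<lambda>\<zeta>. py \<zeta> j') (cc z) = (\<Sum>l<n. c' l * D 0 0 (u l) k z) + yc z j' * yg j z k"
      using der_unique[OF der_y[OF j'(1) zX] c'[rule_format, OF k] zX k] by simp
    thus ?thesis using j'(2) unfolding yg_def[of j'] C_def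
      by (simp add: add_divide_distrib sum_divide_distrib)
  qed
  have fr: "frame u' i' j' z l k = (\<Sum>m<N. T l m * frame u i j z m k)"
    if l: "l < N" and k: "k < N" for l k
  proof -
    have D: "D 0 0 (u' l) k z = (\<Sum>m<n. J l m * D 0 0 (u m) k z)" if "l < n"
      by (rule D_eq[OF J[OF that k] zX k])
    have 1: "(\<Sum>m<n. T l m * frame u i j z m k) = (\<Sum>m<n. T l m * D 0 0 (u m) k z)"
      by (rule sum.cong) (auto simp: frame_def)
    consider "l < n" | "l = n" | "l = n + 1" using l by linarith
    thus ?thesis
    proof cases
      case 1
      have "(\<Sum>m<n. T l m * D 0 0 (u m) k z) = (\<Sum>m<n. J l m * D 0 0 (u m) k z)"
        by (rule sum.cong) (use 1 in \<open>auto simp: T_def\<close>)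
      thus ?thesis unfolding sum_split_frame \<open>(\<Sum>m<n. T l m * frame u i j z m k) = _\<close>
        using 1 D by (simp add: frame_def T_def)
    next
      case 2
      have "(\<Sum>m<n. T l m * D 0 0 (u m) k z) = (\<Sum>m<n. C n m * D 0 0 (u m) k z)"
        by (rule sum.cong) (use 2 in \<open>auto simp: T_def\<close>)
      thus ?thesis unfolding sum_split_frame 1 using 2 x[OF k] by (simp add: frame_def T_def)
    next
      case 3
      have "(\<Sum>m<n. T l m * D 0 0 (u m) k z) = (\<Sum>m<n. C (n + 1) m * D 0 0 (u m) k z)"
        by (rule sum.cong) (use 3 in \<open>auto simp: T_def\<close>)
      thus ?thesis unfolding sum_split_frame 1 using 3 y[OF k] by (simp add: frame_def T_def)
    qed
  qed
  let ?T = "mat (N) (N) (\<lambda>(l, m). T l m)"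
  have "frame_mat u' i' j' z = ?T * frame_mat u i j z" unfolding frame_mat_def
    by (rule eq_matI) (simp_all add: scalar_prod_def fr lessThan_atLeast0)
  hence "Determinant.det (frame_mat u' i' j' z) = Determinant.det ?T * Determinant.det (frame_mat u i j z)"
    by (simp add: det_mult[of _ "N"] frame_mat_def)
  also have "Determinant.det ?T = Determinant.det (mat n n (\<lambda>(l, m). J l m))"
    unfolding T_def by (rule det_unit_block)
  finally show ?thesis .
qed

text \<open>The gradient of every Cox coordinate is a combination of the rows of the frame.\<close>

lemma det_frame_nonzero:
  fixes z :: "'k::field_char_0 pt" and u :: "nat => 'k pt => 'k"
  assumes lc: "local_coordinates n s (PE r s) n W u" and W: "W = PE r s \<inter> U0" "zopen n s U0"
    and z: "z \<in> W" and i: "i \<le> n" "xc z i \<noteq> 0" and j: "j \<le> s" "yc z j \<noteq> 0"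
  shows "Determinant.det (frame_mat u i j z) \<noteq> 0"
proof -
  have zX: "z \<in> PE r s" using z W by auto
  note S = spanned_types[OF lc W z i j]
  have ex: "\<exists>t. \<forall>k<N. (\<Sum>m<N. t m * frame u i j z m k) = (if l = k then 1 else 0)"
    if l: "l < N" for l
  proof -
    have "all_spanned u i j z (wd l) (we l)" using S by (simp add: wd_def we_def)
    moreover have "tw n s (PE r s \<inter> biproj n s) (wd l) (we l) (\<lambda>q. cc q l)"
      by (rule tw_subset[OF cc_tw[OF l]]) blast
    ultimately have "spanned u i j z (wd l) (we l) (\<lambda>q. cc q l)"
      using zopen_biproj[of "n" s] zX PE_sub unfolding all_spanned_def by blast
    then obtain c where c: "\<forall>k<N. der (wd l) (we l) (\<lambda>q. cc q l) k z ((\<Sum>m<n. c m * D 0 0 (u m) k z) +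
       of_int (wd l) * cc z l * xg i z k + of_int (we l) * cc z l * yg j z k)" unfolding spanned_def by blast
    define t where "t m = (if m < n then c m else if m = n then of_int (wd l) * cc z l else of_int (we l) * cc z l)" for m
    show ?thesis
    proof (intro exI[of _ t] allI impI)
      fix k assume k: "k < N"
      have "(if l = k then 1 else 0) = (\<Sum>m<n. c m * D 0 0 (u m) k z) +
       of_int (wd l) * cc z l * xg i z k + of_int (we l) * cc z l * yg j z k"
        using der_unique[OF der_CP[OF CP_coord[OF l] zX] c[rule_format, OF k] zX k] by (simp add: pd_coord)
      moreover have "(\<Sum>m<n. t m * frame u i j z m k) = (\<Sum>m<n. c m * D 0 0 (u m) k z)"
        by (rule sum.cong) (auto simp: t_def frame_def)
      ultimately show "(\<Sum>m<N. t m * frame u i j z m k) = (if l = k then 1 else 0)"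
        unfolding sum_split_frame by (simp add: t_def frame_def)
    qed
  qed
  have "\<forall>l. \<exists>t. l < N --> (\<forall>k<N. (\<Sum>m<N. t m * frame u i j z m k) = (if l = k then 1 else 0))"
    using ex by blast
  from choice[OF this] obtain T where T: "\<forall>l. l < N -->
    (\<forall>k<N. (\<Sum>m<N. T l m * frame u i j z m k) = (if l = k then 1 else 0))" ..
  let ?T = "mat (N) (N) (\<lambda>(l, m). T l m)"
  have "?T * frame_mat u i j z = 1\<^sub>m (N)"
    unfolding frame_mat_def by (rule eq_matI) (use T in \<open>simp_all add: scalar_prod_def lessThan_atLeast0\<close>)
  hence "Determinant.det ?T * Determinant.det (frame_mat u i j z) = 1"
    by (simp add: frame_mat_def flip: det_mult[of _ "N"])
  thus ?thesis by auto
qed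

text \<open>All entries of a column have the same type, so every permutation contributes a product
  of the same total type.\<close>

lemma det_tw:
  assumes "W \<subseteq> biproj a b"
    and "\<And>l k. l < N ==> k < N ==> tw a b W (d k) (e k) (\<lambda>q. f q l k)"
  shows "tw a b W (\<Sum>k<N. d k) (\<Sum>k<N. e k) (\<lambda>q. Determinant.det (mat N N (\<lambda>(l, k). f q l k)))"
proof -
  have eq: "Determinant.det (mat N N (\<lambda>(l, k). f q l k)) =
    (\<Sum>\<pi>\<in>{\<pi>. \<pi> permutes {0..<N}}. signof \<pi> * (\<Prod>l\<in>{0..<N}. f q l (\<pi> l)))" for q
  proof -
    have "Determinant.det (mat N N (\<lambda>(l, k). f q l k)) =
      (\<Sum>\<pi>\<in>{\<pi>. \<pi> permutes {0..<N}}. signof \<pi> * (\<Prod>l\<in>{0..<N}. mat N N (\<lambda>(l, k). f q l k) $$ (l, \<pi> l)))"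
      by (rule det_def') simp
    also have "\<dots> = (\<Sum>\<pi>\<in>{\<pi>. \<pi> permutes {0..<N}}. signof \<pi> * (\<Prod>l\<in>{0..<N}. f q l (\<pi> l)))"
    proof (intro sum.cong refl arg_cong2[of _ _ _ _ "(*)"] prod.cong)
      fix \<pi> l assume "\<pi> \<in> {\<pi>. \<pi> permutes {0..<N}}" "l \<in> {0..<N}"
      hence "l < N" "\<pi> l < N" using permutes_in_image[of \<pi> "{0..<N}" l] by auto
      thus "mat N N (\<lambda>(l, k). f q l k) $$ (l, \<pi> l) = f q l (\<pi> l)" by simp
    qed
    finally show ?thesis .
  qed
  show ?thesis unfolding eq
  proof (rule tw_sum[OF assms(1)])
    fix \<pi> assume "\<pi> \<in> {\<pi>. \<pi> permutes {0..<N}}"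
    hence \<pi>: "\<pi> permutes {0..<N}" by simp
    have sums: "(\<Sum>l\<in>{0..<N}. g (\<pi> l)) = (\<Sum>k<N. g k)" for g :: "nat => int"
      using sum.permute[OF \<pi>, of g] by (simp add: lessThan_atLeast0 comp_def)
    have "tw a b W (\<Sum>l\<in>{0..<N}. d (\<pi> l)) (\<Sum>l\<in>{0..<N}. e (\<pi> l)) (\<lambda>q. \<Prod>l\<in>{0..<N}. f q l (\<pi> l))"
    proof (rule tw_prod)
      fix l assume "l \<in> {0..<N}"
      hence "l < N" "\<pi> l < N" using permutes_in_image[OF \<pi>, of l] by auto
      thus "tw a b W (d (\<pi> l)) (e (\<pi> l)) (\<lambda>q. f q l (\<pi> l))" by (rule assms(2))
    qed simp
    thus "tw a b W (\<Sum>k<N. d k) (\<Sum>k<N. e k) (\<lambda>q. signof \<pi> * (\<Prod>l\<in>{0..<N}. f q l (\<pi> l)))"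
      unfolding sums by (rule tw_scale)
  qed
qed

lemma ix_nonzero:
  assumes "q \<in> biproj a b"
  shows "ix q \<le> a" "xc q (ix q) \<noteq> 0"
proof -
  obtain j where j: "j \<le> a" "xc q j \<noteq> 0" using ex_xc_nonzero[OF assms] by blast
  show "xc q (ix q) \<noteq> 0" unfolding ix_def by (rule LeastI[of "\<lambda>j. xc q j \<noteq> 0"]) (rule j(2))
  show "ix q \<le> a" unfolding ix_def using Least_le[of "\<lambda>j. xc q j \<noteq> 0", OF j(2)] j(1) by simp
qed

text \<open>Minus the sum of all Cox weights, the usual expression for the canonical class of a
  toric variety.\<close>

lemma sum_weights: "(\<Sum>k<N. - wd k) = - (int r + 1)" "(\<Sum>k<N. - we k) = - int s"
proof -
  have split: "(\<Sum>k<N. h k) = h 0 + (\<Sum>i<r. h (Suc i)) + (\<Sum>j<s + 1. h (Suc r + j))" for h :: "nat => int"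
    using sum_lessThan_add[of h "Suc r" "s + 1"] sum.lessThan_Suc_shift[of h r] by simp
  show "(\<Sum>k<N. - wd k) = - (int r + 1)" unfolding split by (simp add: wd_def)
  show "(\<Sum>k<N. - we k) = - int s" unfolding split by (simp add: we_def)
qed

lemma canonical_type:
  fixes K :: "'k::field_char_0 lbundle"
  assumes K: "canonical_bundle n s (PE r s) n K"
  shows "has_type n s (PE r s) K (- (int r + 1)) (- int s)"
proof -
  let ?X = "PE r s :: 'k pt set" and ?n = "n"
  have L: "line_bundle ?n s ?X K" using K unfolding canonical_bundle_def by blast
  obtain u where lc: "\<forall>p\<in>?X. local_coordinates ?n s ?X ?n (?X \<inter> nbhd K p) (u p)"
    and J: "\<forall>p\<in>?X. \<forall>q\<in>?X. \<forall>z\<in>?X \<inter> nbhd K p \<inter> nbhd K q.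
           \<exists>J. (\<forall>i<?n. has_differential ?n s ?X z ?n (u p) (u q i) (J i)) \<and>
               trans K p q z = Determinant.det (mat ?n ?n (\<lambda>(i, j). J i j))"
    using K unfolding canonical_bundle_def by (elim conjE exE)
  note nb = line_bundleD[OF L PE_sub]
  have der_u: "der 0 0 (u p l) k z (D 0 0 (u p l) k z)"
    if p: "p \<in> ?X" and z: "z \<in> ?X \<inter> nbhd K p" and l: "l < ?n" and k: "k < ?n + 2" for p z l k
  proof -
    have R: "regular_on ?n s (?X \<inter> nbhd K p) (u p l)" using lc p l unfolding local_coordinates_def by blast
    have "?X \<inter> nbhd K p \<subseteq> biproj ?n s" using PE_sub by blast
    hence "tw ?n s (?X \<inter> nbhd K p) 0 0 (u p l)" using R regular_on_iff_tw by blast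
    then obtain v where "der 0 0 (u p l) k z v" using der_ex[OF nb(1)[OF p p]] z by blast
    thus ?thesis using D_eq[of 0 0 "u p l" k z v] z k by auto
  qed
  have change: "Determinant.det (frame_mat (u q) i' j' z) = trans K p q z * Determinant.det (frame_mat (u p) i j z)"
    if p: "p \<in> ?X" and q: "q \<in> ?X" and z: "z \<in> ?X" "z \<in> nbhd K p" "z \<in> nbhd K q"
      and ij: "i \<le> ?n" "xc z i \<noteq> 0" "j \<le> s" "yc z j \<noteq> 0" "i' \<le> ?n" "xc z i' \<noteq> 0" "j' \<le> s" "yc z j' \<noteq> 0"
    for p q z i j i' j'
  proof -
    obtain J where J: "\<forall>i<?n. has_differential ?n s ?X z ?n (u p) (u q i) (J i)"
      "trans K p q z = Determinant.det (mat ?n ?n (\<lambda>(i, j). J i j))" using J p q z by blast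
    have zp: "z \<in> ?X \<inter> nbhd K p" using z by blast
    show ?thesis unfolding J(2)
    proof (rule det_frame_change[OF bspec[OF lc p] refl nb(1)[OF p p] zp ij])
      fix l k assume lk: "l < ?n" "k < ?n + 2"
      show "der 0 0 (u q l) k z (\<Sum>m<?n. J l m * D 0 0 (u p m) k z)"
        by (rule der_differential[OF J(1)[rule_format, OF lk(1)] z(1) lk(2) der_u[OF p zp _ lk(2)]])
    qed
  qed
  have trans_self: "trans K p p z = 1" if p: "p \<in> ?X" and z: "z \<in> ?X" "z \<in> nbhd K p" for p z
  proof -
    have "trans K p p z = trans K p p z * trans K p p z" using L p z unfolding line_bundle_def by blast
    moreover have "trans K p p z \<noteq> 0" using nb(4)[OF p p z(1,2,2)] .
    ultimately show ?thesis by simp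
  qed
  define \<psi> where "\<psi> p z = Determinant.det (frame_mat (u p) (ix z) (jy z) z)" for p z
  have ij: "ix z \<le> ?n" "xc z (ix z) \<noteq> 0" "jy z \<le> s" "yc z (jy z) \<noteq> 0" if "z \<in> ?X" for z
    using ix_nonzero[of z ?n s] jy_nonzero[of z ?n] that PE_sub by auto
  show ?thesis
  proof (rule has_typeI)
    fix p assume p: "p \<in> ?X"
    show "zopen ?n s (nbhd K p) \<and> p \<in> nbhd K p" using nb[OF p p] by blast
    show "tw ?n s (?X \<inter> nbhd K p) (- (int r + 1)) (- int s) (\<psi> p)"
    proof (rule tw_local)
      show "?X \<inter> nbhd K p \<subseteq> biproj ?n s" using PE_sub by blast
      fix w assume w: "w \<in> ?X \<inter> nbhd K p"
      hence wX: "w \<in> ?X" by blast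
      define i where "i = ix w"
      define j where "j = jy w"
      note ijw = ij[OF wX, folded i_def j_def]
      let ?Ux = "{q \<in> biproj ?n s. form_at (\<lambda>x y. x i) q \<noteq> (0::'k)}"
      let ?Uy = "{q \<in> biproj ?n s. form_at (\<lambda>x y. y j) q \<noteq> (0::'k)}"
      let ?W = "?X \<inter> nbhd K p \<inter> (?Ux \<inter> ?Uy)"
      have WX: "?W \<subseteq> ?X" by blast
      have U: "zopen ?n s (?Ux \<inter> ?Uy)"
        by (rule zopen_Int[OF zopen_form[OF biform.coord_x[OF ijw(1)]] zopen_form[OF biform.coord_y[OF ijw(3)]]])
      \<comment> \<open>\<open>\<psi> p\<close> uses the indices \<open>ix z\<close> and
        \<open>jy z\<close>, which vary with \<open>z\<close>. By \<open>change\<close> with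
        \<open>p\<close> in both places the determinant does not depend on them, so near
        \<open>w\<close> they may be frozen to those of \<open>w\<close>.\<close>
      have "\<psi> p z = Determinant.det (mat (?n + 2) (?n + 2) (\<lambda>(l, k). frame (u p) i j z l k))" if z: "z \<in> ?W" for z
      proof -
        have z': "z \<in> ?X" "z \<in> nbhd K p" "xc z i \<noteq> 0" "yc z j \<noteq> 0" using z by simp_all
        show ?thesis unfolding \<psi>_def frame_mat_def[symmetric]
          using change[OF p p z'(1,2,2) ijw(1) z'(3) ijw(3) z'(4) ij[OF z'(1)]] trans_self[OF p z'(1,2)] by simp
      qed
      hence eq: "tw ?n s ?W (- (int r + 1)) (- int s) (\<psi> p) \<longleftrightarrow> tw ?n s ?W (- (int r + 1)) (- int s)
        (\<lambda>z. Determinant.det (mat (?n + 2) (?n + 2) (\<lambda>(l, k). frame (u p) i j z l k)))" by (rule tw_cong)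
      have "tw ?n s ?W (\<Sum>k<?n + 2. - wd k) (\<Sum>k<?n + 2. - we k)
        (\<lambda>z. Determinant.det (mat (?n + 2) (?n + 2) (\<lambda>(l, k). frame (u p) i j z l k)))"
      proof (rule det_tw)
        show "?W \<subseteq> biproj ?n s" by blast
        fix l k assume lk: "l < ?n + 2" "k < ?n + 2"
        consider "l < ?n" | "l = ?n" | "l = ?n + 1" using lk(1) by linarith
        thus "tw ?n s ?W (- wd k) (- we k) (\<lambda>z. frame (u p) i j z l k)"
        proof cases
          case 1
          have R: "regular_on ?n s (?X \<inter> nbhd K p) (u p l)" using lc p 1 unfolding local_coordinates_def by blast
          have "?X \<inter> nbhd K p \<subseteq> biproj ?n s" using PE_sub by blast
          hence "tw ?n s (?X \<inter> nbhd K p) 0 0 (u p l)" using R regular_on_iff_tw by blast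
          have "tw ?n s ?W (0 - wd k) (0 - we k) (D 0 0 (u p l) k)"
            by (rule tw_subset[OF D_tw[OF nb(1)[OF p p] \<open>tw _ _ _ _ _ (u p l)\<close> lk(2)]]) blast
          thus ?thesis using 1 by (simp add: frame_def)
        next
          case 2
          have "tw ?n s ?W (- wd k) (- we k) (\<lambda>z. pd k (\<lambda>\<zeta>. px \<zeta> i) (cc z) * inverse (xc z i))"
            by (rule tw_mult[OF tw_subset[OF CP_tw[OF pd_CP[OF CP_px[OF ijw(1)] lk(2)]] WX]
                  tw_inverse[OF tw_x[OF ijw(1)]]]) auto
          thus ?thesis using 2 by (simp add: frame_def xg_def divide_inverse)
        next
          case 3
          have "tw ?n s ?W (- wd k) (- we k) (\<lambda>z. pd k (\<lambda>\<zeta>. py \<zeta> j) (cc z) * inverse (yc z j))"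
            by (rule tw_mult[OF tw_subset[OF CP_tw[OF pd_CP[OF CP_py[OF ijw(3)] lk(2)]] WX]
                  tw_inverse[OF tw_y[OF ijw(3)]]]) auto
          thus ?thesis using 3 by (simp add: frame_def yg_def divide_inverse)
        qed
      qed
      hence "tw ?n s ?W (- (int r + 1)) (- int s) (\<psi> p)" unfolding sum_weights eq .
      moreover have "w \<in> ?Ux \<inter> ?Uy" using ijw wX PE_sub by auto
      ultimately show "\<exists>U. zopen ?n s U \<and> w \<in> U \<and> tw ?n s (?X \<inter> nbhd K p \<inter> U) (- (int r + 1)) (- int s) (\<psi> p)"
        using U by blast
    qed
  next
    fix p z assume h: "p \<in> ?X" "z \<in> ?X" "z \<in> nbhd K p"
    have "z \<in> ?X \<inter> nbhd K p" using h by blast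
    from det_frame_nonzero[OF bspec[OF lc h(1)] refl nb(1)[OF h(1,1)] this ij[OF h(2)]]
    show "\<psi> p z \<noteq> 0" by (simp add: \<psi>_def)
  next
    fix p q z assume h: "p \<in> ?X" "q \<in> ?X" "z \<in> ?X" "z \<in> nbhd K p" "z \<in> nbhd K q"
    show "trans K p q z * \<psi> p z = \<psi> q z"
      unfolding \<psi>_def by (rule change[OF h ij[OF h(3)] ij[OF h(3)], symmetric])
  qed
qed

end

section \<open>A line in a fibre of the projective bundle\<close>

lemma zclosed_finite: "finite W ==> W \<subseteq> biproj a b ==> zclosed a b W"
proof (induction W rule: finite_induct)
  case empty
  show ?case by (rule zclosed_empty)
next
  case (insert p W)
  have "zclosed a b ({p} \<union> W)" by (rule zclosed_Un[OF zclosed_singleton insert.IH]) (use insert.prems in auto)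
  thus ?case by simp
qed

lemma irreducible_finite:
  assumes W: "irreducible_closed a b W" "finite W"
  shows "\<exists>p. W = {p}"
proof -
  have cl: "zclosed a b W" "W \<noteq> {}" using W(1) unfolding irreducible_closed_def by blast+
  have sub: "W \<subseteq> biproj a b" by (rule zclosed_subset[OF cl(1)])
  obtain p where p: "p \<in> W" using cl(2) by blast
  have "zclosed a b {p}" by (rule zclosed_finite) (use p sub in auto)
  moreover have "zclosed a b (W - {p})" by (rule zclosed_finite) (use W(2) sub in auto)
  moreover have "W = {p} \<union> (W - {p})" using p by blast
  ultimately have "W = {p} \<or> W = W - {p}" using W(1) unfolding irreducible_closed_def by blast
  thus ?thesis using p by blast
qed

lemma form_line:
  "biform a b d e F ==> \<exists>P. \<forall>t. poly P t = F (\<lambda>i. v i + t * w i) y"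
proof (induction rule: biform.induct)
  case (const c)
  show ?case by (rule exI[of _ "[:c:]"]) simp
next
  case (coord_x i)
  show ?case by (rule exI[of _ "[:v i, w i:]"]) simp
next
  case (coord_y j)
  show ?case by (rule exI[of _ "[:y j:]"]) simp
next
  case (add d e F G)
  obtain P Q where "\<forall>t. poly P t = F (\<lambda>i. v i + t * w i) y" "\<forall>t. poly Q t = G (\<lambda>i. v i + t * w i) y"
    using add.IH by blast
  thus ?case by (intro exI[of _ "P + Q"]) simp
next
  case (mult d e F d' e' G)
  obtain P Q where "\<forall>t. poly P t = F (\<lambda>i. v i + t * w i) y" "\<forall>t. poly Q t = G (\<lambda>i. v i + t * w i) y"
    using mult.IH by blast
  thus ?case by (intro exI[of _ "P * Q"]) simp
qed

context blowup
begin

text \<open>Coordinates on a line in the fibre over \<open>e0\<close>. It joins the point with only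
  \<open>x_0\<close> nonzero, off the exceptional divisor, to the point with only
  \<open>x_(s+1)\<close> nonzero, which lies on it.\<close>

definition lvec :: "'k::field => 'k => nat => 'k" where
  "lvec a b i = (if i = 0 then a else if i = s + 1 then b else 0)"

definition e0 :: "nat => 'k::field" where
  "e0 j = (if j = 0 then 1 else 0)"

definition lp :: "'k::field => 'k => 'k pt" where
  "lp a b = (ppoint (lvec a b), ppoint e0)"

definition fline :: "'k::field pt set" where
  "fline = {lp a b | a b. a \<noteq> 0 \<or> b \<noteq> 0}"

lemma fline_mem: "a \<noteq> 0 \<or> b \<noteq> 0 ==> lp a b \<in> fline" unfolding fline_def by blast

lemma lvec_props:
  assumes "a \<noteq> 0 \<or> b \<noteq> 0"
  shows "lvec a b \<noteq> (\<lambda>_. 0)" "\<forall>i>n. lvec a b i = 0" "(e0 :: nat => 'k::field) \<noteq> (\<lambda>_. 0)"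
    "\<forall>j>s. (e0 :: nat => 'k) j = 0"
proof -
  have "lvec a b 0 \<noteq> 0 \<or> lvec a b (s + 1) \<noteq> 0" using assms by (simp add: lvec_def)
  thus "lvec a b \<noteq> (\<lambda>_. 0)" by metis
  show "\<forall>i>n. lvec a b i = 0" using r1 by (auto simp: lvec_def)
  have "(e0 :: nat => 'k) 0 \<noteq> 0" by (simp add: e0_def)
  thus "(e0 :: nat => 'k::field) \<noteq> (\<lambda>_. 0)" by metis
  show "\<forall>j>s. (e0 :: nat => 'k) j = 0" by (simp add: e0_def)
qed

lemma lp_spec:
  fixes a b :: "'k::field"
  assumes "a \<noteq> 0 \<or> b \<noteq> 0"
  shows "lp a b \<in> biproj n s"
    and "\<exists>c. c \<noteq> 0 \<and> xc (lp a b) = (\<lambda>i. c * lvec a b i)"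
    and "\<exists>c. c \<noteq> 0 \<and> yc (lp a b) = (\<lambda>i. c * e0 i)"
    and "biform n s d e F ==> form_at F (lp a b) = 0 \<longleftrightarrow> F (lvec a b) e0 = 0" unfolding lp_def
  by (rule biproj_pointI[OF lvec_props[OF assms]], rule biproj_pointI[OF lvec_props[OF assms]],
      rule biproj_pointI[OF lvec_props[OF assms]], rule form_at_point_eq_0_iff[OF _ lvec_props[OF assms]])

lemma lp_scale: "c \<noteq> 0 ==> lp (c * a) (c * b) = lp a b"
proof -
  assume c: "c \<noteq> 0"
  have "lvec (c * a) (c * b) = (\<lambda>i. c * lvec a b i)" by (auto simp: lvec_def)
  thus ?thesis unfolding lp_def using ppoint_scale[OF c] by simp
qed

lemma fline_cases:
  fixes q :: "'k::field pt"
  assumes "q \<in> fline"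
  shows "q = lp 0 1 \<or> (\<exists>t. q = lp 1 t)"
proof -
  obtain a b :: 'k where q: "q = lp a b" "a \<noteq> 0 \<or> b \<noteq> 0" using assms unfolding fline_def by blast
  show ?thesis
  proof (cases "a = 0")
    case True
    thus ?thesis using lp_scale[of b 0 1] q by simp
  next
    case False
    thus ?thesis using lp_scale[of a 1 "b / a"] q by auto
  qed
qed

lemma fline_PE: "fline \<subseteq> PE r s"
proof
  fix q :: "'a pt" assume "q \<in> fline"
  then obtain a b :: 'a where q: "q = lp a b" "a \<noteq> 0 \<or> b \<noteq> 0" unfolding fline_def by blast
  obtain c where c: "xc q = (\<lambda>i. c * lvec a b i)" using lp_spec(2)[OF q(2)] q(1) by blast
  obtain c' where c': "c' \<noteq> 0" "yc q = (\<lambda>i. c' * e0 i)" using lp_spec(3)[OF q(2)] q(1) by blast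
  have "\<forall>i\<le>s. xc q i = (c * a / c') * yc q i" unfolding c c'(2) using c'(1) by (simp add: lvec_def e0_def)
  thus "q \<in> PE r s" unfolding PE_iff using lp_spec(1)[OF q(2)] q(1) by blast
qed

lemma fline_zclosed: "zclosed n s (fline :: 'k::field pt set)"
proof (rule zclosedI)
  show "(fline :: 'k pt set) \<subseteq> biproj n s" using fline_PE PE_sub by blast
  fix p :: "'k pt" assume p: "p \<in> biproj n s" "p \<notin> fline"
  have vanish: "xc q i = 0" "yc q j = 0" if q: "q \<in> fline" and "i \<noteq> 0" "i \<noteq> s + 1" "j \<noteq> 0" for q :: "'k pt" and i j
  proof -
    obtain a b :: 'k where q: "q = lp a b" "a \<noteq> 0 \<or> b \<noteq> 0" using q unfolding fline_def by blast
    obtain c where c: "xc q = (\<lambda>i. c * lvec a b i)" using lp_spec(2)[OF q(2)] q(1) by blast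
    obtain c' where c': "yc q = (\<lambda>i. c' * e0 i)" using lp_spec(3)[OF q(2)] q(1) by blast
    show "xc q i = 0" "yc q j = 0" using that(2-4) by (simp_all add: c c' lvec_def e0_def)
  qed
  consider i where "i \<le> n" "i \<noteq> 0" "i \<noteq> s + 1" "xc p i \<noteq> 0" | j where "j \<le> s" "j \<noteq> 0" "yc p j \<noteq> 0"
    | "\<forall>i\<le>n. i \<noteq> 0 --> i \<noteq> s + 1 --> xc p i = 0" "\<forall>j\<le>s. j \<noteq> 0 --> yc p j = 0" by blast
  thus "\<exists>F d e. biform n s d e F \<and> form_at F p \<noteq> 0 \<and> (\<forall>q\<in>fline. form_at F q = 0)"
  proof cases
    case 1
    show ?thesis
      by (intro exI conjI ballI, rule biform.coord_x[OF 1(1)]) (use 1 vanish(1)[of _ i 1] in simp_all)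
  next
    case 2
    show ?thesis
      by (intro exI conjI ballI, rule biform.coord_y[OF 2(1)]) (use 2 vanish(2)[of _ "s + 2" j] in simp_all)
  next
    case 3
    have x: "xc p = lvec (xc p 0) (xc p (s + 1))"
    proof
      fix i show "xc p i = lvec (xc p 0) (xc p (s + 1)) i"
        using 3(1) xc_zero[OF p(1), of i] by (cases "i \<le> n") (auto simp: lvec_def)
    qed
    have y: "yc p = (\<lambda>j. yc p 0 * e0 j)"
    proof
      fix j show "yc p j = yc p 0 * e0 j"
        using 3(2) yc_zero[OF p(1), of j] by (cases "j \<le> s") (auto simp: e0_def)
    qed
    obtain i j where "i \<le> n" "xc p i \<noteq> 0" "j \<le> s" "yc p j \<noteq> 0"
      using ex_xc_nonzero[OF p(1)] ex_yc_nonzero[OF p(1)] by (elim exE conjE)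
    hence "xc p 0 \<noteq> 0 \<or> xc p (s + 1) \<noteq> 0" "yc p 0 \<noteq> 0"
      using 3(1)[rule_format, of i] 3(2)[rule_format, of j] by (metis, metis)
    moreover have "p = lp (xc p 0) (xc p (s + 1))"
    proof (rule prod_eqI)
      show "fst p = fst (lp (xc p 0) (xc p (s + 1)))"
        unfolding lp_def fst_conv x[symmetric] by (rule fst_biproj[OF p(1)])
      have "snd p = ppoint (\<lambda>j. yc p 0 * e0 j)" unfolding y[symmetric] by (rule snd_biproj[OF p(1)])
      thus "snd p = snd (lp (xc p 0) (xc p (s + 1)))"
        unfolding lp_def snd_conv ppoint_scale[OF \<open>yc p 0 \<noteq> 0\<close>] .
    qed
    ultimately have "p \<in> fline" unfolding fline_def by blast
    thus ?thesis using p(2) by blast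
  qed
qed

text \<open>In the chart \<open>lp 1 t\<close> the form becomes the polynomial \<open>P\<close>. If
  \<open>P\<close> were 0, the polynomial \<open>R\<close> of the other chart would vanish for all
  \<open>t \<noteq> 0\<close>, hence also at 0, and \<open>F\<close> would vanish on the whole
  line.\<close>

lemma fline_zeros_finite:
  fixes F :: "(nat => 'k::field_char_0) => (nat => 'k) => 'k"
  assumes F: "biform n s d e F" and p: "p \<in> fline" "form_at F p \<noteq> 0"
  shows "finite {q \<in> fline. form_at F q = 0}"
proof -
  have l1: "lvec 1 t = (\<lambda>i. lvec 1 0 i + t * lvec 0 1 i)" for t :: 'k by (auto simp: lvec_def)
  have l2: "lvec t 1 = (\<lambda>i. lvec 0 1 i + t * lvec 1 0 i)" for t :: 'k by (auto simp: lvec_def)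
  obtain P where P: "\<forall>t. poly P t = F (lvec 1 t) e0"
    using form_line[OF F, of "lvec 1 0" "lvec 0 1" e0] unfolding l1[symmetric] by blast
  obtain R where R: "\<forall>t. poly R t = F (lvec t 1) e0"
    using form_line[OF F, of "lvec 0 1" "lvec 1 0" e0] unfolding l2[symmetric] by blast
  have "P \<noteq> 0"
  proof
    assume P0: "P = 0"
    hence z: "form_at F (lp 1 t) = 0" for t using P lp_spec(4)[OF disjI1[OF one_neq_zero] F] by simp
    have "poly R t = 0" if "t \<noteq> 0" for t
    proof -
      have "lp t 1 = lp 1 (1 / t)" using lp_scale[OF that, of 1 "1 / t"] that by simp
      hence "form_at F (lp t 1) = 0" using z by simp
      thus ?thesis using R lp_spec(4)[OF disjI2[OF one_neq_zero] F] by simp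
    qed
    hence "UNIV - {0} \<subseteq> {t. poly R t = 0}" by auto
    moreover have "infinite (UNIV - {0::'k})" using infinite_UNIV_char_0 by simp
    ultimately have "R = 0" using poly_roots_finite finite_subset by blast
    hence "form_at F (lp 0 1) = 0" using R lp_spec(4)[OF disjI2[OF one_neq_zero] F, of 0] by simp
    thus False using p z fline_cases[OF p(1)] by auto
  qed
  have "{q \<in> fline. form_at F q = 0} \<subseteq> insert (lp 0 1) (lp 1 ` {t. poly P t = 0})"
  proof
    fix q assume "q \<in> {q \<in> fline. form_at F q = 0}"
    hence q: "q \<in> fline" "form_at F q = 0" by auto
    from fline_cases[OF q(1)] show "q \<in> insert (lp 0 1) (lp 1 ` {t. poly P t = 0})"
    proof
      assume "\<exists>t. q = lp 1 t"
      then obtain t where t: "q = lp 1 t" by blast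
      hence "poly P t = 0" using P q(2) lp_spec(4)[OF disjI1[OF one_neq_zero] F] by simp
      thus ?thesis using t by blast
    qed simp
  qed
  thus ?thesis using poly_roots_finite[OF \<open>P \<noteq> 0\<close>] finite_subset by blast
qed

lemma fline_infinite: "infinite (fline :: 'k::field_char_0 pt set)"
proof
  assume fin: "finite (fline :: 'k pt set)"
  have "inj (lp 1 :: 'k => 'k pt)"
  proof (rule injI)
    fix t t' :: 'k assume eq: "lp 1 t = lp 1 t'"
    obtain c where c: "c \<noteq> 0" "xc (lp 1 t) = (\<lambda>i. c * lvec 1 t i)" using lp_spec(2)[of 1 t] by auto
    obtain c' where c': "c' \<noteq> 0" "xc (lp 1 t) = (\<lambda>i. c' * lvec 1 t' i)" using lp_spec(2)[of 1 t'] eq by auto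
    have "c = c'" using fun_cong[OF c(2), of 0] fun_cong[OF c'(2), of 0] by (simp add: lvec_def)
    thus "t = t'" using fun_cong[OF c(2), of "s + 1"] fun_cong[OF c'(2), of "s + 1"] c(1) by (simp add: lvec_def)
  qed
  moreover have "range (lp 1) \<subseteq> (fline :: 'k pt set)" by (rule image_subsetI, rule fline_mem) simp
  ultimately have "finite (UNIV :: 'k set)" using finite_imageD[OF finite_subset[OF _ fin]] by blast
  thus False using infinite_UNIV_char_0 by blast
qed

lemma fline_proper_finite:
  fixes W :: "'k::field_char_0 pt set"
  assumes "zclosed n s W" "W \<subseteq> fline" "W \<noteq> fline"
  shows "finite W"
proof -
  obtain p where p: "p \<in> fline" "p \<notin> W" using assms(2,3) by blast
  hence "p \<in> biproj n s" using fline_PE PE_sub by blast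
  from zclosed_separate[OF assms(1) this p(2)] obtain F d e where
    F: "biform n s d e F" "form_at F p \<noteq> 0" "\<forall>q\<in>W. form_at F q = 0" by blast
  have "W \<subseteq> {q \<in> fline. form_at F q = 0}" using F(3) assms(2) by blast
  thus ?thesis using fline_zeros_finite[OF F(1) p(1) F(2)] finite_subset by blast
qed

text \<open>Proper closed subsets are finite while the line is infinite, so it is irreducible; and a
  finite irreducible set is a point.\<close>

lemma fline_curve: "curve n s (fline :: 'k::field_char_0 pt set)"
proof -
  let ?C = "fline :: 'k pt set"
  have "irreducible_closed n s ?C" unfolding irreducible_closed_def
  proof (intro conjI allI impI fline_zclosed)
    show "?C \<noteq> {}" using fline_infinite[where 'k = 'k] by auto
    fix Z1 Z2 assume Z: "zclosed n s Z1" "zclosed n s Z2" "?C = Z1 \<union> Z2"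
    show "?C = Z1 \<or> ?C = Z2"
    proof (rule ccontr)
      assume "\<not> ?thesis"
      hence "finite Z1" "finite Z2" using fline_proper_finite[OF Z(1)] fline_proper_finite[OF Z(2)] Z(3) by auto
      thus False using fline_infinite[where 'k = 'k] Z(3) by auto
    qed
  qed
  moreover have "\<nexists>p. ?C = {p}" using fline_infinite[where 'k = 'k] by auto
  moreover have "\<exists>p. W = {p}" if "irreducible_closed n s W" "W \<subset> ?C" for W
    by (rule irreducible_finite[OF that(1)], rule fline_proper_finite)
      (use that in \<open>auto simp: irreducible_closed_def\<close>)
  ultimately show ?thesis unfolding curve_def by blast
qed

end

section \<open>Nef classes and the Seshadri constant\<close>

lemma intersection_number_curve:
  assumes C: "C \<subseteq> biproj a b" and f: "\<forall>L d e. has_type a b C L d e --> euler_char a b C L = f d e"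
    and L: "has_type a b C L d e"
  shows "intersection_number a b C [L] = f d e - f 0 0"
proof -
  have 0: "euler_char a b C (tensor_list a b []) = f 0 0"
    using has_type_tensor_list[OF C, of "[]" "[]"] f by simp
  have 1: "euler_char a b C (tensor_list a b [L]) = f d e"
    using has_type_tensor_list[OF C, of "[L]" "[(d, e)]"] f L by simp
  have P: "Pow {..<1::nat} = {{}, {0}}" by auto
  show ?thesis unfolding intersection_number_def using 0 1 by (simp add: P[simplified])
qed

lemma intersect_cls:
  assumes "C \<subseteq> biproj a b" "\<forall>L d e. has_type a b C L d e --> euler_char a b C L = f d e" "has_type a b C L d e"
  shows "intersect a b C [cls L] = f d e - f 0 0"
  using intersection_number_curve[OF assms] by (simp add: intersect_def cls_def)

lemma intersect_sub_mult:
  assumes "C \<subseteq> biproj a b" "\<forall>L d e. has_type a b C L d e --> euler_char a b C L = f d e"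
    "has_type a b C L d e" "has_type a b C L' d' e'"
  shows "intersect a b C [sub_mult (cls L) t (cls L')] = (f d e - f 0 0) - t * (f d' e' - f 0 0)"
  using intersection_number_curve[OF assms(1,2,3)] intersection_number_curve[OF assms(1,2,4)]
  by (simp add: intersect_def cls_def sub_mult_def)

context blowup
begin

lemma nef_taut:
  fixes M :: "'k::{alg_closed_field,field_char_0} lbundle"
  assumes M: "has_type n s (PE r s) M 1 0"
  shows "nef n s (PE r s) (cls M)" unfolding nef_def
proof (intro allI impI)
  fix C :: "'k pt set" assume C: "curve n s C" "C \<subseteq> PE r s"
  obtain f where f: "\<forall>L d e. has_type n s C L d e --> euler_char n s C L = f d e"
    "\<forall>d e. f d e \<le> f (d + 1) e" using curve_euler_char[OF C(1)] by blast
  have "f 0 0 \<le> f 1 0" using f(2)[rule_format, of 0 0] by simp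
  thus "0 \<le> intersect n s C [cls M]"
    using intersect_cls[OF _ f(1) has_type_subset[OF M C(2)]] C(2) PE_sub by force
qed

lemma nef_iff:
  fixes M E :: "'k::{alg_closed_field,field_char_0} lbundle"
  assumes M: "has_type n s (PE r s) M 1 0" and E: "has_type n s (PE r s) E 1 (- 1)" and t: "0 \<le> t"
  shows "nef n s (PE r s) (sub_mult (cls M) t (cls E)) \<longleftrightarrow> t \<le> 1"
proof
  assume nef: "nef n s (PE r s) (sub_mult (cls M) t (cls E))"
  let ?C = "fline :: 'k pt set"
  obtain f where f: "\<forall>L d e. has_type n s ?C L d e --> euler_char n s ?C L = f d e"
    "\<forall>j\<le>s. (\<forall>p\<in>?C. yc p j \<noteq> 0) --> (\<forall>d e. f d (e + 1) = f d e)"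
    "\<forall>i\<le>n. (\<exists>p\<in>?C. xc p i \<noteq> 0) --> (\<exists>p\<in>?C. xc p i = 0) --> (\<forall>d e. f d e + 1 \<le> f (d + 1) e)"
    using curve_euler_char[OF fline_curve[where 'k = 'k]] by blast
  have "yc p 0 \<noteq> 0" if pC: "p \<in> ?C" for p
  proof -
    obtain a b :: 'k where q: "p = lp a b" "a \<noteq> 0 \<or> b \<noteq> 0" using pC unfolding fline_def by blast
    obtain c where "c \<noteq> 0" "yc p = (\<lambda>i. c * e0 i)" using lp_spec(3)[OF q(2)] q(1) by blast
    thus ?thesis by (simp add: e0_def)
  qed
  \<comment> \<open>The coordinate \<open>y_0\<close> has no zero on the line, so twisting by O(0,
    1) changes nothing there, and \<open>M\<close> and \<open>E\<close> have the same
    degree.\<close>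
  hence "f 1 (- 1 + 1) = f 1 (- 1)" using f(2) by blast
  moreover have "f 0 0 + 1 \<le> f (0 + 1) 0"
  proof -
    have mem: "lp 1 0 \<in> ?C" "lp 0 1 \<in> ?C" by (rule fline_mem, simp)+
    obtain c :: 'k where "c \<noteq> 0" "xc (lp 1 0) = (\<lambda>i. c * lvec 1 0 i)" using lp_spec(2)[of 1 "0::'k"] by auto
    hence "xc (lp 1 0 :: 'k pt) 0 \<noteq> 0" by (simp add: lvec_def)
    moreover obtain c' :: 'k where "xc (lp 0 1) = (\<lambda>i. c' * lvec 0 1 i)" using lp_spec(2)[of "0::'k" 1] by auto
    hence "xc (lp 0 1 :: 'k pt) 0 = 0" by (simp add: lvec_def)
    ultimately show ?thesis using f(3)[rule_format, of 0] mem by blast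
  qed
  moreover have "0 \<le> intersect n s ?C [sub_mult (cls M) t (cls E)]"
    using nef fline_curve fline_PE unfolding nef_def by blast
  moreover have "intersect n s ?C [sub_mult (cls M) t (cls E)] = (f 1 0 - f 0 0) - t * (f 1 (- 1) - f 0 0)"
    by (rule intersect_sub_mult[OF _ f(1) has_type_subset[OF M fline_PE] has_type_subset[OF E fline_PE]])
      (use fline_PE PE_sub in blast)
  ultimately have "0 \<le> (1 - t) * (f 1 0 - f 0 0)" "1 \<le> f 1 0 - f 0 0" by (simp_all add: algebra_simps)
  thus "t \<le> 1" using mult_neg_pos[of "1 - t" "f 1 0 - f 0 0"] by linarith
next
  assume t1: "t \<le> 1"
  show "nef n s (PE r s) (sub_mult (cls M) t (cls E))" unfolding nef_def
  proof (intro allI impI)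
    fix C :: "'k pt set" assume C: "curve n s C" "C \<subseteq> PE r s"
    obtain f where f: "\<forall>L d e. has_type n s C L d e --> euler_char n s C L = f d e"
      "\<forall>d e. f d e \<le> f (d + 1) e" "\<forall>d e. f d e \<le> f d (e + 1)" using curve_euler_char[OF C(1)] by blast
    have "f 0 0 \<le> f 1 0" "f 1 (- 1) \<le> f 1 0"
      using f(2)[rule_format, of 0 0] f(3)[rule_format, of 1 "- 1"] by simp_all
    \<comment> \<open>\<open>M - t E = (1 - t) M + t (M - E)\<close> is a convex combination of two
      classes of nonnegative degree.\<close>
    hence "0 \<le> (1 - t) * (f 1 0 - f 0 0) + t * (f 1 0 - f 1 (- 1))" using t t1 by simp
    also have "\<dots> = (f 1 0 - f 0 0) - t * (f 1 (- 1) - f 0 0)" by (simp add: algebra_simps)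
    also have "\<dots> = intersect n s C [sub_mult (cls M) t (cls E)]"
      by (rule intersect_sub_mult[OF _ f(1) has_type_subset[OF M C(2)] has_type_subset[OF E C(2)], symmetric])
        (use C(2) PE_sub in blast)
    finally show "0 \<le> intersect n s C [sub_mult (cls M) t (cls E)]" .
  qed
qed

lemma seshadri_eq:
  fixes M E :: "'k::{alg_closed_field,field_char_0} lbundle"
  assumes "has_type n s (PE r s) M 1 0" "has_type n s (PE r s) E 1 (- 1)"
  shows "seshadri n s (PE r s) (cls M) (cls E) = 1"
proof -
  have "{t. 0 \<le> t \<and> nef n s (PE r s) (sub_mult (cls M) t (cls E))} = {0..1}"
    using nef_iff[OF assms] by auto
  thus ?thesis by (simp add: seshadri_def)
qed

end

section \<open>The slopes\<close>

definition bern :: "nat => nat => real => real" where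
  "bern m k t = real (m choose k) * t ^ k * (1 - t) ^ (m - k)"

definition sbern :: "nat => nat => real => real" where
  "sbern m k t = (\<Sum>j\<le>k. bern m j t)"

text \<open>The derivative of a Bernstein polynomial of degree \<open>Suc m\<close> is
  \<open>Suc m\<close> times the difference of two neighbouring ones of degree \<open>m\<close>, so
  the sum telescopes to its last term.\<close>

lemma sbern_deriv: "(sbern (Suc m) k has_real_derivative - (real (Suc m) * bern m k t)) (at t)"
proof (induction k)
  case 0
  have "sbern (Suc m) 0 = (\<lambda>t. (1 - t) ^ Suc m)" by (simp add: sbern_def bern_def fun_eq_iff)
  moreover have "((\<lambda>t. (1 - t) ^ Suc m) has_real_derivative - (real (Suc m) * bern m 0 t)) (at t)"
    by (auto intro!: derivative_eq_intros simp: bern_def simp del: power_Suc)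
  ultimately show ?case by simp
next
  case (Suc k)
  have D: "(bern (Suc m) (Suc k) has_real_derivative
      real (Suc m choose Suc k) * (real (Suc k) * t ^ k * (1 - t) ^ (m - k) - real (m - k) * (1 - t) ^ (m - k - 1) * t ^ Suc k)) (at t)"
    unfolding bern_def[abs_def]
    by (auto intro!: derivative_eq_intros simp: algebra_simps simp del: power_Suc binomial_Suc_Suc)
  have 1: "real (Suc m choose Suc k) * real (Suc k) = real (Suc m) * real (m choose k)"
    using Suc_times_binomial_eq[of m k] by (simp only: flip: of_nat_mult)
  have 2: "real (Suc m choose Suc k) * real (m - k) = real (Suc m) * real (m choose Suc k)"
    using binomial_absorb_comp[of "Suc m" "Suc k"] by (simp only: diff_Suc_Suc diff_Suc_1 mult.commute flip: of_nat_mult)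
  have "real (Suc m choose Suc k) * (real (Suc k) * t ^ k * (1 - t) ^ (m - k) - real (m - k) * (1 - t) ^ (m - k - 1) * t ^ Suc k)
     = (real (Suc m choose Suc k) * real (Suc k)) * (t ^ k * (1 - t) ^ (m - k)) -
       (real (Suc m choose Suc k) * real (m - k)) * ((1 - t) ^ (m - Suc k) * t ^ Suc k)"
    by (simp add: right_diff_distrib mult_ac del: power_Suc binomial_Suc_Suc)
  also have "\<dots> = real (Suc m) * bern m k t - real (Suc m) * bern m (Suc k) t"
    unfolding 1 2 bern_def by (simp add: mult_ac del: power_Suc)
  finally have "(bern (Suc m) (Suc k) has_real_derivative real (Suc m) * bern m k t - real (Suc m) * bern m (Suc k) t) (at t)"
    using D by simp
  from DERIV_add[OF Suc.IH this] show ?case by (simp add: sbern_def[abs_def])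
qed

lemma sbern_0: "sbern m k 0 = 1"
proof -
  have "sbern m k 0 = (\<Sum>j\<le>k. if j = 0 then 1 else 0)" unfolding sbern_def bern_def by (rule sum.cong) auto
  thus ?thesis by simp
qed

lemma sbern_1: "k < m ==> sbern m k 1 = 0" unfolding sbern_def bern_def by (rule sum.neutral) auto

text \<open>Up to a constant factor \<open>sbern (Suc m) k\<close> is an antiderivative, and it
  drops from 1 at \<open>t = 0\<close> to 0 at \<open>t = 1\<close> whatever
  \<open>k \<le> m\<close> is.\<close>

lemma bern_integral:
  assumes "k \<le> m"
  shows "(bern m k has_integral 1 / real (Suc m)) {0..1}"
proof -
  have "((\<lambda>t. - (1 / real (Suc m)) * (- (real (Suc m) * bern m k t))) has_integral
      (- (1 / real (Suc m)) * sbern (Suc m) k 1 - - (1 / real (Suc m)) * sbern (Suc m) k 0)) {0..1}"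
  proof (rule fundamental_theorem_of_calculus)
    fix t :: real
    show "((\<lambda>t. - (1 / real (Suc m)) * sbern (Suc m) k t) has_vector_derivative
      - (1 / real (Suc m)) * (- (real (Suc m) * bern m k t))) (at t within {0..1})"
      unfolding has_real_derivative_iff_has_vector_derivative[symmetric]
      by (rule DERIV_cmult[OF DERIV_subset[OF sbern_deriv]]) simp
  qed simp
  thus ?thesis using assms by (simp add: sbern_0 sbern_1)
qed

lemma sbern_integral:
  assumes "k \<le> m"
  shows "(sbern m k has_integral real (Suc k) / real (Suc m)) {0..1}"
proof -
  have "((\<lambda>t. \<Sum>j\<in>{..k}. bern m j t) has_integral (\<Sum>j\<in>{..k}. 1 / real (Suc m))) {0..1}"
    by (rule has_integral_sum) (use bern_integral assms in auto)
  thus ?thesis by (simp add: sbern_def[abs_def])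
qed

context blowup
begin

lemma typoly_replicate: "typoly (replicate m (a, b)) = [:a, b:] ^ m" by (simp add: typoly_def)

text \<open>\<open>M - t E\<close> has type \<open>(1 - t, t)\<close>; this is the origin of the
  Bernstein polynomials.\<close>

lemma coeff_power_bern: "coeff ([:1 - t, t:] ^ m) j = bern m j t"
proof (cases "j \<le> m")
  case True
  thus ?thesis by (simp add: coeff_linear_poly_power bern_def)
next
  case False
  have "degree ([:1 - t, t:] ^ m) \<le> 1 * m" by (rule order_trans[OF degree_power_le]) (simp add: mult_right_mono)
  hence "coeff ([:1 - t, t:] ^ m) j = 0" using False by (intro coeff_eq_0) simp
  thus ?thesis using False by (simp add: bern_def)
qed

lemma class_type_replicate:
  "class_type a b X A d e ==> list_all2 (\<lambda>A u. class_type a b X A (fst u) (snd u)) (replicate m A) (replicate m (d, e))"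
  by (induction m) simp_all

lemma alpha0_eq:
  fixes M E :: "'k::{alg_closed_field,field_char_0} lbundle"
  assumes M: "has_type n s (PE r s) M 1 0" and E: "has_type n s (PE r s) E 1 (- 1)"
  shows "alpha0 n s (PE r s) n (cls M) (cls E) = (\<lambda>t. 1 / fact n * sbern n s t)"
proof
  fix t :: real
  have "class_type n s (PE r s) (sub_mult (cls M) t (cls E)) (1 - t) t"
    using class_type_sub_mult[OF M E, of t] by simp
  from intersect_PE[OF class_type_replicate[OF this, of "n"]]
  have "intersect n s (PE r s) (replicate n (sub_mult (cls M) t (cls E))) = sbern n s t"
    by (simp add: typoly_replicate top_def coeff_power_bern sbern_def)
  thus "alpha0 n s (PE r s) n (cls M) (cls E) t = 1 / fact n * sbern n s t"
    by (simp add: alpha0_def)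
qed

lemma alpha1_eq:
  fixes K M E :: "'k::{alg_closed_field,field_char_0} lbundle"
  assumes M: "has_type n s (PE r s) M 1 0" and E: "has_type n s (PE r s) E 1 (- 1)"
    and K: "has_type n s (PE r s) K (- (int r + 1)) (- int s)"
  shows "alpha1 n s (PE r s) n (cls K) (cls M) (cls E) = (\<lambda>t. 1 / (2 * fact (n - 1)) *
    ((real r + 1) * sbern (n - 1) s t + real s * sbern (n - 1) (s - 1) t))"
proof
  fix t :: real
  let ?P = "[:1 - t, t:] ^ (n - 1)"
  have 1: "class_type n s (PE r s) (sub_mult (cls M) t (cls E)) (1 - t) t"
    using class_type_sub_mult[OF M E, of t] by simp
  have 2: "class_type n s (PE r s) (cls K) (- (real r + 1)) (- real s)"
    using class_type_cls[OF K] by simp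
  have L: "list_all2 (\<lambda>A u. class_type n s (PE r s) A (fst u) (snd u))
      (cls K # replicate (n - 1) (sub_mult (cls M) t (cls E))) ((- (real r + 1), - real s) # replicate (n - 1) (1 - t, t))"
    using class_type_replicate[OF 1] 2 by simp
  have "intersect n s (PE r s) (cls K # replicate (n - 1) (sub_mult (cls M) t (cls E))) =
    top ([:- (real r + 1), - real s:] * ?P)"
    using intersect_PE[OF L] r1 by (simp add: typoly_def del: mult_pCons_left)
  also have "\<dots> = (\<Sum>j\<le>s. - (real r + 1) * coeff ?P j + (case j of 0 => 0 | Suc i => - real s * coeff ?P i))"
    unfolding top_def by (rule sum.cong) (simp_all add: coeff_pCons split: nat.splits)
  \<comment> \<open>Multiplication by the variable shifts the index, so the second sum reaches only
    \<open>s - 1\<close>; positivity of \<open>s\<close> allows the term \<open>j = 0\<close> to be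
    peeled off.\<close>
  also have "\<dots> = - (real r + 1) * (\<Sum>j\<le>s. coeff ?P j) + (\<Sum>j\<le>Suc (s - 1). case j of 0 => 0 | Suc i => - real s * coeff ?P i)"
    using s1 by (simp add: sum.distrib sum_distrib_left)
  also have "\<dots> = - (real r + 1) * sbern (n - 1) s t - real s * sbern (n - 1) (s - 1) t"
    unfolding sum.atMost_Suc_shift by (simp add: sbern_def coeff_power_bern sum_distrib_left sum_negf)
  finally have I: "intersect n s (PE r s) (cls K # replicate (n - 1) (sub_mult (cls M) t (cls E))) =
    - (real r + 1) * sbern (n - 1) s t - real s * sbern (n - 1) (s - 1) t" .
  show "alpha1 n s (PE r s) n (cls K) (cls M) (cls E) t = 1 / (2 * fact (n - 1)) *
    ((real r + 1) * sbern (n - 1) s t + real s * sbern (n - 1) (s - 1) t)"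
    unfolding alpha1_def I by (simp add: divide_simps) (simp add: algebra_simps)
qed

lemma slopes_eq:
  fixes K M E :: "'k::{alg_closed_field,field_char_0} lbundle"
  assumes M: "has_type n s (PE r s) M 1 0" and E: "has_type n s (PE r s) E 1 (- 1)"
    and K: "has_type n s (PE r s) K (- (int r + 1)) (- int s)"
  shows "slope_c n s (PE r s) n (cls K) (cls M) (cls E) 1 =
    slope n s (PE r s) n (cls K) (cls M) (cls E)"
proof -
  obtain m where m: "n = Suc m" using r1 by (cases "n") auto
  have le: "s \<le> m" using m r1 by simp
  have mrs: "real m = real r + real s - 1" using m by linarith
  let ?f = "fact m :: real"
  have a0: "alpha0 n s (PE r s) n (cls M) (cls E) = (\<lambda>t. 1 / fact (Suc m) * sbern (Suc m) s t)"
    using alpha0_eq[OF M E] unfolding m .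
  have a1: "alpha1 n s (PE r s) n (cls K) (cls M) (cls E) = (\<lambda>t. 1 / (2 * ?f) *
    ((real r + 1) * sbern m s t + real s * sbern m (s - 1) t))"
    using alpha1_eq[OF M E K] unfolding m diff_Suc_1 .
  have "((\<lambda>t. 1 / fact (Suc m) * sbern (Suc m) s t) has_real_derivative
      1 / fact (Suc m) * - (real (Suc m) * bern m s t)) (at t)" for t
    by (rule DERIV_cmult[OF sbern_deriv])
  moreover have "1 / fact (Suc m) * - (real (Suc m) * x) = - (1 / ?f) * x" for x :: real
    by (simp add: fact_Suc del: of_nat_Suc)
  ultimately have "((\<lambda>t. 1 / fact (Suc m) * sbern (Suc m) s t) has_real_derivative - (1 / ?f) * bern m s t) (at t)" for t
    by metis
  hence d: "deriv (\<lambda>t. 1 / fact (Suc m) * sbern (Suc m) s t) t = - (1 / ?f) * bern m s t" for t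
    by (rule DERIV_imp_deriv)
  have I1: "((\<lambda>t. 1 / (2 * ?f) * ((real r + 1) * sbern m s t + real s * sbern m (s - 1) t) + - (1 / (2 * ?f)) * bern m s t)
    has_integral (1 / (2 * ?f) * ((real r + 1) * (real (Suc s) / real (Suc m)) + real s * (real (Suc (s - 1)) / real (Suc m)))
      + - (1 / (2 * ?f)) * (1 / real (Suc m)))) {0..1}"
    by (intro has_integral_add has_integral_mult_right sbern_integral bern_integral) (use le in auto)
  have i1: "integral {0..1} (\<lambda>t. 1 / (2 * ?f) * ((real r + 1) * sbern m s t + real s * sbern m (s - 1) t) +
      (- (1 / ?f) * bern m s t) / 2) = real (s + 1) / (2 * ?f)"
  proof -
    have "1 / (2 * ?f) * ((real r + 1) * (real (Suc s) / real (Suc m)) + real s * (real (Suc (s - 1)) / real (Suc m)))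
      + - (1 / (2 * ?f)) * (1 / real (Suc m)) =
      ((real r + 1) * (real s + 1) + real s * real s - 1) / (2 * ?f * real (Suc m))"
    proof -
      have "1 / (2 * F) * (A * (B / N) + S * (S / N)) + - (1 / (2 * F)) * (1 / N) = (A * B + S * S - 1) / (2 * F * N)"
        if "F \<noteq> 0" "N \<noteq> 0" for A B S F N :: real using that by (simp add: divide_simps)
      moreover have "real (Suc (s - 1)) = real s" "real s + 1 = real (Suc s)" using s1 by simp_all
      ultimately show ?thesis by simp
    qed
    \<comment> \<open>The arithmetic behind the equality of slopes: it produces the factor
      \<open>s + 1\<close>, which cancels against the same factor in the integral of
      \<open>alpha0\<close>.\<close>
    also have "(real r + 1) * (real s + 1) + real s * real s - 1 = real (s + 1) * real (Suc m)"
      using mrs by (simp add: algebra_simps)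
    also have "real (s + 1) * real (Suc m) / (2 * ?f * real (Suc m)) = real (s + 1) / (2 * ?f)" by simp
    finally show ?thesis using integral_unique[OF I1] by (simp add: mult.commute)
  qed
  have i2: "integral {0..1} (\<lambda>t. 1 / fact (Suc m) * sbern (Suc m) s t) = real (s + 1) / (fact (Suc m) * real (Suc (Suc m)))"
    using integral_unique[OF has_integral_mult_right[OF sbern_integral[of s "Suc m"], of "1 / fact (Suc m)"]] le
    by simp
  have q: "S / (2 * F) / (S / (N * F * N')) = N * N' / 2" if "S \<noteq> 0" "F \<noteq> 0" for S F N N' :: real
    using that by simp
  have "slope_c n s (PE r s) n (cls K) (cls M) (cls E) 1 = real (Suc m) * real (Suc (Suc m)) / 2"
    unfolding slope_c_def a0 a1 unfolding d unfolding i1 i2 unfolding fact_Suc of_nat_id by (rule q) simp_all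
  \<comment> \<open>At \<open>t = 0\<close> every \<open>sbern\<close> equals 1, which leaves
    \<open>(r + 1 + s) / 2\<close> times \<open>n! / (n - 1)!\<close>.\<close>
  moreover have "slope n s (PE r s) n (cls K) (cls M) (cls E) = real (Suc m) * real (Suc (Suc m)) / 2"
    unfolding slope_def a0 a1 sbern_0 using mrs by (simp add: field_simps)
  ultimately show ?thesis by simp
qed

end

theorem corollary1p2:
  fixes r s n :: nat
    and X :: "'k::{alg_closed_field, field_char_0} pt set"
    and M E K :: "'k lbundle"
  assumes "r \<ge> 1" and "s \<ge> 1" and "n = r + s"
    and "X = PE r s"
    and "M = taut r s"
    and "exceptional_bundle r s E"
    and "canonical_bundle (r + s) s X n K"
  shows "big (r + s) s X n M \<and> nef (r + s) s X (cls M) \<and>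
    slope_semistable (r + s) s X n (cls K) (cls M) (cls E) \<and>
    \<not> slope_stable (r + s) s X n (cls K) (cls M) (cls E)"
proof -
  interpret blowup r s by unfold_locales (use assms in auto)
  have M: "has_type (r + s) s (PE r s) M 1 0"
    unfolding assms(5) taut_def by (rule has_type_O_bundle[OF PE_sub])
  have E: "has_type (r + s) s (PE r s) E 1 (- 1)" by (rule exceptional_type[OF assms(6)])
  have K: "has_type (r + s) s (PE r s) K (- (int r + 1)) (- int s)"
    by (rule canonical_type) (use assms(3,4,7) in simp)
  have "slope_c (r + s) s X n (cls K) (cls M) (cls E) (seshadri (r + s) s X (cls M) (cls E)) =
      slope (r + s) s X n (cls K) (cls M) (cls E)"
    unfolding assms(3,4) seshadri_eq[OF M E] by (rule slopes_eq[OF M E K])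
  thus ?thesis
    using big_taut nef_taut[OF M] assms(3,4,5) by (simp add: slope_semistable_def slope_stable_def)
qed

end
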